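(* Let $N\ge1$ and let $\Psi^N_1=\{S_{\mathbf t,\mathbf w}:(\mathbf t,\mathbf w)\in\widehat\Theta^N\}$. Then the closed unit ball of $(H^\infty_1)^{N\times N}$, i.e. the set of holomorphic $S\colon\mathbb D\to\mathbb C^{N\times N}$ with $\sup_{z\in\mathbb D}\|S(z)\|\le1$ and $S'(0)=0$, coincides with the test-function Schur–Agler class $\mathcal{SA}_{\Psi^N_1}(\mathbb C^N,\mathbb C^N)$ on $\Omega=\mathbb D$.
   Context: $H^\infty_1$ is the algebra of bounded holomorphic $f$ on the unit disk $\mathbb D$ with $f'(0)=0$. $\widehat\Theta^N$ is the set of pairs $(\mathbf t,\mathbf w)$ with $\mathbf t=(t_1,\dots,t_n)$ distinct points of $\mathbb T$ ($1\le n\le3N$) and $\mathbf w=(W_1,\dots,W_n)$ positive semidefinite $N\times N$ matrices with $\sum W_r=I_N$, $\sum_r(\operatorname{Re}t_r)W_r=0$, $\sum_r(\operatorname{Im}t_r)W_r=0$, and such that any Hermitian $T_1,\dots,T_n$ with $\operatorname{Ran}T_r\subset\operatorname{Ran}W_r$, $\sum T_r=0$, $\sum(\operatorname{Re}t_r)T_r=0$, $\sum(\operatorname{Im}t_r)T_r=0$ are all zero. $F_{\mathbf t,\mathbf w}(z)=\sum_r\frac{t_r+z}{t_r-z}W_r$ and $S_{\mathbf t,\mathbf w}(z)=(F_{\mathbf t,\mathbf w}(z)+I)^{-1}(F_{\mathbf t,\mathbf w}(z)-I)$. Schur–Agler class for test functions $\Psi$ ($\psi\colon\mathbb D\to\mathbb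 C^{N\times N}$, $\sup_\psi\|\psi(z)\|<1$ for each $z$): a positive $\mathbb C^{N\times N}$-valued kernel $K$ on $\mathbb D$ is admissible if right multiplication $f\mapsto f\psi$ is contractive on $\mathcal H(K)_{\mathbb C^N}$ for each $\psi\in\Psi$, where $\mathcal H(K)_{\mathbb C^N}$ is the completion of the span of $K(\cdot,w)U$ ($U\in\mathbb C^{N\times N}$) in the inner product $\langle K(\cdot,w)U,K(\cdot,z)V\rangle=\operatorname{tr}(K(z,w)UV^* )$; $\mathcal{SA}_\Psi(\mathbb C^N,\mathbb C^N)$ consists of all $S$ with $f\mapsto fS$ contractive on $\mathcal H(K)_{\mathbb C^N}$ for every admissible $K$. *)

theory Defs
  imports "HOL-Analysis.Analysis"
begin

type_synonym 'n cmat = "complex^'n^'n"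

definition cadj :: "'n::finite cmat \<Rightarrow> 'n cmat" where
  "cadj A = (\<chi> i j. cnj (A $ j $ i))"

definition cscale :: "complex \<Rightarrow> 'n::finite cmat \<Rightarrow> 'n cmat" (infixr "*\<^sub>m" 75) where
  "c *\<^sub>m A = (\<chi> i j. c * A $ i $ j)"

definition hermitian :: "'n::finite cmat \<Rightarrow> bool" where
  "hermitian A \<longleftrightarrow> cadj A = A"

definition qform :: "'n::finite cmat \<Rightarrow> complex^'n \<Rightarrow> complex" where
  "qform A v = (\<Sum>i\<in>UNIV. \<Sum>j\<in>UNIV. cnj (v $ i) * A $ i $ j * v $ j)"

definition psd :: "'n::finite cmat \<Rightarrow> bool" where
  "psd A \<longleftrightarrow> hermitian A \<and> (\<forall>v. Im (qform A v) = 0 \<and> Re (qform A v) \<ge> 0)"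

definition mran :: "'n::finite cmat \<Rightarrow> (complex^'n) set" where
  "mran A = range (\<lambda>v. A *v v)"

definition opnorm :: "'n::finite cmat \<Rightarrow> real" where
  "opnorm A = onorm (\<lambda>v. A *v v)"

definition disk :: "complex set" where
  "disk = ball 0 1"

definition ThetaHat :: "nat \<Rightarrow> (nat \<Rightarrow> complex) \<Rightarrow> (nat \<Rightarrow> 'n::finite cmat) \<Rightarrow> bool" where
  "ThetaHat n t W \<longleftrightarrow>
     1 \<le> n \<and> n \<le> 3 * CARD('n) \<and>
     inj_on t {..<n} \<and> (\<forall>r<n. cmod (t r) = 1) \<and>
     (\<forall>r<n. psd (W r)) \<and>
     (\<Sum>r<n. W r) = mat 1 \<and>
     (\<Sum>r<n. of_real (Re (t r)) *\<^sub>m W r) = 0 \<and>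
     (\<Sum>r<n. of_real (Im (t r)) *\<^sub>m W r) = 0 \<and>
     (\<forall>T :: nat \<Rightarrow> 'n cmat.
        (\<forall>r<n. hermitian (T r) \<and> mran (T r) \<subseteq> mran (W r)) \<and>
        (\<Sum>r<n. T r) = 0 \<and>
        (\<Sum>r<n. of_real (Re (t r)) *\<^sub>m T r) = 0 \<and>
        (\<Sum>r<n. of_real (Im (t r)) *\<^sub>m T r) = 0
        \<longrightarrow> (\<forall>r<n. T r = 0))"

definition Ffun :: "nat \<Rightarrow> (nat \<Rightarrow> complex) \<Rightarrow> (nat \<Rightarrow> 'n::finite cmat) \<Rightarrow> complex \<Rightarrow> 'n cmat" where
  "Ffun n t W z = (\<Sum>r<n. ((t r + z) / (t r - z)) *\<^sub>m W r)"

definition Sfun :: "nat \<Rightarrow> (nat \<Rightarrow> complex) \<Rightarrow> (nat \<Rightarrow> 'n::finite cmat) \<Rightarrow> complex \<Rightarrow> 'n cmat" where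
  "Sfun n t W z = matrix_inv (Ffun n t W z + mat 1) ** (Ffun n t W z - mat 1)"

definition Psi1 :: "(complex \<Rightarrow> 'n::finite cmat) set" where
  "Psi1 = {Sfun n t W | n t W. ThetaHat n t W}"

definition pos_kernel :: "(complex \<Rightarrow> complex \<Rightarrow> 'n::finite cmat) \<Rightarrow> bool" where
  "pos_kernel K \<longleftrightarrow>
     (\<forall>(m::nat) (z :: nat \<Rightarrow> complex) (v :: nat \<Rightarrow> complex^'n).
        (\<forall>i<m. z i \<in> disk) \<longrightarrow>
        (let s = (\<Sum>i<m. \<Sum>j<m. \<Sum>a\<in>UNIV. \<Sum>b\<in>UNIV.
                    cnj (v i $ a) * K (z i) (z j) $ a $ b * v j $ b)
         in Im s = 0 \<and> Re s \<ge> 0))"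

text \<open>Gram value \<parallel>\<Sum>_i K(.,z_i) V_i\<parallel>^2 = \<Sum>_{i,j} tr(K(z_j,z_i) V_i V_j^*).\<close>
definition kgram :: "(complex \<Rightarrow> complex \<Rightarrow> 'n::finite cmat) \<Rightarrow> nat \<Rightarrow> (nat \<Rightarrow> complex)
                      \<Rightarrow> (nat \<Rightarrow> 'n cmat) \<Rightarrow> complex" where
  "kgram K m z V = (\<Sum>i<m. \<Sum>j<m. trace (K (z j) (z i) ** V i ** cadj (V j)))"

text \<open>f belongs to H(K)_{C^N} with norm at most c: the functional
  \<Sum>_i K(.,z_i)V_i \<mapsto> <f, \<Sum>_i K(.,z_i)V_i> = \<Sum>_i tr(f(z_i) V_i^*) is bounded by c on the span
  of the kernel functions (so f is the function represented by an element of the completion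
  of norm \<le> c).\<close>
definition in_HK_ball :: "(complex \<Rightarrow> complex \<Rightarrow> 'n::finite cmat) \<Rightarrow> (complex \<Rightarrow> 'n cmat) \<Rightarrow> real \<Rightarrow> bool" where
  "in_HK_ball K f c \<longleftrightarrow> 0 \<le> c \<and>
     (\<forall>(m::nat) (z :: nat \<Rightarrow> complex) (V :: nat \<Rightarrow> 'n cmat).
        (\<forall>i<m. z i \<in> disk) \<longrightarrow>
        (cmod (\<Sum>i<m. trace (f (z i) ** cadj (V i))))\<^sup>2 \<le> c\<^sup>2 * Re (kgram K m z V))"

definition right_mult_contractive :: "(complex \<Rightarrow> complex \<Rightarrow> 'n::finite cmat) \<Rightarrow> (complex \<Rightarrow> 'n cmat) \<Rightarrow> bool" where
  "right_mult_contractive K \<psi> \<longleftrightarrow>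
     (\<forall>f c. in_HK_ball K f c \<longrightarrow> in_HK_ball K (\<lambda>z. f z ** \<psi> z) c)"

definition admissible :: "(complex \<Rightarrow> 'n::finite cmat) set \<Rightarrow> (complex \<Rightarrow> complex \<Rightarrow> 'n cmat) \<Rightarrow> bool" where
  "admissible \<Psi> K \<longleftrightarrow> pos_kernel K \<and> (\<forall>\<psi>\<in>\<Psi>. right_mult_contractive K \<psi>)"

definition SchurAgler :: "(complex \<Rightarrow> 'n::finite cmat) set \<Rightarrow> (complex \<Rightarrow> 'n cmat) set" where
  "SchurAgler \<Psi> = {S. \<forall>K. admissible \<Psi> K \<longrightarrow> right_mult_contractive K S}"

definition H1_ball :: "(complex \<Rightarrow> 'n::finite cmat) set" where
  "H1_ball = {S. (\<forall>i j. (\<lambda>z. S z $ i $ j) holomorphic_on disk) \<and>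
                 (\<forall>z\<in>disk. opnorm (S z) \<le> 1) \<and>
                 (\<forall>i j. deriv (\<lambda>z. S z $ i $ j) 0 = 0)}"

end

theory Submission
  imports Defs "HOL-Complex_Analysis.Complex_Analysis" "HOL-Computational_Algebra.Fundamental_Theorem_Algebra"
begin

text \<open>
  Contractivity of right multiplication by \<open>S\<close> on \<open>H(K)\<close> says that
  \<open>\<Sum>\<^sub>b q((S \<alpha>)\<^sub>b) \<le> \<Sum>\<^sub>b q(\<alpha>\<^sub>b)\<close> for all tuples \<open>\<alpha>\<close> of rows over finitely many points, where
  \<open>q\<close> is the Gram form of \<open>K\<close>. After a Cayley transform it becomes a positivity statement about a
  Herglotz function, linear in its matrix measure; the measures in question have total mass \<open>I\<close>
  and vanishing first moment. By Krein-Milman, admissibility of \<open>K\<close> gives this positivity for all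
  such measures with at most \<open>3N\<close> atoms.

  The heart of the matter is that \<open>3N\<close> atoms are enough. Write \<open>W\<^sub>j = w\<^sub>j\<^sup>* w\<^sub>j\<close> for atoms at
  \<open>\<tau>\<^sub>j\<^sup>*\<close>. The vanishing moment means that the columns of \<open>w\<close> and of \<open>\<tau>\<^sup>* w\<close> together are
  orthonormal, and multiplication by \<open>\<tau>\<close> becomes a unitary colligation with \<open>N\<close> inputs,
  \<open>N\<close> outputs and \<open>d\<close> states, for which it remains to show that \<open>\<zeta>\<^sup>2\<close> times the outputs is
  dominated by the inputs. If \<open>d \<le> N\<close>, feeding the outputs back through \<open>N\<close> further states and
  diagonalising produces a measure with at most \<open>3N\<close> atoms. If \<open>d > N\<close>, an eigenvector of a
  pencil \<open>X - \<nu> X\<^sup>*\<close> decouples two coordinates of the colligation, which can be deleted at the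
  price of one application of the contractivity of \<open>\<zeta>\<^sup>2\<close>, that is, of the measure with atoms \<open>\<plusminus>1\<close>.

  A function in the unit ball is a limit of functions \<open>S\<close> with \<open>S'(0) = 0\<close>, strictly contractive on
  a larger disk. For those, \<open>(1 + S)(1 - S)\<^sup>-\<^sup>1\<close> is approximated by polynomials with positive real
  part on the circle, and sampling at roots of unity yields discrete measures with first moment
  exactly zero. Conversely, the kernel \<open>(1/(1 - z w\<^sup>*) - z w\<^sup>*) I\<close> is admissible, and contractivity of
  \<open>S\<close> for this single kernel forces holomorphy, \<open>S'(0) = 0\<close> and \<open>\<parallel>S(z)\<parallel> \<le> 1\<close>.
\<close>

section \<open>Unitary matrices over finite index sets\<close>

text \<open>The number 3N: total mass I and zero first moment give F(0) = I and F'(0) = 0, so the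
  Cayley transform of F vanishes to second order at the origin; dividing out z^2 leaves the transfer
  function of the colligation. The columns \<open>w\<close> and \<open>cnj \<tau> w\<close> use up
  2N of the card J dimensions, so d = card J - 2N, and d \<le> N says exactly that card J \<le> 3N.
  The last clause of \<open>ThetaHat\<close> bounds only the sum of the squares of the ranks of the
  weights, by 3N^2 (a count of real dimensions), so for N > 1 it does not by itself keep an extreme
  measure within 3N nodes. Hence Krein-Milman is applied at 3N fixed nodes, and larger measures are
  reached by deleting states. A function with S(0) \<noteq> 0 gives a Herglotz function whose value
  at the origin is not I. The skew-Hermitian part of that value does not affect the real part of the
  form, and its Hermitian part is normalised by a congruence. In the colligation argument resolvents
  are replaced by solutions of linear relations, so coordinates can be changed and states deleted
  without inverting anything.\<close>

definition uni :: "'i set \<Rightarrow> 'j set \<Rightarrow> ('i \<Rightarrow> 'j \<Rightarrow> complex) \<Rightarrow> bool" where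
  "uni I J U \<longleftrightarrow> finite I \<and> finite J \<and>
     (\<forall>i\<in>I. \<forall>i'\<in>I. (\<Sum>j\<in>J. U i j * cnj (U i' j)) = of_bool (i = i')) \<and>
     (\<forall>j\<in>J. \<forall>j'\<in>J. (\<Sum>i\<in>I. cnj (U i j) * U i j') = of_bool (j = j'))"

lemma uniD:
  assumes "uni I J U"
  shows "finite I" "finite J"
    "\<And>i i'. i \<in> I \<Longrightarrow> i' \<in> I \<Longrightarrow> (\<Sum>j\<in>J. U i j * cnj (U i' j)) = of_bool (i = i')"
    "\<And>j j'. j \<in> J \<Longrightarrow> j' \<in> J \<Longrightarrow> (\<Sum>i\<in>I. cnj (U i j) * U i j') = of_bool (j = j')"
  using assms unfolding uni_def by auto

lemma uniI:
  assumes "finite I" "finite J"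
    "\<And>i i'. i \<in> I \<Longrightarrow> i' \<in> I \<Longrightarrow> (\<Sum>j\<in>J. U i j * cnj (U i' j)) = of_bool (i = i')"
    "\<And>j j'. j \<in> J \<Longrightarrow> j' \<in> J \<Longrightarrow> (\<Sum>i\<in>I. cnj (U i j) * U i j') = of_bool (j = j')"
  shows "uni I J U"
  using assms unfolding uni_def by auto

lemma of_bool_sum:
  fixes f :: "'i \<Rightarrow> complex"
  assumes "finite I" "i \<in> I"
  shows "(\<Sum>k\<in>I. of_bool (i = k) * f k) = f i" "(\<Sum>k\<in>I. f k * of_bool (i = k)) = f i"
    "(\<Sum>k\<in>I. of_bool (k = i) * f k) = f i" "(\<Sum>k\<in>I. f k * of_bool (k = i)) = f i"
proof -
  have "(\<Sum>k\<in>I. of_bool (i = k) * f k) = (\<Sum>k\<in>I. if i = k then f k else 0)" by (rule sum.cong) auto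
  then show *: "(\<Sum>k\<in>I. of_bool (i = k) * f k) = f i" using assms by simp
  then show "(\<Sum>k\<in>I. f k * of_bool (i = k)) = f i" by (simp add: mult.commute)
  show "(\<Sum>k\<in>I. of_bool (k = i) * f k) = f i" using * by (simp add: eq_commute)
  then show "(\<Sum>k\<in>I. f k * of_bool (k = i)) = f i" by (simp add: mult.commute)
qed

section \<open>Linear systems and orthonormal families over finite index sets\<close>

lemma homogeneous_system:
  fixes \<beta> :: "'b \<Rightarrow> 's \<Rightarrow> complex"
  assumes "finite B" "finite S" "card B < card S"
  shows "\<exists>\<eta>. (\<exists>s\<in>S. \<eta> s \<noteq> 0) \<and> (\<forall>s. s \<notin> S \<longrightarrow> \<eta> s = 0) \<and> (\<forall>b\<in>B. (\<Sum>s\<in>S. \<eta> s * \<beta> b s) = 0)"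
  using assms
proof (induction B arbitrary: S \<beta> rule: finite_induct)
  case empty
  then obtain s where "s \<in> S" by fastforce
  then show ?case by (intro exI[of _ "\<lambda>t. if t = s then 1 else 0"]) auto
next
  case (insert b0 B)
  show ?case
  proof (cases "\<forall>s\<in>S. \<beta> b0 s = 0")
    case True
    have "card B < card S" using insert by simp
    from insert.IH[OF insert.prems(1) this, of \<beta>] obtain \<eta> where
      "(\<exists>s\<in>S. \<eta> s \<noteq> 0) \<and> (\<forall>s. s \<notin> S \<longrightarrow> \<eta> s = 0) \<and> (\<forall>b\<in>B. (\<Sum>s\<in>S. \<eta> s * \<beta> b s) = 0)" by blast
    then show ?thesis using True by (intro exI[of _ \<eta>]) (auto intro!: sum.neutral)
  next
    case False
    then obtain s0 where s0: "s0 \<in> S" "\<beta> b0 s0 \<noteq> 0" by auto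
    let ?S = "S - {s0}"
    have c: "card B < card ?S" using insert s0 by simp
    from insert.IH[OF _ c, of "\<lambda>b s. \<beta> b s - \<beta> b s0 / \<beta> b0 s0 * \<beta> b0 s"] insert.prems obtain \<eta> where
      \<eta>: "\<exists>s\<in>?S. \<eta> s \<noteq> 0" "\<forall>s. s \<notin> ?S \<longrightarrow> \<eta> s = 0"
        "\<forall>b\<in>B. (\<Sum>s\<in>?S. \<eta> s * (\<beta> b s - \<beta> b s0 / \<beta> b0 s0 * \<beta> b0 s)) = 0" by auto
    \<comment> \<open>Gaussian elimination: equation \<open>b0\<close> is solved for the unknown at
      the pivot \<open>s0\<close>, and the induction hypothesis was applied to the remaining
      equations after substitution.\<close>
    define x where "x = - (\<Sum>s\<in>?S. \<eta> s * \<beta> b0 s) / \<beta> b0 s0"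
    define \<eta>' where "\<eta>' = \<eta>(s0 := x)"
    have split: "(\<Sum>s\<in>S. \<eta>' s * \<beta> b s) = x * \<beta> b s0 + (\<Sum>s\<in>?S. \<eta> s * \<beta> b s)" for b
      using s0 insert.prems(1) by (simp add: sum.remove[of S s0] \<eta>'_def cong: sum.cong_simp)
    have "(\<Sum>s\<in>S. \<eta>' s * \<beta> b0 s) = 0" using s0 by (simp add: split x_def)
    moreover have "(\<Sum>s\<in>S. \<eta>' s * \<beta> b s) = 0" if "b \<in> B" for b
    proof -
      have "0 = (\<Sum>s\<in>?S. \<eta> s * \<beta> b s) - \<beta> b s0 / \<beta> b0 s0 * (\<Sum>s\<in>?S. \<eta> s * \<beta> b0 s)"
        using \<eta>(3) that by (simp add: right_diff_distrib sum_subtractf sum_distrib_left mult.left_commute mult.assoc)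
      then have "(\<Sum>s\<in>?S. \<eta> s * \<beta> b s) = - x * \<beta> b s0" by (simp add: x_def)
      then show ?thesis by (simp add: split)
    qed
    moreover have "\<exists>s\<in>S. \<eta>' s \<noteq> 0" using \<eta>(1) by (auto simp: \<eta>'_def)
    moreover have "\<forall>s. s \<notin> S \<longrightarrow> \<eta>' s = 0" using \<eta>(2) s0 by (auto simp: \<eta>'_def)
    ultimately show ?thesis by (intro exI[of _ \<eta>']) auto
  qed
qed

text \<open>By induction on \<open>B\<close>: if some \<open>e\<close> annihilates the remaining
  vectors but not the one at \<open>b0\<close>, pairing \<open>v\<close> with \<open>e\<close>
  determines the coefficient at \<open>b0\<close>; if there is no such \<open>e\<close>, the
  annihilator is already that of \<open>B\<close>, and the coefficient is 0.\<close>

lemma fredholm_alternative: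
  fixes \<beta> :: "'b \<Rightarrow> 's \<Rightarrow> complex"
  assumes "finite B" 
    and "\<And>\<eta>. (\<forall>b\<in>B. (\<Sum>s\<in>S. \<eta> s * \<beta> b s) = 0) \<Longrightarrow> (\<Sum>s\<in>S. \<eta> s * v s) = 0"
    and "finite S"
  shows "\<exists>a. \<forall>s\<in>S. v s = (\<Sum>b\<in>B. a b * \<beta> b s)"
  using assms
proof (induction B arbitrary: v rule: finite_induct)
  case empty
  have "v s = 0" if "s \<in> S" for s
    using empty.prems(1)[of "\<lambda>t. of_bool (t = s)"] that empty.prems(2) by (simp add: of_bool_sum)
  then show ?case by simp
next
  case (insert b0 B)
  show ?case
  proof (cases "\<exists>\<eta>. (\<forall>b\<in>B. (\<Sum>s\<in>S. \<eta> s * \<beta> b s) = 0) \<and> (\<Sum>s\<in>S. \<eta> s * \<beta> b0 s) \<noteq> 0")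
    case True
    then obtain e where e: "\<forall>b\<in>B. (\<Sum>s\<in>S. e s * \<beta> b s) = 0" "(\<Sum>s\<in>S. e s * \<beta> b0 s) \<noteq> 0" by blast
    define c where "c = (\<Sum>s\<in>S. e s * v s) / (\<Sum>s\<in>S. e s * \<beta> b0 s)"
    have "\<exists>a. \<forall>s\<in>S. v s - c * \<beta> b0 s = (\<Sum>b\<in>B. a b * \<beta> b s)"
    proof (rule insert.IH)
      fix \<eta> assume \<eta>: "\<forall>b\<in>B. (\<Sum>s\<in>S. \<eta> s * \<beta> b s) = 0"
      define d where "d = (\<Sum>s\<in>S. \<eta> s * \<beta> b0 s) / (\<Sum>s\<in>S. e s * \<beta> b0 s)"
      have lin: "(\<Sum>s\<in>S. (\<eta> s - d * e s) * w s) = (\<Sum>s\<in>S. \<eta> s * w s) - d * (\<Sum>s\<in>S. e s * w s)" for w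
        by (simp add: left_diff_distrib sum_subtractf sum_distrib_left mult.assoc)
      have "(\<Sum>s\<in>S. (\<eta> s - d * e s) * v s) = 0"
        by (rule insert.prems(1)) (unfold lin, use \<eta> e in \<open>simp add: d_def\<close>)
      then have "(\<Sum>s\<in>S. \<eta> s * v s) = d * (\<Sum>s\<in>S. e s * v s)" by (simp add: lin)
      moreover have "(\<Sum>s\<in>S. \<eta> s * (v s - c * \<beta> b0 s)) = (\<Sum>s\<in>S. \<eta> s * v s) - c * (\<Sum>s\<in>S. \<eta> s * \<beta> b0 s)"
        by (simp add: right_diff_distrib sum_subtractf sum_distrib_left mult.left_commute)
      ultimately show "(\<Sum>s\<in>S. \<eta> s * (v s - c * \<beta> b0 s)) = 0" using e(2) by (simp add: c_def d_def field_simps)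
    qed (use insert in auto)
    then obtain a where a: "\<forall>s\<in>S. v s - c * \<beta> b0 s = (\<Sum>b\<in>B. a b * \<beta> b s)" by blast
    have "v s = (\<Sum>b\<in>insert b0 B. (a(b0 := c)) b * \<beta> b s)" if "s \<in> S" for s
    proof -
      have "(\<Sum>b\<in>B. (a(b0 := c)) b * \<beta> b s) = (\<Sum>b\<in>B. a b * \<beta> b s)"
        using insert.hyps by (intro sum.cong) auto
      then have "(\<Sum>b\<in>insert b0 B. (a(b0 := c)) b * \<beta> b s) = c * \<beta> b0 s + (\<Sum>b\<in>B. a b * \<beta> b s)"
        using insert.hyps by simp
      moreover have "v s - c * \<beta> b0 s = (\<Sum>b\<in>B. a b * \<beta> b s)" using a that by blast
      ultimately show ?thesis by (simp add: algebra_simps)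
    qed
    then show ?thesis by blast
  next
    case False
    have "\<exists>a. \<forall>s\<in>S. v s = (\<Sum>b\<in>B. a b * \<beta> b s)"
      by (rule insert.IH) (use insert False in auto)
    then obtain a where a: "\<forall>s\<in>S. v s = (\<Sum>b\<in>B. a b * \<beta> b s)" by blast
    have "v s = (\<Sum>b\<in>insert b0 B. (a(b0 := 0)) b * \<beta> b s)" if "s \<in> S" for s
    proof -
      have "(\<Sum>b\<in>B. (a(b0 := 0)) b * \<beta> b s) = (\<Sum>b\<in>B. a b * \<beta> b s)"
        using insert.hyps by (intro sum.cong) auto
      then show ?thesis using a that insert.hyps by simp
    qed
    then show ?thesis by blast
  qed
qed

lemma sum_norm_sq: "(\<Sum>s\<in>S. x s * cnj (x s)) = complex_of_real (\<Sum>s\<in>S. (cmod (x s))\<^sup>2)"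
  by (simp only: of_real_sum complex_norm_square)

lemma sum_norm_sq_eq_0:
  assumes "finite S" "(\<Sum>s\<in>S. x s * cnj (x s)) = 0" "s \<in> S"
  shows "x s = 0"
proof -
  have "(\<Sum>s\<in>S. (cmod (x s))\<^sup>2) = 0" using assms(2) unfolding sum_norm_sq of_real_eq_0_iff .
  then show ?thesis using assms(1,3) by (simp add: sum_nonneg_eq_0_iff)
qed

lemma normalise_vector:
  fixes x :: "'s \<Rightarrow> complex"
  assumes "finite S" "\<exists>s\<in>S. x s \<noteq> 0"
  shows "\<exists>c::complex. c \<noteq> 0 \<and> (\<Sum>s\<in>S. (c * x s) * cnj (c * x s)) = 1"
proof -
  let ?n = "\<Sum>s\<in>S. (cmod (x s))\<^sup>2"
  have "?n \<noteq> 0" using assms by (auto simp: sum_nonneg_eq_0_iff)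
  moreover have "?n \<ge> 0" by (simp add: sum_nonneg)
  ultimately have p: "?n > 0" by linarith
  define c where "c = complex_of_real (1 / sqrt ?n)"
  have "(\<Sum>s\<in>S. (c * x s) * cnj (c * x s)) = c * cnj c * (\<Sum>s\<in>S. x s * cnj (x s))"
    by (simp add: sum_distrib_left mult_ac)
  also have "\<dots> = of_real ((1 / sqrt ?n) * (1 / sqrt ?n) * ?n)" unfolding sum_norm_sq c_def of_real_mult complex_cnj_complex_of_real by (rule refl)
  also have "(1 / sqrt ?n) * (1 / sqrt ?n) * ?n = 1" using p by (simp add: field_simps)
  finally show ?thesis using p by (intro exI[of _ c]) (auto simp: c_def)
qed

lemma orthonormal_card_le:
  assumes "finite I" "finite J"
    and o: "\<And>i i'. i \<in> I \<Longrightarrow> i' \<in> I \<Longrightarrow> (\<Sum>j\<in>J. U i j * cnj (U i' j)) = of_bool (i = i')"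
  shows "card I \<le> card J"
proof (rule ccontr)
  assume "\<not> card I \<le> card J"
  from homogeneous_system[of J I "\<lambda>j i. U i j"] this assms obtain c where
    c: "\<exists>i\<in>I. c i \<noteq> 0" "\<forall>j\<in>J. (\<Sum>i\<in>I. c i * U i j) = 0" by auto
  have "c i = 0" if "i \<in> I" for i
  proof -
    have "0 = (\<Sum>j\<in>J. (\<Sum>i'\<in>I. c i' * U i' j) * cnj (U i j))" using c(2) by simp
    also have "\<dots> = (\<Sum>j\<in>J. \<Sum>i'\<in>I. c i' * (U i' j * cnj (U i j)))" by (simp add: sum_distrib_right mult.assoc)
    also have "\<dots> = (\<Sum>i'\<in>I. c i' * (\<Sum>j\<in>J. U i' j * cnj (U i j)))"
      by (subst sum.swap) (simp add: sum_distrib_left)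
    also have "\<dots> = (\<Sum>i'\<in>I. c i' * of_bool (i' = i))" using o that by (intro sum.cong) auto
    also have "\<dots> = c i" using that assms by (simp add: of_bool_sum)
    finally show ?thesis by simp
  qed
  then show False using c(1) by auto
qed

text \<open>The residual \<open>r\<close> of a unit vector after projection to the rows is
  orthogonal to every row. If it did not vanish, the rows and the normalised residual would be card
  J + 1 orthonormal vectors in card J dimensions; the additional row is indexed by
  \<open>None\<close>.\<close>

lemma uni_if_orthonormal_rows:
  assumes fin: "finite I" "finite J" and card: "card I = card J"
    and o: "\<And>i i'. i \<in> I \<Longrightarrow> i' \<in> I \<Longrightarrow> (\<Sum>j\<in>J. U i j * cnj (U i' j)) = of_bool (i = i')"
  shows "uni I J U"
proof (rule uniI)
  fix j0 j' assume j: "j0 \<in> J" "j' \<in> J"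
  define r where "r j = of_bool (j = j0) - (\<Sum>i\<in>I. cnj (U i j0) * U i j)" for j
  have orth: "(\<Sum>j\<in>J. r j * cnj (U i j)) = 0" if "i \<in> I" for i
  proof -
    have "(\<Sum>j\<in>J. r j * cnj (U i j)) = cnj (U i j0) - (\<Sum>j\<in>J. (\<Sum>i'\<in>I. cnj (U i' j0) * U i' j) * cnj (U i j))"
      using j fin by (simp add: r_def left_diff_distrib sum_subtractf of_bool_sum)
    also have "(\<Sum>j\<in>J. (\<Sum>i'\<in>I. cnj (U i' j0) * U i' j) * cnj (U i j))
       = (\<Sum>j\<in>J. \<Sum>i'\<in>I. cnj (U i' j0) * (U i' j * cnj (U i j)))" by (simp add: sum_distrib_right mult.assoc)
    also have "\<dots> = (\<Sum>i'\<in>I. cnj (U i' j0) * (\<Sum>j\<in>J. U i' j * cnj (U i j)))"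
      by (subst sum.swap) (simp add: sum_distrib_left)
    also have "\<dots> = (\<Sum>i'\<in>I. cnj (U i' j0) * of_bool (i' = i))" using o that by (intro sum.cong) auto
    also have "\<dots> = cnj (U i j0)" using that fin by (simp add: of_bool_sum)
    finally show ?thesis by simp
  qed
  have "r j = 0" if "j \<in> J" for j
  proof (rule ccontr)
    assume "r j \<noteq> 0"
    then obtain c where c: "c \<noteq> 0" "(\<Sum>s\<in>J. (c * r s) * cnj (c * r s)) = 1"
      using normalise_vector[of J r] fin \<open>j \<in> J\<close> by blast
    let ?V = "\<lambda>i. case i of None \<Rightarrow> (\<lambda>j. c * r j) | Some i \<Rightarrow> U i"
    have 1: "(\<Sum>j\<in>J. c * r j * cnj (U i j)) = 0" if "i \<in> I" for i
      using orth[OF that] by (simp add: mult.assoc flip: sum_distrib_left)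
    have 2: "(\<Sum>j\<in>J. U i j * cnj (c * r j)) = 0" if "i \<in> I" for i
      using arg_cong[OF 1[OF that], of cnj] by (simp add: cnj_sum mult_ac)
    have "card (insert None (Some ` I)) \<le> card J"
      by (rule orthonormal_card_le[of _ _ ?V]) (use fin o 1 2 c in auto)
    moreover have "card (insert None (Some ` I)) = Suc (card I)" using fin by (simp add: card_image)
    ultimately show False using card by simp
  qed
  from this[OF j(2)] show "(\<Sum>i\<in>I. cnj (U i j0) * U i j') = of_bool (j0 = j')" by (auto simp: r_def)
qed (use fin o in auto)

text \<open>Changes of coordinates are prescribed below on a few rows only; the remaining rows are
  supplied here, each as a normalised solution of the orthogonality equations, of which there are
  fewer than unknowns.\<close>

lemma complete_orthonormal:
  assumes fin: "finite I'" "finite J" and sub: "I \<subseteq> I'" and card: "card I' = card J"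
    and o: "\<And>i i'. i \<in> I \<Longrightarrow> i' \<in> I \<Longrightarrow> (\<Sum>j\<in>J. U i j * cnj (U i' j)) = of_bool (i = i')"
  shows "\<exists>V. uni I' J V \<and> (\<forall>i\<in>I. V i = U i)"
proof -
  have fI: "finite I" using fin sub finite_subset by blast
  have "\<exists>V. (\<forall>i\<in>I. V i = U i) \<and> (\<forall>i\<in>I\<union>D. \<forall>i'\<in>I\<union>D. (\<Sum>j\<in>J. V i j * cnj (V i' j)) = of_bool (i = i'))"
    if "finite D" "D \<subseteq> I' - I" for D
    using that
  proof (induction D rule: finite_induct)
    case empty
    then show ?case using o by auto
  next
    case (insert d D)
    then obtain V where V: "\<forall>i\<in>I. V i = U i" 
      "\<forall>i\<in>I\<union>D. \<forall>i'\<in>I\<union>D. (\<Sum>j\<in>J. V i j * cnj (V i' j)) = of_bool (i = i')" by auto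
    have "I \<union> D \<subset> I'" using insert sub by auto
    then have "card (I \<union> D) < card J" using fin card by (metis psubset_card_mono)
    then obtain \<eta> where \<eta>: "\<exists>s\<in>J. \<eta> s \<noteq> 0" "\<forall>i\<in>I\<union>D. (\<Sum>s\<in>J. \<eta> s * cnj (V i s)) = 0"
      using homogeneous_system[of "I \<union> D" J "\<lambda>i s. cnj (V i s)"] fI insert fin by auto
    obtain c where c: "(\<Sum>s\<in>J. (c * \<eta> s) * cnj (c * \<eta> s)) = 1" using normalise_vector[of J \<eta>] fin \<eta> by blast
    let ?V = "V(d := \<lambda>j. c * \<eta> j)"
    have 1: "(\<Sum>j\<in>J. c * \<eta> j * cnj (V i j)) = 0" if "i \<in> I \<union> D" for i
      using \<eta>(2) that by (simp add: mult.assoc flip: sum_distrib_left)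
    have 2: "(\<Sum>j\<in>J. V i j * cnj (c * \<eta> j)) = 0" if "i \<in> I \<union> D" for i
      using arg_cong[OF 1[OF that], of cnj] by (simp add: cnj_sum mult_ac)
    have "d \<notin> I" "d \<notin> D" using insert by auto
    then have "(\<forall>i\<in>I. ?V i = U i) \<and> (\<forall>i\<in>I\<union>insert d D. \<forall>i'\<in>I\<union>insert d D. (\<Sum>j\<in>J. ?V i j * cnj (?V i' j)) = of_bool (i = i'))"
      using V 1 2 c by auto
    then show ?case by blast
  qed
  from this[of "I' - I"] fin sub have "\<exists>V. (\<forall>i\<in>I. V i = U i) \<and> (\<forall>i\<in>I'. \<forall>i'\<in>I'. (\<Sum>j\<in>J. V i j * cnj (V i' j)) = of_bool (i = i'))"
    by (simp add: Un_absorb1)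
  then show ?thesis using uni_if_orthonormal_rows[OF fin card] by metis
qed

text \<open>A family of functions of \<open>p\<close> is mixed by a scalar matrix. Since the matrix
  does not depend on \<open>p\<close>, this commutes with multiplication by a function of
  \<open>p\<close>, in particular by \<zeta>.\<close>

definition app :: "'j set \<Rightarrow> ('i \<Rightarrow> 'j \<Rightarrow> complex) \<Rightarrow> ('j \<Rightarrow> 'p \<Rightarrow> complex) \<Rightarrow> 'i \<Rightarrow> 'p \<Rightarrow> complex" where
  "app J U a i p = (\<Sum>j\<in>J. U i j * a j p)"

definition mmul :: "'j set \<Rightarrow> ('i \<Rightarrow> 'j \<Rightarrow> complex) \<Rightarrow> ('j \<Rightarrow> 'k \<Rightarrow> complex) \<Rightarrow> 'i \<Rightarrow> 'k \<Rightarrow> complex" where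
  "mmul J U V i k = (\<Sum>j\<in>J. U i j * V j k)"

definition adj :: "('i \<Rightarrow> 'j \<Rightarrow> complex) \<Rightarrow> 'j \<Rightarrow> 'i \<Rightarrow> complex" where
  "adj U j i = cnj (U i j)"

lemma uni_adj: "uni I J U \<Longrightarrow> uni J I (adj U)"
  unfolding uni_def adj_def by (simp add: eq_commute mult.commute)

lemma mmul_assoc: "mmul J U (mmul K V W) i l = mmul K (mmul J U V) W i l"
  unfolding mmul_def sum_distrib_left sum_distrib_right mult.assoc by (rule sum.swap)

lemma app_mmul: "app K (mmul J U V) a i p = app J U (app K V a) i p"
  unfolding mmul_def app_def sum_distrib_left sum_distrib_right mult.assoc by (rule sum.swap)

lemma uni_mmul:
  assumes U: "uni I J U" and V: "uni J K V"
  shows "uni I K (mmul J U V)"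
proof -
  have *: "(\<Sum>k\<in>K. mmul J U V i k * cnj (mmul J U V i' k)) = of_bool (i = i')" 
    if "uni I J U" "uni J K V" "i \<in> I" "i' \<in> I" for i i' and I :: "'x set" and J :: "'y set" and K :: "'z set" and U V
  proof -
    have "(\<Sum>k\<in>K. mmul J U V i k * cnj (mmul J U V i' k))
       = (\<Sum>k\<in>K. \<Sum>j\<in>J. \<Sum>j'\<in>J. U i j * cnj (U i' j') * (V j k * cnj (V j' k)))"
      unfolding mmul_def cnj_sum sum_product by (simp add: mult_ac)
    also have "\<dots> = (\<Sum>j\<in>J. \<Sum>j'\<in>J. U i j * cnj (U i' j') * (\<Sum>k\<in>K. V j k * cnj (V j' k)))"
      by (subst sum.swap, rule sum.cong[OF refl], subst sum.swap) (simp add: sum_distrib_left)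
    also have "\<dots> = (\<Sum>j\<in>J. \<Sum>j'\<in>J. U i j * cnj (U i' j') * of_bool (j = j'))"
      using uniD(3)[OF that(2)] by simp
    also have "\<dots> = (\<Sum>j\<in>J. U i j * cnj (U i' j))"
      using uniD(1)[OF that(2)] by (intro sum.cong) (auto simp: of_bool_sum)
    finally show ?thesis using uniD(3)[OF that(1)] that by simp
  qed
  have a: "mmul J (adj V) (adj U) = adj (mmul J U V)" by (auto simp: fun_eq_iff mmul_def adj_def cnj_sum mult.commute)
  show ?thesis
  proof (rule uniI)
    fix k k' assume "k \<in> K" "k' \<in> K"
    from *[OF uni_adj[OF V] uni_adj[OF U] this]
    show "(\<Sum>i\<in>I. cnj (mmul J U V i k) * mmul J U V i k') = of_bool (k = k')"
      unfolding a by (simp add: adj_def)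
  next
    fix i i' assume "i \<in> I" "i' \<in> I"
    then show "(\<Sum>k\<in>K. mmul J U V i k * cnj (mmul J U V i' k)) = of_bool (i = i')" by (rule *[OF U V])
  qed (use uniD(1,2)[OF U] uniD(1,2)[OF V] in auto)
qed

lemma uni_inverse_app:
  assumes "uni I J U" "j \<in> J"
  shows "app I (adj U) (app J U a) j p = a j p"
proof -
  have "app I (adj U) (app J U a) j p = (\<Sum>j'\<in>J. (\<Sum>i\<in>I. cnj (U i j) * U i j') * a j' p)"
    unfolding app_def adj_def sum_distrib_left sum_distrib_right mult.assoc by (rule sum.swap)
  also have "\<dots> = (\<Sum>j'\<in>J. of_bool (j = j') * a j' p)" using uniD(4)[OF assms(1)] assms(2) by simp
  also have "\<dots> = a j p" using assms uniD(2)[OF assms(1)] by (simp add: of_bool_sum)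
  finally show ?thesis .
qed

lemma uni_block:
  assumes U: "uni I J U" and V: "uni I' J' V" and dis: "I \<inter> I' = {}" "J \<inter> J' = {}"
    and W: "\<And>i j. i \<in> I \<Longrightarrow> j \<in> J \<Longrightarrow> W i j = U i j" "\<And>i j. i \<in> I' \<Longrightarrow> j \<in> J' \<Longrightarrow> W i j = V i j"
      "\<And>i j. i \<in> I \<Longrightarrow> j \<in> J' \<Longrightarrow> W i j = 0" "\<And>i j. i \<in> I' \<Longrightarrow> j \<in> J \<Longrightarrow> W i j = 0"
  shows "uni (I \<union> I') (J \<union> J') W"
proof (rule uniI)
  fix i i' assume i: "i \<in> I \<union> I'" "i' \<in> I \<union> I'"
  have "(\<Sum>j\<in>J \<union> J'. W i j * cnj (W i' j)) = (\<Sum>j\<in>J. W i j * cnj (W i' j)) + (\<Sum>j\<in>J'. W i j * cnj (W i' j))"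
    using uniD[OF U] uniD[OF V] dis by (intro sum.union_disjoint) auto
  also have "\<dots> = of_bool (i = i')"
    using i uniD(3)[OF U, of i i'] uniD(3)[OF V, of i i'] dis W by auto
  finally show "(\<Sum>j\<in>J \<union> J'. W i j * cnj (W i' j)) = of_bool (i = i')" .
next
  fix i i' assume i: "i \<in> J \<union> J'" "i' \<in> J \<union> J'"
  have "(\<Sum>j\<in>I \<union> I'. cnj (W j i) * W j i') = (\<Sum>j\<in>I. cnj (W j i) * W j i') + (\<Sum>j\<in>I'. cnj (W j i) * W j i')"
    using uniD[OF U] uniD[OF V] dis by (intro sum.union_disjoint) auto
  also have "\<dots> = of_bool (i = i')"
    using i uniD(4)[OF U, of i i'] uniD(4)[OF V, of i i'] dis W by auto
  finally show "(\<Sum>j\<in>I \<union> I'. cnj (W j i) * W j i') = of_bool (i = i')" .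
qed (use uniD[OF U] uniD[OF V] in auto)

text \<open>The inner product with the unit row \<open>i0\<close> reads off the entry in column
  \<open>j0\<close>.\<close>

lemma uni_row_unit:
  assumes U: "uni I J U" and i0: "i0 \<in> I" "j0 \<in> J" and row: "\<And>j. j \<in> J \<Longrightarrow> U i0 j = of_bool (j = j0)"
    and i: "i \<in> I" "i \<noteq> i0"
  shows "U i j0 = 0"
proof -
  have "(\<Sum>j\<in>J. U i j * cnj (U i0 j)) = (\<Sum>j\<in>J. U i j * of_bool (j = j0))" using row by (intro sum.cong) auto
  then show ?thesis using uniD(3)[OF U i(1) i0(1)] uniD(2)[OF U] i i0 by (simp add: of_bool_sum)
qed

section \<open>Eigenvectors\<close>

text \<open>\<open>ev p\<close> is p(E) f. If p is a nonzero polynomial of least degree with p(E) f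
  = 0 and a is a root of p, then the cofactor r of X - a does not annihilate f, and r(E) f is an
  eigenvector for a.\<close>

lemma eigenvector_in_invariant_subspace:
  fixes E :: "('i \<Rightarrow> complex) \<Rightarrow> 'i \<Rightarrow> complex"
  assumes fin: "finite I" and supp: "\<And>f i. f \<in> V \<Longrightarrow> i \<notin> I \<Longrightarrow> f i = 0"
    and add: "\<And>f g. f \<in> V \<Longrightarrow> g \<in> V \<Longrightarrow> (\<lambda>i. f i + g i) \<in> V"
    and scale: "\<And>c f. f \<in> V \<Longrightarrow> (\<lambda>i. c * f i) \<in> V"
    and EV: "\<And>f. f \<in> V \<Longrightarrow> E f \<in> V"
    and Eadd: "\<And>f g. f \<in> V \<Longrightarrow> g \<in> V \<Longrightarrow> E (\<lambda>i. f i + g i) = (\<lambda>i. E f i + E g i)"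
    and Escale: "\<And>c f. f \<in> V \<Longrightarrow> E (\<lambda>i. c * f i) = (\<lambda>i. c * E f i)"
    and f: "f \<in> V" "f \<noteq> (\<lambda>_. 0)"
  shows "\<exists>\<mu> g. g \<in> V \<and> g \<noteq> (\<lambda>_. 0) \<and> E g = (\<lambda>i. \<mu> * g i)"
proof -
  define ev where "ev p = fold_coeffs (\<lambda>a g i. a * f i + E g i) p (\<lambda>_. 0)" for p
  have zero: "(\<lambda>_. 0) \<in> V" using scale[OF f(1), of 0] by simp
  have E0: "E (\<lambda>_. 0) = (\<lambda>_. 0)" using Escale[OF f(1), of 0] Escale[OF zero, of 0] by simp
  have ev0: "ev 0 = (\<lambda>_. 0)" by (simp add: ev_def)
  have evC: "ev (pCons a p) = (\<lambda>i. a * f i + E (ev p) i)" for a p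
  proof (cases "p = 0 \<and> a = 0")
    case True then show ?thesis by (simp add: ev0 E0)
  next
    case False then show ?thesis by (cases "p = 0") (simp_all add: ev_def)
  qed
  have evV: "ev p \<in> V" for p
    by (induction p) (auto simp: ev0 evC zero intro!: add scale f EV)
  have ev_add: "ev (p + q) = (\<lambda>i. ev p i + ev q i)" for p q
    by (induction p q rule: poly_induct2) (simp_all add: ev0 evC Eadd[OF evV evV] algebra_simps)
  have ev_smult: "ev (smult c p) = (\<lambda>i. c * ev p i)" for c p
    by (induction p) (simp_all add: ev0 evC Escale[OF evV] algebra_simps)
  have ev_sum: "ev (sum g A) = (\<lambda>i. \<Sum>a\<in>A. ev (g a) i)" if "finite A" for g and A :: "nat set"
    using that by (induction A rule: finite_induct) (auto simp: ev0 ev_add)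
  define n where "n = card I"
  \<comment> \<open>The card I + 1 vectors f, E f, ..., E^n f live in card I dimensions, so some
    nonzero polynomial annihilates f.\<close>
  have "\<exists>c. (\<exists>k\<in>{..n}. c k \<noteq> 0) \<and> (\<forall>k. k \<notin> {..n} \<longrightarrow> c k = 0) \<and> (\<forall>i\<in>I. (\<Sum>k\<in>{..n}. c k * ev (monom 1 k) i) = 0)"
    by (rule homogeneous_system) (auto simp: fin n_def)
  then obtain c k0 where c: "k0 \<le> n" "c k0 \<noteq> 0" "\<forall>i\<in>I. (\<Sum>k\<in>{..n}. c k * ev (monom 1 k) i) = 0" by auto
  define p where "p = (\<Sum>k\<in>{..n}. smult (c k) (monom 1 k))"
  have "coeff p k0 = c k0" unfolding p_def using c(1) by (simp add: coeff_sum if_distrib[of "(*) _"] cong: if_cong)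
  then have p0: "p \<noteq> 0" using c(2) by auto
  have "ev p i = 0" for i
  proof (cases "i \<in> I")
    case True then show ?thesis using c(3) by (simp add: p_def ev_sum ev_smult del: smult_monom)
  next
    case False then show ?thesis using supp evV by blast
  qed
  then have "ev p = (\<lambda>_. 0)" by auto
  then obtain p where p: "p \<noteq> 0" "ev p = (\<lambda>_. 0)" "\<And>q. q \<noteq> 0 \<Longrightarrow> ev q = (\<lambda>_. 0) \<Longrightarrow> degree p \<le> degree q"
    using p0 ex_has_least_nat[of "\<lambda>q. q \<noteq> 0 \<and> ev q = (\<lambda>_. 0)" p degree] by blast
  have "degree p \<noteq> 0"
  proof
    assume "degree p = 0"
    then obtain a where "p = [:a:]" by (metis degree_eq_zeroE)
    with p(1,2) f(2) show False by (auto simp: evC ev0 E0 fun_eq_iff)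
  qed
  then have "\<exists>z. poly p z = 0"
    by (intro fundamental_theorem_of_algebra_alt notI) (metis degree_pCons_0 pCons_0_0)
  then obtain a where "poly p a = 0" by blast
  then obtain r where r: "p = [:- a, 1:] * r" using poly_eq_0_iff_dvd by blast
  have r0: "r \<noteq> 0" using p(1) r by auto
  have "degree p = Suc (degree r)" using r0 unfolding r by (subst degree_mult_eq) auto
  then have evr: "ev r \<noteq> (\<lambda>_. 0)" using p(3)[OF r0] by fastforce
  have "p = smult (- a) r + pCons 0 r" unfolding r by simp
  then have "ev p = (\<lambda>i. - a * ev r i + E (ev r) i)" by (simp only: ev_add ev_smult evC) simp
  with p(2) have "E (ev r) = (\<lambda>i. a * ev r i)" by (auto simp: fun_eq_iff)
  then show ?thesis using evr evV by blast
qed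

text \<open>\<open>normal\<close> is the property of normal matrices that matters: a row eigenvector
  is, after conjugation, a column eigenvector for the same eigenvalue. Hence the orthogonal
  complement of the eigenvectors found so far is invariant and contains a further eigenvector. It
  serves unitary matrices as well as Hermitian ones.\<close>

lemma orthonormal_row_eigenbasis:
  fixes M :: "'i \<Rightarrow> 'i \<Rightarrow> complex"
  assumes fin: "finite I"
    and normal: "\<And>e \<mu>. (\<forall>j\<in>I. (\<Sum>i\<in>I. e i * M i j) = \<mu> * e j) \<Longrightarrow> (\<forall>i\<in>I. (\<Sum>j\<in>I. M i j * cnj (e j)) = \<mu> * cnj (e i))"
  shows "\<exists>G \<tau>. uni I I G \<and> (\<forall>i\<in>I. \<forall>j\<in>I. (\<Sum>k\<in>I. G i k * M k j) = \<tau> i * G i j)"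
proof -
  have "\<exists>G \<tau>. (\<forall>i\<in>D. \<forall>i'\<in>D. (\<Sum>j\<in>I. G i j * cnj (G i' j)) = of_bool (i = i'))
      \<and> (\<forall>i\<in>D. \<forall>j\<in>I. (\<Sum>k\<in>I. G i k * M k j) = \<tau> i * G i j)"
    if "finite D" "D \<subseteq> I" for D
    using that
  proof (induction D rule: finite_induct)
    case (insert d D)
    then obtain G \<tau> where G: "\<forall>i\<in>D. \<forall>i'\<in>D. (\<Sum>j\<in>I. G i j * cnj (G i' j)) = of_bool (i = i')"
      "\<forall>i\<in>D. \<forall>j\<in>I. (\<Sum>k\<in>I. G i k * M k j) = \<tau> i * G i j" by auto
    define V where "V = {f. (\<forall>i. i \<notin> I \<longrightarrow> f i = 0) \<and> (\<forall>i\<in>D. (\<Sum>j\<in>I. f j * cnj (G i j)) = 0)}"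
    define E where "E f j = (if j \<in> I then \<Sum>i\<in>I. f i * M i j else 0)" for f j
    have "D \<subset> I" using insert by auto
    then have "card D < card I" using fin by (metis psubset_card_mono)
    then obtain f where f: "\<exists>s\<in>I. f s \<noteq> 0" "\<forall>s. s \<notin> I \<longrightarrow> f s = 0" "\<forall>i\<in>D. (\<Sum>s\<in>I. f s * cnj (G i s)) = 0"
      using homogeneous_system[of D I "\<lambda>i s. cnj (G i s)"] insert fin by auto
    have "\<exists>\<mu> g. g \<in> V \<and> g \<noteq> (\<lambda>_. 0) \<and> E g = (\<lambda>i. \<mu> * g i)"
    proof (rule eigenvector_in_invariant_subspace[where I = I and V = V and f = f])
      fix g assume g: "g \<in> V"
      have "(\<Sum>j\<in>I. E g j * cnj (G i j)) = 0" if "i \<in> D" for i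
      proof -
        have "(\<Sum>j\<in>I. E g j * cnj (G i j)) = (\<Sum>j\<in>I. \<Sum>k\<in>I. g k * (M k j * cnj (G i j)))"
          by (simp add: E_def sum_distrib_right mult.assoc)
        also have "\<dots> = (\<Sum>k\<in>I. g k * (\<Sum>j\<in>I. M k j * cnj (G i j)))"
          by (subst sum.swap) (simp add: sum_distrib_left)
        also have "\<dots> = (\<Sum>k\<in>I. g k * (\<tau> i * cnj (G i k)))"
          using normal[of "G i" "\<tau> i"] G(2) that by simp
        also have "\<dots> = \<tau> i * (\<Sum>k\<in>I. g k * cnj (G i k))" by (simp add: sum_distrib_left mult_ac)
        also have "\<dots> = 0" using g that by (simp add: V_def)
        finally show ?thesis .
      qed
      then show "E g \<in> V" by (simp add: V_def E_def)
    next
      fix c g assume "g \<in> V" then show "(\<lambda>i. c * g i) \<in> V"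
        by (simp add: V_def mult.assoc flip: sum_distrib_left)
    next
      show "f \<in> V" using f by (simp add: V_def)
      show "f \<noteq> (\<lambda>_. 0)" using f(1) by auto
    qed (auto simp: fin V_def E_def fun_eq_iff distrib_right sum.distrib sum_distrib_left mult.assoc)
    then obtain \<mu> g where g: "g \<in> V" "g \<noteq> (\<lambda>_. 0)" "E g = (\<lambda>i. \<mu> * g i)" by blast
    have "\<exists>s\<in>I. g s \<noteq> 0" using g by (fastforce simp: V_def)
    then obtain c where c: "(\<Sum>s\<in>I. (c * g s) * cnj (c * g s)) = 1" using normalise_vector[of I g] fin by blast
    have 1: "(\<Sum>j\<in>I. c * g j * cnj (G i j)) = 0" if "i \<in> D" for i
      using g(1) that by (simp add: V_def mult.assoc flip: sum_distrib_left)
    have 2: "(\<Sum>j\<in>I. G i j * cnj (c * g j)) = 0" if "i \<in> D" for i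
      using arg_cong[OF 1[OF that], of cnj] by (simp add: cnj_sum mult_ac)
    have 3: "(\<Sum>k\<in>I. c * g k * M k j) = \<mu> * (c * g j)" if "j \<in> I" for j
    proof -
      have "(\<Sum>k\<in>I. g k * M k j) = \<mu> * g j" using fun_cong[OF g(3), of j] that by (simp add: E_def)
      then show ?thesis by (simp add: mult.assoc flip: sum_distrib_left) 
    qed
    have "d \<notin> D" using insert by auto
    then have ne: "x \<noteq> d" if "x \<in> D" for x using that by auto
    let ?G = "G(d := \<lambda>j. c * g j)" and ?\<tau> = "\<tau>(d := \<mu>)"
    have "(\<forall>i\<in>insert d D. \<forall>i'\<in>insert d D. (\<Sum>j\<in>I. ?G i j * cnj (?G i' j)) = of_bool (i = i'))"
      using G(1) 1 2 c \<open>d \<notin> D\<close> by auto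
    moreover have "(\<forall>i\<in>insert d D. \<forall>j\<in>I. (\<Sum>k\<in>I. ?G i k * M k j) = ?\<tau> i * ?G i j)"
      using G(2) 3 \<open>d \<notin> D\<close> by auto
    ultimately show ?case by blast
  qed auto
  from this[OF fin order.refl] obtain G \<tau> where "\<forall>i\<in>I. \<forall>i'\<in>I. (\<Sum>j\<in>I. G i j * cnj (G i' j)) = of_bool (i = i')"
    "\<forall>i\<in>I. \<forall>j\<in>I. (\<Sum>k\<in>I. G i k * M k j) = \<tau> i * G i j" by blast
  then show ?thesis using uni_if_orthonormal_rows[OF fin fin refl] by blast
qed

text \<open>The adjoint undoes U, so an eigenvector of U for \<mu> is one of the adjoint for
  1/\<mu>, and preservation of norms makes this \<open>cnj \<mu>\<close>. The zero vector has to be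
  treated apart, because \<open>normal\<close> is required for it too.\<close>

lemma uni_diagonalise:
  assumes U: "uni I I U"
  shows "\<exists>G \<tau>. uni I I G \<and> (\<forall>i\<in>I. cmod (\<tau> i) = 1) \<and> (\<forall>i\<in>I. \<forall>j\<in>I. (\<Sum>k\<in>I. G i k * U k j) = \<tau> i * G i j)"
proof -
  have bk: "(\<Sum>j\<in>I. (\<Sum>i\<in>I. e i * U i j) * cnj (U k j)) = e k" if "k \<in> I" for e k
  proof -
    have "(\<Sum>j\<in>I. (\<Sum>i\<in>I. e i * U i j) * cnj (U k j)) = (\<Sum>j\<in>I. \<Sum>i\<in>I. e i * (U i j * cnj (U k j)))"
      by (simp add: sum_distrib_right mult.assoc)
    also have "\<dots> = (\<Sum>i\<in>I. e i * (\<Sum>j\<in>I. U i j * cnj (U k j)))" by (subst sum.swap) (simp add: sum_distrib_left)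
    also have "\<dots> = e k" using that uniD(3)[OF U _ that] uniD(1)[OF U] by (simp add: of_bool_sum)
    finally show ?thesis .
  qed
  have un: "(\<forall>j\<in>I. e j = 0) \<or> \<mu> * cnj \<mu> = 1" if "\<forall>j\<in>I. (\<Sum>i\<in>I. e i * U i j) = \<mu> * e j" for e \<mu>
  proof -
    have "(\<Sum>k\<in>I. e k * cnj (e k)) = (\<Sum>k\<in>I. (\<Sum>j\<in>I. \<mu> * e j * cnj (U k j)) * cnj (e k))"
      using bk[of _ e] that by simp
    also have "\<dots> = (\<Sum>k\<in>I. \<Sum>j\<in>I. \<mu> * e j * (cnj (U k j) * cnj (e k)))" by (simp add: sum_distrib_right mult.assoc)
    also have "\<dots> = (\<Sum>j\<in>I. \<mu> * e j * cnj (\<Sum>k\<in>I. e k * U k j))"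
      by (subst sum.swap) (simp add: sum_distrib_left mult_ac)
    also have "\<dots> = \<mu> * cnj \<mu> * (\<Sum>j\<in>I. e j * cnj (e j))" using that by (simp add: sum_distrib_left mult_ac)
    finally have "(\<Sum>j\<in>I. e j * cnj (e j)) = 0 \<or> \<mu> * cnj \<mu> = 1" by auto
    then show ?thesis using sum_norm_sq_eq_0[OF uniD(1)[OF U], of e] by blast
  qed
  have "\<exists>G \<tau>. uni I I G \<and> (\<forall>i\<in>I. \<forall>j\<in>I. (\<Sum>k\<in>I. G i k * U k j) = \<tau> i * G i j)"
  proof (rule orthonormal_row_eigenbasis[OF uniD(1)[OF U]], intro ballI)
    fix e \<mu> i assume e: "\<forall>j\<in>I. (\<Sum>i\<in>I. e i * U i j) = \<mu> * e j" and i: "i \<in> I"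
    from un[OF e] show "(\<Sum>j\<in>I. U i j * cnj (e j)) = \<mu> * cnj (e i)"
    proof
      assume "\<mu> * cnj \<mu> = 1"
      have "cnj (e i) = cnj (\<Sum>j\<in>I. \<mu> * e j * cnj (U i j))" using bk[OF i, of e] e by simp
      also have "\<dots> = cnj \<mu> * (\<Sum>j\<in>I. U i j * cnj (e j))" by (simp add: sum_distrib_left mult_ac)
      finally show ?thesis using \<open>\<mu> * cnj \<mu> = 1\<close> by simp
    qed (use i in auto)
  qed
  then obtain G \<tau> where G: "uni I I G" "\<forall>i\<in>I. \<forall>j\<in>I. (\<Sum>k\<in>I. G i k * U k j) = \<tau> i * G i j" by blast
  have "cmod (\<tau> i) = 1" if "i \<in> I" for i
  proof -
    have "\<not> (\<forall>j\<in>I. G i j = 0)"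
    proof
      assume "\<forall>j\<in>I. G i j = 0"
      then have "(\<Sum>j\<in>I. G i j * cnj (G i j)) = 0" by simp
      then show False using uniD(3)[OF G(1) that that] by simp
    qed
    then have "\<tau> i * cnj (\<tau> i) = 1" using un[of "G i" "\<tau> i"] G(2) that by auto
    then have "complex_of_real ((cmod (\<tau> i))\<^sup>2) = 1" by (simp only: complex_norm_square)
    then have "(cmod (\<tau> i))\<^sup>2 = 1" by (simp only: of_real_eq_1_iff)
    then show ?thesis by (metis abs_norm_cancel abs_square_eq_1)
  qed
  then show ?thesis using G by blast
qed

text \<open>Row \<open>i0\<close> is a combination of the other rows. Without it there are fewer
  equations than unknowns, and any solution of the rest solves the omitted equation as well.\<close>

lemma singular_transpose:
  fixes M :: "'i \<Rightarrow> 'i \<Rightarrow> complex"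
  assumes fin: "finite K" and c: "\<exists>i\<in>K. c i \<noteq> 0" "\<forall>j\<in>K. (\<Sum>i\<in>K. c i * M i j) = 0"
  shows "\<exists>y. (\<exists>j\<in>K. y j \<noteq> 0) \<and> (\<forall>i\<in>K. (\<Sum>j\<in>K. M i j * y j) = 0)"
proof -
  obtain i0 where i0: "i0 \<in> K" "c i0 \<noteq> 0" using c by blast
  have "card (K - {i0}) < card K" using i0 fin by (meson card_Diff1_less)
  then obtain y where y: "\<exists>j\<in>K. y j \<noteq> 0" "\<forall>i\<in>K - {i0}. (\<Sum>j\<in>K. y j * M i j) = 0"
    using homogeneous_system[of "K - {i0}" K M] fin by auto
  have "(\<Sum>i\<in>K. c i * (\<Sum>j\<in>K. y j * M i j)) = (\<Sum>i\<in>K. \<Sum>j\<in>K. y j * (c i * M i j))"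
    by (simp add: sum_distrib_left mult_ac)
  also have "\<dots> = (\<Sum>j\<in>K. y j * (\<Sum>i\<in>K. c i * M i j))" by (subst sum.swap) (simp add: sum_distrib_left)
  also have "\<dots> = 0" using c(2) by simp
  finally have "(\<Sum>i\<in>K. c i * (\<Sum>j\<in>K. y j * M i j)) = 0" .
  moreover have "(\<Sum>i\<in>K. c i * (\<Sum>j\<in>K. y j * M i j)) = c i0 * (\<Sum>j\<in>K. y j * M i0 j)"
    using y(2) fin i0 by (subst sum.remove[of K i0]) auto
  ultimately have "(\<Sum>j\<in>K. y j * M i0 j) = 0" using i0 by simp
  then have "\<forall>i\<in>K. (\<Sum>j\<in>K. M i j * y j) = 0" using y(2) by (auto simp: mult.commute)
  then show ?thesis using y(1) by blast
qed

text \<open>The roots of \<open>det (X - \<nu> X\<^sup>*)\<close> are symmetric with respect to the unit circle.\<close>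

lemma adjoint_pencil_eigenvalue:
  fixes X :: "'i \<Rightarrow> 'i \<Rightarrow> complex"
  assumes fin: "finite K" and ne: "K \<noteq> {}"
  shows "\<exists>\<nu> c. cmod \<nu> \<le> 1 \<and> (\<exists>i\<in>K. c i \<noteq> 0) \<and> (\<forall>j\<in>K. (\<Sum>i\<in>K. c i * X i j) = \<nu> * (\<Sum>i\<in>K. c i * cnj (X j i)))"
proof (cases "\<exists>c. (\<exists>i\<in>K. c i \<noteq> 0) \<and> (\<forall>j\<in>K. (\<Sum>i\<in>K. c i * X i j) = 0)")
  case True
  then show ?thesis by (intro exI[of _ 0]) auto
next
  case False
  have inv: "\<exists>a. \<forall>s\<in>K. v s = (\<Sum>b\<in>K. a b * cnj (X s b))" for v
  proof (rule fredholm_alternative[OF fin _ fin])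
    fix \<eta> assume \<eta>: "\<forall>b\<in>K. (\<Sum>s\<in>K. \<eta> s * cnj (X s b)) = 0"
    have "\<forall>b\<in>K. (\<Sum>s\<in>K. cnj (\<eta> s) * X s b) = 0"
    proof
      fix b assume "b \<in> K"
      then have "cnj (\<Sum>s\<in>K. \<eta> s * cnj (X s b)) = 0" using \<eta> by simp
      then show "(\<Sum>s\<in>K. cnj (\<eta> s) * X s b) = 0" by simp
    qed
    then have "\<not> (\<exists>s\<in>K. cnj (\<eta> s) \<noteq> 0)" using False[unfolded not_ex, rule_format, of "\<lambda>s. cnj (\<eta> s)"] by blast
    then show "(\<Sum>s\<in>K. \<eta> s * v s) = 0" by simp
  qed
  have "\<forall>j. \<exists>a. \<forall>s\<in>K. of_bool (s = j) = (\<Sum>b\<in>K. a b * cnj (X s b))" by (intro allI inv)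
  then obtain Y where Y: "\<And>j s. s \<in> K \<Longrightarrow> of_bool (s = j) = (\<Sum>b\<in>K. Y j b * cnj (X s b))" by metis
  define V where "V = {f :: 'i \<Rightarrow> complex. \<forall>i. i \<notin> K \<longrightarrow> f i = 0}"
  \<comment> \<open>\<open>Y\<close> inverts the adjoint of \<open>X\<close>, so \<open>E\<close> is
    f -> f X Y, and an eigenvector of \<open>E\<close> is an eigenvector of the pencil with the same
    eigenvalue.\<close>
  define E where "E f k = (if k \<in> K then \<Sum>j\<in>K. (\<Sum>i\<in>K. f i * X i j) * Y j k else 0)" for f k
  obtain k0 where "k0 \<in> K" using ne by auto
  have "\<exists>\<mu> g. g \<in> V \<and> g \<noteq> (\<lambda>_. 0) \<and> E g = (\<lambda>i. \<mu> * g i)"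
    by (rule eigenvector_in_invariant_subspace[where I = K and V = V and f = "\<lambda>i. of_bool (i = k0)"])
      (use \<open>k0 \<in> K\<close> in \<open>auto simp: fin V_def E_def fun_eq_iff distrib_right sum.distrib sum_distrib_left sum_distrib_right mult.assoc\<close>)
  then obtain \<mu> g where g: "g \<in> V" "g \<noteq> (\<lambda>_. 0)" "E g = (\<lambda>i. \<mu> * g i)" by blast
  have gK: "\<exists>i\<in>K. g i \<noteq> 0" using g(1,2) by (fastforce simp: V_def)
  have pencil: "(\<Sum>i\<in>K. g i * X i s) = \<mu> * (\<Sum>k\<in>K. g k * cnj (X s k))" if s: "s \<in> K" for s
  proof -
    have "\<mu> * (\<Sum>k\<in>K. g k * cnj (X s k)) = (\<Sum>k\<in>K. (\<mu> * g k) * cnj (X s k))" by (simp add: sum_distrib_left mult.assoc)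
    also have "\<dots> = (\<Sum>k\<in>K. (\<Sum>j\<in>K. (\<Sum>i\<in>K. g i * X i j) * Y j k) * cnj (X s k))"
    proof (rule sum.cong[OF refl])
      fix k assume "k \<in> K"
      then show "\<mu> * g k * cnj (X s k) = (\<Sum>j\<in>K. (\<Sum>i\<in>K. g i * X i j) * Y j k) * cnj (X s k)"
        using fun_cong[OF g(3), of k] by (simp add: E_def)
    qed
    also have "\<dots> = (\<Sum>k\<in>K. \<Sum>j\<in>K. (\<Sum>i\<in>K. g i * X i j) * (Y j k * cnj (X s k)))" by (simp add: sum_distrib_right mult.assoc)
    also have "\<dots> = (\<Sum>j\<in>K. (\<Sum>i\<in>K. g i * X i j) * (\<Sum>k\<in>K. Y j k * cnj (X s k)))" 
      by (subst sum.swap) (simp add: sum_distrib_left)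
    also have "\<dots> = (\<Sum>j\<in>K. (\<Sum>i\<in>K. g i * X i j) * of_bool (s = j))" using Y[OF s] by simp
    also have "\<dots> = (\<Sum>i\<in>K. g i * X i s)" using s fin by (simp add: of_bool_sum)
    finally show ?thesis by simp
  qed
  show ?thesis
  proof (cases "cmod \<mu> \<le> 1")
    case True then show ?thesis using gK pencil by blast
  next
    case f: False
    \<comment> \<open>Here |\<mu>| > 1. A column vector \<open>y\<close> in the kernel of X - \<mu>
      adj X, conjugated and read as a row, is an eigenvector of the pencil for 1 / cnj \<mu>, which
      lies inside the disk.\<close>
    have "\<forall>j\<in>K. (\<Sum>i\<in>K. g i * (X i j - \<mu> * cnj (X j i))) = 0"
      using pencil by (simp add: right_diff_distrib sum_subtractf sum_distrib_left mult.left_commute)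
    from singular_transpose[OF fin gK this] obtain y where y: "\<exists>j\<in>K. y j \<noteq> 0"
      "\<forall>i\<in>K. (\<Sum>j\<in>K. (X i j - \<mu> * cnj (X j i)) * y j) = 0" by blast
    have "(\<Sum>i\<in>K. cnj (y i) * X i j) = (1 / cnj \<mu>) * (\<Sum>i\<in>K. cnj (y i) * cnj (X j i))" if j: "j \<in> K" for j
    proof -
      have "cnj (\<Sum>i\<in>K. (X j i - \<mu> * cnj (X i j)) * y i) = 0" using y(2) j by simp
      then have "(\<Sum>i\<in>K. cnj (y i) * cnj (X j i)) = cnj \<mu> * (\<Sum>i\<in>K. cnj (y i) * X i j)"
        by (simp add: left_diff_distrib right_diff_distrib sum_subtractf sum_distrib_left mult_ac)
      moreover have "\<mu> \<noteq> 0" using f by auto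
      ultimately show ?thesis by simp
    qed
    moreover have "cmod (1 / cnj \<mu>) \<le> 1" using f by (simp add: norm_divide divide_simps)
    moreover have "\<exists>j\<in>K. cnj (y j) \<noteq> 0" using y(1) by simp
    ultimately show ?thesis by (intro exI[of _ "1 / cnj \<mu>"] exI[of _ "\<lambda>i. cnj (y i)"]) simp
  qed
qed

text \<open>The rows in \<open>B\<close> are unit vectors, so by orthogonality the columns
  \<open>c b\<close> vanish in all other rows. The deleted block is thus decoupled from what
  remains.\<close>

lemma uni_delete_set:
  assumes U: "uni I J U" and B: "B \<subseteq> I" "c ` B \<subseteq> J"
    and row: "\<And>b j. b \<in> B \<Longrightarrow> j \<in> J \<Longrightarrow> U b j = of_bool (j = c b)"
  shows "uni (I - B) (J - c ` B) U"
    and "\<And>i b. i \<in> I - B \<Longrightarrow> b \<in> B \<Longrightarrow> U i (c b) = 0"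
proof -
  show z: "U i (c b) = 0" if "i \<in> I - B" "b \<in> B" for i b
    by (rule uni_row_unit[OF U, of b]) (use that B row in auto)
  show "uni (I - B) (J - c ` B) U"
  proof (rule uniI)
    fix i i' assume i: "i \<in> I - B" "i' \<in> I - B"
    have "(\<Sum>j\<in>J - c ` B. U i j * cnj (U i' j)) = (\<Sum>j\<in>J. U i j * cnj (U i' j))"
      by (rule sum.mono_neutral_left) (use uniD(2)[OF U] z i in auto)
    then show "(\<Sum>j\<in>J - c ` B. U i j * cnj (U i' j)) = of_bool (i = i')" using uniD(3)[OF U] i by auto
  next
    fix i i' assume i: "i \<in> J - c ` B" "i' \<in> J - c ` B"
    have "U b i = 0" if "b \<in> B" for b using row[OF that, of i] i that by auto
    then have "(\<Sum>j\<in>I - B. cnj (U j i) * U j i') = (\<Sum>j\<in>I. cnj (U j i) * U j i')"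
      by (intro sum.mono_neutral_left) (use uniD(1)[OF U] B in auto)
    then show "(\<Sum>j\<in>I - B. cnj (U j i) * U j i') = of_bool (i = i')" using uniD(4)[OF U] i by auto
  qed (use uniD[OF U] in auto)
qed

lemma uni_reindex_rows:
  assumes U: "uni I J U" and f: "bij_betw f I' I"
  shows "uni I' J (\<lambda>i. U (f i))"
proof (rule uniI)
  have inj: "inj_on f I'" and im: "f ` I' = I" using f by (auto simp: bij_betw_def)
  show "finite I'" using f uniD(1)[OF U] bij_betw_finite by blast
  show "finite J" using uniD(2)[OF U] .
  show "(\<Sum>j\<in>J. U (f i) j * cnj (U (f i') j)) = of_bool (i = i')" if "i \<in> I'" "i' \<in> I'" for i i'
    using uniD(3)[OF U, of "f i" "f i'"] that im inj by (auto simp: inj_on_eq_iff)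
  show "(\<Sum>i\<in>I'. cnj (U (f i) j) * U (f i) j') = of_bool (j = j')" if "j \<in> J" "j' \<in> J" for j j'
    using uniD(4)[OF U that] sum.reindex_bij_betw[OF f, of "\<lambda>i. cnj (U i j) * U i j'"] by simp
qed

lemma uni_right_inverse:
  assumes "uni I J U" "j \<in> J"
  shows "(\<Sum>i\<in>I. (\<Sum>k\<in>J. e k * cnj (U i k)) * U i j) = e j"
proof -
  have "(\<Sum>i\<in>I. (\<Sum>k\<in>J. e k * cnj (U i k)) * U i j) = (\<Sum>i\<in>I. \<Sum>k\<in>J. e k * (cnj (U i k) * U i j))"
    by (simp add: sum_distrib_right mult.assoc)
  also have "\<dots> = (\<Sum>k\<in>J. e k * (\<Sum>i\<in>I. cnj (U i k) * U i j))" by (subst sum.swap) (simp add: sum_distrib_left)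
  also have "\<dots> = (\<Sum>k\<in>J. e k * of_bool (k = j))" using uniD(4)[OF assms(1)] assms(2) by simp
  also have "\<dots> = e j" using assms uniD(2)[OF assms(1)] by (simp add: of_bool_sum)
  finally show ?thesis .
qed

lemma uni_inner_rows:
  assumes U: "uni I J U"
  shows "(\<Sum>j\<in>J. (\<Sum>i\<in>I. x i * U i j) * cnj (\<Sum>i\<in>I. y i * U i j)) = (\<Sum>i\<in>I. x i * cnj (y i))"
proof -
  have "(\<Sum>j\<in>J. (\<Sum>i\<in>I. x i * U i j) * cnj (\<Sum>i\<in>I. y i * U i j))
     = (\<Sum>j\<in>J. \<Sum>i\<in>I. \<Sum>i'\<in>I. x i * cnj (y i') * (U i j * cnj (U i' j)))"
    unfolding cnj_sum sum_product by (simp add: mult_ac)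
  also have "\<dots> = (\<Sum>i\<in>I. \<Sum>i'\<in>I. x i * cnj (y i') * (\<Sum>j\<in>J. U i j * cnj (U i' j)))"
    by (subst sum.swap, rule sum.cong[OF refl], subst sum.swap) (simp add: sum_distrib_left)
  also have "\<dots> = (\<Sum>i\<in>I. \<Sum>i'\<in>I. x i * cnj (y i') * of_bool (i = i'))" using uniD(3)[OF U] by simp
  also have "\<dots> = (\<Sum>i\<in>I. x i * cnj (y i))" 
    using uniD(1)[OF U] by (intro sum.cong refl) (simp add: of_bool_sum)
  finally show ?thesis .
qed

text \<open>A largest orthonormal system in the left kernel of \<beta>; sizes are bounded by card S,
  and a vector of the kernel outside the span would yield a larger system. \<open>k > 0\<close>
  because there are fewer equations than unknowns.\<close>

lemma orthonormal_basis_of_kernel: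
  fixes \<beta> :: "'b \<Rightarrow> 's \<Rightarrow> complex"
  assumes "finite S" "finite B" "card B < card S"
  obtains k :: nat and n where "k > 0"
    "\<And>i b. i < k \<Longrightarrow> b \<in> B \<Longrightarrow> (\<Sum>s\<in>S. n i s * \<beta> b s) = 0"
    "\<And>i i'. i < k \<Longrightarrow> i' < k \<Longrightarrow> (\<Sum>s\<in>S. n i s * cnj (n i' s)) = of_bool (i = i')"
    "\<And>\<eta>. (\<forall>b\<in>B. (\<Sum>s\<in>S. \<eta> s * \<beta> b s) = 0) \<Longrightarrow> \<exists>c. \<forall>s\<in>S. \<eta> s = (\<Sum>i<k. c i * n i s)"
proof -
  define ok where "ok k \<longleftrightarrow> (\<exists>n. (\<forall>i<k. \<forall>b\<in>B. (\<Sum>s\<in>S. n i s * \<beta> b s) = 0)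
    \<and> (\<forall>i<k. \<forall>i'<k. (\<Sum>s\<in>S. n i s * cnj (n i' s)) = of_bool (i = i')))" for k :: nat
  have bnd: "k \<le> card S" if "ok k" for k
  proof -
    from that obtain n where "\<forall>i<k. \<forall>i'<k. (\<Sum>s\<in>S. n i s * cnj (n i' s)) = of_bool (i = i')" unfolding ok_def by blast
    then show ?thesis using orthonormal_card_le[of "{..<k}" S n] assms by auto
  qed
  have "ok 0" unfolding ok_def by simp
  have fok: "finite {k. ok k}" using bnd by (intro finite_subset[OF _ finite_atMost[of "card S"]] subsetI) simp
  define k where "k = Max {k. ok k}"
  have k: "ok k" "\<And>l. ok l \<Longrightarrow> l \<le> k"
    using Max_in[OF fok] Max_ge[OF fok] \<open>ok 0\<close> by (auto simp: k_def)
  then obtain n where n: "\<forall>i<k. \<forall>b\<in>B. (\<Sum>s\<in>S. n i s * \<beta> b s) = 0"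
    "\<forall>i<k. \<forall>i'<k. (\<Sum>s\<in>S. n i s * cnj (n i' s)) = of_bool (i = i')" unfolding ok_def by blast
  have ext: "\<forall>s\<in>S. \<rho> s = 0" if r: "\<forall>b\<in>B. (\<Sum>s\<in>S. \<rho> s * \<beta> b s) = 0" "\<forall>i<k. (\<Sum>s\<in>S. \<rho> s * cnj (n i s)) = 0" for \<rho>
  proof (rule ccontr)
    assume "\<not> (\<forall>s\<in>S. \<rho> s = 0)"
    then obtain c where c: "(\<Sum>s\<in>S. (c * \<rho> s) * cnj (c * \<rho> s)) = 1" using normalise_vector[of S \<rho>] assms by blast
    have 1: "(\<Sum>j\<in>S. c * \<rho> j * cnj (n i j)) = 0" if "i < k" for i
      using r(2) that by (simp add: mult.assoc flip: sum_distrib_left)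
    have 2: "(\<Sum>j\<in>S. n i j * cnj (c * \<rho> j)) = 0" if "i < k" for i
      using arg_cong[OF 1[OF that], of cnj] by (simp add: cnj_sum mult_ac)
    have 3: "(\<Sum>j\<in>S. c * \<rho> j * \<beta> b j) = 0" if "b \<in> B" for b
      using r(1) that by (simp add: mult.assoc flip: sum_distrib_left)
    have "ok (Suc k)" unfolding ok_def
      by (rule exI[of _ "n(k := \<lambda>s. c * \<rho> s)"]) (use n 1 2 3 c in \<open>auto simp: less_Suc_eq\<close>)
    then show False using k(2) by fastforce
  qed
  have span: "\<exists>c. \<forall>s\<in>S. \<eta> s = (\<Sum>i<k. c i * n i s)" if e: "\<forall>b\<in>B. (\<Sum>s\<in>S. \<eta> s * \<beta> b s) = 0" for \<eta>
  proof -
    define c where "c i = (\<Sum>s\<in>S. \<eta> s * cnj (n i s))" for i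
    have lin: "(\<Sum>s\<in>S. (\<eta> s - (\<Sum>i<k. c i * n i s)) * x s) = (\<Sum>s\<in>S. \<eta> s * x s) - (\<Sum>i<k. c i * (\<Sum>s\<in>S. n i s * x s))" for x
    proof -
      have "(\<Sum>i<k. c i * (\<Sum>s\<in>S. n i s * x s)) = (\<Sum>s\<in>S. \<Sum>i<k. c i * n i s * x s)"
        by (subst sum.swap) (simp add: sum_distrib_left mult.assoc)
      then show ?thesis by (simp add: left_diff_distrib sum_subtractf sum_distrib_right)
    qed
    have "(\<Sum>s\<in>S. (\<eta> s - (\<Sum>i<k. c i * n i s)) * \<beta> b s) = 0" if "b \<in> B" for b
      unfolding lin using e n(1) that by simp
    moreover have "(\<Sum>s\<in>S. (\<eta> s - (\<Sum>i<k. c i * n i s)) * cnj (n i s)) = 0" if "i < k" for i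
      unfolding lin using n(2) that by (simp add: of_bool_sum c_def[symmetric])
    ultimately have "\<forall>s\<in>S. \<eta> s - (\<Sum>i<k. c i * n i s) = 0" using ext[of "\<lambda>s. \<eta> s - (\<Sum>i<k. c i * n i s)"] by blast
    then show ?thesis by auto
  qed
  have "k \<noteq> 0"
  proof
    assume "k = 0"
    obtain \<eta> where "\<exists>s\<in>S. \<eta> s \<noteq> 0" "\<forall>b\<in>B. (\<Sum>s\<in>S. \<eta> s * \<beta> b s) = 0"
      using homogeneous_system[of B S \<beta>] assms by blast
    with span[of \<eta>] \<open>k = 0\<close> show False by simp
  qed
  then show ?thesis using n by (intro that[of k n] span) auto
qed

text \<open>In the notation \<open>U = (D C; B A)\<close> for the colligation, \<open>\<eta> B = 0\<close> and
  \<open>\<eta> A\<^sup>* - \<nu> \<eta> A\<close> is orthogonal to the left kernel of \<open>B\<close>; the compressions of \<open>A\<^sup>*\<close> and \<open>A\<close> to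
  that kernel are adjoint to each other.\<close>

lemma decoupling_vector:
  assumes U: "uni (B \<union> S) (B \<union> S) U" and dis: "B \<inter> S = {}" and card: "card B < card S"
  shows "\<exists>\<eta> \<theta> \<nu> e r. cmod \<nu> \<le> 1 \<and> (\<Sum>s\<in>S. \<eta> s * cnj (\<eta> s)) = 1 \<and> (\<forall>b\<in>B. \<eta> b = 0) \<and> (\<forall>b\<in>B. \<theta> b = 0)
     \<and> (\<forall>s\<in>S. e s = \<eta> s) \<and> (\<forall>s\<in>S. r s = \<nu> * \<theta> s)
     \<and> (\<forall>j\<in>B\<union>S. (\<Sum>i\<in>B\<union>S. \<eta> i * U i j) = \<theta> j) \<and> (\<forall>j\<in>B\<union>S. (\<Sum>i\<in>B\<union>S. r i * U i j) = e j)"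
proof -
  have fin: "finite B" "finite S" using uniD(1)[OF U] by auto
  have split: "(\<Sum>i\<in>B\<union>S. f i) = (\<Sum>i\<in>B. f i) + (\<Sum>i\<in>S. f i)" for f :: "'a \<Rightarrow> complex"
    using fin dis by (rule sum.union_disjoint)
  show ?thesis
  proof (rule orthonormal_basis_of_kernel[OF fin(2,1) card, of "\<lambda>b s. U s b"])
  fix k :: nat and n
  assume k: "k > 0" and ker: "\<And>i b. i < k \<Longrightarrow> b \<in> B \<Longrightarrow> (\<Sum>s\<in>S. n i s * U s b) = 0"
    and on: "\<And>i i'. i < k \<Longrightarrow> i' < k \<Longrightarrow> (\<Sum>s\<in>S. n i s * cnj (n i' s)) = of_bool (i = i')"
    and span: "\<And>\<eta>. (\<forall>b\<in>B. (\<Sum>s\<in>S. \<eta> s * U s b) = 0) \<Longrightarrow> \<exists>c. \<forall>s\<in>S. \<eta> s = (\<Sum>i<k. c i * n i s)"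
  \<comment> \<open>Matrix of the compression to the left kernel of B of the adjoint of A; by
    \<open>X'\<close> its conjugate transpose is the matrix of the compression of A.\<close>
  define X where "X i j = (\<Sum>s\<in>S. (\<Sum>t\<in>S. n i t * cnj (U s t)) * cnj (n j s))" for i j
  have X': "cnj (X j i) = (\<Sum>s\<in>S. (\<Sum>t\<in>S. n i t * U t s) * cnj (n j s))" for i j
  proof -
    have "cnj (X j i) = (\<Sum>s\<in>S. \<Sum>t\<in>S. cnj (n j t) * U s t * n i s)"
      unfolding X_def cnj_sum by (simp add: cnj_sum sum_distrib_right)
    also have "\<dots> = (\<Sum>t\<in>S. \<Sum>s\<in>S. n i s * U s t * cnj (n j t))" by (subst sum.swap) (simp add: mult_ac)
    finally show ?thesis by (simp add: sum_distrib_right)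
  qed
  have "{..<k} \<noteq> {}" using k by auto
  from adjoint_pencil_eigenvalue[OF finite_lessThan this, of X] obtain \<nu> c where
    \<nu>: "cmod \<nu> \<le> 1" and c: "\<exists>i<k. c i \<noteq> 0" 
    and pen: "\<And>j. j < k \<Longrightarrow> (\<Sum>i<k. c i * X i j) = \<nu> * (\<Sum>i<k. c i * cnj (X j i))" by auto
  define \<eta>0 where "\<eta>0 s = (if s \<in> S then \<Sum>i<k. c i * n i s else 0)" for s
  have exch: "(\<Sum>s\<in>S. \<eta>0 s * x s) = (\<Sum>i<k. c i * (\<Sum>s\<in>S. n i s * x s))" for x
  proof -
    have "(\<Sum>i<k. c i * (\<Sum>s\<in>S. n i s * x s)) = (\<Sum>s\<in>S. \<Sum>i<k. c i * n i s * x s)"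
      by (subst sum.swap) (simp add: sum_distrib_left mult.assoc)
    then show ?thesis by (simp add: \<eta>0_def sum_distrib_right)
  qed
  have "\<exists>s\<in>S. \<eta>0 s \<noteq> 0"
  proof (rule ccontr)
    assume z: "\<not> (\<exists>s\<in>S. \<eta>0 s \<noteq> 0)"
    obtain j where j: "j < k" "c j \<noteq> 0" using c by blast
    have "0 = (\<Sum>s\<in>S. \<eta>0 s * cnj (n j s))" using z by simp
    also have "\<dots> = c j" unfolding exch using on j by (simp add: of_bool_sum)
    finally show False using j by simp
  qed
  then obtain d where d: "(\<Sum>s\<in>S. (d * \<eta>0 s) * cnj (d * \<eta>0 s)) = 1" using normalise_vector[of S \<eta>0] fin by blast
  define \<eta> where "\<eta> s = d * \<eta>0 s" for s
  have eS: "(\<Sum>s\<in>S. \<eta> s * x s) = d * (\<Sum>i<k. c i * (\<Sum>s\<in>S. n i s * x s))" for x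
    unfolding exch[symmetric] by (simp add: \<eta>_def sum_distrib_left mult.assoc)
  have eB: "\<eta> b = 0" if "b \<in> B" for b using that dis by (auto simp: \<eta>_def \<eta>0_def)
  define \<theta> where "\<theta> j = (\<Sum>i\<in>B\<union>S. \<eta> i * U i j)" for j
  have th: "\<theta> j = (\<Sum>i\<in>S. \<eta> i * U i j)" for j by (simp add: \<theta>_def split eB)
  have thB: "\<theta> b = 0" if "b \<in> B" for b unfolding th eS using ker that by simp
  \<comment> \<open>The pencil equation says that \<open>v\<close> is orthogonal to the left kernel
    of B, so the Fredholm alternative writes it through the columns of B.\<close>
  define v where "v s = (\<Sum>t\<in>S. \<eta> t * cnj (U s t)) - \<nu> * \<theta> s" for s
  have orth: "(\<Sum>s\<in>S. v s * cnj (n j s)) = 0" if j: "j < k" for j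
  proof -
    have a: "(\<Sum>s\<in>S. (\<Sum>t\<in>S. \<eta> t * x s t) * cnj (n j s)) = d * (\<Sum>i<k. c i * (\<Sum>s\<in>S. (\<Sum>t\<in>S. n i t * x s t) * cnj (n j s)))" for x
    proof -
      have "(\<Sum>s\<in>S. (\<Sum>t\<in>S. \<eta> t * x s t) * cnj (n j s)) = (\<Sum>s\<in>S. d * (\<Sum>i<k. c i * ((\<Sum>t\<in>S. n i t * x s t) * cnj (n j s))))"
        unfolding eS by (simp add: sum_distrib_right sum_distrib_left mult.assoc)
      also have "\<dots> = d * (\<Sum>i<k. \<Sum>s\<in>S. c i * ((\<Sum>t\<in>S. n i t * x s t) * cnj (n j s)))"
        unfolding sum_distrib_left[symmetric] by (subst sum.swap) (simp only: sum_distrib_left)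
      finally show ?thesis by (simp add: sum_distrib_left)
    qed
    have "(\<Sum>s\<in>S. v s * cnj (n j s)) = (\<Sum>s\<in>S. (\<Sum>t\<in>S. \<eta> t * cnj (U s t)) * cnj (n j s)) - \<nu> * (\<Sum>s\<in>S. (\<Sum>t\<in>S. \<eta> t * U t s) * cnj (n j s))"
      by (simp only: v_def th left_diff_distrib sum_subtractf mult.assoc flip: sum_distrib_left)
    also have "\<dots> = d * (\<Sum>i<k. c i * X i j) - \<nu> * (d * (\<Sum>i<k. c i * cnj (X j i)))"
      unfolding a X' by (simp add: X_def)
    also have "\<dots> = 0" using pen[OF j] by simp
    finally show ?thesis .
  qed
  have "\<exists>a. \<forall>s\<in>S. v s = (\<Sum>b\<in>B. a b * cnj (U s b))"
  proof (rule fredholm_alternative[OF fin(1) _ fin(2)])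
    fix \<rho> assume \<rho>: "\<forall>b\<in>B. (\<Sum>s\<in>S. \<rho> s * cnj (U s b)) = 0"
    have "\<forall>b\<in>B. (\<Sum>s\<in>S. cnj (\<rho> s) * U s b) = 0"
    proof
      fix b assume "b \<in> B"
      then have "cnj (\<Sum>s\<in>S. \<rho> s * cnj (U s b)) = 0" using \<rho> by simp
      then show "(\<Sum>s\<in>S. cnj (\<rho> s) * U s b) = 0" by simp
    qed
    from span[OF this] obtain f where f: "\<forall>s\<in>S. cnj (\<rho> s) = (\<Sum>i<k. f i * n i s)" by blast
    have "(\<Sum>s\<in>S. \<rho> s * v s) = (\<Sum>s\<in>S. \<Sum>i<k. cnj (f i) * (v s * cnj (n i s)))"
    proof (rule sum.cong[OF refl])
      fix s assume "s \<in> S"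
      then have "\<rho> s = cnj (\<Sum>i<k. f i * n i s)" using f by (metis complex_cnj_cnj)
      then show "\<rho> s * v s = (\<Sum>i<k. cnj (f i) * (v s * cnj (n i s)))" by (simp add: sum_distrib_right sum_distrib_left mult_ac)
    qed
    also have "\<dots> = (\<Sum>i<k. cnj (f i) * (\<Sum>s\<in>S. v s * cnj (n i s)))" by (subst sum.swap) (simp add: sum_distrib_left)
    finally show "(\<Sum>s\<in>S. \<rho> s * v s) = 0" using orth by simp
  qed
  then obtain a where a: "\<And>s. s \<in> S \<Longrightarrow> v s = (\<Sum>b\<in>B. a b * cnj (U s b))" by blast
  \<comment> \<open>The components \<open>- a\<close> on \<open>B\<close> are chosen to cancel
    \<open>v\<close>: pulling \<open>e\<close> back by the adjoint of U then gives \<nu> \<theta> on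
    \<open>S\<close>.\<close>
  define e where "e j = (if j \<in> B then - a j else \<eta> j)" for j
  define r where "r i = (\<Sum>j\<in>B\<union>S. e j * cnj (U i j))" for i
  have "r s = \<nu> * \<theta> s" if "s \<in> S" for s
  proof -
    have "(\<Sum>j\<in>S. e j * cnj (U s j)) = (\<Sum>j\<in>S. \<eta> j * cnj (U s j))"
      using dis by (intro sum.cong) (auto simp: e_def)
    moreover have "(\<Sum>j\<in>B. e j * cnj (U s j)) = - v s" unfolding a[OF that] by (simp add: e_def sum_negf)
    ultimately show ?thesis by (simp add: r_def split v_def)
  qed
  moreover have "(\<Sum>i\<in>B\<union>S. r i * U i j) = e j" if "j \<in> B \<union> S" for j
    unfolding r_def by (rule uni_right_inverse[OF U that])
  ultimately show ?thesis
    using \<nu> d eB thB dis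
    by (intro exI[of _ \<eta>] exI[of _ \<theta>] exI[of _ \<nu>] exI[of _ e] exI[of _ r]) (auto simp: \<eta>_def e_def \<theta>_def)
  qed
qed

section \<open>The colligation argument\<close>

text \<open>In the application \<open>P\<close> consists of pairs of a node and a coordinate,
  \<kappa> is the Gram matrix of the kernel at these nodes, and \<zeta> is the value of the
  coordinate function at the node.\<close>

locale hermitian_form =
  fixes P :: "'p set" and \<kappa> :: "'p \<Rightarrow> 'p \<Rightarrow> complex" and \<zeta> :: "'p \<Rightarrow> complex"
  assumes finP: "finite P" and herm: "\<And>p p'. p \<in> P \<Longrightarrow> p' \<in> P \<Longrightarrow> \<kappa> p' p = cnj (\<kappa> p p')"
begin

definition frm :: "('p \<Rightarrow> complex) \<Rightarrow> ('p \<Rightarrow> complex) \<Rightarrow> complex" where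
  "frm \<xi> \<eta> = (\<Sum>p\<in>P. \<Sum>p'\<in>P. \<xi> p * \<kappa> p p' * cnj (\<eta> p'))"

definition qn :: "('p \<Rightarrow> complex) \<Rightarrow> real" where
  "qn \<xi> = Re (frm \<xi> \<xi>)"

lemma frm_cong:
  "(\<And>p. p \<in> P \<Longrightarrow> \<xi> p = \<xi>' p) \<Longrightarrow> (\<And>p. p \<in> P \<Longrightarrow> \<eta> p = \<eta>' p) \<Longrightarrow> frm \<xi> \<eta> = frm \<xi>' \<eta>'"
  unfolding frm_def by (intro sum.cong) auto

lemma frm_sum: "frm (\<lambda>p. \<Sum>j\<in>J. c j * a j p) (\<lambda>p. \<Sum>k\<in>K. d k * b k p)
   = (\<Sum>j\<in>J. \<Sum>k\<in>K. c j * cnj (d k) * frm (a j) (b k))"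
proof -
  have "frm (\<lambda>p. \<Sum>j\<in>J. c j * a j p) (\<lambda>p. \<Sum>k\<in>K. d k * b k p)
    = (\<Sum>p\<in>P. \<Sum>p'\<in>P. \<Sum>j\<in>J. \<Sum>k\<in>K. c j * cnj (d k) * (a j p * \<kappa> p p' * cnj (b k p')))"
    unfolding frm_def by (simp add: sum_distrib_left sum_distrib_right mult_ac cnj_sum)
  also have "\<dots> = (\<Sum>j\<in>J. \<Sum>k\<in>K. \<Sum>p\<in>P. \<Sum>p'\<in>P. c j * cnj (d k) * (a j p * \<kappa> p p' * cnj (b k p')))"
    by (simp only: sum.swap[of _ P J] sum.swap[of _ P K])
  finally show ?thesis unfolding frm_def by (simp add: sum_distrib_left)
qed

lemma frm_cnj: "frm \<eta> \<xi> = cnj (frm \<xi> \<eta>)"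
proof -
  have "cnj (frm \<xi> \<eta>) = (\<Sum>p'\<in>P. \<Sum>p\<in>P. cnj (\<xi> p' * \<kappa> p' p * cnj (\<eta> p)))" by (simp add: frm_def cnj_sum)
  also have "\<dots> = (\<Sum>p\<in>P. \<Sum>p'\<in>P. cnj (\<xi> p' * \<kappa> p' p * cnj (\<eta> p)))" by (rule sum.swap)
  also have "\<dots> = (\<Sum>p\<in>P. \<Sum>p'\<in>P. \<eta> p * \<kappa> p p' * cnj (\<xi> p'))"
  proof (intro sum.cong refl)
    fix p p' assume "p \<in> P" "p' \<in> P"
    then have "cnj (\<kappa> p' p) = \<kappa> p p'" using herm[of p' p] by simp
    then show "cnj (\<xi> p' * \<kappa> p' p * cnj (\<eta> p)) = \<eta> p * \<kappa> p p' * cnj (\<xi> p')" by simp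
  qed
  finally show ?thesis by (simp add: frm_def)
qed

lemma frm_im0: "Im (frm \<xi> \<xi>) = 0"
  using frm_cnj[of \<xi> \<xi>] by (simp add: complex_eq_iff)

lemma frm_self: "frm \<xi> \<xi> = of_real (qn \<xi>)"
  by (simp add: qn_def complex_eq_iff frm_im0)

lemma qn_0 [simp]: "qn (\<lambda>_. 0) = 0"
  by (simp add: qn_def frm_def)

lemma frm_cmult: "frm (\<lambda>p. c * a p) (\<lambda>p. d * b p) = c * cnj d * frm a b"
  using frm_sum[where J = "{()}" and K = "{()}" and c = "\<lambda>_. c" and a = "\<lambda>_. a" and d = "\<lambda>_. d" and b = "\<lambda>_. b"] by simp

lemma frm_add1: "frm (\<lambda>p. a p + b p) c = frm a c + frm b c"
  unfolding frm_def by (simp add: distrib_right sum.distrib)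

lemma frm_diff1: "frm (\<lambda>p. a p - b p) c = frm a c - frm b c"
  unfolding frm_def by (simp add: left_diff_distrib sum_subtractf)

lemma frm_add2: "frm c (\<lambda>p. a p + b p) = frm c a + frm c b"
  unfolding frm_def by (simp add: distrib_left sum.distrib)

lemma frm_diff2: "frm c (\<lambda>p. a p - b p) = frm c a - frm c b"
  unfolding frm_def by (simp add: right_diff_distrib sum_subtractf)

text \<open>The sum is the trace of the Gram matrix of the family, which a unitary mixing of the
  family conjugates.\<close>

lemma qn_app:
  assumes U: "uni I J U"
  shows "(\<Sum>i\<in>I. qn (app J U a i)) = (\<Sum>j\<in>J. qn (a j))"
proof -
  have "(\<Sum>i\<in>I. frm (app J U a i) (app J U a i)) = (\<Sum>i\<in>I. \<Sum>j\<in>J. \<Sum>k\<in>J. U i j * cnj (U i k) * frm (a j) (a k))"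
    unfolding frm_sum[symmetric] app_def[abs_def] by simp
  also have "\<dots> = (\<Sum>j\<in>J. \<Sum>k\<in>J. (\<Sum>i\<in>I. cnj (U i k) * U i j) * frm (a j) (a k))"
    by (subst sum.swap, rule sum.cong[OF refl], subst sum.swap) (simp add: sum_distrib_right sum_distrib_left mult_ac)
  also have "\<dots> = (\<Sum>j\<in>J. \<Sum>k\<in>J. of_bool (k = j) * frm (a j) (a k))" using uniD(4)[OF U] by simp
  also have "\<dots> = (\<Sum>j\<in>J. frm (a j) (a j))" 
    using uniD(2)[OF U] by (intro sum.cong refl) (simp add: of_bool_sum)
  finally show ?thesis by (simp add: qn_def flip: Re_sum)
qed

lemma qn_app_mult:
  assumes U: "uni I J U"
  shows "(\<Sum>i\<in>I. qn (\<lambda>p. f p * app J U a i p)) = (\<Sum>j\<in>J. qn (\<lambda>p. f p * a j p))"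
proof -
  have "(\<lambda>p. f p * app J U a i p) = app J U (\<lambda>j p. f p * a j p) i" for i
    by (simp add: app_def fun_eq_iff sum_distrib_left mult_ac)
  then show ?thesis using qn_app[OF U, of "\<lambda>j p. f p * a j p"] by simp
qed

text \<open>\<open>a\<close> on \<open>B\<close> is the input, \<open>b\<close> on \<open>B\<close>
  the output, and the states satisfy a = \<zeta> b. Eliminating them gives output = T(\<zeta>) input
  for the transfer function T of U, so the inequality is contractivity of \<zeta>^2 T. All unitary U
  are quantified over, as the induction changes U.\<close>

definition contr :: "'i set \<Rightarrow> 'i set \<Rightarrow> bool" where
  "contr B S \<longleftrightarrow> (\<forall>U a b. uni (B \<union> S) (B \<union> S) U \<longrightarrow> (\<forall>i\<in>B\<union>S. b i = app (B \<union> S) U a i) \<longrightarrow>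
     (\<forall>s\<in>S. a s = (\<lambda>p. \<zeta> p * b s p)) \<longrightarrow>
     (\<Sum>i\<in>B. qn (\<lambda>p. (\<zeta> p)\<^sup>2 * b i p)) \<le> (\<Sum>i\<in>B. qn (a i)))"

end

lemma app_cong: "(\<And>j. j \<in> J \<Longrightarrow> a j = a' j) \<Longrightarrow> app J U a = app J U a'"
  by (auto simp: app_def fun_eq_iff intro!: sum.cong)

text \<open>On \<open>S\<close> the vector \<open>x\<close> is a multiple of row \<open>s1\<close>
  of \<open>E\<close>, hence orthogonal to the other rows of \<open>E\<close> extended by zero. Its
  part on \<open>B\<close> only enters the norm.\<close>

lemma unitary_frame:
  assumes fin: "finite B" and dis: "B \<inter> S = {}" and s1: "s1 \<in> S" and E: "uni S S E"
    and x: "\<And>s. s \<in> S \<Longrightarrow> x s = \<mu> * E s1 s" and norm: "(\<Sum>j\<in>B\<union>S. x j * cnj (x j)) = 1"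
  shows "\<exists>L. uni (B \<union> S) (B \<union> S) L \<and> (\<forall>j. L s1 j = x j) \<and>
    (\<forall>s\<in>S - {s1}. \<forall>j. L s j = (if j \<in> S then E s j else 0))"
proof -
  have finS: "finite S" using uniD(1)[OF E] .
  define L0 where "L0 s j = (if s = s1 then x j else if j \<in> S then E s j else 0)" for s j
  have split: "(\<Sum>i\<in>B\<union>S. f i) = (\<Sum>i\<in>B. f i) + (\<Sum>i\<in>S. f i)" for f :: "'a \<Rightarrow> complex"
    using fin finS dis by (rule sum.union_disjoint)
  have "(\<Sum>j\<in>B\<union>S. L0 s j * cnj (L0 s' j)) = of_bool (s = s')" if s: "s \<in> S" "s' \<in> S" for s s'
  proof -
    have Bz: "(\<Sum>j\<in>B. L0 s j * cnj (L0 s' j)) = 0" if "s \<noteq> s1 \<or> s' \<noteq> s1"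
      using that dis by (intro sum.neutral) (auto simp: L0_def)
    consider "s = s1" "s' = s1" | "s = s1" "s' \<noteq> s1" | "s \<noteq> s1" "s' = s1" | "s \<noteq> s1" "s' \<noteq> s1" by blast
    then show ?thesis
    proof cases
      case 1 then show ?thesis using norm by (simp add: L0_def)
    next
      case 2
      have "(\<Sum>j\<in>S. L0 s j * cnj (L0 s' j)) = \<mu> * (\<Sum>j\<in>S. E s1 j * cnj (E s' j))"
        using 2 by (simp add: L0_def x sum_distrib_left mult.assoc)
      then show ?thesis unfolding split using 2 Bz uniD(3)[OF E s1 s(2)] by simp
    next
      case 3
      have "(\<Sum>j\<in>S. L0 s j * cnj (L0 s' j)) = cnj \<mu> * (\<Sum>j\<in>S. E s j * cnj (E s1 j))"
        using 3 by (simp add: L0_def x sum_distrib_left mult_ac)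
      then show ?thesis unfolding split using 3 Bz uniD(3)[OF E s(1) s1] by simp
    next
      case 4
      have "(\<Sum>j\<in>S. L0 s j * cnj (L0 s' j)) = (\<Sum>j\<in>S. E s j * cnj (E s' j))"
        using 4 by (simp add: L0_def)
      then show ?thesis unfolding split using 4 Bz uniD(3)[OF E s] by simp
    qed
  qed
  then obtain L where "uni (B \<union> S) (B \<union> S) L" "\<forall>s\<in>S. L s = L0 s"
    using complete_orthonormal[of "B \<union> S" "B \<union> S" S L0] fin finS by auto
  then show ?thesis using s1 by (intro exI[of _ L]) (auto simp: L0_def)
qed

context hermitian_form
begin

text \<open>Both changes of coordinates \<open>L\<close> and \<open>L'\<close> are chosen such that the transformed
  colligation acts as the identity on the two coordinates \<open>s1\<close> and \<open>s2\<close>; deleting them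
  leaves a smaller colligation, at the price of one application of \<open>H1\<close>.\<close>

lemma contr_step:
  fixes B :: "'i set"
  assumes H1: "\<And>\<xi>. qn (\<lambda>p. (\<zeta> p)\<^sup>2 * \<xi> p) \<le> qn \<xi>"
    and fin: "finite B" "finite S" and dis: "B \<inter> S = {}"
    and s: "s1 \<in> S" "s2 \<in> S" "s1 \<noteq> s2" and IH: "contr B (S - {s1, s2})"
    and U: "uni (B \<union> S) (B \<union> S) U" and b: "\<And>i. i \<in> B \<union> S \<Longrightarrow> b i = app (B \<union> S) U a i"
    and ab: "\<And>s. s \<in> S \<Longrightarrow> a s = (\<lambda>p. \<zeta> p * b s p)"
    and zB: "\<And>i. i \<in> B \<Longrightarrow> \<eta> i = 0" "\<And>i. i \<in> B \<Longrightarrow> \<theta> i = 0"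
    and n1: "(\<Sum>s\<in>S. \<eta> s * cnj (\<eta> s)) = 1" and n12: "(\<Sum>s\<in>S. \<eta> s * cnj (\<theta> s)) = 0"
    and e: "\<And>s. s \<in> S \<Longrightarrow> e s = \<eta> s" and r: "\<And>s. s \<in> S \<Longrightarrow> r s = \<nu> * \<theta> s"
    and rows: "\<And>j. j \<in> B \<union> S \<Longrightarrow> (\<Sum>i\<in>B\<union>S. \<eta> i * U i j) = \<theta> j"
      "\<And>j. j \<in> B \<union> S \<Longrightarrow> (\<Sum>i\<in>B\<union>S. r i * U i j) = e j"
  shows "(\<Sum>i\<in>B. qn (\<lambda>p. (\<zeta> p)\<^sup>2 * b i p)) \<le> (\<Sum>i\<in>B. qn (a i))"
proof -
  let ?T = "B \<union> S"
  have split: "(\<Sum>i\<in>?T. f i) = (\<Sum>i\<in>B. f i) + (\<Sum>i\<in>S. f i)" for f :: "'i \<Rightarrow> 'z::comm_monoid_add"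
    using fin dis by (intro sum.union_disjoint) auto
  have n2: "(\<Sum>s\<in>S. \<theta> s * cnj (\<theta> s)) = 1"
  proof -
    have "(\<Sum>j\<in>?T. \<theta> j * cnj (\<theta> j)) = (\<Sum>j\<in>?T. \<eta> j * cnj (\<eta> j))"
      using uni_inner_rows[OF U, of \<eta> \<eta>] rows(1) by simp
    then show ?thesis by (simp add: split zB n1)
  qed
  have n21: "(\<Sum>s\<in>S. \<theta> s * cnj (\<eta> s)) = 0"
    using arg_cong[OF n12, of cnj] by (simp add: cnj_sum mult.commute)
  define Einit where "Einit = (\<lambda>i. if i = s1 then \<eta> else \<theta>)"
  have "\<exists>E. uni S S E \<and> (\<forall>i\<in>{s1,s2}. E i = Einit i)"
    by (rule complete_orthonormal) (use fin s n1 n2 n12 n21 in \<open>auto simp: Einit_def\<close>)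
  then obtain E where E: "uni S S E" "E s1 = \<eta>" "E s2 = \<theta>" using s by (auto simp: Einit_def)
  \<comment> \<open>With \<open>E\<close> the coordinates \<open>s1\<close>, \<open>s2\<close> are
    the pairings with \<eta>, \<theta>; with \<open>E'\<close> they are the pairings with \<theta>,
    \<eta>.\<close>
  define E' where "E' i = E (Transposition.transpose s1 s2 i)" for i
  have E': "uni S S E'" "E' s1 = \<theta>" "E' s2 = \<eta>"
  proof -
    have "bij_betw (Transposition.transpose s1 s2) S S" using s by simp
    from uni_reindex_rows[OF E(1) this] show "uni S S E'" by (simp add: E'_def[abs_def])
  qed (use E in \<open>simp_all add: E'_def\<close>)
  have E'o: "E' t = E t" if "t \<in> S - {s1, s2}" for t using that by (simp add: E'_def)
  define nn where "nn = (\<Sum>i\<in>?T. (cmod (e i))\<^sup>2)"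
  have e2: "(\<Sum>i\<in>?T. e i * cnj (e i)) = of_real nn" unfolding nn_def by (rule sum_norm_sq)
  have r2: "(\<Sum>i\<in>?T. r i * cnj (r i)) = of_real nn"
  proof -
    have "(\<Sum>i\<in>?T. r i * cnj (r i)) = (\<Sum>i\<in>?T. e i * cnj (e i))"
      using uni_inner_rows[OF U, of r r] rows(2) by simp
    then show ?thesis using e2 by simp
  qed
  have "(\<Sum>s\<in>S. (cmod (e s))\<^sup>2) = 1"
  proof -
    have "complex_of_real (\<Sum>s\<in>S. (cmod (e s))\<^sup>2) = 1" unfolding sum_norm_sq[symmetric] using e n1 by simp
    then show ?thesis by (simp only: of_real_eq_1_iff)
  qed
  then have nn: "nn > 0" unfolding nn_def split by (smt (verit) sum_nonneg zero_le_power2)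
  \<comment> \<open>One factor normalises both \<open>e\<close> and \<open>r\<close>, since r U = e
    and U preserves norms.\<close>
  define c where "c = complex_of_real (1 / sqrt nn)"
  have cc: "c * cnj c * of_real nn = 1"
  proof -
    have "c * cnj c * of_real nn = of_real (1 / sqrt nn * (1 / sqrt nn) * nn)"
      unfolding c_def complex_cnj_complex_of_real of_real_mult by (rule refl)
    also have "1 / sqrt nn * (1 / sqrt nn) * nn = 1" using nn by (simp add: field_simps)
    finally show ?thesis by simp
  qed
  have nrm: "(\<Sum>i\<in>?T. (c * x i) * cnj (c * x i)) = c * cnj c * (\<Sum>i\<in>?T. x i * cnj (x i))" for x
    by (simp add: sum_distrib_left mult_ac)
  \<comment> \<open>\<open>L\<close> is \<open>E\<close> with row \<eta> replaced by c e, and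
    \<open>L'\<close> is \<open>E'\<close> with row \<theta> replaced by c r; their rows
    \<open>s2\<close> are \<theta> and \<eta>. The identities r U = e and \<eta> U = \<theta> are
    then exactly what turns the rows \<open>s1\<close> and \<open>s2\<close> of \<open>V\<close>
    into unit vectors.\<close>
  obtain L where L: "uni ?T ?T L" "\<And>j. L s1 j = c * e j"
    "\<And>t j. t \<in> S - {s1} \<Longrightarrow> L t j = (if j \<in> S then E t j else 0)"
    using unitary_frame[OF fin(1) dis s(1) E(1), of "\<lambda>j. c * e j" c] e E nrm e2 cc by auto
  obtain L' where L': "uni ?T ?T L'" "\<And>j. L' s1 j = c * r j"
    "\<And>t j. t \<in> S - {s1} \<Longrightarrow> L' t j = (if j \<in> S then E' t j else 0)"
    using unitary_frame[OF fin(1) dis s(1) E'(1), of "\<lambda>j. c * r j" "c * \<nu>"] r E' nrm r2 cc by auto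
  define V where "V = mmul ?T L' (mmul ?T U (adj L))"
  have V: "uni ?T ?T V" unfolding V_def by (intro uni_mmul[OF L'(1)] uni_mmul[OF U] uni_adj L(1))
  have Vrow: "V i j = of_bool (j = i)" if i: "i \<in> {s1, s2}" and j: "j \<in> ?T" for i j
  proof -
    have "(\<Sum>k\<in>?T. L' i k * U k l) = L i l" if l: "l \<in> ?T" for l
    proof (cases "i = s1")
      case True
      then show ?thesis using rows(2)[OF l] by (simp add: L L' mult.assoc flip: sum_distrib_left)
    next
      case False
      then have "i = s2" using i by auto
      have "(\<Sum>k\<in>?T. L' s2 k * U k l) = (\<Sum>k\<in>?T. \<eta> k * U k l)"
        using s zB by (intro sum.cong) (auto simp: L' E')
      then show ?thesis using rows(1)[OF l] s \<open>i = s2\<close> zB l by (auto simp: L E)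
    qed
    then have "mmul ?T (mmul ?T L' U) (adj L) i j = (\<Sum>l\<in>?T. L i l * cnj (L j l))"
      by (simp add: mmul_def adj_def)
    then show ?thesis using uniD(3)[OF L(1), of i j] i j s unfolding V_def mmul_assoc by auto
  qed
  define a' where "a' = app ?T L a"
  define b' where "b' = app ?T L' b"
  have b'V: "b' i = app ?T V a' i" for i
  proof -
    have 1: "app ?T (adj L) a' j = a j" if "j \<in> ?T" for j
      unfolding a'_def using uni_inverse_app[OF L(1) that] by (auto simp: fun_eq_iff)
    have "app ?T V a' i = app ?T L' (app ?T U (app ?T (adj L) a')) i" 
      unfolding V_def by (simp add: app_mmul fun_eq_iff app_mmul[abs_def])
    also have "app ?T U (app ?T (adj L) a') = app ?T U a" using 1 by (rule app_cong)
    also have "app ?T L' (app ?T U a) i = b' i" unfolding b'_def using b by (subst app_cong[of ?T "app ?T U a" b]) auto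
    finally show ?thesis by simp
  qed
  have b's1: "b' s1 = a' s1"
  proof
    fix p
    have "b' s1 p = (\<Sum>j\<in>?T. V s1 j * a' j p)" by (simp add: b'V app_def)
    also have "\<dots> = (\<Sum>j\<in>?T. of_bool (j = s1) * a' j p)" using Vrow by (intro sum.cong) auto
    also have "\<dots> = a' s1 p" using fin s by (intro of_bool_sum) auto
    finally show "b' s1 p = a' s1 p" .
  qed
  have T': "?T - {s1, s2} = B \<union> (S - {s1, s2})" using dis s by auto
  have ImV: "id ` {s1, s2} = {s1, s2}" by simp
  have sub: "{s1, s2} \<subseteq> ?T" "id ` {s1, s2} \<subseteq> ?T" using s by auto
  have Vid: "V b0 j = of_bool (j = id b0)" if "b0 \<in> {s1, s2}" "j \<in> ?T" for b0 j using Vrow that by simp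
  note del = uni_delete_set[OF V sub Vid]
  have sub2: "S - {s1} = insert s2 (S - {s1, s2})" using s by auto
  have "(\<Sum>i\<in>B. qn (\<lambda>p. (\<zeta> p)\<^sup>2 * b' i p)) \<le> (\<Sum>i\<in>B. qn (a' i))"
  proof -
    have 1: "uni (B \<union> (S - {s1, s2})) (B \<union> (S - {s1, s2})) V" using del(1) unfolding ImV T' .
    have 2: "b' i = app (B \<union> (S - {s1, s2})) V a' i" if i: "i \<in> B \<union> (S - {s1, s2})" for i
    proof
      fix p
      have z: "V i j = 0" if "j \<in> {s1, s2}" for j using del(2)[of i j] i that T' by auto
      have "b' i p = (\<Sum>j\<in>?T. V i j * a' j p)" by (simp add: b'V app_def)
      also have "\<dots> = (\<Sum>j\<in>?T - {s1, s2}. V i j * a' j p)"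
        by (rule sum.mono_neutral_right) (use fin z in auto)
      finally show "b' i p = app (B \<union> (S - {s1, s2})) V a' i p" unfolding T' by (simp add: app_def)
    qed
    have 3: "a' t = (\<lambda>p. \<zeta> p * b' t p)" if t: "t \<in> S - {s1, s2}" for t
    proof
      fix p
      have L0: "L t j = (if j \<in> S then E t j else 0)" "L' t j = (if j \<in> S then E t j else 0)" for j
        using L(3)[of t j] L'(3)[of t j] t E'o[OF t] by auto
      have B0: "(\<Sum>j\<in>B. (if j \<in> S then E t j else 0) * x j) = 0" for x
        using dis by (intro sum.neutral) auto
      have "a' t p = (\<Sum>j\<in>S. E t j * a j p)" unfolding a'_def app_def split L0 B0 by simp
      also have "\<dots> = \<zeta> p * (\<Sum>j\<in>S. E t j * b j p)" by (simp add: ab sum_distrib_left mult_ac)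
      also have "(\<Sum>j\<in>S. E t j * b j p) = b' t p" unfolding b'_def app_def split L0 B0 by simp
      finally show "a' t p = \<zeta> p * b' t p" .
    qed
    show ?thesis using IH 1 2 3 unfolding contr_def by blast
  qed
  \<comment> \<open>\<open>L''\<close> preserves the total over \<open>B\<close> and
    \<open>S\<close>, \<open>E''\<close> that over \<open>S\<close>, and the two agree on all rows
    of \<open>S\<close> except \<open>s1\<close>; subtraction leaves only the terms of
    \<open>B\<close> and of \<open>s1\<close>.\<close>
  moreover have norm_id: "(\<Sum>i\<in>B. qn (\<lambda>p. f p * app ?T L'' x i p)) + qn (\<lambda>p. f p * app ?T L'' x s1 p)
      = (\<Sum>i\<in>B. qn (\<lambda>p. f p * x i p)) + qn (\<lambda>p. f p * app S E'' x s1 p)" 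
    if L'': "uni ?T ?T L''" "\<And>t j. t \<in> S - {s1} \<Longrightarrow> L'' t j = (if j \<in> S then E'' t j else 0)" "uni S S E''" for f x L'' E''
  proof -
    have B0: "(\<Sum>j\<in>B. (if j \<in> S then E'' t j else 0) * x j) = 0" for x t
      using dis by (intro sum.neutral) auto
    have "app ?T L'' x t = app S E'' x t" if "t \<in> S - {s1}" for t
      using L''(2)[OF that] by (simp add: fun_eq_iff app_def split B0)
    then have "(\<Sum>t\<in>S - {s1}. qn (\<lambda>p. f p * app ?T L'' x t p)) = (\<Sum>t\<in>S - {s1}. qn (\<lambda>p. f p * app S E'' x t p))"
      by (intro sum.cong) auto
    moreover have "(\<Sum>t\<in>S. qn (\<lambda>p. f p * app S E'' x t p)) = (\<Sum>t\<in>S. qn (\<lambda>p. f p * x t p))" by (rule qn_app_mult[OF L''(3)])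
    moreover have "(\<Sum>t\<in>?T. qn (\<lambda>p. f p * app ?T L'' x t p)) = (\<Sum>t\<in>?T. qn (\<lambda>p. f p * x t p))" by (rule qn_app_mult[OF L''(1)])
    ultimately show ?thesis unfolding split by (simp add: sum.remove[OF fin(2) s(1)])
  qed
  \<comment> \<open>Writing pairings as products: \<eta> a = \<zeta> (\<eta> b) = \<zeta> (\<theta>
    a) = \<zeta>^2 (\<theta> b), where the outer equalities are a = \<zeta> b on \<open>S\<close>
    and the middle one is \<eta> U = \<theta>.\<close>
  moreover have "(\<lambda>p. (\<zeta> p)\<^sup>2 * app S E' b s1 p) = app S E a s1"
  proof
    fix p
    have et: "app S E b s1 p = app S E' a s1 p"
    proof -
      have "app S E b s1 p = (\<Sum>i\<in>?T. \<eta> i * b i p)" by (simp add: app_def E split zB)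
      also have "\<dots> = (\<Sum>i\<in>?T. \<eta> i * (\<Sum>j\<in>?T. U i j * a j p))" using b by (intro sum.cong) (auto simp: app_def)
      also have "\<dots> = (\<Sum>j\<in>?T. (\<Sum>i\<in>?T. \<eta> i * U i j) * a j p)"
        unfolding sum_distrib_left sum_distrib_right mult.assoc by (rule sum.swap)
      also have "\<dots> = (\<Sum>j\<in>?T. \<theta> j * a j p)" using rows(1) by simp
      also have "\<dots> = app S E' a s1 p" by (simp add: app_def E' split zB)
      finally show ?thesis .
    qed
    have mz: "app S F a s1 p = \<zeta> p * app S F b s1 p" for F
      by (simp add: app_def ab sum_distrib_left mult_ac)
    show "(\<zeta> p)\<^sup>2 * app S E' b s1 p = app S E a s1 p"
      using et mz[of E] mz[of E'] by (simp add: power2_eq_square)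
  qed
  \<comment> \<open>In the balance of the two instances of \<open>norm_id\<close> the \<eta>- and
    \<theta>-pairings cancel. What is left over is \<zeta>^2 times the common coordinate b' s1 = a'
    s1 against that coordinate itself.\<close>
  moreover have "qn (\<lambda>p. (\<zeta> p)\<^sup>2 * a' s1 p) \<le> qn (a' s1)" by (rule H1)
  ultimately show ?thesis
    using norm_id[OF L(1) L(3) E(1), of "\<lambda>_. 1" a] norm_id[OF L'(1) L'(3) E'(1), of "\<lambda>p. (\<zeta> p)\<^sup>2" b] b's1
    by (simp add: a'_def b'_def)
qed

end

text \<open>The atoms have rank one and points may repeat, so a weight of rank k occupies k indices:
  \<open>card J\<close> counts atoms with rank. The second sum is the zero first moment for atoms
  located at \<open>cnj (\<tau> j)\<close>.\<close>

definition normalised :: "'j set \<Rightarrow> ('j \<Rightarrow> complex) \<Rightarrow> ('j \<Rightarrow> 'n::finite \<Rightarrow> complex) \<Rightarrow> bool" where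
  "normalised J \<tau> w \<longleftrightarrow> finite J \<and> (\<forall>j\<in>J. cmod (\<tau> j) = 1)
     \<and> (\<forall>a b. (\<Sum>j\<in>J. cnj (w j a) * w j b) = of_bool (a = b))
     \<and> (\<forall>a b. (\<Sum>j\<in>J. \<tau> j * cnj (w j a) * w j b) = 0)"

lemma resolvent_eqI:
  fixes x :: complex
  assumes "x = a * (t * x) + y"
  shows "(1 - a * t) * x = y"
proof -
  have "(1 - a * t) * x = x - a * (t * x)" by (simp add: algebra_simps)
  also have "\<dots> = y" using assms by (metis add_diff_cancel_left')
  finally show ?thesis .
qed

lemma cnj_of_bool [simp]: "cnj (of_bool b) = of_bool b"
  by (cases b) auto

context hermitian_form
begin

text \<open>\<open>contr_step\<close> deletes two states but wants \<eta> and \<theta> orthogonal.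
  If they are not, a state \<open>s0\<close> with a unimodular loop and no connection to the rest is
  added first to make them so; two states are then deleted, and the net loss is still one.\<close>

lemma contr_reduce:
  fixes B :: "'i set"
  assumes H1: "\<And>\<xi>. qn (\<lambda>p. (\<zeta> p)\<^sup>2 * \<xi> p) \<le> qn \<xi>"
    and inf: "infinite (UNIV :: 'i set)" and Bne: "B \<noteq> {}"
    and fin: "finite B" "finite S" and dis: "B \<inter> S = {}" and card: "card B < card S"
    and IH: "\<And>S'. finite S' \<Longrightarrow> B \<inter> S' = {} \<Longrightarrow> card S' < card S \<Longrightarrow> contr B S'"
  shows "contr B S"
  unfolding contr_def
proof (intro allI impI)
  fix U a b
  assume U: "uni (B \<union> S) (B \<union> S) U" and b: "\<forall>i\<in>B \<union> S. b i = app (B \<union> S) U a i"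
    and ab: "\<forall>s\<in>S. a s = (\<lambda>p. \<zeta> p * b s p)"
  let ?T = "B \<union> S"
  have split: "(\<Sum>i\<in>?T. f i) = (\<Sum>i\<in>B. f i) + (\<Sum>i\<in>S. f i)" for f :: "'i \<Rightarrow> complex"
    using fin dis by (intro sum.union_disjoint) auto
  from decoupling_vector[OF U dis card] obtain \<eta> \<theta> \<nu> e r where
    \<nu>: "cmod \<nu> \<le> 1" and n1: "(\<Sum>s\<in>S. \<eta> s * cnj (\<eta> s)) = 1" 
    and zB: "\<And>b. b \<in> B \<Longrightarrow> \<eta> b = 0" "\<And>b. b \<in> B \<Longrightarrow> \<theta> b = 0"
    and e: "\<And>s. s \<in> S \<Longrightarrow> e s = \<eta> s" and r: "\<And>s. s \<in> S \<Longrightarrow> r s = \<nu> * \<theta> s"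
    and rows: "\<And>j. j \<in> ?T \<Longrightarrow> (\<Sum>i\<in>?T. \<eta> i * U i j) = \<theta> j" "\<And>j. j \<in> ?T \<Longrightarrow> (\<Sum>i\<in>?T. r i * U i j) = e j"
    by blast
  define m where "m = (\<Sum>s\<in>S. \<eta> s * cnj (\<theta> s))"
  \<comment> \<open>Both row identities paired through the isometry U. In particular |\<nu>| = 1 as
    soon as m \<noteq> 0.\<close>
  have m: "cnj m = cnj \<nu> * m"
  proof -
    have "(\<Sum>j\<in>?T. \<theta> j * cnj (e j)) = (\<Sum>i\<in>?T. \<eta> i * cnj (r i))"
      using uni_inner_rows[OF U, of \<eta> r] rows by simp
    then have "(\<Sum>s\<in>S. \<theta> s * cnj (\<eta> s)) = (\<Sum>s\<in>S. \<eta> s * cnj (\<nu> * \<theta> s))"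
      by (simp add: split zB e r)
    then show ?thesis by (simp add: m_def cnj_sum sum_distrib_left mult_ac)
  qed
  have cB: "card B \<ge> 1" using Bne fin by (simp add: card_gt_0_iff Suc_leI)
  show "(\<Sum>i\<in>B. qn (\<lambda>p. (\<zeta> p)\<^sup>2 * b i p)) \<le> (\<Sum>i\<in>B. qn (a i))"
  proof (cases "m = 0")
    case True
    have "\<not> card S \<le> 1" using cB card by linarith
    then obtain s1 s2 where s: "s1 \<in> S" "s2 \<in> S" "s1 \<noteq> s2" using card_le_Suc0_iff_eq[OF fin(2)] by auto
    have "card (S - {s1, s2}) < card S" using fin s by (intro psubset_card_mono) auto
    then have "contr B (S - {s1, s2})" using fin dis by (intro IH) auto
    from contr_step[OF H1 fin dis s this U, of b a \<eta> \<theta> e r \<nu>] show ?thesis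
      using b ab zB n1 True e r rows by (auto simp: m_def)
  next
    case False
    obtain s0 where s0: "s0 \<notin> ?T" using fin ex_new_if_finite[OF inf, of ?T] by auto
    \<comment> \<open>The components at \<open>s0\<close> are to be \<open>k\<close> for \<eta> and
      k \<omega> for \<theta>. They contribute |m| cnj \<omega> = -m to the inner product, which
      makes it zero, and \<open>g\<close> restores norm 1. The second identity survives because
      \<nu> \<omega>^2 = 1, a consequence of \<open>m\<close>.\<close>
    define \<omega> where "\<omega> = - cnj m / cmod m"
    define k where "k = complex_of_real (sqrt (cmod m))"
    define g where "g = complex_of_real (1 / sqrt (1 + cmod m))"
    have kk: "k * cnj k = cmod m" by (simp add: k_def flip: of_real_mult)
    have gg: "g * cnj g * (1 + cmod m) = 1"
    proof -
      have p: "1 + cmod m > 0" by (smt (verit) norm_ge_zero)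
      have "g * cnj g * (1 + cmod m) = of_real (1 / sqrt (1 + cmod m) * (1 / sqrt (1 + cmod m)) * (1 + cmod m))"
        unfolding g_def complex_cnj_complex_of_real of_real_mult by simp
      also have "1 / sqrt (1 + cmod m) * (1 / sqrt (1 + cmod m)) * (1 + cmod m) = 1" using p by (simp add: field_simps)
      finally show ?thesis by simp
    qed
    have cm: "complex_of_real (cmod m) \<noteq> 0" using False by simp
    have mm: "m * cnj m = cmod m * cmod m" by (simp add: power2_eq_square flip: complex_norm_square)
    have \<omega>1: "\<omega> * cnj \<omega> = 1"
      using mm cm by (simp add: \<omega>_def field_simps)
    have "m = \<nu> * cnj m" using arg_cong[OF m, of cnj] by simp
    then have \<nu>\<omega>: "\<nu> * \<omega> * \<omega> = 1"
      using mm cm False by (simp add: \<omega>_def field_simps)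
    let ?S = "insert s0 S"
    have TS: "B \<union> ?S = ?T \<union> {s0}" by auto
    define U' where "U' i j = (if i = s0 \<and> j = s0 then \<omega> else if i = s0 \<or> j = s0 then 0 else U i j)" for i j
    have U': "uni (?T \<union> {s0}) (?T \<union> {s0}) U'"
    proof (rule uni_block[OF U])
      show "uni {s0} {s0} (\<lambda>_ _. \<omega>)" using \<omega>1 by (auto simp: uni_def mult.commute)
    qed (use s0 in \<open>auto simp: U'_def\<close>)
    have split0: "(\<Sum>i\<in>?T \<union> {s0}. f i) = (\<Sum>i\<in>?T. f i) + f s0" for f :: "'i \<Rightarrow> complex"
      using fin s0 by (subst sum.union_disjoint) auto
    define ex where "ex x y i = g * (if i = s0 then y else x i)" for x :: "'i \<Rightarrow> complex" and y i
    have exrow: "(\<Sum>i\<in>?T \<union> {s0}. ex x y i * U' i j) = ex (\<lambda>j. \<Sum>i\<in>?T. x i * U i j) (y * \<omega>) j" if "j \<in> ?T \<union> {s0}" for x y j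
    proof (cases "j = s0")
      case True
      have "(\<Sum>i\<in>?T. ex x y i * U' i j) = 0" using True s0 by (intro sum.neutral) (auto simp: U'_def)
      then show ?thesis unfolding split0 using True by (simp add: ex_def U'_def)
    next
      case False
      have "(\<Sum>i\<in>?T. ex x y i * U' i j) = g * (\<Sum>i\<in>?T. x i * U i j)"
        unfolding sum_distrib_left using False s0 by (intro sum.cong) (auto simp: U'_def ex_def)
      then show ?thesis unfolding split0 using False by (simp add: ex_def U'_def)
    qed
    have exin: "(\<Sum>i\<in>?S. ex x y i * cnj (ex x' y' i)) = g * cnj g * ((\<Sum>i\<in>S. x i * cnj (x' i)) + y * cnj y')" for x y x' y'
    proof -
      have "(\<Sum>i\<in>S. ex x y i * cnj (ex x' y' i)) = g * cnj g * (\<Sum>i\<in>S. x i * cnj (x' i))"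
        unfolding sum_distrib_left using s0 by (intro sum.cong) (auto simp: ex_def)
      then show ?thesis using fin s0 by (simp add: ex_def algebra_simps)
    qed
    \<comment> \<open>The new state carries the zero vector, so that the state equation a = \<zeta>
      b holds there and the terms over \<open>B\<close> are unchanged.\<close>
    define a' where "a' = a(s0 := \<lambda>_. 0)"
    define b' where "b' = b(s0 := \<lambda>_. 0)"
    obtain s1 where s1: "s1 \<in> S" using card by fastforce
    have s: "s1 \<in> ?S" "s0 \<in> ?S" "s1 \<noteq> s0" using s1 s0 by auto
    have S': "?S - {s1, s0} = S - {s1}" using s0 by auto
    have "card (S - {s1}) < card S" using fin s1 by (intro psubset_card_mono) auto
    then have "contr B (?S - {s1, s0})"
      unfolding S' using fin dis by (intro IH) auto
    note step = contr_step[OF H1 fin(1) _ _ s this, of U' b' a' "ex \<eta> k" "ex \<theta> (k * \<omega>)" "ex e k" "ex r (\<nu> * k * \<omega>)" \<nu>]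
    have "(\<Sum>i\<in>B. qn (\<lambda>p. (\<zeta> p)\<^sup>2 * b' i p)) \<le> (\<Sum>i\<in>B. qn (a' i))"
    proof (rule step)
      show "uni (B \<union> ?S) (B \<union> ?S) U'" unfolding TS by (rule U')
      show "b' i = app (B \<union> ?S) U' a' i" if i: "i \<in> B \<union> ?S" for i
      proof
        fix p
        have "app (B \<union> ?S) U' a' i p = (\<Sum>j\<in>?T. U' i j * a' j p)"
          unfolding TS app_def split0 by (simp add: a'_def)
        also have "\<dots> = b' i p"
        proof (cases "i = s0")
          case True
          then show ?thesis using s0 by (auto simp: b'_def U'_def intro!: sum.neutral)
        next
          case False
          then have "i \<in> ?T" using i by auto
          then have "b' i p = (\<Sum>j\<in>?T. U i j * a j p)" using b False by (auto simp: b'_def app_def)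
          also have "\<dots> = (\<Sum>j\<in>?T. U' i j * a' j p)" using False s0 by (intro sum.cong) (auto simp: U'_def a'_def)
          finally show ?thesis by simp
        qed
        finally show "b' i p = app (B \<union> ?S) U' a' i p" by simp
      qed
      show "(\<Sum>i\<in>?S. ex \<eta> k i * cnj (ex \<eta> k i)) = 1" unfolding exin n1 kk using gg by simp
      show "(\<Sum>i\<in>?S. ex \<eta> k i * cnj (ex \<theta> (k * \<omega>) i)) = 0"
      proof -
        have "k * cnj (k * \<omega>) = cnj \<omega> * cmod m" using kk by (simp add: mult_ac)
        then show ?thesis unfolding exin m_def[symmetric] using cm by (simp add: \<omega>_def)
      qed
      show "(\<Sum>i\<in>B \<union> ?S. ex \<eta> k i * U' i j) = ex \<theta> (k * \<omega>) j" if "j \<in> B \<union> ?S" for j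
        using that unfolding TS exrow[OF that[unfolded TS]] using rows(1) by (auto simp: ex_def)
      show "(\<Sum>i\<in>B \<union> ?S. ex r (\<nu> * k * \<omega>) i * U' i j) = ex e k j" if "j \<in> B \<union> ?S" for j
      proof -
        have "\<nu> * k * \<omega> * \<omega> = k" using \<nu>\<omega> by (simp add: mult_ac)
        then show ?thesis using that unfolding TS exrow[OF that[unfolded TS]] using rows(2) by (auto simp: ex_def)
      qed
    qed (use fin dis s0 ab zB e r in \<open>auto simp: ex_def a'_def b'_def\<close>)
    moreover have "b' i = b i" "a' i = a i" if "i \<in> B" for i using that s0 by (auto simp: a'_def b'_def)
    ultimately show ?thesis by simp
  qed
qed

text \<open>\<open>v j\<close> is w \<alpha> / (1 - \<zeta> \<tau>) written without division. By
  \<open>herg_meas\<close> the difference of the two sides is the real part of the form of the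
  Herglotz transform of the measure.\<close>

definition meas_pos :: "'j set \<Rightarrow> ('j \<Rightarrow> complex) \<Rightarrow> ('j \<Rightarrow> 'n::finite \<Rightarrow> complex) \<Rightarrow> bool" where
  "meas_pos J \<tau> w \<longleftrightarrow> (\<forall>v \<alpha>. (\<forall>j\<in>J. \<forall>p. (1 - \<zeta> p * \<tau> j) * v j p = (\<Sum>b\<in>UNIV. w j b * \<alpha> b p)) \<longrightarrow>
     (\<Sum>j\<in>J. qn (\<lambda>p. \<zeta> p * v j p)) \<le> (\<Sum>j\<in>J. qn (v j)))"

text \<open>The outputs are fed back to the inputs through one additional state each. The closed
  loop satisfies v = \<zeta> Q v + \<alpha> with Q unitary, and an eigenbasis of Q turns this into
  the defining equation of \<open>meas_pos\<close>. The eigenvectors are card S + 2N in number, at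
  most 3N exactly when card S \<le> N.\<close>

lemma contr_base:
  fixes S :: "('n::finite + nat) set"
  assumes H2: "\<And>(J :: ('n + nat) set) \<tau> (w :: 'n + nat \<Rightarrow> 'n \<Rightarrow> complex). card J \<le> 3 * CARD('n) \<Longrightarrow> normalised J \<tau> w \<Longrightarrow> meas_pos J \<tau> w"
    and fin: "finite S" and dis: "range Inl \<inter> S = {}" and card: "card S \<le> CARD('n)"
  shows "contr (range (Inl :: 'n \<Rightarrow> 'n + nat)) S"
  unfolding contr_def
proof (intro allI impI)
  let ?B = "range (Inl :: 'n \<Rightarrow> 'n + nat)"
  let ?T = "?B \<union> S"
  fix U a b
  assume U: "uni ?T ?T U" and b: "\<forall>i\<in>?T. b i = app ?T U a i" and ab: "\<forall>s\<in>S. a s = (\<lambda>p. \<zeta> p * b s p)"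
  have cB: "card ?B = CARD('n)" by (simp add: card_image)
  have "infinite (UNIV - ?T)" using fin by (simp add: Diff_infinite_finite infinite_UNIV_nat)
  then obtain C where C: "finite C" "card C = CARD('n)" "C \<subseteq> UNIV - ?T"
    by (meson infinite_arbitrarily_large)
  obtain c where c: "bij_betw c C ?B"
    using C cB by (metis finite_same_card_bij finite finite_imageI)
  have CT: "C \<inter> ?T = {}" using C by auto
  let ?I = "(S \<union> C) \<union> ?B"
  have I2: "?I = ?T \<union> C" by auto
  have cinB: "c j \<in> ?B" if "j \<in> C" for j using c that by (auto simp: bij_betw_def)
  define f where "f i = (if i \<in> C then c i else i)" for i
  \<comment> \<open>The states in \<open>C\<close> hold the outputs delayed once.\<close>
  define v where "v j = (if j \<in> C then (\<lambda>p. \<zeta> p * b (c j) p) else a j)" for j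
  \<comment> \<open>Rows of \<open>S\<close> and \<open>C\<close> are rows of \<open>U\<close> and
    produce \<open>b\<close>; rows of \<open>B\<close> only read the delay states, so the block of
    \<open>Q\<close> from \<open>B\<close> to \<open>B\<close> is zero.\<close>
  define Q where "Q i j = (if i \<in> ?B then of_bool (j \<in> C \<and> i = c j) else if j \<in> C then 0 else U (f i) j)" for i j
  have bf: "bij_betw f (S \<union> C) ?T"
  proof -
    have "bij_betw f C ?B" using c by (rule bij_betw_cong[THEN iffD1, rotated]) (simp add: f_def)
    moreover have "bij_betw f S S" 
      by (rule bij_betw_cong[THEN iffD1, rotated, OF bij_betw_id]) (use CT in \<open>auto simp: f_def\<close>)
    ultimately have "bij_betw f (C \<union> S) ?T" using dis by (intro bij_betw_combine) auto
    then show ?thesis by (simp add: Un_commute)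
  qed
  have Qc: "uni ?B C (\<lambda>i j. of_bool (i = c j))"
  proof (rule uniI)
    fix i i' assume i: "i \<in> ?B" "i' \<in> ?B"
    have "(\<Sum>j\<in>C. of_bool (i = c j) * cnj (of_bool (i' = c j))) = (\<Sum>j\<in>C. of_bool (i = c j) * of_bool (i' = c j) :: complex)" by simp
    also have "\<dots> = (\<Sum>k\<in>?B. of_bool (i = k) * of_bool (i' = k))" by (rule sum.reindex_bij_betw[OF c])
    also have "\<dots> = of_bool (i = i')" using i by (subst of_bool_sum) auto
    finally show "(\<Sum>j\<in>C. of_bool (i = c j) * cnj (of_bool (i' = c j))) = (of_bool (i = i') :: complex)" .
  next
    fix j j' assume j: "j \<in> C" "j' \<in> C"
    have "(\<Sum>i\<in>?B. cnj (of_bool (i = c j)) * of_bool (i = c j')) = (\<Sum>i\<in>?B. of_bool (i = c j) * of_bool (i = c j') :: complex)" by simp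
    also have "\<dots> = of_bool (c j = c j')" using cinB[OF j(1)] by (subst of_bool_sum) auto
    also have "c j = c j' \<longleftrightarrow> j = j'" using c j by (auto simp: bij_betw_def inj_on_eq_iff)
    finally show "(\<Sum>i\<in>?B. cnj (of_bool (i = c j)) * of_bool (i = c j')) = (of_bool (j = j') :: complex)" .
  qed (use C in auto)
  have Q: "uni ?I ?I Q"
  proof -
    have "uni ((S \<union> C) \<union> ?B) (?T \<union> C) Q"
      by (rule uni_block[OF uni_reindex_rows[OF U bf] Qc]) (use dis CT in \<open>auto simp: Q_def\<close>)
    then show ?thesis unfolding I2[symmetric] .
  qed
  have splitI: "(\<Sum>i\<in>?I. h i) = (\<Sum>i\<in>S. h i) + (\<Sum>i\<in>C. h i) + (\<Sum>i\<in>?B. h i)" for h :: "_ \<Rightarrow> 'z::comm_monoid_add"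
    using fin C dis CT by (subst sum.union_disjoint, auto)+
  have Qv: "app ?I Q v i = (if i \<in> ?B then v (inv_into C c i) else b (f i))" if i: "i \<in> ?I" for i
  proof
    fix p
    show "app ?I Q v i p = (if i \<in> ?B then v (inv_into C c i) else b (f i)) p"
    proof (cases "i \<in> ?B")
      case True
      have "app ?I Q v i p = (\<Sum>j\<in>C. of_bool (i = c j) * v j p)"
        unfolding app_def using True by (intro sum.mono_neutral_cong_right) (use fin C in \<open>auto simp: Q_def\<close>)
      also have "\<dots> = (\<Sum>j\<in>C. of_bool (j = inv_into C c i) * v j p)"
        using c True by (intro sum.cong) (auto simp: bij_betw_def inv_into_f_f f_inv_into_f)
      also have "\<dots> = v (inv_into C c i) p"
        using C True c by (intro of_bool_sum) (auto simp: bij_betw_def intro: inv_into_into)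
      finally show ?thesis using True by simp
    next
      case False
      then have fi: "f i \<in> ?T" using bf i by (auto simp: bij_betw_def)
      have "app ?I Q v i p = (\<Sum>j\<in>?T. U (f i) j * a j p)"
        unfolding app_def using False CT by (intro sum.mono_neutral_cong_right) (use fin C in \<open>auto simp: Q_def v_def\<close>)
      then show ?thesis using False b fi by (simp add: app_def)
    qed
  qed
  \<comment> \<open>What has to be injected at \<open>B\<close> so that the input is
    \<open>a\<close> although \<zeta>^2 b returns through the loop.\<close>
  define \<alpha> where "\<alpha> n p = a (Inl n) p - (\<zeta> p)\<^sup>2 * b (Inl n) p" for n p
  have vrel: "v i p = \<zeta> p * app ?I Q v i p + (if i \<in> ?B then \<alpha> (projl i) p else 0)" if i: "i \<in> ?I" for i p
  proof -
    consider "i \<in> S" "i \<notin> C" "i \<notin> ?B" | "i \<in> C" "i \<notin> ?B" | "i \<in> ?B" "i \<notin> C" using i dis CT by blast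
    then show ?thesis
    proof cases
      case 1 then show ?thesis using ab i by (simp add: Qv v_def f_def)
    next
      case 2 then show ?thesis using i by (simp add: Qv v_def f_def)
    next
      case 3
      then have "inv_into C c i \<in> C" "c (inv_into C c i) = i" using c by (auto simp: bij_betw_def f_inv_into_f inv_into_into)
      then show ?thesis using 3 i by (auto simp: Qv v_def \<alpha>_def power2_eq_square)
    qed
  qed
  obtain G \<tau> where G: "uni ?I ?I G" "\<forall>i\<in>?I. cmod (\<tau> i) = 1" "\<forall>i\<in>?I. \<forall>j\<in>?I. (\<Sum>k\<in>?I. G i k * Q k j) = \<tau> i * G i j"
    using uni_diagonalise[OF Q] by blast
  define w where "w j n = G j (Inl n)" for j n
  have finI: "finite ?I" using fin C by simp
  have cardI: "card ?I \<le> 3 * CARD('n)"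
  proof -
    have "card ?I \<le> card S + card C + card ?B" by (meson card_Un_le add_le_mono1 order_trans)
    then show ?thesis using card C cB by simp
  qed
  have "normalised ?I \<tau> w"
    unfolding normalised_def
  proof (intro conjI allI)
    show "finite ?I" by (rule finI)
    show "\<forall>j\<in>?I. cmod (\<tau> j) = 1" by (rule G(2))
    fix n n' :: 'n
    show "(\<Sum>j\<in>?I. cnj (w j n) * w j n') = of_bool (n = n')"
      unfolding w_def using uniD(4)[OF G(1), of "Inl n" "Inl n'"] by simp
    \<comment> \<open>The first moment of the spectral measure of \<open>Q\<close>, compressed to
      \<open>B\<close>, is the zero block of \<open>Q\<close> from \<open>B\<close> to
      \<open>B\<close>.\<close>
    have "(\<Sum>j\<in>?I. \<tau> j * cnj (w j n) * w j n') = (\<Sum>j\<in>?I. cnj (G j (Inl n)) * (\<Sum>k\<in>?I. G j k * Q k (Inl n')))"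
      using G(3) by (intro sum.cong) (auto simp: w_def)
    also have "\<dots> = (\<Sum>k\<in>?I. (\<Sum>j\<in>?I. cnj (G j (Inl n)) * G j k) * Q k (Inl n'))"
      unfolding sum_distrib_left sum_distrib_right mult.assoc by (rule sum.swap)
    also have "\<dots> = (\<Sum>k\<in>?I. of_bool (Inl n = k) * Q k (Inl n'))" using uniD(4)[OF G(1)] by simp
    also have "\<dots> = Q (Inl n) (Inl n')" using finI by (intro of_bool_sum) auto
    also have "\<dots> = 0" using CT by (auto simp: Q_def)
    finally show "(\<Sum>j\<in>?I. \<tau> j * cnj (w j n) * w j n') = 0" .
  qed
  from H2[OF cardI this] have mp: "meas_pos ?I \<tau> w" .
  have "(1 - \<zeta> p * \<tau> j) * app ?I G v j p = (\<Sum>n\<in>UNIV. w j n * \<alpha> n p)" if j: "j \<in> ?I" for j p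
  proof -
    have "app ?I G v j p = \<zeta> p * (\<Sum>i\<in>?I. G j i * app ?I Q v i p) + (\<Sum>i\<in>?I. G j i * (if i \<in> ?B then \<alpha> (projl i) p else 0))"
      unfolding app_def[of _ G] sum_distrib_left sum.distrib[symmetric]
      using vrel by (intro sum.cong) (auto simp: algebra_simps)
    also have "(\<Sum>i\<in>?I. G j i * app ?I Q v i p) = (\<Sum>k\<in>?I. (\<Sum>i\<in>?I. G j i * Q i k) * v k p)"
      unfolding app_def sum_distrib_left sum_distrib_right mult.assoc by (rule sum.swap)
    also have "\<dots> = \<tau> j * app ?I G v j p" using G(3) j by (simp add: app_def sum_distrib_left mult.assoc)
    also have "(\<Sum>i\<in>?I. G j i * (if i \<in> ?B then \<alpha> (projl i) p else 0)) = (\<Sum>i\<in>?B. G j i * \<alpha> (projl i) p)"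
      by (rule sum.mono_neutral_cong_right) (use finI in auto)
    also have "\<dots> = (\<Sum>n\<in>UNIV. w j n * \<alpha> n p)" by (rule sum.reindex_cong[of Inl UNIV]) (simp_all add: w_def)
    finally show ?thesis by (rule resolvent_eqI)
  qed
  then have "(\<Sum>j\<in>?I. qn (\<lambda>p. \<zeta> p * app ?I G v j p)) \<le> (\<Sum>j\<in>?I. qn (app ?I G v j))"
    using mp unfolding meas_pos_def by blast
  then have "(\<Sum>j\<in>?I. qn (\<lambda>p. \<zeta> p * v j p)) \<le> (\<Sum>j\<in>?I. qn (v j))"
    unfolding qn_app_mult[OF G(1)] qn_app[OF G(1)] .
  \<comment> \<open>The contributions of \<open>S\<close> and of \<open>C\<close> occur identically
    on both sides of the inequality and cancel, leaving the claim.\<close>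
  moreover have "(\<Sum>j\<in>?I. qn (\<lambda>p. \<zeta> p * v j p)) = (\<Sum>i\<in>S. qn (\<lambda>p. \<zeta> p * b i p)) + (\<Sum>i\<in>?B. qn (\<lambda>p. \<zeta> p * b i p)) + (\<Sum>i\<in>?B. qn (\<lambda>p. (\<zeta> p)\<^sup>2 * b i p))"
  proof -
    have "(\<Sum>j\<in>?I. qn (\<lambda>p. \<zeta> p * v j p)) = (\<Sum>j\<in>?I. qn (\<lambda>p. \<zeta> p * app ?I Q v j p))" by (rule qn_app_mult[OF Q, symmetric])
    also have "\<dots> = (\<Sum>j\<in>S. qn (\<lambda>p. \<zeta> p * app ?I Q v j p)) + (\<Sum>j\<in>C. qn (\<lambda>p. \<zeta> p * app ?I Q v j p)) + (\<Sum>j\<in>?B. qn (\<lambda>p. \<zeta> p * app ?I Q v j p))"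
      by (rule splitI)
    also have "(\<Sum>j\<in>S. qn (\<lambda>p. \<zeta> p * app ?I Q v j p)) = (\<Sum>i\<in>S. qn (\<lambda>p. \<zeta> p * b i p))"
    proof (rule sum.cong[OF refl])
      fix j assume j: "j \<in> S" then have "j \<notin> ?B" "j \<notin> C" using dis CT by auto
      then show "qn (\<lambda>p. \<zeta> p * app ?I Q v j p) = qn (\<lambda>p. \<zeta> p * b j p)" using j by (simp add: Qv f_def)
    qed
    also have "(\<Sum>j\<in>C. qn (\<lambda>p. \<zeta> p * app ?I Q v j p)) = (\<Sum>j\<in>C. qn (\<lambda>p. \<zeta> p * b (c j) p))"
    proof (rule sum.cong[OF refl])
      fix j assume j: "j \<in> C" then have "j \<notin> ?B" using CT by auto
      then show "qn (\<lambda>p. \<zeta> p * app ?I Q v j p) = qn (\<lambda>p. \<zeta> p * b (c j) p)" using j by (simp add: Qv f_def)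
    qed
    also have "\<dots> = (\<Sum>i\<in>?B. qn (\<lambda>p. \<zeta> p * b i p))" by (rule sum.reindex_bij_betw[OF c])
    also have "(\<Sum>j\<in>?B. qn (\<lambda>p. \<zeta> p * app ?I Q v j p)) = (\<Sum>i\<in>?B. qn (\<lambda>p. (\<zeta> p)\<^sup>2 * b i p))"
    proof (rule sum.cong[OF refl])
      fix j assume j: "j \<in> ?B"
      then have "inv_into C c j \<in> C" "c (inv_into C c j) = j" using c by (auto simp: bij_betw_def f_inv_into_f inv_into_into)
      then show "qn (\<lambda>p. \<zeta> p * app ?I Q v j p) = qn (\<lambda>p. (\<zeta> p)\<^sup>2 * b j p)" using j by (simp add: Qv v_def power2_eq_square mult.assoc)
    qed
    finally show ?thesis .
  qed
  moreover have "(\<Sum>j\<in>?I. qn (v j)) = (\<Sum>i\<in>S. qn (\<lambda>p. \<zeta> p * b i p)) + (\<Sum>i\<in>?B. qn (\<lambda>p. \<zeta> p * b i p)) + (\<Sum>i\<in>?B. qn (a i))"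
  proof -
    have "(\<Sum>j\<in>S. qn (v j)) = (\<Sum>i\<in>S. qn (\<lambda>p. \<zeta> p * b i p))"
      using CT ab by (intro sum.cong) (auto simp: v_def)
    moreover have "(\<Sum>j\<in>?B. qn (v j)) = (\<Sum>i\<in>?B. qn (a i))"
      using CT by (intro sum.cong) (auto simp: v_def)
    moreover have "(\<Sum>j\<in>C. qn (v j)) = (\<Sum>i\<in>?B. qn (\<lambda>p. \<zeta> p * b i p))"
      by (simp add: v_def sum.reindex_bij_betw[OF c, of "\<lambda>i. qn (\<lambda>p. \<zeta> p * b i p)"])
    ultimately show ?thesis by (simp only: splitI)
  qed
  ultimately show "(\<Sum>i\<in>?B. qn (\<lambda>p. (\<zeta> p)\<^sup>2 * b i p)) \<le> (\<Sum>i\<in>?B. qn (a i))" by simp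
qed

end

section \<open>From measures with at most 3N atoms to all discrete measures\<close>

context hermitian_form
begin

lemma qn_cmult: "qn (\<lambda>p. c * \<xi> p) = (cmod c)\<^sup>2 * qn \<xi>"
proof -
  have "qn (\<lambda>p. c * \<xi> p) = Re (c * cnj c * of_real (qn \<xi>))"
    unfolding qn_def[of "\<lambda>p. c * \<xi> p"] frm_cmult frm_self ..
  also have "c * cnj c * of_real (qn \<xi>) = of_real ((cmod c)\<^sup>2 * qn \<xi>)"
    by (simp only: complex_norm_square[symmetric] of_real_mult)
  finally show ?thesis by simp
qed

lemma qn_parallelogram: "qn (\<lambda>p. a p + b p) + qn (\<lambda>p. a p - b p) = 2 * qn a + 2 * qn b"
  by (simp add: qn_def frm_add1 frm_add2 frm_diff1 frm_diff2)

lemma contr_all: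
  fixes S :: "('n::finite + nat) set"
  assumes H1: "\<And>\<xi>. qn (\<lambda>p. (\<zeta> p)\<^sup>2 * \<xi> p) \<le> qn \<xi>"
    and H2: "\<And>(J :: ('n + nat) set) \<tau> (w :: 'n + nat \<Rightarrow> 'n \<Rightarrow> complex). card J \<le> 3 * CARD('n) \<Longrightarrow> normalised J \<tau> w \<Longrightarrow> meas_pos J \<tau> w"
    and "finite S" "range Inl \<inter> S = {}"
  shows "contr (range (Inl :: 'n \<Rightarrow> 'n + nat)) S"
  using assms(3,4)
proof (induction "card S" arbitrary: S rule: less_induct)
  case less
  have cB: "card (range (Inl :: 'n \<Rightarrow> 'n + nat)) = CARD('n)" by (simp add: card_image)
  show ?case
  proof (cases "card S \<le> CARD('n)")
    case True
    show ?thesis by (rule contr_base[OF H2 less.prems True])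
  next
    case False
    show ?thesis
    proof (rule contr_reduce[OF H1])
      show "infinite (UNIV :: ('n + nat) set)" by simp
    qed (use less False cB in auto)
  qed
qed

text \<open>The measure with atoms at \<open>1\<close> and \<open>-1\<close>.\<close>

lemma square_contractive:
  assumes H2: "\<And>(J :: ('n::finite + nat) set) \<tau> (w :: 'n + nat \<Rightarrow> 'n \<Rightarrow> complex). card J \<le> 3 * CARD('n) \<Longrightarrow> normalised J \<tau> w \<Longrightarrow> meas_pos J \<tau> w"
  shows "qn (\<lambda>p. (\<zeta> p)\<^sup>2 * \<xi> p) \<le> qn \<xi>"
proof -
  obtain idx :: "'n \<Rightarrow> nat" where idx: "bij_betw idx UNIV {..<CARD('n)}"
    using ex_bij_betw_finite_nat[of "UNIV :: 'n set"] by (auto simp: atLeast0LessThan)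
  define J1 where "J1 = range (Inl :: 'n \<Rightarrow> 'n + nat)"
  define J2 where "J2 = range (\<lambda>n. (Inr (idx n) :: 'n + nat))"
  have inj: "inj idx" using idx by (simp add: bij_betw_def)
  have i1: "inj (Inl :: 'n \<Rightarrow> 'n + nat)" and i2: "inj (\<lambda>n. (Inr (idx n) :: 'n + nat))"
    using inj by (auto simp: inj_def)
  have dis: "J1 \<inter> J2 = {}" by (auto simp: J1_def J2_def)
  have fin: "finite J1" "finite J2" by (auto simp: J1_def J2_def)
  have sumJ: "(\<Sum>j\<in>J1 \<union> J2. h j) = (\<Sum>n\<in>UNIV. h (Inl n)) + (\<Sum>n\<in>UNIV. h (Inr (idx n)))" for h :: "'n + nat \<Rightarrow> 'z::comm_monoid_add"
    by (subst sum.union_disjoint[OF fin dis]) (simp add: J1_def J2_def sum.reindex[OF i1] sum.reindex[OF i2])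
  define s where "s = complex_of_real (1 / sqrt 2)"
  have ss: "s * s = 1/2" "cnj s = s" 
  proof -
    have "s * s = of_real (1 / sqrt 2 * (1 / sqrt 2))" unfolding s_def of_real_mult ..
    also have "1 / sqrt 2 * (1 / sqrt 2) = (1/2::real)" by simp
    finally show "s * s = 1/2" by simp
  qed (simp add: s_def)
  define \<tau> :: "'n + nat \<Rightarrow> complex" where "\<tau> j = (case j of Inl _ \<Rightarrow> 1 | Inr _ \<Rightarrow> - 1)" for j
  define w :: "'n + nat \<Rightarrow> 'n \<Rightarrow> complex" where "w j b = (case j of Inl n \<Rightarrow> s * of_bool (n = b) | Inr k \<Rightarrow> s * of_bool (k = idx b))" for j b
  have wI: "w (Inl n) b = s * of_bool (n = b)" "w (Inr (idx n)) b = s * of_bool (n = b)" for n b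
    using inj by (auto simp: w_def inj_eq)
  have bb: "(\<Sum>n\<in>UNIV. of_bool (n = a) * of_bool (n = b)) = (of_bool (a = b) :: complex)" for a b :: 'n
    by (subst of_bool_sum) auto
  have "normalised (J1 \<union> J2) \<tau> w"
    unfolding normalised_def
  proof (intro conjI allI)
    fix a b
    have "(\<Sum>n\<in>UNIV. cnj (w (Inl n) a) * w (Inl n) b) = s * s * (\<Sum>n\<in>UNIV. of_bool (n = a) * of_bool (n = b))"
      unfolding sum_distrib_left by (intro sum.cong) (simp_all add: wI ss(2) mult_ac)
    then have X1: "(\<Sum>n\<in>UNIV. cnj (w (Inl n) a) * w (Inl n) b) = 1/2 * of_bool (a = b)" unfolding bb ss(1) .
    have "(\<Sum>n\<in>UNIV. cnj (w (Inr (idx n)) a) * w (Inr (idx n)) b) = s * s * (\<Sum>n\<in>UNIV. of_bool (n = a) * of_bool (n = b))"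
      unfolding sum_distrib_left by (intro sum.cong) (simp_all add: wI ss(2) mult_ac)
    then have X2: "(\<Sum>n\<in>UNIV. cnj (w (Inr (idx n)) a) * w (Inr (idx n)) b) = 1/2 * of_bool (a = b)" unfolding bb ss(1) .
    show "(\<Sum>j\<in>J1 \<union> J2. cnj (w j a) * w j b) = of_bool (a = b)"
      unfolding sumJ X1 X2 by simp
    have "(\<Sum>j\<in>J1 \<union> J2. \<tau> j * cnj (w j a) * w j b)
       = (\<Sum>n\<in>UNIV. cnj (w (Inl n) a) * w (Inl n) b) - (\<Sum>n\<in>UNIV. cnj (w (Inr (idx n)) a) * w (Inr (idx n)) b)"
      unfolding sumJ by (simp add: \<tau>_def sum_negf)
    then show "(\<Sum>j\<in>J1 \<union> J2. \<tau> j * cnj (w j a) * w j b) = 0" unfolding X1 X2 by simp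
  qed (use fin in \<open>auto simp: \<tau>_def split: sum.splits\<close>)
  moreover have "card (J1 \<union> J2) \<le> 3 * CARD('n)"
    using card_Un_le[of J1 J2] card_image[OF i1] card_image[OF i2] by (simp add: J1_def J2_def)
  ultimately have mp: "meas_pos (J1 \<union> J2) \<tau> w" by (intro H2)
  obtain n0 :: 'n where True by blast
  \<comment> \<open>The factor 1 - \<zeta>^2 cancels the resolvents of both atoms: at \<tau> = 1 and
    \<tau> = -1 the solutions are s (1 + \<zeta>) \<xi> and s (1 - \<zeta>) \<xi>.\<close>
  define \<alpha> where "\<alpha> b p = of_bool (b = n0) * (1 - (\<zeta> p)\<^sup>2) * \<xi> p" for b p
  define v where "v j p = (case j of Inl n \<Rightarrow> of_bool (n = n0) * s * (\<xi> p + \<zeta> p * \<xi> p)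
     | Inr k \<Rightarrow> of_bool (k = idx n0) * s * (\<xi> p - \<zeta> p * \<xi> p))" for j p
  have "(1 - \<zeta> p * \<tau> j) * v j p = (\<Sum>b\<in>UNIV. w j b * \<alpha> b p)" if j: "j \<in> J1 \<union> J2" for j p
  proof -
    have "(\<Sum>b\<in>UNIV. w j b * \<alpha> b p) = (\<Sum>b\<in>UNIV. of_bool (b = n0) * (w j b * (1 - (\<zeta> p)\<^sup>2) * \<xi> p))"
      by (intro sum.cong) (simp_all add: \<alpha>_def mult_ac)
    also have "\<dots> = w j n0 * (1 - (\<zeta> p)\<^sup>2) * \<xi> p" by (subst of_bool_sum) auto
    also have "\<dots> = (1 - \<zeta> p * \<tau> j) * v j p"
      using j inj by (auto simp: J1_def J2_def w_def v_def \<tau>_def inj_eq power2_eq_square algebra_simps)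
    finally show ?thesis by simp
  qed
  then have le: "(\<Sum>j\<in>J1 \<union> J2. qn (\<lambda>p. \<zeta> p * v j p)) \<le> (\<Sum>j\<in>J1 \<union> J2. qn (v j))"
    using mp unfolding meas_pos_def by blast
  have half: "(cmod s)\<^sup>2 = 1/2" by (simp add: s_def norm_divide power_divide)
  \<comment> \<open>Parallelogram law. For f = \<zeta> and f = 1 the two sides of \<open>le\<close>
    share the value at \<zeta> \<xi>, which cancels.\<close>
  have ev: "(\<Sum>j\<in>J1 \<union> J2. qn (\<lambda>p. f p * v j p)) = qn (\<lambda>p. f p * \<xi> p) + qn (\<lambda>p. f p * \<zeta> p * \<xi> p)" for f
  proof -
    let ?p = "\<lambda>p. f p * \<xi> p + f p * \<zeta> p * \<xi> p" and ?m = "\<lambda>p. f p * \<xi> p - f p * \<zeta> p * \<xi> p"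
    have "qn (\<lambda>p. f p * v (Inl n) p) = (if n = n0 then qn (\<lambda>p. s * ?p p) else 0)" for n
      by (auto simp: v_def algebra_simps)
    then have A: "(\<Sum>n\<in>UNIV. qn (\<lambda>p. f p * v (Inl n) p)) = qn (\<lambda>p. s * ?p p)" by simp
    have "qn (\<lambda>p. f p * v (Inr (idx n)) p) = (if n = n0 then qn (\<lambda>p. s * ?m p) else 0)" for n
      using inj by (auto simp: v_def inj_eq algebra_simps)
    then have B: "(\<Sum>n\<in>UNIV. qn (\<lambda>p. f p * v (Inr (idx n)) p)) = qn (\<lambda>p. s * ?m p)" by simp
    show ?thesis unfolding sumJ A B qn_cmult half
      using qn_parallelogram[of "\<lambda>p. f p * \<xi> p" "\<lambda>p. f p * \<zeta> p * \<xi> p"] by simp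
  qed
  show ?thesis using le ev[of \<zeta>] ev[of "\<lambda>_. 1"] by (simp add: power2_eq_square)
qed

text \<open>The hypothesis on measures with few atoms implies positivity for all discrete measures:
  on \<open>\<complex>\<^sup>J\<close> the columns \<open>w b\<close> and \<open>cnj \<tau> w b\<close> are orthonormal; completing them
  turns multiplication by \<open>\<tau>\<close> into a colligation.\<close>

lemma meas_pos_normalised:
  fixes w :: "'j \<Rightarrow> 'n::finite \<Rightarrow> complex"
  assumes H2: "\<And>(J :: ('n + nat) set) \<tau> (w :: 'n + nat \<Rightarrow> 'n \<Rightarrow> complex). card J \<le> 3 * CARD('n) \<Longrightarrow> normalised J \<tau> w \<Longrightarrow> meas_pos J \<tau> w"
    and nrm: "normalised J \<tau> w"
  shows "meas_pos J \<tau> w"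
  unfolding meas_pos_def
proof (intro allI impI)
  fix v \<alpha>
  assume v: "\<forall>j\<in>J. \<forall>p. (1 - \<zeta> p * \<tau> j) * v j p = (\<Sum>b\<in>UNIV. w j b * \<alpha> b p)"
  have finJ: "finite J" and t1: "\<And>j. j \<in> J \<Longrightarrow> cmod (\<tau> j) = 1"
    and w1: "\<And>a b. (\<Sum>j\<in>J. cnj (w j a) * w j b) = of_bool (a = b)"
    and w2: "\<And>a b. (\<Sum>j\<in>J. \<tau> j * cnj (w j a) * w j b) = 0"
    using nrm by (auto simp: normalised_def)
  have tt: "\<tau> j * cnj (\<tau> j) = 1" if "j \<in> J" for j
    using t1[OF that] by (simp add: complex_norm_square[symmetric])
  obtain idx :: "'n \<Rightarrow> nat" where idx: "bij_betw idx UNIV {..<CARD('n)}"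
    using ex_bij_betw_finite_nat[of "UNIV :: 'n set"] by (auto simp: atLeast0LessThan)
  have inj: "inj idx" and ran: "range idx = {..<CARD('n)}" using idx by (auto simp: bij_betw_def)
  define c where "c n = (Inr (idx n) :: 'n + nat)" for n
  have injc: "inj c" using inj by (auto simp: inj_def c_def)
  define B where "B = range (Inl :: 'n \<Rightarrow> 'n + nat)"
  define C where "C = range c"
  \<comment> \<open>Indices for completing 2N prescribed rows to card J rows. The codes below N
    belong to \<open>C\<close>, hence the shifted interval of length card J - 2N; these indices
    become the states.\<close>
  define S where "S = (Inr :: nat \<Rightarrow> 'n + nat) ` {CARD('n)..<card J - CARD('n)}"
  have C': "C = Inr ` {..<CARD('n)}" unfolding C_def c_def ran[symmetric] by auto
  have dis: "B \<inter> C = {}" "B \<inter> S = {}" "C \<inter> S = {}" by (auto simp: B_def C' S_def)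
  have fin: "finite B" "finite C" "finite S" by (auto simp: B_def C_def S_def)
  \<comment> \<open>The rows are the adjoints of the columns \<open>w\<close> (at
    \<open>Inl n\<close>) and \<open>cnj \<tau> w\<close> (at \<open>c n\<close>).\<close>
  define V0 where "V0 i j = (case i of Inl n \<Rightarrow> cnj (w j n) | Inr k \<Rightarrow> \<tau> j * cnj (w j (inv idx k)))" for i j
  have V0: "V0 (Inl n) j = cnj (w j n)" "V0 (c n) j = \<tau> j * cnj (w j n)" for n j
    using inj by (auto simp: V0_def c_def inv_f_f)
  have orth: "(\<Sum>j\<in>J. V0 i j * cnj (V0 i' j)) = of_bool (i = i')" if i: "i \<in> B \<union> C" "i' \<in> B \<union> C" for i i'
  proof -
    have 1: "(\<Sum>j\<in>J. cnj (w j n) * (cnj (\<tau> j) * w j n')) = 0" for n n'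
      using arg_cong[OF w2[of n' n], of cnj] by (simp add: cnj_sum mult_ac)
    have 2: "(\<Sum>j\<in>J. \<tau> j * cnj (w j n) * (cnj (\<tau> j) * w j n')) = of_bool (n = n')" for n n'
    proof -
      have "(\<Sum>j\<in>J. \<tau> j * cnj (w j n) * (cnj (\<tau> j) * w j n')) = (\<Sum>j\<in>J. cnj (w j n) * w j n')"
      proof (rule sum.cong[OF refl])
        fix j assume "j \<in> J"
        have "\<tau> j * cnj (w j n) * (cnj (\<tau> j) * w j n') = \<tau> j * cnj (\<tau> j) * (cnj (w j n) * w j n')" by (simp add: mult_ac)
        then show "\<tau> j * cnj (w j n) * (cnj (\<tau> j) * w j n') = cnj (w j n) * w j n'" using tt[OF \<open>j \<in> J\<close>] by simp
      qed
      then show ?thesis using w1 by simp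
    qed
    have ne: "Inl n \<noteq> c n'" "c n' \<noteq> Inl n" for n n' by (auto simp: c_def)
    show ?thesis using i w1 w2 1 2 injc ne by (auto simp: B_def C_def V0 inj_eq)
  qed
  have cardB: "card B = CARD('n)" "card C = CARD('n)"
    by (simp_all add: B_def C_def card_image injc)
  have cBC: "card (B \<union> C) = 2 * CARD('n)" using card_Un_disjoint[OF fin(1,2) dis(1)] cardB by simp
  have le: "2 * CARD('n) \<le> card J"
    using orthonormal_card_le[of "B \<union> C" J V0] orth fin finJ cBC by auto
  let ?I = "B \<union> C \<union> S"
  have "card S = card J - 2 * CARD('n)" by (simp add: S_def card_image)
  then have cI: "card ?I = card J" using card_Un_disjoint[of "B \<union> C" S] fin dis cBC le by auto
  have "\<exists>V. uni ?I J V \<and> (\<forall>i\<in>B \<union> C. V i = V0 i)"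
    by (rule complete_orthonormal) (use fin finJ cI orth in auto)
  then obtain V where V: "uni ?I J V" "\<And>i. i \<in> B \<union> C \<Longrightarrow> V i = V0 i" by blast
  have VB: "V (Inl n) j = cnj (w j n)" "V (c n) j = \<tau> j * cnj (w j n)" for n j
    using V(2)[of "Inl n"] V(2)[of "c n"] by (auto simp: B_def C_def V0)
  define u where "u = app J V v"
  define y where "y = app J V (\<lambda>j p. \<tau> j * v j p)"
  have uy: "u i p = \<zeta> p * y i p + (\<Sum>b\<in>UNIV. of_bool (i = Inl b) * \<alpha> b p)" if i: "i \<in> ?I" for i p
  proof -
    have "u i p = (\<Sum>j\<in>J. V i j * (\<zeta> p * (\<tau> j * v j p) + (\<Sum>b\<in>UNIV. w j b * \<alpha> b p)))"
      unfolding u_def app_def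
    proof (rule sum.cong[OF refl])
      fix j assume "j \<in> J"
      then have "(1 - \<zeta> p * \<tau> j) * v j p = (\<Sum>b\<in>UNIV. w j b * \<alpha> b p)" using v by blast
      from this[symmetric] show "V i j * v j p = V i j * (\<zeta> p * (\<tau> j * v j p) + (\<Sum>b\<in>UNIV. w j b * \<alpha> b p))"
        by (simp add: algebra_simps)
    qed
    also have "\<dots> = \<zeta> p * y i p + (\<Sum>j\<in>J. \<Sum>b\<in>UNIV. (V i j * w j b) * \<alpha> b p)"
      unfolding y_def app_def distrib_left sum.distrib sum_distrib_left by (simp add: mult_ac)
    also have "(\<Sum>j\<in>J. \<Sum>b\<in>UNIV. (V i j * w j b) * \<alpha> b p) = (\<Sum>b\<in>UNIV. (\<Sum>j\<in>J. V i j * cnj (V (Inl b) j)) * \<alpha> b p)"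
      by (subst sum.swap) (simp add: VB sum_distrib_right)
    also have "\<dots> = (\<Sum>b\<in>UNIV. of_bool (i = Inl b) * \<alpha> b p)"
      using uniD(3)[OF V(1) i] by (simp add: B_def)
    finally show ?thesis .
  qed
  have uy': "u i = (\<lambda>p. \<zeta> p * y i p)" if "i \<in> C \<union> S" for i
  proof
    fix p
    have "i \<noteq> Inl b" for b using that dis by (auto simp: B_def)
    then show "u i p = \<zeta> p * y i p" using uy[of i p] that by simp
  qed
  \<comment> \<open>Row \<open>Inl n\<close> of \<open>V\<close> times \<tau> is row
    \<open>c n\<close>. Therefore row \<open>Inl n\<close> of \<open>Q\<close>, which is \<tau> in
    the coordinates \<open>V\<close>, is a unit vector and can be deleted together with column
    \<open>c n\<close>.\<close>
  have yB: "y (Inl n) = u (c n)" for n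
    by (simp add: fun_eq_iff y_def u_def app_def VB mult_ac)
  define Q where "Q = mmul J V (\<lambda>j k. \<tau> j * cnj (V k j))"
  have Q: "uni ?I ?I Q" unfolding Q_def
  proof (rule uni_mmul[OF V(1)], rule uniI)
    fix j j' assume j: "j \<in> J" "j' \<in> J"
    have "(\<Sum>k\<in>?I. \<tau> j * cnj (V k j) * cnj (\<tau> j' * cnj (V k j'))) = \<tau> j * cnj (\<tau> j') * (\<Sum>k\<in>?I. cnj (V k j) * V k j')"
      by (simp add: sum_distrib_left mult_ac)
    then show "(\<Sum>k\<in>?I. \<tau> j * cnj (V k j) * cnj (\<tau> j' * cnj (V k j'))) = of_bool (j = j')"
      using uniD(4)[OF V(1) j] tt[OF j(1)] by (cases "j = j'") auto
  next
    fix k k' assume k: "k \<in> ?I" "k' \<in> ?I"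
    have "(\<Sum>j\<in>J. cnj (\<tau> j * cnj (V k j)) * (\<tau> j * cnj (V k' j))) = (\<Sum>j\<in>J. V k j * cnj (V k' j))"
    proof (rule sum.cong[OF refl])
      fix j assume "j \<in> J"
      have "cnj (\<tau> j * cnj (V k j)) * (\<tau> j * cnj (V k' j)) = \<tau> j * cnj (\<tau> j) * (V k j * cnj (V k' j))" by (simp add: mult_ac)
      then show "cnj (\<tau> j * cnj (V k j)) * (\<tau> j * cnj (V k' j)) = V k j * cnj (V k' j)" using tt[OF \<open>j \<in> J\<close>] by simp
    qed
    then show "(\<Sum>j\<in>J. cnj (\<tau> j * cnj (V k j)) * (\<tau> j * cnj (V k' j))) = of_bool (k = k')"
      using uniD(3)[OF V(1) k] by simp
  qed (use finJ fin in auto)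
  have yQ: "y i p = app ?I Q u i p" for i p
  proof -
    have "app ?I Q u i p = app J V (app ?I (\<lambda>j k. \<tau> j * cnj (V k j)) u) i p" unfolding Q_def by (rule app_mmul)
    also have "app J V (app ?I (\<lambda>j k. \<tau> j * cnj (V k j)) u) = app J V (\<lambda>j p. \<tau> j * v j p)"
    proof (rule app_cong)
      fix j assume j: "j \<in> J"
      have "app ?I (\<lambda>j k. \<tau> j * cnj (V k j)) u j p = \<tau> j * app ?I (adj V) u j p" for p
        by (simp add: app_def adj_def sum_distrib_left mult_ac)
      then show "app ?I (\<lambda>j k. \<tau> j * cnj (V k j)) u j = (\<lambda>p. \<tau> j * v j p)"
        using uni_inverse_app[OF V(1) j, of v] by (simp add: fun_eq_iff u_def)
    qed
    finally show ?thesis by (simp add: y_def)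
  qed
  have Qrow: "Q (Inl n) k = of_bool (k = c n)" if k: "k \<in> ?I" for n k
  proof -
    have "Q (Inl n) k = (\<Sum>j\<in>J. V (c n) j * cnj (V k j))" by (simp add: Q_def mmul_def VB mult_ac)
    also have "\<dots> = of_bool (k = c n)" using uniD(3)[OF V(1), of "c n" k] k by (auto simp: C_def)
    finally show ?thesis .
  qed
  define c' where "c' = (\<lambda>i :: 'n + nat. c (projl i))"
  have c'B: "c' ` B = C" by (auto simp: c'_def B_def C_def image_image)
  have subB: "B \<subseteq> ?I" "c' ` B \<subseteq> ?I" unfolding c'B by auto
  have Qrow': "Q b j = of_bool (j = c' b)" if "b \<in> B" "j \<in> ?I" for b j
  proof -
    obtain n where "b = Inl n" using \<open>b \<in> B\<close> by (auto simp: B_def)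
    then show ?thesis using Qrow[OF \<open>j \<in> ?I\<close>, of n] by (simp add: c'_def)
  qed
  have del1: "uni (?I - B) (?I - c' ` B) Q" by (rule uni_delete_set(1)[OF Q subB]) (rule Qrow')
  have del2: "Q i (c' b) = 0" if "i \<in> ?I - B" "b \<in> B" for i b
    by (rule uni_delete_set(2)[OF Q subB _ that]) (rule Qrow')
  let ?T = "B \<union> S"
  \<comment> \<open>After the deletion the rows are \<open>C \<union> S\<close> and the columns
    \<open>B \<union> S\<close>. Renaming row \<open>c n\<close> to \<open>Inl n\<close> yields a
    colligation with inputs \<open>u\<close> at \<open>B\<close> and outputs \<open>y\<close> at
    \<open>C\<close>.\<close>
  define f where "f i = (if i \<in> B then c' i else i)" for i
  have bf: "bij_betw f ?T (?I - B)"
  proof -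
    have "bij_betw f B C" unfolding bij_betw_def
    proof
      show "inj_on f B"
      proof (rule inj_onI)
        fix x y assume xy: "x \<in> B" "y \<in> B" "f x = f y"
        obtain n n' where "x = Inl n" "y = Inl n'" using xy(1,2) unfolding B_def by blast
        then show "x = y" using xy injD[OF injc, of n n'] by (simp add: f_def c'_def)
      qed
      have "f ` B = c' ` B" by (auto simp: f_def)
      then show "f ` B = C" using c'B by simp
    qed
    moreover have "bij_betw f S S" 
      by (rule bij_betw_cong[THEN iffD1, rotated, OF bij_betw_id]) (use dis in \<open>auto simp: f_def\<close>)
    ultimately have "bij_betw f ?T (C \<union> S)" using dis by (intro bij_betw_combine) auto
    moreover have "?I - B = C \<union> S" using dis by auto
    ultimately show ?thesis by simp
  qed
  have IC: "?I - c' ` B = ?T" unfolding c'B using dis by auto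
  have U: "uni ?T ?T (\<lambda>i. Q (f i))" using uni_reindex_rows[OF del1 bf] unfolding IC .
  have "(\<Sum>i\<in>B. qn (\<lambda>p. (\<zeta> p)\<^sup>2 * y (f i) p)) \<le> (\<Sum>i\<in>B. qn (u i))"
  proof -
    have H1: "qn (\<lambda>p. (\<zeta> p)\<^sup>2 * \<xi> p) \<le> qn \<xi>" for \<xi> by (rule square_contractive[OF H2])
    have "contr (range (Inl :: 'n \<Rightarrow> 'n + nat)) S"
      by (rule contr_all[OF H1 H2]) (use fin dis in \<open>auto simp: B_def\<close>)
    then have "contr B S" by (simp add: B_def)
    note C1 = this[unfolded contr_def, THEN spec[of _ "\<lambda>i. Q (f i)"], THEN spec[of _ u], THEN spec[of _ "\<lambda>i. y (f i)"]]
    have p1: "y (f i) = app ?T (\<lambda>i. Q (f i)) u i" if i: "i \<in> ?T" for i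
    proof
      fix p
      have fi: "f i \<in> ?I - B" using bf i by (auto simp: bij_betw_def)
      have z: "Q (f i) k = 0" if k: "k \<in> C" for k
      proof -
        obtain b where "b \<in> B" "k = c' b" using k unfolding c'B[symmetric] by auto
        then show ?thesis using del2[OF fi] by simp
      qed
      have "y (f i) p = (\<Sum>k\<in>?I. Q (f i) k * u k p)" by (simp add: yQ app_def)
      also have "\<dots> = (\<Sum>k\<in>?T. Q (f i) k * u k p)"
        by (rule sum.mono_neutral_right) (use fin z in auto)
      finally show "y (f i) p = app ?T (\<lambda>i. Q (f i)) u i p" by (simp add: app_def)
    qed
    have p2: "u s = (\<lambda>p. \<zeta> p * y (f s) p)" if "s \<in> S" for s
      using uy'[of s] that dis by (auto simp: f_def)
    show ?thesis by (rule C1[THEN mp, THEN mp, THEN mp]) (use U p1 p2 in blast)+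
  qed
  then have main: "(\<Sum>n\<in>UNIV. qn (\<lambda>p. (\<zeta> p)\<^sup>2 * y (c n) p)) \<le> (\<Sum>n\<in>UNIV. qn (u (Inl n)))"
    by (simp add: B_def sum.reindex f_def c'_def)
  have splitI: "(\<Sum>i\<in>?I. h i) = (\<Sum>n\<in>UNIV. h (Inl n)) + (\<Sum>i\<in>C \<union> S. h i)" for h :: "'n + nat \<Rightarrow> real"
  proof -
    have "(\<Sum>i\<in>?I. h i) = (\<Sum>i\<in>B. h i) + (\<Sum>i\<in>C \<union> S. h i)"
      unfolding Un_assoc by (rule sum.union_disjoint) (use fin dis in auto)
    then show ?thesis by (simp add: B_def sum.reindex)
  qed
  have "(\<Sum>j\<in>J. qn (\<lambda>p. \<zeta> p * v j p)) = (\<Sum>j\<in>J. qn (\<lambda>p. \<zeta> p * (\<tau> j * v j p)))"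
  proof (rule sum.cong[OF refl])
    fix j assume "j \<in> J"
    have "qn (\<lambda>p. \<zeta> p * (\<tau> j * v j p)) = qn (\<lambda>p. \<tau> j * (\<zeta> p * v j p))" by (simp add: mult_ac)
    then show "qn (\<lambda>p. \<zeta> p * v j p) = qn (\<lambda>p. \<zeta> p * (\<tau> j * v j p))"
      unfolding qn_cmult using t1[OF \<open>j \<in> J\<close>] by simp
  qed
  also have "\<dots> = (\<Sum>i\<in>?I. qn (\<lambda>p. \<zeta> p * y i p))" unfolding y_def by (rule qn_app_mult[OF V(1), symmetric])
  also have "\<dots> = (\<Sum>n\<in>UNIV. qn (\<lambda>p. \<zeta> p * y (Inl n) p)) + (\<Sum>i\<in>C \<union> S. qn (\<lambda>p. \<zeta> p * y i p))" by (rule splitI)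
  \<comment> \<open>y (Inl n) = u (c n) = \<zeta> y (c n): this second delay is the source of
    \<zeta>^2 in \<open>contr\<close>.\<close>
  also have "(\<Sum>n\<in>UNIV. qn (\<lambda>p. \<zeta> p * y (Inl n) p)) = (\<Sum>n\<in>UNIV. qn (\<lambda>p. (\<zeta> p)\<^sup>2 * y (c n) p))"
  proof (rule sum.cong[OF refl])
    fix n
    have "u (c n) = (\<lambda>p. \<zeta> p * y (c n) p)" by (rule uy') (simp add: C_def)
    then show "qn (\<lambda>p. \<zeta> p * y (Inl n) p) = qn (\<lambda>p. (\<zeta> p)\<^sup>2 * y (c n) p)"
      by (simp add: yB power2_eq_square mult.assoc)
  qed
  also have "(\<Sum>i\<in>C \<union> S. qn (\<lambda>p. \<zeta> p * y i p)) = (\<Sum>i\<in>C \<union> S. qn (u i))" using uy' by (intro sum.cong) auto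
  also have "(\<Sum>n\<in>UNIV. qn (\<lambda>p. (\<zeta> p)\<^sup>2 * y (c n) p)) + (\<Sum>i\<in>C \<union> S. qn (u i)) \<le> (\<Sum>n\<in>UNIV. qn (u (Inl n))) + (\<Sum>i\<in>C \<union> S. qn (u i))"
    using main by simp
  also have "\<dots> = (\<Sum>i\<in>?I. qn (u i))" by (rule splitI[symmetric])
  also have "\<dots> = (\<Sum>j\<in>J. qn (v j))" unfolding u_def by (rule qn_app[OF V(1)])
  finally show "(\<Sum>j\<in>J. qn (\<lambda>p. \<zeta> p * v j p)) \<le> (\<Sum>j\<in>J. qn (v j))" .
qed

text \<open>The mass \<open>D\<close> is positive definite by \<open>inj\<close>. With D
  diagonalised by G, a congruence by G and the inverse square roots of the eigenvalues makes the
  mass I and keeps the moment zero; the inverse change of \<alpha> keeps w \<alpha>, and with it the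
  same \<open>v\<close>.\<close>

lemma meas_pos_nondegenerate:
  fixes w :: "'j \<Rightarrow> 'n::finite \<Rightarrow> complex"
  assumes H2: "\<And>(J :: ('n + nat) set) \<tau> (w :: 'n + nat \<Rightarrow> 'n \<Rightarrow> complex). card J \<le> 3 * CARD('n) \<Longrightarrow> normalised J \<tau> w \<Longrightarrow> meas_pos J \<tau> w"
    and fin: "finite J" and t1: "\<And>j. j \<in> J \<Longrightarrow> cmod (\<tau> j) = 1"
    and w2: "\<And>a b. (\<Sum>j\<in>J. \<tau> j * cnj (w j a) * w j b) = 0"
    and inj: "\<And>x. (\<forall>j\<in>J. (\<Sum>a\<in>UNIV. w j a * x a) = 0) \<Longrightarrow> x = (\<lambda>_. 0)"
  shows "meas_pos J \<tau> w"
proof -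
  define D where "D a b = (\<Sum>j\<in>J. cnj (w j a) * w j b)" for a b
  have Dh: "cnj (D a b) = D b a" for a b by (simp add: D_def cnj_sum mult.commute)
  have quad: "(\<Sum>b\<in>UNIV. (\<Sum>a\<in>UNIV. e a * D a b) * cnj (e b)) = (\<Sum>j\<in>J. (cmod (\<Sum>b\<in>UNIV. w j b * cnj (e b)))\<^sup>2)" for e
  proof -
    have "(\<Sum>b\<in>UNIV. (\<Sum>a\<in>UNIV. e a * D a b) * cnj (e b)) = (\<Sum>b\<in>UNIV. \<Sum>a\<in>UNIV. \<Sum>j\<in>J. e a * cnj (w j a) * (w j b * cnj (e b)))"
      by (simp add: D_def sum_distrib_left sum_distrib_right mult_ac)
    also have "\<dots> = (\<Sum>j\<in>J. \<Sum>b\<in>UNIV. \<Sum>a\<in>UNIV. e a * cnj (w j a) * (w j b * cnj (e b)))"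
      by (simp only: sum.swap[of _ J UNIV])
    also have "\<dots> = (\<Sum>j\<in>J. (\<Sum>b\<in>UNIV. w j b * cnj (e b)) * cnj (\<Sum>b\<in>UNIV. w j b * cnj (e b)))"
      unfolding cnj_sum sum_product by (simp add: mult_ac)
    finally show ?thesis unfolding sum_norm_sq .
  qed
  have real: "(\<forall>b. e b = 0) \<or> (\<exists>r>0. \<mu> = complex_of_real r)" if e: "\<forall>b\<in>UNIV. (\<Sum>a\<in>UNIV. e a * D a b) = \<mu> * e b" for e \<mu>
  proof (rule disjCI)
    assume "\<not> (\<exists>r>0. \<mu> = complex_of_real r)"
    define q where "q = (\<Sum>j\<in>J. (cmod (\<Sum>b\<in>UNIV. w j b * cnj (e b)))\<^sup>2)"
    define n where "n = (\<Sum>b\<in>UNIV. (cmod (e b))\<^sup>2)"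
    have "\<mu> * (\<Sum>b\<in>UNIV. e b * cnj (e b)) = of_real q"
      using quad[of e] e by (simp add: q_def sum_distrib_left mult.assoc)
    then have mq: "\<mu> * of_real n = of_real q" unfolding n_def sum_norm_sq .
    show "\<forall>b. e b = 0"
    proof (rule ccontr)
      assume "\<not> (\<forall>b. e b = 0)"
      then have ne: "\<exists>b. e b \<noteq> 0" by blast
      then have "n \<noteq> 0" by (auto simp: n_def sum_nonneg_eq_0_iff)
      then have npos: "n > 0" using sum_nonneg[of UNIV "\<lambda>b. (cmod (e b))\<^sup>2"] by (simp add: n_def)
      have "q \<noteq> 0"
      proof
        assume "q = 0"
        then have "\<forall>j\<in>J. (\<Sum>b\<in>UNIV. w j b * cnj (e b)) = 0" using fin by (simp add: q_def sum_nonneg_eq_0_iff)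
        then have "(\<lambda>b. cnj (e b)) = (\<lambda>_. 0)" by (rule inj)
        then show False using ne by (auto simp: fun_eq_iff)
      qed
      then have "q > 0" using sum_nonneg[of J "\<lambda>j. (cmod (\<Sum>b\<in>UNIV. w j b * cnj (e b)))\<^sup>2"] by (simp add: q_def)
      moreover have "\<mu> = of_real (q / n)" using mq npos by (simp add: field_simps)
      ultimately show False using npos \<open>\<not> (\<exists>r>0. \<mu> = complex_of_real r)\<close> by (metis divide_pos_pos)
    qed
  qed
  have "\<exists>(G :: 'n \<Rightarrow> 'n \<Rightarrow> complex) \<mu>. uni UNIV UNIV G \<and> (\<forall>i\<in>UNIV. \<forall>j\<in>UNIV. (\<Sum>k\<in>UNIV. G i k * D k j) = \<mu> i * G i j)"
  proof (rule orthonormal_row_eigenbasis)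
    fix e \<mu> assume e: "\<forall>j\<in>UNIV. (\<Sum>i\<in>UNIV. e i * D i j) = \<mu> * e j"
    have "(\<Sum>j\<in>UNIV. D i j * cnj (e j)) = cnj (\<mu> * e i)" for i
      using arg_cong[OF e[rule_format, of i], of cnj] by (simp add: cnj_sum Dh mult.commute)
    then show "\<forall>i\<in>UNIV. (\<Sum>j\<in>UNIV. D i j * cnj (e j)) = \<mu> * cnj (e i)" using real[OF e] by auto
  qed simp
  then obtain G :: "'n \<Rightarrow> 'n \<Rightarrow> complex" and \<mu> where G: "uni UNIV UNIV G" "\<And>i j. (\<Sum>k\<in>UNIV. G i k * D k j) = \<mu> i * G i j" by auto
  have "\<exists>r>0. \<mu> i = complex_of_real r" for i
  proof -
    have "\<not> (\<forall>b. G i b = 0)"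
    proof
      assume "\<forall>b. G i b = 0"
      then have "(\<Sum>j\<in>UNIV. G i j * cnj (G i j)) = 0" by simp
      then show False using uniD(3)[OF G(1), of i i] by simp
    qed
    then show ?thesis using real[of "G i" "\<mu> i"] G(2) by auto
  qed
  then obtain r where r: "\<And>i. r i > 0" "\<And>i. \<mu> i = complex_of_real (r i)" by metis
  define s where "s i = complex_of_real (sqrt (r i))" for i
  have s: "s i \<noteq> 0" "s i * s i = \<mu> i" "cnj (s i) = s i" for i
    using r(1)[of i] by (auto simp: s_def r(2) simp flip: of_real_mult)
  define t where "t i = 1 / s i" for i
  have ct: "cnj (t i) = t i" for i by (simp add: t_def s)
  define w' where "w' j i = t i * (\<Sum>b\<in>UNIV. w j b * cnj (G i b))" for j i
  have w'w': "(\<Sum>j\<in>J. f j * cnj (w' j i) * w' j k) = t i * t k * (\<Sum>b\<in>UNIV. (\<Sum>a\<in>UNIV. G i a * (\<Sum>j\<in>J. f j * cnj (w j a) * w j b)) * cnj (G k b))" for f i k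
  proof -
    have "(\<Sum>j\<in>J. f j * cnj (w' j i) * w' j k) = (\<Sum>j\<in>J. \<Sum>a\<in>UNIV. \<Sum>b\<in>UNIV. t i * t k * (G i a * (f j * cnj (w j a) * w j b) * cnj (G k b)))"
      unfolding w'_def by (simp add: cnj_sum ct sum_distrib_left sum_distrib_right mult_ac)
    also have "\<dots> = (\<Sum>a\<in>UNIV. \<Sum>b\<in>UNIV. \<Sum>j\<in>J. t i * t k * (G i a * (f j * cnj (w j a) * w j b) * cnj (G k b)))"
      by (simp only: sum.swap[of _ J UNIV])
    also have "\<dots> = (\<Sum>b\<in>UNIV. \<Sum>a\<in>UNIV. \<Sum>j\<in>J. t i * t k * (G i a * (f j * cnj (w j a) * w j b) * cnj (G k b)))"
      by (rule sum.swap)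
    finally show ?thesis by (simp add: sum_distrib_left sum_distrib_right mult.assoc)
  qed
  have "normalised J \<tau> w'"
    unfolding normalised_def
  proof (intro conjI allI)
    fix i k
    have "(\<Sum>j\<in>J. cnj (w' j i) * w' j k) = t i * t k * (\<Sum>b\<in>UNIV. (\<Sum>a\<in>UNIV. G i a * D a b) * cnj (G k b))"
      using w'w'[of "\<lambda>_. 1" i k] by (simp add: D_def)
    also have "\<dots> = t i * t k * (\<mu> i * (\<Sum>b\<in>UNIV. G i b * cnj (G k b)))"
      unfolding G(2) by (simp add: sum_distrib_left mult.assoc)
    also have "\<dots> = of_bool (i = k)"
      using uniD(3)[OF G(1), of i k] s[of i] by (auto simp: t_def field_simps)
    finally show "(\<Sum>j\<in>J. cnj (w' j i) * w' j k) = of_bool (i = k)" .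
    show "(\<Sum>j\<in>J. \<tau> j * cnj (w' j i) * w' j k) = 0" unfolding w'w' w2 by simp
  qed (use fin t1 in auto)
  then have mp: "meas_pos J \<tau> w'" using meas_pos_normalised[of J \<tau> w'] H2 by blast
  show ?thesis
    unfolding meas_pos_def
  proof (intro allI impI)
    fix v \<alpha>
    assume v: "\<forall>j\<in>J. \<forall>p. (1 - \<zeta> p * \<tau> j) * v j p = (\<Sum>b\<in>UNIV. w j b * \<alpha> b p)"
    define \<alpha>' where "\<alpha>' i p = s i * (\<Sum>b\<in>UNIV. G i b * \<alpha> b p)" for i p
    have "(\<Sum>i\<in>UNIV. w' j i * \<alpha>' i p) = (\<Sum>b\<in>UNIV. w j b * \<alpha> b p)" for j p
    proof -
      have "(\<Sum>i\<in>UNIV. w' j i * \<alpha>' i p) = (\<Sum>i\<in>UNIV. \<Sum>b\<in>UNIV. \<Sum>b'\<in>UNIV. w j b * cnj (G i b) * (G i b' * \<alpha> b' p))"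
      proof (rule sum.cong[OF refl])
        fix i
        have "w' j i * \<alpha>' i p = (t i * s i) * ((\<Sum>b\<in>UNIV. w j b * cnj (G i b)) * (\<Sum>b\<in>UNIV. G i b * \<alpha> b p))"
          unfolding w'_def \<alpha>'_def by (simp only: mult_ac)
        then show "w' j i * \<alpha>' i p = (\<Sum>b\<in>UNIV. \<Sum>b'\<in>UNIV. w j b * cnj (G i b) * (G i b' * \<alpha> b' p))"
          unfolding sum_product using s(1)[of i] by (simp add: t_def)
      qed
      also have "\<dots> = (\<Sum>b\<in>UNIV. \<Sum>b'\<in>UNIV. w j b * \<alpha> b' p * (\<Sum>i\<in>UNIV. cnj (G i b) * G i b'))"
        by (subst sum.swap, rule sum.cong[OF refl], subst sum.swap) (simp add: sum_distrib_left mult_ac)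
      also have "\<dots> = (\<Sum>b\<in>UNIV. \<Sum>b'\<in>UNIV. w j b * \<alpha> b' p * of_bool (b = b'))"
        using uniD(4)[OF G(1)] by simp
      also have "\<dots> = (\<Sum>b\<in>UNIV. w j b * \<alpha> b p)" by (intro sum.cong refl) (subst of_bool_sum, auto)
      finally show ?thesis .
    qed
    then have "\<forall>j\<in>J. \<forall>p. (1 - \<zeta> p * \<tau> j) * v j p = (\<Sum>i\<in>UNIV. w' j i * \<alpha>' i p)"
      using v by simp
    then show "(\<Sum>j\<in>J. qn (\<lambda>p. \<zeta> p * v j p)) \<le> (\<Sum>j\<in>J. qn (v j))"
      using mp unfolding meas_pos_def by blast
  qed
qed

end

section \<open>Kernels and right multiplication\<close>

definition kpts :: "nat \<Rightarrow> (nat \<times> 'n::finite) set" where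
  "kpts m = {..<m} \<times> UNIV"

lemma sum_kpts: "(\<Sum>p\<in>kpts m. f p) = (\<Sum>i<m. \<Sum>a\<in>UNIV. f (i, a))"
  by (simp add: kpts_def sum.cartesian_product)

definition kker :: "(complex \<Rightarrow> complex \<Rightarrow> 'n::finite cmat) \<Rightarrow> (nat \<Rightarrow> complex) \<Rightarrow> nat \<times> 'n \<Rightarrow> nat \<times> 'n \<Rightarrow> complex" where
  "kker K z p p' = K (z (fst p)) (z (fst p')) $ snd p $ snd p'"

text \<open>Polarisation: diagonal terms are real, and the two-point test vectors with coefficients
  (1, 1) and (1, i) give the real and imaginary part of the claim.\<close>

lemma pos_kernel_hermitian:
  fixes K :: "complex \<Rightarrow> complex \<Rightarrow> 'n::finite cmat"
  assumes K: "pos_kernel K" and w: "w0 \<in> disk" "w1 \<in> disk"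
  shows "K w1 w0 $ b $ a = cnj (K w0 w1 $ a $ b)"
proof -
  have ax: "(\<Sum>c\<in>UNIV. f c * (if c = a then x else 0)) = f a * x" "(\<Sum>c\<in>UNIV. (if c = a then x else 0) * f c) = x * f a"
    for f :: "'n \<Rightarrow> complex" and x a
    by (simp_all add: if_distrib[of "(*) _"] if_distrib[of "\<lambda>x. x * _"] cong: if_cong)
  define V where "V a x = (\<chi> c::'n. (if c = a then x else (0::complex)))" for a x
  have sums: "(\<Sum>a'\<in>UNIV. \<Sum>b'\<in>UNIV. cnj (V a x $ a') * M $ a' $ b' * V b y $ b') = cnj x * M $ a $ b * y"
    for M :: "'n cmat" and a b x y
  proof -
    have "(\<Sum>a'\<in>UNIV. \<Sum>b'\<in>UNIV. cnj (V a x $ a') * M $ a' $ b' * V b y $ b')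
       = (\<Sum>a'\<in>UNIV. (\<Sum>b'\<in>UNIV. M $ a' $ b' * V b y $ b') * (if a' = a then cnj x else 0))"
      unfolding sum_distrib_right by (intro sum.cong refl) (simp add: V_def)
    then show ?thesis by (simp add: V_def ax)
  qed
  have one: "Im (K w w $ a $ a) = 0" if "w \<in> disk" for w a
    using K[unfolded pos_kernel_def, rule_format, of 1 "\<lambda>_. w" "\<lambda>_. V a 1"] that by (simp add: sums Let_def)
  have two: "Im (cnj x * K w0 w1 $ a $ b * y + cnj y * K w1 w0 $ b $ a * x) = 0" for x y
  proof -
    have diag: "Im (cnj x * K w w $ a $ a * x) = 0" if "w \<in> disk" for w a x
    proof -
      have "cnj x * K w w $ a $ a * x = of_real ((cmod x)\<^sup>2) * K w w $ a $ a"
        by (simp only: complex_norm_square mult_ac)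
      then show ?thesis using one[OF that] by simp
    qed
    define zz where "zz i = (if i = 0 then w0 else w1)" for i :: nat
    define vv where "vv i = (if i = 0 then V a x else V b y)" for i :: nat
    have "\<forall>i<2. zz i \<in> disk" using w by (simp add: zz_def)
    from K[unfolded pos_kernel_def, rule_format, of 2 zz vv] this
    have "Im (\<Sum>i<2. \<Sum>j<2. \<Sum>a'\<in>UNIV. \<Sum>b'\<in>UNIV. cnj (vv i $ a') * K (zz i) (zz j) $ a' $ b' * vv j $ b') = 0"
      by (simp add: Let_def)
    then show ?thesis using diag[OF w(1), of x a] diag[OF w(2), of y b]
      by (simp add: numeral_2_eq_2 zz_def vv_def sums)
  qed
  from two[of 1 1] two[of 1 \<i>] show ?thesis by (auto simp: complex_eq_iff)
qed

lemma hermitian_form_kker: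
  assumes "pos_kernel K" "\<And>i. z i \<in> disk"
  shows "hermitian_form (kpts m) (kker K z)"
proof
  show "finite (kpts m)" by (simp add: kpts_def)
  show "kker K z p' p = cnj (kker K z p p')" for p p'
    unfolding kker_def by (rule pos_kernel_hermitian) (use assms in auto)
qed

lemma qn_kker_nonneg:
  fixes K :: "complex \<Rightarrow> complex \<Rightarrow> 'n::finite cmat"
  assumes K: "pos_kernel K" and z: "\<And>i. z i \<in> disk"
  shows "hermitian_form.qn (kpts m) (kker K z) \<xi> \<ge> 0"
proof -
  interpret hermitian_form "kpts m" "kker K z" \<zeta> for \<zeta> by (rule hermitian_form_kker[OF K z])
  \<comment> \<open>\<open>pos_kernel\<close> conjugates the first argument, \<open>frm\<close> the
    second.\<close>
  define v where "v i = (\<chi> a. cnj (\<xi> (i, a)))" for i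
  have "frm \<xi> \<xi> = (\<Sum>i<m. \<Sum>a\<in>UNIV. \<Sum>j<m. \<Sum>b\<in>UNIV. cnj (v i $ a) * K (z i) (z j) $ a $ b * v j $ b)"
    unfolding frm_def by (simp add: sum_kpts kker_def v_def)
  also have "\<dots> = (\<Sum>i<m. \<Sum>j<m. \<Sum>a\<in>UNIV. \<Sum>b\<in>UNIV. cnj (v i $ a) * K (z i) (z j) $ a $ b * v j $ b)"
    by (rule sum.cong[OF refl]) (rule sum.swap)
  finally show ?thesis using K[unfolded pos_kernel_def, rule_format, of m z v] z by (simp add: qn_def Let_def)
qed

lemma sum_rotate4:
  "(\<Sum>i\<in>I. \<Sum>j\<in>J. \<Sum>a\<in>A. \<Sum>b\<in>B. f i j a b) = (\<Sum>b\<in>B. \<Sum>i\<in>I. \<Sum>j\<in>J. \<Sum>a\<in>A. f i j a b)"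
proof -
  have "(\<Sum>i\<in>I. \<Sum>j\<in>J. \<Sum>a\<in>A. \<Sum>b\<in>B. f i j a b) = (\<Sum>i\<in>I. \<Sum>j\<in>J. \<Sum>b\<in>B. \<Sum>a\<in>A. f i j a b)"
    by (intro sum.cong refl) (rule sum.swap)
  also have "\<dots> = (\<Sum>i\<in>I. \<Sum>b\<in>B. \<Sum>j\<in>J. \<Sum>a\<in>A. f i j a b)"
    by (intro sum.cong refl) (rule sum.swap)
  also have "\<dots> = (\<Sum>b\<in>B. \<Sum>i\<in>I. \<Sum>j\<in>J. \<Sum>a\<in>A. f i j a b)" by (rule sum.swap)
  finally show ?thesis .
qed

lemma trace_triple:
  fixes A :: "'n::finite cmat"
  shows "trace (A ** V ** cadj V') = (\<Sum>a\<in>UNIV. \<Sum>b\<in>UNIV. \<Sum>c\<in>UNIV. A $ a $ c * V $ c $ b * cnj (V' $ a $ b))"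
  by (simp add: trace_def matrix_matrix_mult_def cadj_def sum_distrib_right)

text \<open>The trace decouples over the columns of the coefficient matrices. Conjugated columns
  become the rows \<alpha> b, and right multiplication, which mixes columns, becomes the action of S
  on the index b.\<close>

lemma cross_gram:
  fixes K :: "complex \<Rightarrow> complex \<Rightarrow> 'n::finite cmat"
  assumes K: "pos_kernel K" and z: "\<And>i. z i \<in> disk"
  shows "(\<Sum>i<m. \<Sum>j<m. trace (K (z j) (z i) ** V i ** cadj (V' j)))
     = (\<Sum>b\<in>UNIV. hermitian_form.frm (kpts m) (kker K z) (\<lambda>(i,a). cnj (V' i $ a $ b)) (\<lambda>(i,a). cnj (V i $ a $ b)))"
proof -
  interpret hermitian_form "kpts m" "kker K z" \<zeta> for \<zeta> by (rule hermitian_form_kker[OF K z])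
  have f: "frm (\<lambda>(i,a). cnj (V' i $ a $ b)) (\<lambda>(i,a). cnj (V i $ a $ b))
     = (\<Sum>j<m. \<Sum>a\<in>UNIV. \<Sum>i<m. \<Sum>c\<in>UNIV. K (z j) (z i) $ a $ c * V i $ c $ b * cnj (V' j $ a $ b))" for b
    unfolding frm_def by (simp add: sum_kpts kker_def mult_ac)
  have "(\<Sum>i<m. \<Sum>j<m. trace (K (z j) (z i) ** V i ** cadj (V' j)))
    = (\<Sum>i<m. \<Sum>j<m. \<Sum>a\<in>UNIV. \<Sum>b\<in>UNIV. \<Sum>c\<in>UNIV. K (z j) (z i) $ a $ c * V i $ c $ b * cnj (V' j $ a $ b))"
    by (simp add: trace_triple)
  also have "\<dots> = (\<Sum>b\<in>UNIV. \<Sum>i<m. \<Sum>j<m. \<Sum>a\<in>UNIV. \<Sum>c\<in>UNIV. K (z j) (z i) $ a $ c * V i $ c $ b * cnj (V' j $ a $ b))"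
    by (rule sum_rotate4)
  also have "\<dots> = (\<Sum>b\<in>UNIV. \<Sum>j<m. \<Sum>a\<in>UNIV. \<Sum>i<m. \<Sum>c\<in>UNIV. K (z j) (z i) $ a $ c * V i $ c $ b * cnj (V' j $ a $ b))"
  proof (rule sum.cong[OF refl])
    fix b
    show "(\<Sum>i<m. \<Sum>j<m. \<Sum>a\<in>UNIV. \<Sum>c\<in>UNIV. K (z j) (z i) $ a $ c * V i $ c $ b * cnj (V' j $ a $ b))
      = (\<Sum>j<m. \<Sum>a\<in>UNIV. \<Sum>i<m. \<Sum>c\<in>UNIV. K (z j) (z i) $ a $ c * V i $ c $ b * cnj (V' j $ a $ b))"
      by (subst sum.swap) (intro sum.cong[OF refl], rule sum.swap)
  qed
  finally show ?thesis unfolding f .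
qed

lemma kgram_eq:
  fixes K :: "complex \<Rightarrow> complex \<Rightarrow> 'n::finite cmat"
  assumes K: "pos_kernel K" and z: "\<And>i. z i \<in> disk"
  shows "kgram K m z V = (\<Sum>b\<in>UNIV. of_real (hermitian_form.qn (kpts m) (kker K z) (\<lambda>(i,a). cnj (V i $ a $ b))))"
proof -
  interpret hermitian_form "kpts m" "kker K z" \<zeta> for \<zeta> by (rule hermitian_form_kker[OF K z])
  show ?thesis unfolding kgram_def cross_gram[OF K z] frm_self ..
qed

context hermitian_form
begin

text \<open>The classical argument, for the semidefinite form on tuples over
  \<open>B\<close>.\<close>

lemma cauchy_schwarz:
  assumes pos: "\<And>\<xi>. qn \<xi> \<ge> 0" and "finite B"
  shows "(cmod (\<Sum>b\<in>B. frm (\<alpha> b) (\<beta> b)))\<^sup>2 \<le> (\<Sum>b\<in>B. qn (\<alpha> b)) * (\<Sum>b\<in>B. qn (\<beta> b))"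
proof -
  define X where "X = (\<Sum>b\<in>B. frm (\<alpha> b) (\<beta> b))"
  define A where "A = (\<Sum>b\<in>B. qn (\<alpha> b))"
  define C where "C = (\<Sum>b\<in>B. qn (\<beta> b))"
  have C0: "C \<ge> 0" unfolding C_def by (rule sum_nonneg) (rule pos)
  have ex: "0 \<le> A - 2 * s * (cmod X)\<^sup>2 + s\<^sup>2 * (cmod X)\<^sup>2 * C" for s :: real
  proof -
    \<comment> \<open>The resulting quadratic in s is least at s = 1 / C. If C = 0 it is affine, and
      a large s forces X = 0.\<close>
    define t where "t = - of_real s * X"
    have "qn (\<lambda>p. \<alpha> b p + t * \<beta> b p) = qn (\<alpha> b) + 2 * Re (cnj t * frm (\<alpha> b) (\<beta> b)) + (cmod t)\<^sup>2 * qn (\<beta> b)" for b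
    proof -
      have "frm (\<alpha> b) (\<lambda>p. t * \<beta> b p) = cnj t * frm (\<alpha> b) (\<beta> b)"
        using frm_cmult[of 1 "\<alpha> b" t "\<beta> b"] by simp
      moreover have "frm (\<lambda>p. t * \<beta> b p) (\<alpha> b) = cnj (frm (\<alpha> b) (\<lambda>p. t * \<beta> b p))" by (rule frm_cnj)
      ultimately show ?thesis
        using qn_cmult[of t "\<beta> b"] by (simp add: qn_def frm_add1 frm_add2)
    qed
    then have "(\<Sum>b\<in>B. qn (\<lambda>p. \<alpha> b p + t * \<beta> b p)) = A + 2 * Re (cnj t * X) + (cmod t)\<^sup>2 * C"
      by (simp add: A_def C_def X_def sum.distrib sum_distrib_left)
    also have "cnj t * X = - of_real s * of_real ((cmod X)\<^sup>2)" unfolding t_def complex_norm_square by simp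
    also have "(cmod t)\<^sup>2 = s\<^sup>2 * (cmod X)\<^sup>2" by (simp add: t_def norm_mult power_mult_distrib)
    finally have "(\<Sum>b\<in>B. qn (\<lambda>p. \<alpha> b p + t * \<beta> b p)) = A - 2 * s * (cmod X)\<^sup>2 + s\<^sup>2 * (cmod X)\<^sup>2 * C" by simp
    then show ?thesis using sum_nonneg[of B "\<lambda>b. qn (\<lambda>p. \<alpha> b p + t * \<beta> b p)"] pos by simp
  qed
  have "(cmod X)\<^sup>2 \<le> A * C"
  proof (cases "C = 0")
    case True
    have "X = 0"
    proof (rule ccontr)
      assume "X \<noteq> 0"
      then have "2 * ((A + 1) / (cmod X)\<^sup>2) * (cmod X)\<^sup>2 = 2 * (A + 1)" by simp
      then show False using ex[of "(A + 1) / (cmod X)\<^sup>2"] ex[of 0] True by simp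
    qed
    then show ?thesis using True by simp
  next
    case False
    then have "C > 0" using C0 by simp
    then show ?thesis using ex[of "1 / C"] by (simp add: field_simps power2_eq_square)
  qed
  then show ?thesis by (simp add: X_def A_def C_def)
qed

end

text \<open>Both node lists are concatenated and the coefficients padded with zeros, so that the
  pairing becomes one value of a single form.\<close>

lemma kgram_cross_bound:
  fixes K :: "complex \<Rightarrow> complex \<Rightarrow> 'n::finite cmat"
  assumes K: "pos_kernel K" and z: "\<And>i. z i \<in> disk" "\<And>i. z' i \<in> disk"
  shows "(cmod (\<Sum>j<m'. trace ((\<Sum>i<m. K (z' j) (z i) ** V i) ** cadj (V' j))))\<^sup>2
     \<le> Re (kgram K m z V) * Re (kgram K m' z' V')"
proof -
  define zz where "zz i = (if i < m then z i else z' (i - m))" for i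
  define A where "A i = (if i < m then V i else 0)" for i
  define B where "B i = (if i < m then 0 else V' (i - m))" for i
  have zz: "zz i \<in> disk" for i using z by (simp add: zz_def)
  interpret hermitian_form "kpts (m + m')" "kker K zz" \<zeta> for \<zeta> by (rule hermitian_form_kker[OF K zz])
  have split: "(\<Sum>i<m + m'. f i) = (\<Sum>i<m. f i) + (\<Sum>i<m'. f (m + i))" for f :: "nat \<Rightarrow> complex"
    by (induction m') (simp_all add: add.assoc)
  have tz: "trace (0 :: 'n cmat) = 0" by (simp add: trace_def)
  have cz: "cadj (0 :: 'n cmat) = 0" by (simp add: cadj_def vec_eq_iff)
  have mz: "M ** (0 :: 'n cmat) = 0" "(0 :: 'n cmat) ** M = 0" for M by (simp_all add: matrix_matrix_mult_def vec_eq_iff)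
  have "(\<Sum>i<m + m'. \<Sum>j<m + m'. trace (K (zz j) (zz i) ** A i ** cadj (B j)))
      = (\<Sum>i<m. \<Sum>j<m'. trace (K (z' j) (z i) ** V i ** cadj (V' j)))"
    by (simp add: split A_def B_def zz_def cz mz tz)
  also have "\<dots> = (\<Sum>j<m'. trace ((\<Sum>i<m. K (z' j) (z i) ** V i) ** cadj (V' j)))"
  proof -
    have "trace ((\<Sum>i<m. M i) ** N) = (\<Sum>i<m. trace (M i ** N))" for M :: "nat \<Rightarrow> 'n cmat" and N
    proof (induction m)
      case (Suc m)
      have "trace ((P + Q) ** N) = trace (P ** N) + trace (Q ** N)" for P Q :: "'n cmat"
        by (simp add: trace_def matrix_matrix_mult_def distrib_right sum.distrib)
      then show ?case using Suc by simp
    qed (simp add: mz tz)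
    then show ?thesis by (subst sum.swap) simp
  qed
  finally have X: "(\<Sum>j<m'. trace ((\<Sum>i<m. K (z' j) (z i) ** V i) ** cadj (V' j)))
     = (\<Sum>b\<in>UNIV. frm (\<lambda>(i,a). cnj (B i $ a $ b)) (\<lambda>(i,a). cnj (A i $ a $ b)))"
    unfolding cross_gram[OF K zz] by simp
  have gA: "kgram K (m + m') zz A = kgram K m z V" 
    unfolding kgram_def by (simp add: split A_def zz_def cz mz tz)
  have gB: "kgram K (m + m') zz B = kgram K m' z' V'" 
    unfolding kgram_def by (simp add: split B_def zz_def cz mz tz)
  have "(cmod (\<Sum>b\<in>UNIV. frm (\<lambda>(i,a). cnj (B i $ a $ b)) (\<lambda>(i,a). cnj (A i $ a $ b))))\<^sup>2
     \<le> (\<Sum>b\<in>UNIV. qn (\<lambda>(i,a). cnj (B i $ a $ b))) * (\<Sum>b\<in>UNIV. qn (\<lambda>(i,a). cnj (A i $ a $ b)))"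
    by (rule cauchy_schwarz) (use qn_kker_nonneg[OF K zz] in auto)
  then show ?thesis unfolding X gA[symmetric] gB[symmetric] kgram_eq[OF K zz] by (simp add: mult.commute)
qed

lemma cadj_mult: "cadj (A ** B) = cadj B ** cadj A"
  by (simp add: cadj_def matrix_matrix_mult_def vec_eq_iff cnj_sum mult.commute)

lemma cadj_cadj [simp]: "cadj (cadj A) = A"
  by (simp add: cadj_def vec_eq_iff)

lemma kgram_cong: "(\<And>i. i < m \<Longrightarrow> z i = z' i) \<Longrightarrow> (\<And>i. i < m \<Longrightarrow> V i = V' i) \<Longrightarrow> kgram K m z V = kgram K m z' V'"
  unfolding kgram_def by (intro sum.cong) auto

lemma kgram_nonneg:
  assumes K: "pos_kernel K" and z: "\<And>i. z i \<in> disk"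
  shows "Re (kgram K m z V) \<ge> 0" "Im (kgram K m z V) = 0"
  unfolding kgram_eq[OF K z] using qn_kker_nonneg[OF K z] by (auto intro!: sum_nonneg)

text \<open>The adjoint of f -> f S sends K(.,w) V to K(.,w) V \<open>cadj (S w)\<close>; the
  right-hand side is contractivity of that adjoint on the span of the kernel functions.\<close>

lemma right_mult_contractive_iff_kgram:
  fixes K :: "complex \<Rightarrow> complex \<Rightarrow> 'n::finite cmat"
  assumes K: "pos_kernel K"
  shows "right_mult_contractive K S \<longleftrightarrow>
    (\<forall>m z V. (\<forall>i. z i \<in> disk) \<longrightarrow> Re (kgram K m z (\<lambda>i. V i ** cadj (S (z i)))) \<le> Re (kgram K m z V))"
proof
  assume R: "right_mult_contractive K S"
  show "\<forall>m z V. (\<forall>i. z i \<in> disk) \<longrightarrow> Re (kgram K m z (\<lambda>i. V i ** cadj (S (z i)))) \<le> Re (kgram K m z V)"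
  proof (intro allI impI)
    fix m z and V :: "nat \<Rightarrow> 'n cmat" assume "\<forall>i::nat. z i \<in> disk"
    then have z: "\<And>i. z i \<in> disk" by blast
    define V' where "V' i = V i ** cadj (S (z i))" for i
    \<comment> \<open>The image of the element with coefficients \<open>V\<close> under the adjoint,
      of squared norm \<open>g\<close>. Pairing f S with \<open>V\<close> returns \<open>g\<close>,
      so g^2 \<le> g times the Gram value of \<open>V\<close>.\<close>
    define f where "f w = (\<Sum>i<m. K w (z i) ** V' i)" for w
    define g where "g = Re (kgram K m z V')"
    have g0: "g \<ge> 0" unfolding g_def by (rule kgram_nonneg[OF K z])
    have "in_HK_ball K f (sqrt g)"
      unfolding in_HK_ball_def
    proof (intro conjI allI impI)
      fix m' and z' :: "nat \<Rightarrow> complex" and W :: "nat \<Rightarrow> 'n cmat"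
      assume z': "\<forall>i<m'. z' i \<in> disk"
      \<comment> \<open>The lemmas on the form want every node in the disk; nodes from m' on do not
        enter and are set to 0.\<close>
      define z2 where "z2 i = (if i < m' then z' i else 0)" for i
      have z2: "z2 i \<in> disk" for i using z' by (simp add: z2_def disk_def)
      have "(cmod (\<Sum>j<m'. trace ((\<Sum>i<m. K (z2 j) (z i) ** V' i) ** cadj (W j))))\<^sup>2 \<le> g * Re (kgram K m' z2 W)"
        unfolding g_def by (rule kgram_cross_bound[OF K z z2])
      moreover have "kgram K m' z2 W = kgram K m' z' W" by (rule kgram_cong) (auto simp: z2_def)
      ultimately show "(cmod (\<Sum>i<m'. trace (f (z' i) ** cadj (W i))))\<^sup>2 \<le> (sqrt g)\<^sup>2 * Re (kgram K m' z' W)"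
        using g0 by (simp add: f_def z2_def)
    qed (use g0 in auto)
    then have "in_HK_ball K (\<lambda>w. f w ** S w) (sqrt g)" using R unfolding right_mult_contractive_def by blast
    then have "(cmod (\<Sum>i<m. trace (f (z i) ** S (z i) ** cadj (V i))))\<^sup>2 \<le> (sqrt g)\<^sup>2 * Re (kgram K m z V)"
      unfolding in_HK_ball_def using z by blast
    moreover have "(\<Sum>i<m. trace (f (z i) ** S (z i) ** cadj (V i))) = kgram K m z V'"
    proof -
      have "f (z i) ** S (z i) ** cadj (V i) = f (z i) ** cadj (V' i)" for i
        by (simp add: V'_def cadj_mult matrix_mul_assoc)
      moreover have "trace ((\<Sum>i<m. M i) ** N) = (\<Sum>i<m. trace (M i ** N))" for M :: "nat \<Rightarrow> 'n cmat" and N and m :: nat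
      proof (induction m)
        case (Suc m)
        have "trace ((P + Q) ** N) = trace (P ** N) + trace (Q ** N)" for P Q :: "'n cmat"
          by (simp add: trace_def matrix_matrix_mult_def distrib_right sum.distrib)
        then show ?case using Suc by simp
      qed (simp add: trace_def matrix_matrix_mult_def)
      ultimately show ?thesis unfolding kgram_def f_def by (subst sum.swap) simp
    qed
    moreover have "kgram K m z V' = of_real g"
      using kgram_nonneg(2)[OF K z] by (simp add: g_def complex_eq_iff)
    ultimately have "g\<^sup>2 \<le> g * Re (kgram K m z V)" using g0 by simp
    then have "g \<le> Re (kgram K m z V)"
      using g0 kgram_nonneg(1)[where z = z and m = m and V = V, OF K z] by (cases "g = 0") (auto simp: power2_eq_square)
    then show "Re (kgram K m z (\<lambda>i. V i ** cadj (S (z i)))) \<le> Re (kgram K m z V)" by (simp add: g_def V'_def[abs_def])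
  qed
next
  assume R: "\<forall>m z V. (\<forall>i. z i \<in> disk) \<longrightarrow> Re (kgram K m z (\<lambda>i. V i ** cadj (S (z i)))) \<le> Re (kgram K m z V)"
  show "right_mult_contractive K S"
    unfolding right_mult_contractive_def
  proof (intro allI impI)
    fix f c assume f: "in_HK_ball K f c"
    show "in_HK_ball K (\<lambda>z. f z ** S z) c"
      unfolding in_HK_ball_def
    proof (intro conjI allI impI)
      show "0 \<le> c" using f by (simp add: in_HK_ball_def)
      fix m and z :: "nat \<Rightarrow> complex" and V :: "nat \<Rightarrow> 'n cmat"
      assume z: "\<forall>i<m. z i \<in> disk"
      have eq: "f (z i) ** S (z i) ** cadj (V i) = f (z i) ** cadj (V i ** cadj (S (z i)))" for i
        by (simp add: cadj_mult matrix_mul_assoc)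
      define z2 where "z2 i = (if i < m then z i else 0)" for i
      have z2: "\<forall>i. z2 i \<in> disk" using z by (simp add: z2_def disk_def)
      have e1: "kgram K m z2 V = kgram K m z V" by (rule kgram_cong) (auto simp: z2_def)
      have e2: "kgram K m z2 (\<lambda>i. V i ** cadj (S (z2 i))) = kgram K m z (\<lambda>i. V i ** cadj (S (z i)))"
        by (rule kgram_cong) (auto simp: z2_def)
      have "(cmod (\<Sum>i<m. trace (f (z i) ** S (z i) ** cadj (V i))))\<^sup>2 \<le> c\<^sup>2 * Re (kgram K m z (\<lambda>i. V i ** cadj (S (z i))))"
        unfolding eq by (rule f[unfolded in_HK_ball_def, THEN conjunct2, rule_format]) (use z in blast)
      also have "\<dots> \<le> c\<^sup>2 * Re (kgram K m z V)"
        using R[rule_format, of z2 m V] z2 e1 e2 by (intro mult_left_mono) simp_all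
      finally show "(cmod (\<Sum>i<m. trace (f (z i) ** S (z i) ** cadj (V i))))\<^sup>2 \<le> c\<^sup>2 * Re (kgram K m z V)" .
    qed
  qed
qed

text \<open>The form used from here on: tuples \<alpha> of rows and matrices \<open>V\<close> of
  coefficients correspond bijectively on the finitely many nodes.\<close>

lemma right_mult_contractive_iff:
  fixes K :: "complex \<Rightarrow> complex \<Rightarrow> 'n::finite cmat"
  assumes K: "pos_kernel K"
  shows "right_mult_contractive K S \<longleftrightarrow> (\<forall>m z. (\<forall>i. z i \<in> disk) \<longrightarrow> (\<forall>\<alpha>.
     (\<Sum>b\<in>UNIV. hermitian_form.qn (kpts m) (kker K z) (\<lambda>p. \<Sum>c\<in>UNIV. S (z (fst p)) $ b $ c * \<alpha> c p))
      \<le> (\<Sum>b\<in>UNIV. hermitian_form.qn (kpts m) (kker K z) (\<alpha> b))))"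
    (is "_ \<longleftrightarrow> ?R")
proof -
  have eq: "Re (kgram K m z (\<lambda>i. V i ** cadj (S (z i)))) = (\<Sum>b\<in>UNIV. hermitian_form.qn (kpts m) (kker K z) (\<lambda>p. \<Sum>c\<in>UNIV. S (z (fst p)) $ b $ c * \<alpha> c p))"
    "Re (kgram K m z V) = (\<Sum>b\<in>UNIV. hermitian_form.qn (kpts m) (kker K z) (\<alpha> b))"
    if z: "\<And>i. z i \<in> disk" and a: "\<And>b i a. \<alpha> b (i, a) = cnj (V i $ a $ b)" for m z V and \<alpha> :: "'n \<Rightarrow> nat \<times> 'n \<Rightarrow> complex"
  proof -
    have "\<alpha> b = (\<lambda>(i,a). cnj (V i $ a $ b))" for b using a by (auto simp: fun_eq_iff)
    then show "Re (kgram K m z V) = (\<Sum>b\<in>UNIV. hermitian_form.qn (kpts m) (kker K z) (\<alpha> b))"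
      unfolding kgram_eq[OF K z] by simp
    have "(\<lambda>p. \<Sum>c\<in>UNIV. S (z (fst p)) $ b $ c * \<alpha> c p) = (\<lambda>(i,a). cnj ((V i ** cadj (S (z i))) $ a $ b))" for b
      using a by (auto simp: fun_eq_iff matrix_matrix_mult_def cadj_def cnj_sum mult.commute)
    then show "Re (kgram K m z (\<lambda>i. V i ** cadj (S (z i)))) = (\<Sum>b\<in>UNIV. hermitian_form.qn (kpts m) (kker K z) (\<lambda>p. \<Sum>c\<in>UNIV. S (z (fst p)) $ b $ c * \<alpha> c p))"
      unfolding kgram_eq[OF K z] by simp
  qed
  show ?thesis unfolding right_mult_contractive_iff_kgram[OF K]
  proof (intro iffI allI impI)
    fix m z and \<alpha> :: "'n \<Rightarrow> nat \<times> 'n \<Rightarrow> complex"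
    assume R: "\<forall>m z V. (\<forall>i. z i \<in> disk) \<longrightarrow> Re (kgram K m z (\<lambda>i. V i ** cadj (S (z i)))) \<le> Re (kgram K m z V)"
      and z: "\<forall>i::nat. z i \<in> disk"
    define V where "V i = (\<chi> a b. cnj (\<alpha> b (i, a)))" for i
    have a: "\<alpha> b (i, a) = cnj (V i $ a $ b)" for b i a by (simp add: V_def)
    show "(\<Sum>b\<in>UNIV. hermitian_form.qn (kpts m) (kker K z) (\<lambda>p. \<Sum>c\<in>UNIV. S (z (fst p)) $ b $ c * \<alpha> c p))
      \<le> (\<Sum>b\<in>UNIV. hermitian_form.qn (kpts m) (kker K z) (\<alpha> b))"
      unfolding eq[of z \<alpha> V m, OF z[rule_format] a, symmetric] by (rule R[rule_format]) (use z in blast)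
  next
    fix m z and V :: "nat \<Rightarrow> 'n cmat"
    assume R: ?R and z: "\<forall>i::nat. z i \<in> disk"
    define \<alpha> where "\<alpha> b p = cnj (V (fst p) $ snd p $ b)" for b p
    have a: "\<alpha> b (i, a) = cnj (V i $ a $ b)" for b i a by (simp add: \<alpha>_def)
    show "Re (kgram K m z (\<lambda>i. V i ** cadj (S (z i)))) \<le> Re (kgram K m z V)"
      unfolding eq[of z \<alpha> V m, OF z[rule_format] a] by (rule R[rule_format]) (use z in blast)
  qed
qed

section \<open>Test functions and discrete measures\<close>

lemma re_qform: "Re (qform A v) = v \<bullet> (A *v v)"
proof -
  have "Re (qform A v) = (\<Sum>i\<in>UNIV. Re (cnj (v $ i) * (\<Sum>j\<in>UNIV. A $ i $ j * v $ j)))"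
    by (simp add: qform_def sum_distrib_left mult.assoc)
  also have "\<dots> = v \<bullet> (A *v v)"
    by (simp add: inner_vec_def inner_complex_def matrix_vector_mult_def)
  finally show ?thesis .
qed

lemma hermitian_inner:
  assumes "hermitian A"
  shows "(A *v x) \<bullet> y = x \<bullet> (A *v y)"
proof -
  have h: "A $ i $ j = cnj (A $ j $ i)" for i j
    using assms unfolding hermitian_def cadj_def by (metis vec_lambda_beta)
  have r: "x \<bullet> y = Re (\<Sum>i\<in>UNIV. cnj (x $ i) * y $ i)" for x y :: "complex^'n"
    by (simp add: inner_vec_def inner_complex_def)
  have "(\<Sum>i\<in>UNIV. cnj ((A *v x) $ i) * y $ i) = (\<Sum>i\<in>UNIV. \<Sum>j\<in>UNIV. cnj (A $ i $ j) * cnj (x $ j) * y $ i)"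
    by (simp add: matrix_vector_mult_def cnj_sum sum_distrib_right)
  also have "\<dots> = (\<Sum>j\<in>UNIV. \<Sum>i\<in>UNIV. cnj (A $ i $ j) * cnj (x $ j) * y $ i)" by (rule sum.swap)
  also have "\<dots> = (\<Sum>j\<in>UNIV. cnj (x $ j) * (A *v y) $ j)"
    by (simp add: matrix_vector_mult_def sum_distrib_left h[symmetric] mult_ac)
  finally show ?thesis by (simp add: r)
qed

lemma hermitian_im_qform:
  assumes "hermitian A"
  shows "Im (qform A v) = 0"
proof -
  have h: "cnj (A $ i $ j) = A $ j $ i" for i j
    using assms unfolding hermitian_def cadj_def by (metis vec_lambda_beta)
  have "cnj (qform A v) = (\<Sum>i\<in>UNIV. \<Sum>j\<in>UNIV. cnj (v $ j) * A $ j $ i * v $ i)"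
    by (simp add: qform_def cnj_sum h mult_ac)
  also have "\<dots> = qform A v" unfolding qform_def by (rule sum.swap)
  finally show ?thesis by (simp add: complex_eq_iff)
qed

lemma psd_iff: "psd A \<longleftrightarrow> hermitian A \<and> (\<forall>v. 0 \<le> v \<bullet> (A *v v))"
  unfolding psd_def by (auto simp: hermitian_im_qform re_qform)

lemma hermitian_add_scaleR:
  assumes "hermitian A" "hermitian B"
  shows "hermitian (A + c *\<^sub>R B)"
proof -
  have "cadj (A + c *\<^sub>R B) = cadj A + c *\<^sub>R cadj B"
    by (simp add: cadj_def vec_eq_iff)
  then show ?thesis using assms by (simp add: hermitian_def)
qed

lemma matrix_vector_mult_scaleR: "(c *\<^sub>R A) *v x = c *\<^sub>R (A *v x)" for A :: "complex^'n^'m"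
  by (simp add: matrix_vector_mult_def vec_eq_iff scaleR_sum_right)

text \<open>On the range of \<open>W\<close> the form of \<open>W\<close> is bounded below by a
  multiple of the squared norm, by compactness of the unit sphere, and absorbs small multiples of
  \<open>T\<close>. On the orthogonal complement of the range both matrices vanish.\<close>

lemma psd_perturb:
  fixes W T :: "'n::finite cmat"
  assumes W: "psd W" and T: "hermitian T" and ran: "mran T \<subseteq> mran W"
  shows "\<exists>\<epsilon>>0. \<forall>\<delta>. \<bar>\<delta>\<bar> \<le> \<epsilon> \<longrightarrow> psd (W + \<delta> *\<^sub>R T)"
proof -
  have Wh: "hermitian W" and Wp: "\<And>v. 0 \<le> v \<bullet> (W *v v)" using W by (auto simp: psd_iff)
  have bl: "bounded_linear (\<lambda>v. A *v v)" for A :: "'n cmat"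
    by (rule linear_conv_bounded_linear[THEN iffD1], rule linearI)
      (simp_all add: matrix_vector_mult_def vec_eq_iff distrib_left sum.distrib scaleR_sum_right)
  have lin: "linear (\<lambda>v. A *v v)" for A :: "'n cmat" using bl bounded_linear.linear by blast
  define S where "S = mran W"
  have S: "subspace S" unfolding S_def mran_def by (rule linear_subspace_image[OF lin subspace_UNIV])
  have ker: "A *v k = 0" if "hermitian A" "mran A \<subseteq> S" "\<And>y. y \<in> S \<Longrightarrow> k \<bullet> y = 0" for A k
  proof -
    have "(A *v k) \<bullet> (A *v k) = k \<bullet> (A *v (A *v k))" by (rule hermitian_inner[OF that(1)])
    also have "\<dots> = 0" by (rule that(3)) (use that(2) in \<open>auto simp: mran_def\<close>)
    finally show ?thesis by simp
  qed
  have red: "x \<bullet> (A *v x) = u \<bullet> (A *v u)" 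
    if "hermitian A" "mran A \<subseteq> S" "x = u + k" "\<And>y. y \<in> S \<Longrightarrow> k \<bullet> y = 0" for A x u k
  proof -
    have "A *v x = A *v u" using ker[OF that(1,2,4)] that(3) linear_add[OF lin[of A]] by simp
    moreover have "k \<bullet> (A *v u) = 0" by (rule that(4)) (use that(2) in \<open>auto simp: mran_def\<close>)
    ultimately show ?thesis using that(3) by (simp add: inner_add_left)
  qed
  have cont: "continuous_on X (\<lambda>v. v \<bullet> (A *v v))" for A :: "'n cmat" and X
    by (intro continuous_intros bounded_linear.continuous_on[OF bl])
  have pos: "0 < u \<bullet> (W *v u)" if u: "u \<in> S" "u \<noteq> 0" for u
  proof (rule ccontr)
    \<comment> \<open>A zero of a nonnegative form lies in its kernel: the first variation in every
      direction \<open>y\<close> must vanish.\<close>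
    assume "\<not> 0 < u \<bullet> (W *v u)"
    then have z: "u \<bullet> (W *v u) = 0" using Wp[of u] by simp
    have "(W *v u) \<bullet> y = 0" for y
    proof -
      have e: "0 \<le> 2 * s * ((W *v u) \<bullet> y) + s * s * (y \<bullet> (W *v y))" for s :: real
      proof -
        have "(u + s *\<^sub>R y) \<bullet> (W *v (u + s *\<^sub>R y)) = 2 * s * ((W *v u) \<bullet> y) + s * s * (y \<bullet> (W *v y))"
          using z hermitian_inner[OF Wh, of u y] hermitian_inner[OF Wh, of y u]
          by (simp add: linear_add[OF lin] linear_scale[OF lin] inner_add_left inner_add_right inner_commute algebra_simps)
        then show ?thesis using Wp[of "u + s *\<^sub>R y"] by simp
      qed
      define A where "A = (W *v u) \<bullet> y"
      define C where "C = y \<bullet> (W *v y)"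
      have C: "C \<ge> 0" using Wp by (simp add: C_def)
      have "A = 0"
      proof (rule ccontr)
        assume "A \<noteq> 0"
        \<comment> \<open>Near the minimiser; adding 1 to \<open>C\<close> avoids division by zero,
          and s = -d gives the negative value - d^2 (C + 2).\<close>
        define d where "d = A / (C + 1)"
        have Ad: "A = d * (C + 1)" using C by (simp add: d_def)
        have "0 \<le> 2 * (- d) * A + (- d) * (- d) * C"
          using e[of "- d"] by (simp add: A_def C_def)
        also have "\<dots> = - (d * d * (C + 2))" unfolding Ad by (simp add: algebra_simps)
        finally have "d * d * (C + 2) \<le> 0" by simp
        moreover have "d * d > 0" using \<open>A \<noteq> 0\<close> Ad by (auto simp: zero_less_mult_iff linorder_neq_iff)
        ultimately show False using C mult_pos_pos[of "d * d" "C + 2"] by linarith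
      qed
      then show ?thesis by (simp add: A_def)
    qed
    then have Wu: "W *v u = 0" by (metis inner_eq_zero_iff)
    obtain y where "u = W *v y" using u(1) by (auto simp: S_def mran_def)
    then have "u \<bullet> u = y \<bullet> (W *v u)" using hermitian_inner[OF Wh, of y u] by simp
    then show False using Wu u(2) by simp
  qed
  obtain B where B: "B \<ge> 0" "\<And>v. norm (T *v v) \<le> norm v * B"
    using bounded_linear.nonneg_bounded[OF bl[of T]] by auto
  have tb: "\<bar>u \<bullet> (T *v u)\<bar> \<le> B * (norm u)\<^sup>2" for u
  proof -
    have "\<bar>u \<bullet> (T *v u)\<bar> \<le> norm u * norm (T *v u)" by (rule Cauchy_Schwarz_ineq2)
    also have "\<dots> \<le> norm u * (norm u * B)" by (intro mult_left_mono B) auto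
    finally show ?thesis by (simp add: power2_eq_square mult_ac)
  qed
  obtain c where c: "c > 0" "\<And>u. u \<in> S \<Longrightarrow> c * (norm u)\<^sup>2 \<le> u \<bullet> (W *v u)"
  proof (cases "S \<inter> sphere 0 1 = {}")
    case True
    have z0: "u = 0" if "u \<in> S" for u
    proof (rule ccontr)
      assume "u \<noteq> 0"
      then have "(1 / norm u) *\<^sub>R u \<in> S \<inter> sphere 0 1" using that S by (auto simp: subspace_scale)
      then show False using True by blast
    qed
    show ?thesis by (rule that[of 1]) (auto dest: z0)
  next
    case False
    have "compact (S \<inter> sphere 0 1)" by (intro closed_Int_compact closed_subspace S) auto
    from continuous_attains_inf[OF this False cont[of _ W]] obtain u0 where
      u0: "u0 \<in> S \<inter> sphere 0 1" "\<And>u. u \<in> S \<inter> sphere 0 1 \<Longrightarrow> u0 \<bullet> (W *v u0) \<le> u \<bullet> (W *v u)" by blast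
    show ?thesis
    proof (rule that)
      show "u0 \<bullet> (W *v u0) > 0" by (rule pos) (use u0(1) in auto)
      fix u assume u: "u \<in> S"
      show "(u0 \<bullet> (W *v u0)) * (norm u)\<^sup>2 \<le> u \<bullet> (W *v u)"
      proof (cases "u = 0")
        case nz: False
        let ?u = "(1 / norm u) *\<^sub>R u"
        have "?u \<in> S \<inter> sphere 0 1" using u nz S by (auto simp: subspace_scale)
        from u0(2)[OF this] have "u0 \<bullet> (W *v u0) \<le> (1 / norm u) * (1 / norm u) * (u \<bullet> (W *v u))"
          by (simp add: linear_scale[OF lin])
        then show ?thesis using nz by (simp add: field_simps power2_eq_square)
      qed simp
    qed
  qed
  show ?thesis
  proof (intro exI[of _ "c / (B + 1)"] conjI allI impI)
    show "c / (B + 1) > 0" using c B by simp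
    fix \<delta> assume d: "\<bar>\<delta>\<bar> \<le> c / (B + 1)"
    have dB: "\<bar>\<delta>\<bar> * B \<le> c"
    proof -
      have "\<bar>\<delta>\<bar> * B \<le> \<bar>\<delta>\<bar> * (B + 1)" by (intro mult_left_mono) auto
      also have "\<dots> \<le> c" using d B(1) by (simp add: field_simps)
      finally show ?thesis .
    qed
    have "0 \<le> x \<bullet> ((W + \<delta> *\<^sub>R T) *v x)" for x
    proof -
      obtain u k where uk: "u \<in> span S" "\<And>y. y \<in> span S \<Longrightarrow> orthogonal k y" "x = u + k"
        using orthogonal_subspace_decomp_exists[of S x] by blast
      have u: "u \<in> S" and k: "\<And>y. y \<in> S \<Longrightarrow> k \<bullet> y = 0"
        using uk S by (auto simp: orthogonal_def span_eq_iff[THEN iffD2])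
      have e1: "x \<bullet> ((W + \<delta> *\<^sub>R T) *v x) = x \<bullet> (W *v x) + \<delta> * (x \<bullet> (T *v x))"
        by (simp add: matrix_vector_mult_add_rdistrib matrix_vector_mult_scaleR inner_add_right)
      have e2: "x \<bullet> (W *v x) + \<delta> * (x \<bullet> (T *v x)) = u \<bullet> (W *v u) + \<delta> * (u \<bullet> (T *v u))"
        using red[OF Wh _ uk(3) k] red[OF T _ uk(3) k] ran by (simp add: S_def)
      have "\<delta> * (u \<bullet> (T *v u)) \<ge> - (c * (norm u)\<^sup>2)"
      proof -
        have "\<bar>\<delta> * (u \<bullet> (T *v u))\<bar> \<le> \<bar>\<delta>\<bar> * (B * (norm u)\<^sup>2)" unfolding abs_mult by (intro mult_left_mono tb) auto
        also have "\<dots> \<le> c * (norm u)\<^sup>2" using mult_right_mono[OF dB, of "(norm u)\<^sup>2"] by (simp add: mult.assoc)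
        finally show ?thesis by linarith
      qed
      then show ?thesis using c(2)[OF u] unfolding e1 e2 by linarith
    qed
    then show "psd (W + \<delta> *\<^sub>R T)" unfolding psd_iff using hermitian_add_scaleR[OF Wh T] by blast
  qed
qed

section \<open>Herglotz forms and the Cayley transform\<close>

context hermitian_form
begin

text \<open>Re <F \<alpha>, \<alpha>>, where \<open>F p\<close> acts on the tuple at the point
  \<open>p\<close>. It is real-linear in F, which gives access to convexity and to limits.\<close>

definition herg :: "('p \<Rightarrow> 'n \<Rightarrow> 'n \<Rightarrow> complex) \<Rightarrow> ('n::finite \<Rightarrow> 'p \<Rightarrow> complex) \<Rightarrow> real" where
  "herg F \<alpha> = (\<Sum>b\<in>UNIV. Re (frm (\<lambda>p. \<Sum>c\<in>UNIV. F p b c * \<alpha> c p) (\<alpha> b)))"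

lemma frm_sum1: "frm (\<lambda>p. \<Sum>j\<in>J. c j * a j p) \<eta> = (\<Sum>j\<in>J. c j * frm (a j) \<eta>)"
  using frm_sum[where J = J and c = c and a = a and K = "{()}" and d = "\<lambda>_. 1" and b = "\<lambda>_. \<eta>"] by simp

lemma frm_sum2: "frm \<xi> (\<lambda>p. \<Sum>j\<in>J. c j * a j p) = (\<Sum>j\<in>J. cnj (c j) * frm \<xi> (a j))"
  using frm_sum[where K = J and d = c and b = a and J = "{()}" and c = "\<lambda>_. 1" and a = "\<lambda>_. \<xi>"] by simp

text \<open>With u = \<zeta> \<tau> v and |\<tau>| = 1, the difference at one atom is Re <v + u, v -
  u>. Here v - u = w \<alpha>, and v + u is w \<alpha> times the Herglotz kernel.\<close>

lemma herg_meas: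
  assumes z: "\<And>p. cmod (\<zeta> p) < 1" and t: "\<And>j. j \<in> J \<Longrightarrow> cmod (\<tau> j) = 1" and fin: "finite J"
    and v: "\<And>j p. j \<in> J \<Longrightarrow> (1 - \<zeta> p * \<tau> j) * v j p = (\<Sum>b\<in>UNIV. w j b * \<alpha> b p)"
  shows "(\<Sum>j\<in>J. qn (v j)) - (\<Sum>j\<in>J. qn (\<lambda>p. \<zeta> p * v j p))
    = herg (\<lambda>p b c. \<Sum>j\<in>J. cnj (w j b) * w j c * ((1 + \<zeta> p * \<tau> j) / (1 - \<zeta> p * \<tau> j))) \<alpha>"
proof -
  define g where "g p j = (1 + \<zeta> p * \<tau> j) / (1 - \<zeta> p * \<tau> j)" for p j
  have nz: "1 - \<zeta> p * \<tau> j \<noteq> 0" if "j \<in> J" for p j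
  proof
    assume "1 - \<zeta> p * \<tau> j = 0"
    then have "cmod (\<zeta> p * \<tau> j) = 1" by simp
    then show False using z[of p] t[OF that] by (simp add: norm_mult)
  qed
  have "qn (v j) - qn (\<lambda>p. \<zeta> p * v j p) = (\<Sum>b\<in>UNIV. Re (frm (\<lambda>p. \<Sum>c\<in>UNIV. cnj (w j b) * w j c * g p j * \<alpha> c p) (\<alpha> b)))" if j: "j \<in> J" for j
  proof -
    define u where "u p = \<zeta> p * \<tau> j * v j p" for p
    have qu: "qn u = qn (\<lambda>p. \<zeta> p * v j p)"
    proof -
      have "u = (\<lambda>p. \<tau> j * (\<zeta> p * v j p))" by (simp add: u_def fun_eq_iff mult_ac)
      then show ?thesis using t[OF j] by (simp add: qn_cmult)
    qed
    have "qn (v j) - qn u = Re (frm (\<lambda>p. v j p + u p) (\<lambda>p. v j p - u p))"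
      using frm_cnj[of "v j" u] by (simp add: qn_def frm_add1 frm_diff2)
    also have "(\<lambda>p. v j p - u p) = (\<lambda>p. \<Sum>b\<in>UNIV. w j b * \<alpha> b p)"
      using v[OF j] by (simp add: u_def fun_eq_iff left_diff_distrib)
    also have "(\<lambda>p. v j p + u p) = (\<lambda>p. \<Sum>c\<in>UNIV. w j c * (g p j * \<alpha> c p))"
    proof
      fix p
      have vj: "v j p = (\<Sum>c\<in>UNIV. w j c * \<alpha> c p) / (1 - \<zeta> p * \<tau> j)"
        using v[OF j, of p] nz[OF j, of p] by (simp add: field_simps)
      have "v j p + u p = (1 + \<zeta> p * \<tau> j) * v j p" by (simp add: u_def distrib_right)
      also have "\<dots> = g p j * (\<Sum>c\<in>UNIV. w j c * \<alpha> c p)" unfolding vj by (simp add: g_def)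
      also have "\<dots> = (\<Sum>c\<in>UNIV. w j c * (g p j * \<alpha> c p))" unfolding sum_distrib_left by (simp only: mult_ac)
      finally show "v j p + u p = (\<Sum>c\<in>UNIV. w j c * (g p j * \<alpha> c p))" .
    qed
    also have "Re (frm (\<lambda>p. \<Sum>c\<in>UNIV. w j c * (g p j * \<alpha> c p)) (\<lambda>p. \<Sum>b\<in>UNIV. w j b * \<alpha> b p))
       = (\<Sum>b\<in>UNIV. Re (frm (\<lambda>p. cnj (w j b) * (\<Sum>c\<in>UNIV. w j c * (g p j * \<alpha> c p))) (\<alpha> b)))"
    proof -
      have "cnj d * frm \<xi> \<eta> = frm (\<lambda>p. cnj d * \<xi> p) \<eta>" for d \<xi> \<eta> using frm_cmult[of "cnj d" \<xi> 1 \<eta>] by simp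
      then show ?thesis unfolding frm_sum2 by simp
    qed
    also have "\<dots> = (\<Sum>b\<in>UNIV. Re (frm (\<lambda>p. \<Sum>c\<in>UNIV. cnj (w j b) * w j c * g p j * \<alpha> c p) (\<alpha> b)))"
      by (simp add: sum_distrib_left mult_ac)
    finally show ?thesis unfolding qu .
  qed
  then have "(\<Sum>j\<in>J. qn (v j)) - (\<Sum>j\<in>J. qn (\<lambda>p. \<zeta> p * v j p))
     = (\<Sum>j\<in>J. \<Sum>b\<in>UNIV. Re (frm (\<lambda>p. \<Sum>c\<in>UNIV. cnj (w j b) * w j c * g p j * \<alpha> c p) (\<alpha> b)))"
    by (simp add: sum_subtractf[symmetric])
  also have "\<dots> = (\<Sum>b\<in>UNIV. Re (\<Sum>j\<in>J. frm (\<lambda>p. \<Sum>c\<in>UNIV. cnj (w j b) * w j c * g p j * \<alpha> c p) (\<alpha> b)))"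
    by (subst sum.swap) simp
  also have "\<dots> = herg (\<lambda>p b c. \<Sum>j\<in>J. cnj (w j b) * w j c * g p j) \<alpha>"
    unfolding herg_def
  proof (intro sum.cong refl arg_cong[of _ _ Re])
    fix b :: 'b
    have "(\<Sum>j\<in>J. frm (\<lambda>p. \<Sum>c\<in>UNIV. cnj (w j b) * w j c * g p j * \<alpha> c p) (\<alpha> b))
       = frm (\<lambda>p. \<Sum>j\<in>J. 1 * (\<Sum>c\<in>UNIV. cnj (w j b) * w j c * g p j * \<alpha> c p)) (\<alpha> b)"
      unfolding frm_sum1 by simp
    also have "\<dots> = frm (\<lambda>p. \<Sum>c\<in>UNIV. (\<Sum>j\<in>J. cnj (w j b) * w j c * g p j) * \<alpha> c p) (\<alpha> b)"
      by (rule frm_cong) (simp_all add: sum_distrib_right, rule sum.swap)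
    finally show "(\<Sum>j\<in>J. frm (\<lambda>p. \<Sum>c\<in>UNIV. cnj (w j b) * w j c * g p j * \<alpha> c p) (\<alpha> b))
       = frm (\<lambda>p. \<Sum>c\<in>UNIV. (\<Sum>j\<in>J. cnj (w j b) * w j c * g p j) * \<alpha> c p) (\<alpha> b)" .
  qed
  finally show ?thesis by (simp add: g_def)
qed

text \<open>S maps \<alpha> + F \<alpha> to F \<alpha> - \<alpha>, and the squares of these two
  differ by 4 Re <F \<alpha>, \<alpha>>.\<close>

lemma herg_contractive:
  assumes rel: "\<And>p b. (\<Sum>c\<in>UNIV. S p b c * (\<alpha> c p + (\<Sum>d\<in>UNIV. F p c d * \<alpha> d p))) = (\<Sum>d\<in>UNIV. F p b d * \<alpha> d p) - \<alpha> b p"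
    and con: "\<And>\<beta>. (\<Sum>b\<in>UNIV. qn (\<lambda>p. \<Sum>c\<in>UNIV. S p b c * \<beta> c p)) \<le> (\<Sum>b\<in>UNIV. qn (\<beta> b))"
  shows "herg F \<alpha> \<ge> 0"
proof -
  define f where "f b p = (\<Sum>d\<in>UNIV. F p b d * \<alpha> d p)" for b p
  have q: "qn (\<lambda>p. \<alpha> b p + f b p) - qn (\<lambda>p. f b p - \<alpha> b p) = 4 * Re (frm (f b) (\<alpha> b))" for b
    using frm_cnj[of "\<alpha> b" "f b"] by (simp add: qn_def frm_add1 frm_add2 frm_diff1 frm_diff2)
  have "(\<Sum>b\<in>UNIV. qn (\<lambda>p. f b p - \<alpha> b p)) \<le> (\<Sum>b\<in>UNIV. qn (\<lambda>p. \<alpha> b p + f b p))"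
    using con[of "\<lambda>b p. \<alpha> b p + f b p"] rel by (simp add: f_def)
  then have "0 \<le> (\<Sum>b\<in>UNIV. qn (\<lambda>p. \<alpha> b p + f b p) - qn (\<lambda>p. f b p - \<alpha> b p))" by (simp add: sum_subtractf)
  then have "0 \<le> 4 * (\<Sum>b\<in>UNIV. Re (frm (f b) (\<alpha> b)))" unfolding q by (simp add: sum_distrib_left)
  then show ?thesis by (simp add: herg_def f_def[abs_def])
qed

end

lemma cscale_nth [simp]: "(c *\<^sub>m A) $ i $ j = c * A $ i $ j"
  by (simp add: cscale_def)

lemma matrix_distribs:
  fixes A B C :: "'n::finite cmat"
  shows "(A + B) ** C = A ** C + B ** C" "(A - B) ** C = A ** C - B ** C" "A ** (B - C) = A ** B - A ** C"
  by (simp_all add: matrix_matrix_mult_def vec_eq_iff algebra_simps sum.distrib sum_subtractf)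

lemma herglotz_re_pos:
  assumes t: "cmod t = 1" and z: "z \<in> disk"
  shows "Re ((t + z) / (t - z)) > 0"
proof -
  have ne: "t - z \<noteq> 0" using t z by (auto simp: disk_def)
  have "Re ((t + z) / (t - z)) = Re ((t + z) * cnj (t - z)) / (cmod (t - z))\<^sup>2"
    by (subst complex_div_cnj) (simp flip: of_real_power)
  also have "Re ((t + z) * cnj (t - z)) = (cmod t)\<^sup>2 - (cmod z)\<^sup>2"
    unfolding cmod_power2 by (simp add: power2_eq_square algebra_simps)
  finally show ?thesis using ne t z by (simp add: disk_def power_less_one_iff abs_square_less_1)
qed

text \<open>The real part of F is nonnegative, so a vector in the kernel of F + I has nonpositive
  squared norm.\<close>

lemma Ffun_plus_one_invertible:
  fixes W :: "nat \<Rightarrow> 'n::finite cmat"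
  assumes t: "\<And>r. r < n \<Longrightarrow> cmod (t r) = 1" and W: "\<And>r. r < n \<Longrightarrow> psd (W r)" and z: "z \<in> disk"
  shows "invertible (Ffun n t W z + mat 1)"
proof -
  have "u = 0" if u: "(Ffun n t W z + mat 1) *v u = 0" for u
  proof -
    have "u \<bullet> ((g *\<^sub>m A) *v u) = Re g * (u \<bullet> (A *v u))" if "psd A" for g and A :: "'n cmat"
    proof -
      have "qform (g *\<^sub>m A) u = g * qform A u" by (simp add: qform_def sum_distrib_left mult_ac)
      then show ?thesis using that by (simp add: psd_def flip: re_qform)
    qed
    then have "u \<bullet> (((t r + z) / (t r - z)) *\<^sub>m W r *v u) \<ge> 0" if "r < n" for r
      using herglotz_re_pos[OF t[OF that] z] W[OF that] that by (simp add: psd_iff)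
    moreover have "u \<bullet> ((\<Sum>r<k. A r) *v u) = (\<Sum>r<k. u \<bullet> (A r *v u))" for A :: "nat \<Rightarrow> 'n cmat" and k
      by (induction k) (simp_all add: matrix_vector_mult_add_rdistrib inner_add_right)
    ultimately have "u \<bullet> (Ffun n t W z *v u) \<ge> 0" unfolding Ffun_def by (auto intro!: sum_nonneg)
    moreover have "u \<bullet> ((Ffun n t W z + mat 1) *v u) = 0" using u by simp
    ultimately have "u \<bullet> u \<le> 0" by (simp add: matrix_vector_mult_add_rdistrib inner_add_right)
    then have "u \<bullet> u = 0" using inner_ge_zero[of u] by linarith
    then show "u = 0" by simp
  qed
  then show ?thesis
    using matrix_left_invertible_ker[of "Ffun n t W z + mat 1"] invertible_left_inverse by blast
qed

lemma Sfun_relation: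
  fixes W :: "nat \<Rightarrow> 'n::finite cmat"
  assumes inv: "invertible (Ffun n t W z + mat 1)"
  shows "Sfun n t W z ** (Ffun n t W z + mat 1) = Ffun n t W z - mat 1"
proof -
  define F where "F = Ffun n t W z"
  have com: "(F - mat 1) ** (F + mat 1) = (F + mat 1) ** (F - mat 1)"
    by (simp add: matrix_add_ldistrib matrix_distribs)
  have "matrix_inv (F + mat 1) ** (F + mat 1) = mat 1" using inv unfolding F_def[symmetric] invertible_def matrix_inv_def by (rule someI2_ex) blast
  then show ?thesis unfolding Sfun_def F_def[symmetric] matrix_mul_assoc[symmetric] com
    by (simp add: matrix_mul_assoc)
qed

section \<open>Extreme points of the set of weights at fixed nodes\<close>

lemma infinite_unit_circle: "infinite {t :: complex. cmod t = 1}"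
proof
  assume "finite {t :: complex. cmod t = 1}"
  then have "finite (Re ` {t. cmod t = 1})" by simp
  moreover have "{0..1::real} \<subseteq> Re ` {t. cmod t = 1}"
  proof
    fix x :: real assume x: "x \<in> {0..1}"
    then have "x\<^sup>2 \<le> 1" by (simp add: power_le_one)
    then have "cmod (Complex x (sqrt (1 - x\<^sup>2))) = 1" by (simp add: cmod_def)
    then show "x \<in> Re ` {t. cmod t = 1}" by (intro image_eqI[of _ _ "Complex x (sqrt (1 - x\<^sup>2))"]) auto
  qed
  ultimately have "finite {0..1::real}" by (rule finite_subset[rotated])
  then show False using infinite_Icc[of "0::real" 1] by simp
qed

lemma closed_psd: "closed {A :: 'n::finite cmat. psd A}"
proof -
  have "{A :: 'n cmat. psd A} = (\<Inter>i. \<Inter>j. {A. cnj (A $ j $ i) = A $ i $ j}) \<inter> (\<Inter>v. {A. 0 \<le> Re (qform A v)})"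
    by (auto simp: psd_iff re_qform hermitian_def cadj_def vec_eq_iff)
  moreover have "closed \<dots>"
    unfolding qform_def by (intro closed_Int closed_INT ballI closed_Collect_eq closed_Collect_le continuous_intros)
  ultimately show ?thesis by simp
qed

text \<open>Gives boundedness for Krein-Milman. The test vector e_a + c e_b, where \<open>c\<close>
  rotates the entry to minus its modulus, shows that twice the modulus is at most the sum of the two
  diagonal entries.\<close>

lemma psd_entry_bound:
  fixes A :: "'n::finite cmat"
  assumes A: "psd A" and d: "\<And>a. Re (A $ a $ a) \<le> 1"
  shows "cmod (A $ a $ b) \<le> 1"
proof -
  have h: "A $ b $ a = cnj (A $ a $ b)" for a b
    using A unfolding psd_def hermitian_def cadj_def by (metis vec_lambda_beta)
  define x where "x = A $ a $ b"
  define c where "c = (if x = 0 then 1 else - cnj x / cmod x)"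
  have cc: "cmod c = 1" "c * x = - of_real (cmod x)"
  proof -
    show "cmod c = 1" by (simp add: c_def norm_divide)
    show "c * x = - of_real (cmod x)"
    proof (cases "x = 0")
      case False
      have "cnj x * x = of_real (cmod x) * of_real (cmod x)"
        by (metis complex_norm_square mult.commute power2_eq_square of_real_mult)
      then show ?thesis using False by (simp add: c_def)
    qed (simp add: c_def)
  qed
  show ?thesis
  proof (cases "a = b")
    case True
    have "Im (A $ a $ a) = 0" using h[of a a] by (simp add: complex_eq_iff)
    moreover have "Re (A $ a $ a) \<ge> 0"
    proof -
      define v :: "complex^'n" where "v = (\<chi> i. of_bool (i = a))"
      have "qform A v = A $ a $ a"
        unfolding qform_def v_def by (simp add: mult.assoc flip: sum_distrib_left)
      then show ?thesis using A unfolding psd_def by metis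
    qed
    ultimately show ?thesis using d[of a] True by (simp add: cmod_def)
  next
    case False
    define v :: "complex^'n" where "v = (\<chi> i. of_bool (i = a) + c * of_bool (i = b))"
    have "qform A v = (\<Sum>i\<in>UNIV. (of_bool (i = a) + cnj c * of_bool (i = b)) * (\<Sum>j\<in>UNIV. A $ i $ j * (of_bool (j = a) + c * of_bool (j = b))))"
      unfolding qform_def v_def by (simp add: sum_distrib_left mult.assoc)
    also have "\<dots> = (\<Sum>i\<in>UNIV. (of_bool (i = a) + cnj c * of_bool (i = b)) * (A $ i $ a + c * A $ i $ b))"
    proof -
      have "(\<Sum>j\<in>UNIV. A $ i $ j * (of_bool (j = a) + c * of_bool (j = b))) = A $ i $ a + c * A $ i $ b" for i
      proof -
        have "(\<Sum>j\<in>UNIV. A $ i $ j * (of_bool (j = a) + c * of_bool (j = b))) = (\<Sum>j\<in>UNIV. A $ i $ j * of_bool (j = a)) + c * (\<Sum>j\<in>UNIV. A $ i $ j * of_bool (j = b))"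
          by (simp only: distrib_left sum.distrib sum_distrib_left mult.left_commute)
        then show ?thesis by (simp only: of_bool_sum finite UNIV_I)
      qed
      then show ?thesis by simp
    qed
    also have "\<dots> = (A $ a $ a + c * A $ a $ b) + cnj c * (A $ b $ a + c * A $ b $ b)"
    proof -
      have "(\<Sum>i\<in>UNIV. (of_bool (i = a) + cnj c * of_bool (i = b)) * f i) = f a + cnj c * f b" for f :: "_ \<Rightarrow> complex"
      proof -
        have "(\<Sum>i\<in>UNIV. (of_bool (i = a) + cnj c * of_bool (i = b)) * f i) = (\<Sum>i\<in>UNIV. of_bool (i = a) * f i) + cnj c * (\<Sum>i\<in>UNIV. of_bool (i = b) * f i)"
          by (simp only: distrib_right sum.distrib sum_distrib_left mult.assoc)
        then show ?thesis by (simp only: of_bool_sum finite UNIV_I)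
      qed
      then show ?thesis by simp
    qed
    also have "\<dots> = A $ a $ a + (c * x + cnj (c * x)) + (c * cnj c) * A $ b $ b"
      by (simp add: x_def h[of b a] algebra_simps)
    also have "c * cnj c = 1" using cc(1) complex_norm_square[of c] by simp
    finally have "Re (qform A v) = Re (A $ a $ a) - 2 * cmod x + Re (A $ b $ b)" unfolding cc(2) by simp
    moreover have "0 \<le> Re (qform A v)" using A unfolding psd_def by blast
    ultimately show ?thesis using d[of a] d[of b] by (simp add: x_def)
  qed
qed

lemma cscale_of_real: "of_real a *\<^sub>m A = a *\<^sub>R A"
  by (simp add: vec_eq_iff scaleR_conv_of_real[where 'a = complex])

lemma psd_add:
  assumes "psd A" "psd B" "0 \<le> u" "0 \<le> v"
  shows "psd (u *\<^sub>R A + v *\<^sub>R B)"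
proof -
  have "hermitian (u *\<^sub>R A)" using assms hermitian_add_scaleR[of "0" A u]
    by (simp add: psd_def hermitian_def cadj_def vec_eq_iff)
  then have "hermitian (u *\<^sub>R A + v *\<^sub>R B)" using assms by (intro hermitian_add_scaleR) (auto simp: psd_def)
  then show ?thesis using assms
    by (simp add: psd_iff matrix_vector_mult_add_rdistrib matrix_vector_mult_scaleR inner_add_right)
qed

lemma norm_vec_le_sum: "norm x \<le> (\<Sum>i\<in>UNIV. norm (x $ i))"
  unfolding norm_vec_def by (rule L2_set_le_sum) simp

text \<open>The weights at 3N fixed nodes form a compact convex set. At an extreme point a direction
  T as in the last clause of \<open>ThetaHat\<close> must vanish, since by
  \<open>psd_perturb\<close> one can move along both T and -T; a linear functional that is
  nonnegative at these points is nonnegative. \<open>ThetaHat\<close> admits zero weights, so the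
  number of nodes need not vary.\<close>

lemma thetahat_extreme:
  fixes W :: "nat \<Rightarrow> 'n::finite cmat"
  assumes n: "n = 3 * CARD('n)" and t: "inj_on t {..<n}" "\<And>r. r < n \<Longrightarrow> cmod (t r) = 1"
    and W: "\<And>r. r < n \<Longrightarrow> psd (W r)" "(\<Sum>r<n. W r) = mat 1"
      "(\<Sum>r<n. of_real (Re (t r)) *\<^sub>m W r) = 0" "(\<Sum>r<n. of_real (Im (t r)) *\<^sub>m W r) = 0"
    and L: "\<And>W. ThetaHat n t W \<Longrightarrow> 0 \<le> (\<Sum>r<n. \<Sum>b\<in>UNIV. \<Sum>c\<in>UNIV. Re (\<kappa> r b c * W r $ b $ c))"
  shows "0 \<le> (\<Sum>r<n. \<Sum>b\<in>UNIV. \<Sum>c\<in>UNIV. Re (\<kappa> r b c * W r $ b $ c))"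
proof -
  have cn: "CARD('n + 'n + 'n) = n" using n by simp
  \<comment> \<open>A type with 3N elements as index type puts the weights into a Euclidean space,
    where Krein-Milman is available.\<close>
  obtain e :: "nat \<Rightarrow> 'n + 'n + 'n" where e: "bij_betw e {..<n} UNIV"
    using ex_bij_betw_nat_finite[of "UNIV :: ('n + 'n + 'n) set", OF finite_class.finite_UNIV] unfolding atLeast0LessThan cn by blast
  define ei where "ei = inv_into {..<n} e"
  have eie: "ei (e r) = r" if "r < n" for r using e that by (simp add: ei_def bij_betw_def inv_into_f_f)
  have eei: "e (ei k) = k" "ei k < n" for k
    using e by (auto simp: ei_def bij_betw_def f_inv_into_f) (metis UNIV_I inv_into_into lessThan_iff)
  define l where "l X = (\<Sum>r<n. \<Sum>b\<in>UNIV. \<Sum>c\<in>UNIV. Re (\<kappa> r b c * X $ e r $ b $ c))" for X :: "('n cmat)^('n + 'n + 'n)"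
  define S :: "(('n cmat)^('n + 'n + 'n)) set" where "S = {X. (\<forall>k. psd (X $ k)) \<and> (\<Sum>r<n. X $ e r) = mat 1 \<and>
     (\<Sum>r<n. Re (t r) *\<^sub>R X $ e r) = 0 \<and> (\<Sum>r<n. Im (t r) *\<^sub>R X $ e r) = 0}"
  have closed: "closed S"
  proof -
    have "S = (\<Inter>k. (\<lambda>X. X $ k) -` {A. psd A}) \<inter> {X. (\<Sum>r<n. X $ e r) = mat 1} \<inter>
      {X. (\<Sum>r<n. Re (t r) *\<^sub>R X $ e r) = 0} \<inter> {X. (\<Sum>r<n. Im (t r) *\<^sub>R X $ e r) = 0}"
      by (auto simp: S_def)
    moreover have "closed \<dots>"
      by (intro closed_Int closed_INT ballI closed_Collect_eq continuous_intros continuous_closed_vimage closed_psd)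
    ultimately show ?thesis by simp
  qed
  have bounded: "bounded S"
    unfolding bounded_iff
  proof (intro exI ballI)
    fix X assume X: "X \<in> S"
    have "cmod (X $ k $ a $ b) \<le> 1" for k a b
    proof (rule psd_entry_bound)
      show pk: "psd (X $ k)" for k using X by (simp add: S_def)
      fix a
      have nn: "Re (X $ k $ a $ a) \<ge> 0" for k
      proof -
        define v :: "complex^'n" where "v = (\<chi> i. of_bool (i = a))"
        have "qform (X $ k) v = X $ k $ a $ a"
          unfolding qform_def v_def by (simp add: mult.assoc flip: sum_distrib_left)
        then show ?thesis using pk[of k] unfolding psd_def by metis
      qed
      have "Re (X $ k $ a $ a) = Re (X $ e (ei k) $ a $ a)" by (simp add: eei)
      also have "\<dots> \<le> (\<Sum>r<n. Re (X $ e r $ a $ a))"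
        by (rule member_le_sum) (use eei nn in auto)
      also have "\<dots> = Re ((\<Sum>r<n. X $ e r) $ a $ a)" by simp
      also have "\<dots> = 1" using X by (simp add: S_def mat_def)
      finally show "Re (X $ k $ a $ a) \<le> 1" .
    qed
    then have "norm (X $ k $ a) \<le> real CARD('n)" for k a
      using norm_vec_le_sum[of "X $ k $ a"] sum_bounded_above[of UNIV "\<lambda>b. cmod (X $ k $ a $ b)" 1] by fastforce
    then have "norm (X $ k) \<le> real CARD('n) * real CARD('n)" for k
      using norm_vec_le_sum[of "X $ k"] sum_bounded_above[of UNIV "\<lambda>b. norm (X $ k $ b)" "real CARD('n)"] by fastforce
    then show "norm X \<le> real CARD('n + 'n + 'n) * (real CARD('n) * real CARD('n))"
      using norm_vec_le_sum[of "X"] sum_bounded_above[of UNIV "\<lambda>b. norm (X $ b)" "real CARD('n) * real CARD('n)"] by fastforce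
  qed
  have convex: "convex S"
  proof (rule convexI)
    fix X Y and u v :: real
    assume X: "X \<in> S" and Y: "Y \<in> S" and uv: "0 \<le> u" "0 \<le> v" "u + v = 1"
    have lin: "(\<Sum>r<n. f r *\<^sub>R (u *\<^sub>R X + v *\<^sub>R Y) $ e r) = u *\<^sub>R (\<Sum>r<n. f r *\<^sub>R X $ e r) + v *\<^sub>R (\<Sum>r<n. f r *\<^sub>R Y $ e r)" for f :: "nat \<Rightarrow> real"
      by (simp add: scaleR_add_right sum.distrib scaleR_sum_right mult.commute)
    show "u *\<^sub>R X + v *\<^sub>R Y \<in> S"
      using X Y uv lin[of "\<lambda>_. 1"] lin[of "\<lambda>r. Re (t r)"] lin[of "\<lambda>r. Im (t r)"]
      by (auto simp: S_def psd_add simp flip: scaleR_add_left)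
  qed
  have conv_l: "convex {X. 0 \<le> l X}"
  proof (rule convexI)
    fix X Y and u v :: real
    assume XY: "X \<in> {X. 0 \<le> l X}" "Y \<in> {X. 0 \<le> l X}" and uv: "0 \<le> u" "0 \<le> v" "u + v = 1"
    have "Re (k * (u *\<^sub>R x + v *\<^sub>R y)) = u * Re (k * x) + v * Re (k * y)" for k x y
      by (simp add: algebra_simps)
    then have "l (u *\<^sub>R X + v *\<^sub>R Y) = u * l X + v * l Y"
      unfolding l_def vector_add_component vector_scaleR_component by (simp only: sum_distrib_left sum.distrib)
    then show "u *\<^sub>R X + v *\<^sub>R Y \<in> {X. 0 \<le> l X}" using XY uv by simp
  qed
  have ext: "0 \<le> l X" if X: "X extreme_point_of S" for X
  proof -
    define V where "V r = X $ e r" for r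
    have XS: "X \<in> S" using X by (simp add: extreme_point_of_def)
    have "T r = 0"
      if T: "\<forall>r<n. hermitian (T r) \<and> mran (T r) \<subseteq> mran (V r)" "(\<Sum>r<n. T r) = 0"
        "(\<Sum>r<n. of_real (Re (t r)) *\<^sub>m T r) = 0" "(\<Sum>r<n. of_real (Im (t r)) *\<^sub>m T r) = 0" and r: "r < n" for T r
    proof -
      define Y where "Y = (\<chi> k. T (ei k))"
      have Ye: "Y $ e r = T r" if "r < n" for r using that by (simp add: Y_def eie)
      have "\<exists>\<epsilon>>0. \<forall>\<delta>. \<bar>\<delta>\<bar> \<le> \<epsilon> \<longrightarrow> psd (X $ k + \<delta> *\<^sub>R Y $ k)" for k
      proof (rule psd_perturb)
        show "psd (X $ k)" using XS by (simp add: S_def)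
        have "mran (T (ei k)) \<subseteq> mran (V (ei k))" "hermitian (T (ei k))" using T(1) eei(2)[of k] by auto
        then show "hermitian (Y $ k)" "mran (Y $ k) \<subseteq> mran (X $ k)" by (simp_all add: Y_def V_def eei(1))
      qed
      then obtain \<epsilon> where \<epsilon>: "\<And>k. \<epsilon> k > 0" "\<And>k \<delta>. \<bar>\<delta>\<bar> \<le> \<epsilon> k \<Longrightarrow> psd (X $ k + \<delta> *\<^sub>R Y $ k)" by metis
      define d where "d = Min (range \<epsilon>)"
      have d: "d > 0" "\<And>k. d \<le> \<epsilon> k" using \<epsilon>(1) by (auto simp: d_def)
      have sumY: "(\<Sum>r<n. f r *\<^sub>R Y $ e r) = (\<Sum>r<n. f r *\<^sub>R T r)" for f :: "nat \<Rightarrow> real"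
        by (intro sum.cong) (simp_all add: Ye)
      have Y0: "(\<Sum>r<n. Y $ e r) = 0" "(\<Sum>r<n. Re (t r) *\<^sub>R Y $ e r) = 0" "(\<Sum>r<n. Im (t r) *\<^sub>R Y $ e r) = 0"
        using T(2-4) sumY[of "\<lambda>_. 1"] sumY[of "\<lambda>r. Re (t r)"] sumY[of "\<lambda>r. Im (t r)"] by (simp_all add: cscale_of_real)
      have lin: "(\<Sum>r<n. f r *\<^sub>R (X + \<delta> *\<^sub>R Y) $ e r) = (\<Sum>r<n. f r *\<^sub>R X $ e r) + \<delta> *\<^sub>R (\<Sum>r<n. f r *\<^sub>R Y $ e r)" for f :: "nat \<Rightarrow> real" and \<delta>
        by (simp add: scaleR_add_right sum.distrib scaleR_sum_right mult.commute)
      have in_S: "X + \<delta> *\<^sub>R Y \<in> S" if "\<bar>\<delta>\<bar> \<le> d" for \<delta>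
      proof -
        have "psd ((X + \<delta> *\<^sub>R Y) $ k)" for k using \<epsilon>(2)[of \<delta> k] d(2)[of k] that by simp
        then show ?thesis
          using XS lin[of "\<lambda>_. 1" \<delta>] lin[of "\<lambda>r. Re (t r)" \<delta>] lin[of "\<lambda>r. Im (t r)" \<delta>] Y0 by (simp add: S_def)
      qed
      have "Y = 0"
      proof (rule ccontr)
        assume "Y \<noteq> 0"
        define A where "A = X + d *\<^sub>R Y"
        define B where "B = X + (- d) *\<^sub>R Y"
        have "A \<in> S" "B \<in> S" unfolding A_def B_def by (rule in_S, use d in simp)+
        moreover have "midpoint A B = X" by (simp add: midpoint_def A_def B_def flip: scaleR_add_left)
        moreover have "A \<noteq> B"
        proof
          assume "A = B"
          then have "(2 * d) *\<^sub>R Y = 0" by (simp add: A_def B_def scaleR_add_left[symmetric] algebra_simps)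
          then show False using d \<open>Y \<noteq> 0\<close> by simp
        qed
        ultimately show False using X midpoint_in_open_segment[of A B] unfolding extreme_point_of_def by metis
      qed
      then show ?thesis using Ye[OF r] by simp
    qed
    moreover have "1 \<le> n" using n by (simp add: Suc_leI)
    ultimately have "ThetaHat n t V"
      unfolding ThetaHat_def using t n XS by (auto simp: V_def S_def cscale_of_real)
    then show ?thesis using L[of V] by (simp add: l_def V_def)
  qed
  have "compact S" using closed bounded by (simp add: compact_eq_bounded_closed)
  then have hull: "S = convex hull {X. X extreme_point_of S}" using convex by (rule Krein_Milman_Minkowski)
  define X0 where "X0 = (\<chi> k. W (ei k))"
  have X0e: "X0 $ e r = W r" if "r < n" for r using that by (simp add: X0_def eie)
  have sumX: "(\<Sum>r<n. f r *\<^sub>R X0 $ e r) = (\<Sum>r<n. f r *\<^sub>R W r)" for f :: "nat \<Rightarrow> real"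
    by (intro sum.cong) (simp_all add: X0e)
  have "X0 \<in> S"
    using W sumX[of "\<lambda>_. 1"] sumX[of "\<lambda>r. Re (t r)"] sumX[of "\<lambda>r. Im (t r)"] eei(2)
    by (auto simp: S_def cscale_of_real) (simp add: X0_def)
  moreover have "convex hull {X. X extreme_point_of S} \<subseteq> {X. 0 \<le> l X}"
    by (rule hull_minimal) (use ext conv_l in auto)
  ultimately have "0 \<le> l X0" using hull by blast
  then show ?thesis by (simp add: l_def X0e)
qed

lemma regroup:
  fixes f :: "'j \<Rightarrow> complex" and n :: nat
  assumes "finite J" "\<rho> ` J \<subseteq> {..<n}"
  shows "(\<Sum>r<n. \<Sum>j | j \<in> J \<and> \<rho> j = r. f j) = (\<Sum>j\<in>J. f j)"
  by (rule sum.group) (use assms in auto)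

lemma psd_gram:
  fixes w :: "'j \<Rightarrow> 'n::finite \<Rightarrow> complex"
  shows "psd (\<chi> b c. \<Sum>j\<in>J. cnj (w j b) * w j c)"
proof -
  define A :: "'n cmat" where "A = (\<chi> b c. \<Sum>j\<in>J. cnj (w j b) * w j c)"
  have h: "hermitian A" by (simp add: hermitian_def cadj_def A_def vec_eq_iff cnj_sum mult.commute)
  have "Re (qform A x) \<ge> 0" for x
  proof -
    have "qform A x = (\<Sum>i\<in>UNIV. \<Sum>k\<in>UNIV. \<Sum>j\<in>J. cnj (x $ i) * (cnj (w j i) * w j k) * x $ k)"
      by (simp add: qform_def A_def sum_distrib_left sum_distrib_right)
    also have "\<dots> = (\<Sum>i\<in>UNIV. \<Sum>j\<in>J. \<Sum>k\<in>UNIV. cnj (x $ i) * (cnj (w j i) * w j k) * x $ k)"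
      by (intro sum.cong refl sum.swap)
    also have "\<dots> = (\<Sum>j\<in>J. \<Sum>i\<in>UNIV. \<Sum>k\<in>UNIV. cnj (x $ i) * (cnj (w j i) * w j k) * x $ k)" by (rule sum.swap)
    also have "\<dots> = (\<Sum>j\<in>J. cnj (\<Sum>k\<in>UNIV. w j k * x $ k) * (\<Sum>k\<in>UNIV. w j k * x $ k))"
      unfolding cnj_sum sum_product by (simp add: mult_ac)
    also have "\<dots> = (\<Sum>j\<in>J. of_real ((cmod (\<Sum>k\<in>UNIV. w j k * x $ k))\<^sup>2))"
      by (intro sum.cong refl) (metis complex_norm_square mult.commute)
    finally show ?thesis by (simp add: sum_nonneg flip: of_real_power)
  qed
  then show ?thesis using h by (simp add: psd_iff re_qform A_def)
qed

section \<open>Contractivity of the test functions as positivity for few atoms\<close>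

context hermitian_form
begin

text \<open>Brings the form into the shape of the linear functional of the weights in
  \<open>thetahat_extreme\<close>.\<close>

lemma herg_sum:
  "herg (\<lambda>p b c. \<Sum>r\<in>R. g r p * A r b c) \<alpha>
    = (\<Sum>r\<in>R. \<Sum>b\<in>UNIV. \<Sum>c\<in>UNIV. Re (frm (\<lambda>p. g r p * \<alpha> c p) (\<alpha> b) * A r b c))"
proof -
  have "frm (\<lambda>p. \<Sum>c\<in>UNIV. (\<Sum>r\<in>R. g r p * A r b c) * \<alpha> c p) (\<alpha> b)
     = (\<Sum>r\<in>R. \<Sum>c\<in>UNIV. frm (\<lambda>p. g r p * \<alpha> c p) (\<alpha> b) * A r b c)" for b
  proof -
    have "(\<lambda>p. \<Sum>c\<in>UNIV. (\<Sum>r\<in>R. g r p * A r b c) * \<alpha> c p) = (\<lambda>p. \<Sum>c\<in>UNIV. 1 * (\<Sum>r\<in>R. A r b c * (g r p * \<alpha> c p)))"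
      unfolding sum_distrib_right by (simp add: mult_ac)
    then have "frm (\<lambda>p. \<Sum>c\<in>UNIV. (\<Sum>r\<in>R. g r p * A r b c) * \<alpha> c p) (\<alpha> b)
       = (\<Sum>c\<in>UNIV. \<Sum>r\<in>R. A r b c * frm (\<lambda>p. g r p * \<alpha> c p) (\<alpha> b))"
      by (simp only: frm_sum1) simp
    also have "\<dots> = (\<Sum>r\<in>R. \<Sum>c\<in>UNIV. A r b c * frm (\<lambda>p. g r p * \<alpha> c p) (\<alpha> b))" by (rule sum.swap)
    finally show ?thesis by (simp add: mult.commute)
  qed
  then have "herg (\<lambda>p b c. \<Sum>r\<in>R. g r p * A r b c) \<alpha>
     = (\<Sum>b\<in>UNIV. \<Sum>r\<in>R. \<Sum>c\<in>UNIV. Re (frm (\<lambda>p. g r p * \<alpha> c p) (\<alpha> b) * A r b c))"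
    unfolding herg_def by (simp del: times_complex.sel)
  also have "\<dots> = (\<Sum>r\<in>R. \<Sum>b\<in>UNIV. \<Sum>c\<in>UNIV. Re (frm (\<lambda>p. g r p * \<alpha> c p) (\<alpha> b) * A r b c))" by (rule sum.swap)
  finally show ?thesis .
qed

lemma herg_Ffun_nonneg:
  fixes W :: "nat \<Rightarrow> 'n::finite cmat"
  assumes z: "\<And>p. \<zeta> p \<in> disk" and W: "ThetaHat n t W"
    and con: "\<And>\<alpha>. (\<Sum>b\<in>UNIV. qn (\<lambda>p. \<Sum>c\<in>UNIV. Sfun n t W (\<zeta> p) $ b $ c * \<alpha> c p)) \<le> (\<Sum>b\<in>UNIV. qn (\<alpha> b))"
  shows "0 \<le> herg (\<lambda>p b c. Ffun n t W (\<zeta> p) $ b $ c) \<alpha>"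
proof (rule herg_contractive[where S = "\<lambda>p b c. Sfun n t W (\<zeta> p) $ b $ c"])
  fix p b
  define a :: "complex^'n" where "a = (\<chi> c. \<alpha> c p)"
  define F where "F = Ffun n t W (\<zeta> p)"
  have "Sfun n t W (\<zeta> p) ** (F + mat 1) = F - mat 1"
    unfolding F_def using W z[of p] by (intro Sfun_relation Ffun_plus_one_invertible) (auto simp: ThetaHat_def)
  then have "Sfun n t W (\<zeta> p) *v ((F + mat 1) *v a) = (F - mat 1) *v a"
    by (simp add: matrix_vector_mul_assoc)
  then have "(Sfun n t W (\<zeta> p) *v (F *v a + a)) $ b = (F *v a - a) $ b"
    by (simp add: matrix_vector_mult_add_rdistrib matrix_vector_mult_diff_rdistrib)
  then show "(\<Sum>c\<in>UNIV. Sfun n t W (\<zeta> p) $ b $ c * (\<alpha> c p + (\<Sum>d\<in>UNIV. Ffun n t W (\<zeta> p) $ c $ d * \<alpha> d p)))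
      = (\<Sum>d\<in>UNIV. Ffun n t W (\<zeta> p) $ b $ d * \<alpha> d p) - \<alpha> b p"
    by (simp add: matrix_vector_mult_def a_def F_def add.commute)
next
  fix \<beta> show "(\<Sum>b\<in>UNIV. qn (\<lambda>p. \<Sum>c\<in>UNIV. Sfun n t W (\<zeta> p) $ b $ c * \<beta> c p)) \<le> (\<Sum>b\<in>UNIV. qn (\<beta> b))" by (rule con)
qed

text \<open>Atoms at the same point are collected into one weight, and points of the circle with
  weight zero are added until there are exactly 3N distinct nodes.\<close>

lemma test_functions_meas_pos:
  fixes w :: "'j \<Rightarrow> 'n::finite \<Rightarrow> complex"
  assumes z: "\<And>p. \<zeta> p \<in> disk"
    and con: "\<And>n t (W :: nat \<Rightarrow> 'n cmat) \<alpha>. ThetaHat n t W \<Longrightarrow>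
      (\<Sum>b\<in>UNIV. qn (\<lambda>p. \<Sum>c\<in>UNIV. Sfun n t W (\<zeta> p) $ b $ c * \<alpha> c p)) \<le> (\<Sum>b\<in>UNIV. qn (\<alpha> b))"
    and card: "card J \<le> 3 * CARD('n)" and norm: "normalised J \<tau> w"
  shows "meas_pos J \<tau> w"
proof -
  define n where "n = 3 * CARD('n)"
  have fin: "finite J" and t1: "\<And>j. j \<in> J \<Longrightarrow> cmod (\<tau> j) = 1"
    and w1: "\<And>a b. (\<Sum>j\<in>J. cnj (w j a) * w j b) = of_bool (a = b)"
    and w2: "\<And>a b. (\<Sum>j\<in>J. \<tau> j * cnj (w j a) * w j b) = 0"
    using norm by (auto simp: normalised_def)
  \<comment> \<open>The nodes are \<open>cnj (\<tau> j)\<close>: at t = cnj \<tau> the kernel (t +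
    \<zeta>) / (t - \<zeta>) of \<open>Ffun\<close> is (1 + \<zeta> \<tau>) / (1 - \<zeta>
    \<tau>).\<close>
  define T0 where "T0 = (\<lambda>j. cnj (\<tau> j)) ` J"
  have T0: "finite T0" "card T0 \<le> n" "T0 \<subseteq> {t. cmod t = 1}"
    using fin card card_image_le[OF fin, of "\<lambda>j. cnj (\<tau> j)"] t1 by (auto simp: T0_def n_def)
  have "infinite ({t. cmod t = 1} - T0)" using infinite_unit_circle T0(1) by simp
  then obtain B where B: "finite B" "card B = n - card T0" "B \<subseteq> {t. cmod t = 1} - T0"
    using infinite_arbitrarily_large by metis
  have cT: "card (T0 \<union> B) = n" using T0 B by (subst card_Un_disjoint) auto
  then obtain t where t: "bij_betw t {..<n} (T0 \<union> B)"
    using ex_bij_betw_nat_finite[of "T0 \<union> B"] T0 B by (auto simp: atLeast0LessThan)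
  have tc: "cmod (t r) = 1" if "r < n" for r
    using bij_betwE[OF t] that T0(3) B(3) by blast
  define \<rho> where "\<rho> j = inv_into {..<n} t (cnj (\<tau> j))" for j
  have \<rho>: "t (\<rho> j) = cnj (\<tau> j)" "\<rho> j < n" if "j \<in> J" for j
  proof -
    have "cnj (\<tau> j) \<in> t ` {..<n}" using t that by (auto simp: bij_betw_def T0_def)
    then show "t (\<rho> j) = cnj (\<tau> j)" "\<rho> j < n"
      unfolding \<rho>_def using f_inv_into_f[of "cnj (\<tau> j)" t "{..<n}"] inv_into_into[of "cnj (\<tau> j)" t "{..<n}"] by auto
  qed
  have sub: "\<rho> ` J \<subseteq> {..<n}" using \<rho>(2) by auto
  define W :: "nat \<Rightarrow> 'n cmat" where "W r = (\<chi> b c. \<Sum>j | j \<in> J \<and> \<rho> j = r. cnj (w j b) * w j c)" for r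
  have mom: "(\<Sum>r<n. f (t r) * W r $ b $ c) = (\<Sum>j\<in>J. f (cnj (\<tau> j)) * (cnj (w j b) * w j c))" for f b c
  proof -
    have "(\<Sum>r<n. f (t r) * W r $ b $ c) = (\<Sum>r<n. \<Sum>j | j \<in> J \<and> \<rho> j = r. f (cnj (\<tau> j)) * (cnj (w j b) * w j c))"
      unfolding W_def vec_lambda_beta sum_distrib_left by (intro sum.cong refl) (auto simp: \<rho>)
    also have "\<dots> = (\<Sum>j\<in>J. f (cnj (\<tau> j)) * (cnj (w j b) * w j c))" by (rule regroup[OF fin sub])
    finally show ?thesis .
  qed
  have w2': "(\<Sum>j\<in>J. cnj (\<tau> j) * (cnj (w j b) * w j c)) = 0" for b c
  proof -
    have "(\<Sum>j\<in>J. cnj (\<tau> j) * (cnj (w j b) * w j c)) = cnj (\<Sum>j\<in>J. \<tau> j * cnj (w j c) * w j b)"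
      by (simp add: cnj_sum mult_ac)
    then show ?thesis by (simp add: w2)
  qed
  have Wsum: "(\<Sum>r<n. W r) = mat 1"
    using mom[of "\<lambda>_. 1"] w1 by (simp add: vec_eq_iff mat_def)
  have m1: "(\<Sum>r<n. of_real (Re (t r)) *\<^sub>m W r) = 0"
  proof -
    have "(\<Sum>r<n. of_real (Re (t r)) * W r $ b $ c) = 0" for b c
    proof -
      have "(\<Sum>r<n. of_real (Re (t r)) * W r $ b $ c)
          = (\<Sum>j\<in>J. (\<tau> j * cnj (w j b) * w j c + cnj (\<tau> j) * (cnj (w j b) * w j c)) / 2)"
        unfolding mom[of "\<lambda>t. of_real (Re t)"] complex_cnj(1)
        by (intro sum.cong refl) (auto simp: complex_eq_iff algebra_simps)
      also have "\<dots> = 0" by (simp only: sum_divide_distrib[symmetric] sum.distrib w2 w2') simp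
      finally show ?thesis .
    qed
    then show ?thesis by (simp add: vec_eq_iff)
  qed
  have m2: "(\<Sum>r<n. of_real (Im (t r)) *\<^sub>m W r) = 0"
  proof -
    have "(\<Sum>r<n. of_real (Im (t r)) * W r $ b $ c) = 0" for b c
    proof -
      have "(\<Sum>r<n. of_real (Im (t r)) * W r $ b $ c)
          = (\<Sum>j\<in>J. \<i> / 2 * (\<tau> j * cnj (w j b) * w j c - cnj (\<tau> j) * (cnj (w j b) * w j c)))"
      proof -
        have "of_real (Im (cnj s)) = \<i> / 2 * (s - cnj s)" for s by (simp add: complex_eq_iff)
        then show ?thesis unfolding mom[of "\<lambda>t. of_real (Im t)"]
          by (intro sum.cong refl) (simp only: left_diff_distrib right_diff_distrib mult.assoc)
      qed
      also have "\<dots> = 0" by (simp only: sum_distrib_left[symmetric] sum_subtractf w2 w2') simp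
      finally show ?thesis .
    qed
    then show ?thesis by (simp add: vec_eq_iff)
  qed
  define g where "g r p = (t r + \<zeta> p) / (t r - \<zeta> p)" for r p
  have "0 \<le> herg (\<lambda>p b c. \<Sum>j\<in>J. cnj (w j b) * w j c * ((1 + \<zeta> p * \<tau> j) / (1 - \<zeta> p * \<tau> j))) \<alpha>" for \<alpha>
  proof -
    define k where "k r b c = frm (\<lambda>p. g r p * \<alpha> c p) (\<alpha> b)" for r b c
    have hV: "herg (\<lambda>p b c. \<Sum>r<n. g r p * V r $ b $ c) \<alpha> = (\<Sum>r<n. \<Sum>b\<in>UNIV. \<Sum>c\<in>UNIV. Re (k r b c * V r $ b $ c))" for V :: "nat \<Rightarrow> 'n cmat"
      unfolding k_def by (rule herg_sum)
    have "0 \<le> (\<Sum>r<n. \<Sum>b\<in>UNIV. \<Sum>c\<in>UNIV. Re (k r b c * W r $ b $ c))"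
    proof (rule thetahat_extreme[OF n_def _ tc _ Wsum m1 m2])
      show "inj_on t {..<n}" using t by (simp add: bij_betw_def)
      show "psd (W r)" for r unfolding W_def by (rule psd_gram)
      show "0 \<le> (\<Sum>r<n. \<Sum>b\<in>UNIV. \<Sum>c\<in>UNIV. Re (k r b c * V r $ b $ c))" if V: "ThetaHat n t V" for V :: "nat \<Rightarrow> 'n cmat"
        using herg_Ffun_nonneg[OF z V con[OF V], of \<alpha>] unfolding hV[symmetric] by (simp add: Ffun_def g_def)
    qed
    also have "\<dots> = herg (\<lambda>p b c. \<Sum>r<n. g r p * W r $ b $ c) \<alpha>" by (rule hV[symmetric])
    also have "(\<lambda>p b c. \<Sum>r<n. g r p * W r $ b $ c) = (\<lambda>p b c. \<Sum>j\<in>J. cnj (w j b) * w j c * ((1 + \<zeta> p * \<tau> j) / (1 - \<zeta> p * \<tau> j)))"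
    proof (intro ext)
      fix p b c
      have e: "(cnj (\<tau> j) + \<zeta> p) / (cnj (\<tau> j) - \<zeta> p) = (1 + \<zeta> p * \<tau> j) / (1 - \<zeta> p * \<tau> j)" if "j \<in> J" for j
      proof -
        have "cnj (\<tau> j) * \<tau> j = 1" using t1[OF that] complex_norm_square[of "\<tau> j"] by (simp add: mult.commute)
        moreover have "\<tau> j \<noteq> 0" using t1[OF that] by auto
        ultimately have "(cnj (\<tau> j) + \<zeta> p) / (cnj (\<tau> j) - \<zeta> p) = ((cnj (\<tau> j) + \<zeta> p) * \<tau> j) / ((cnj (\<tau> j) - \<zeta> p) * \<tau> j)" by simp
        then show ?thesis using \<open>cnj (\<tau> j) * \<tau> j = 1\<close> by (simp add: distrib_right left_diff_distrib)
      qed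
      show "(\<Sum>r<n. g r p * W r $ b $ c) = (\<Sum>j\<in>J. cnj (w j b) * w j c * ((1 + \<zeta> p * \<tau> j) / (1 - \<zeta> p * \<tau> j)))"
        unfolding g_def mom[of "\<lambda>t. (t + \<zeta> p) / (t - \<zeta> p)"] by (intro sum.cong refl) (simp add: e)
    qed
    finally show ?thesis .
  qed
  then show ?thesis
    unfolding meas_pos_def
  proof (intro allI impI)
    fix v :: "'j \<Rightarrow> 'p \<Rightarrow> complex" and \<alpha> :: "'n \<Rightarrow> 'p \<Rightarrow> complex"
    assume h: "\<And>\<alpha>. 0 \<le> herg (\<lambda>p b c. \<Sum>j\<in>J. cnj (w j b) * w j c * ((1 + \<zeta> p * \<tau> j) / (1 - \<zeta> p * \<tau> j))) \<alpha>"
      and v: "\<forall>j\<in>J. \<forall>p. (1 - \<zeta> p * \<tau> j) * v j p = (\<Sum>b\<in>UNIV. w j b * \<alpha> b p)"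
    have z1: "cmod (\<zeta> p) < 1" for p using z[of p] by (simp add: disk_def)
    have "0 \<le> (\<Sum>j\<in>J. qn (v j)) - (\<Sum>j\<in>J. qn (\<lambda>p. \<zeta> p * v j p))"
      by (subst herg_meas[OF z1 t1 fin, where w = w and \<alpha> = \<alpha>]) (use v h in auto)
    then show "(\<Sum>j\<in>J. qn (\<lambda>p. \<zeta> p * v j p)) \<le> (\<Sum>j\<in>J. qn (v j))" by simp
  qed
qed

end

section \<open>Discretised Herglotz representations\<close>

text \<open>The rows of \<open>w\<close> are orthonormal eigenvectors scaled by the square roots of
  their eigenvalues. A weight thus splits into N rank one atoms at one node.\<close>

lemma psd_factor:
  fixes H :: "'n::finite \<Rightarrow> 'n \<Rightarrow> complex"
  assumes herm: "\<And>b c. H b c = cnj (H c b)"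
    and pos: "\<And>x. 0 \<le> Re (\<Sum>b\<in>UNIV. \<Sum>c\<in>UNIV. cnj (x b) * H b c * x c)"
  shows "\<exists>w :: 'n \<Rightarrow> 'n \<Rightarrow> complex. \<forall>b c. H b c = (\<Sum>e\<in>UNIV. cnj (w e b) * w e c)"
proof -
  have eig: "(\<Sum>c\<in>UNIV. H b c * cnj (e c)) = cnj \<mu> * cnj (e b)" if "\<And>c. (\<Sum>b\<in>UNIV. e b * H b c) = \<mu> * e c" for e \<mu> b
  proof -
    have "(\<Sum>c\<in>UNIV. H b c * cnj (e c)) = cnj (\<Sum>c\<in>UNIV. e c * H c b)"
      unfolding cnj_sum by (intro sum.cong refl) (subst herm, simp add: mult.commute)
    then show ?thesis by (simp add: that)
  qed
  have real: "\<mu> = cnj \<mu>" if "\<And>c. (\<Sum>b\<in>UNIV. e b * H b c) = \<mu> * e c" "e \<noteq> (\<lambda>_. 0)" for e \<mu>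
  proof -
    have "\<mu> * (\<Sum>c\<in>UNIV. e c * cnj (e c)) = (\<Sum>c\<in>UNIV. (\<Sum>b\<in>UNIV. e b * H b c) * cnj (e c))"
      by (simp add: that sum_distrib_left mult.assoc)
    also have "\<dots> = (\<Sum>b\<in>UNIV. e b * (\<Sum>c\<in>UNIV. H b c * cnj (e c)))"
      unfolding sum_distrib_left sum_distrib_right mult.assoc by (rule sum.swap)
    also have "\<dots> = cnj \<mu> * (\<Sum>c\<in>UNIV. e c * cnj (e c))"
      unfolding eig[OF that(1)] by (simp add: sum_distrib_left mult_ac)
    finally have eq: "\<mu> * (\<Sum>c\<in>UNIV. e c * cnj (e c)) = cnj \<mu> * (\<Sum>c\<in>UNIV. e c * cnj (e c))" .
    have "(\<Sum>c\<in>UNIV. e c * cnj (e c)) \<noteq> 0"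
    proof
      assume "(\<Sum>c\<in>UNIV. e c * cnj (e c)) = 0"
      then have "e s = 0" for s by (rule sum_norm_sq_eq_0[OF finite_class.finite_UNIV]) simp
      then show False using that(2) by blast
    qed
    then show ?thesis using eq mult_cancel_right[of \<mu> _ "cnj \<mu>"] by blast
  qed
  have "\<exists>G \<tau>. uni UNIV UNIV G \<and> (\<forall>i\<in>(UNIV::'n set). \<forall>j\<in>UNIV. (\<Sum>k\<in>UNIV. G i k * H k j) = \<tau> i * G i j)"
  proof (rule orthonormal_row_eigenbasis)
    fix e \<mu> assume e: "\<forall>j\<in>UNIV. (\<Sum>i\<in>UNIV. e i * H i j) = \<mu> * e j"
    show "\<forall>i\<in>UNIV. (\<Sum>j\<in>UNIV. H i j * cnj (e j)) = \<mu> * cnj (e i)"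
    proof (cases "e = (\<lambda>_. 0)")
      case False
      then show ?thesis using eig[of e \<mu>] real[of e \<mu>] e by auto
    qed simp
  qed simp
  then obtain G :: "'n \<Rightarrow> 'n \<Rightarrow> complex" and \<tau> where G: "uni UNIV UNIV G" and "\<forall>i\<in>UNIV. \<forall>j\<in>UNIV. (\<Sum>k\<in>UNIV. G i k * H k j) = \<tau> i * G i j" by blast
  then have eg: "(\<Sum>k\<in>UNIV. G i k * H k j) = \<tau> i * G i j" for i j by blast
  have tpos: "\<tau> i = of_real (sqrt (Re (\<tau> i))) * of_real (sqrt (Re (\<tau> i)))" for i
  proof -
    have one: "(\<Sum>j\<in>UNIV. G i j * cnj (G i j)) = 1" using uniD(3)[OF G, of i i] by simp
    then have "G i \<noteq> (\<lambda>_. 0)" by auto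
    then have re: "\<tau> i = cnj (\<tau> i)" by (rule real[OF eg])
    have "(\<Sum>b\<in>UNIV. \<Sum>c\<in>UNIV. cnj (cnj (G i b)) * H b c * cnj (G i c)) = (\<Sum>c\<in>UNIV. (\<Sum>b\<in>UNIV. G i b * H b c) * cnj (G i c))"
      unfolding sum_distrib_right complex_cnj_cnj by (rule sum.swap)
    also have "\<dots> = \<tau> i" unfolding eg mult.assoc sum_distrib_left[symmetric] one by simp
    finally have "0 \<le> Re (\<tau> i)" using pos[of "\<lambda>b. cnj (G i b)"] by simp
    then show ?thesis using re by (simp add: complex_eq_iff)
  qed
  show ?thesis
  proof (intro exI allI)
    fix b c
    have "H b c = (\<Sum>k\<in>UNIV. of_bool (b = k) * H k c)" by (simp add: of_bool_sum)
    also have "\<dots> = (\<Sum>k\<in>UNIV. (\<Sum>i\<in>UNIV. cnj (G i b) * G i k) * H k c)" using uniD(4)[OF G, of b] by simp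
    also have "\<dots> = (\<Sum>i\<in>UNIV. cnj (G i b) * (\<Sum>k\<in>UNIV. G i k * H k c))"
      unfolding sum_distrib_left sum_distrib_right mult.assoc by (rule sum.swap)
    also have "\<dots> = (\<Sum>i\<in>UNIV. cnj (of_real (sqrt (Re (\<tau> i))) * G i b) * (of_real (sqrt (Re (\<tau> i))) * G i c))"
      unfolding eg by (subst tpos) (simp add: mult_ac)
    finally show "H b c = (\<Sum>i\<in>UNIV. cnj (of_real (sqrt (Re (\<tau> i))) * G i b) * (of_real (sqrt (Re (\<tau> i))) * G i c))" .
  qed
qed

lemma primitive_root_of_unity:
  assumes "R > 0"
  obtains \<omega> :: complex where "cmod \<omega> = 1" "\<omega> ^ R = 1" "\<And>m. \<omega> ^ m = 1 \<longleftrightarrow> R dvd m"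
proof
  define \<omega> where "\<omega> = exp (2 * of_real pi * \<i> / of_nat R)"
  have pw: "\<omega> ^ m = exp (2 * of_real pi * \<i> * of_nat m / of_nat R)" for m
    unfolding \<omega>_def exp_of_nat_mult[symmetric] by (simp add: mult_ac)
  show d: "\<omega> ^ m = 1 \<longleftrightarrow> R dvd m" for m
    unfolding pw by (rule complex_root_unity_eq_1) (use assms in simp)
  show "\<omega> ^ R = 1" unfolding d by simp
  show "cmod \<omega> = 1" by (simp add: \<omega>_def)
qed

lemma sum_root_powers:
  assumes "R > 0" and \<omega>: "\<And>m. \<omega> ^ m = (1::complex) \<longleftrightarrow> R dvd m"
  shows "(\<Sum>k<R. (\<omega> ^ k) ^ m) = of_nat R * of_bool (R dvd m)"
proof (cases "R dvd m")
  case True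
  then have "(\<omega> ^ k) ^ m = 1" for k using \<omega>[of "k * m"] by (simp add: power_mult)
  then show ?thesis using True by simp
next
  case False
  then have "\<omega> ^ m \<noteq> 1" using \<omega> by simp
  moreover have "(\<omega> ^ m) ^ R = 1" using \<omega>[of "m * R"] by (simp add: power_mult)
  moreover have "(\<Sum>k<R. (\<omega> ^ k) ^ m) = (\<Sum>k<R. (\<omega> ^ m) ^ k)" by (simp add: power_mult[symmetric] mult.commute)
  ultimately show ?thesis using False by (simp add: geometric_sum)
qed

text \<open>The discrete Herglotz integral of t^l. With u = z cnj t one has u^R = z^R, so the kernel
  times 1 - z^R is the sum of u^j over j < R plus that over 1 \<le> j \<le> R, and orthogonality of
  the powers picks out z^l, twice if l > 0.\<close>

lemma roots_of_unity_kernel: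
  assumes R: "R > 0" and c: "cmod \<omega> = 1" and \<omega>: "\<And>m. \<omega> ^ m = (1::complex) \<longleftrightarrow> R dvd m" and z: "cmod z < 1" and l: "l < R"
  shows "(\<Sum>k<R. (\<omega> ^ k) ^ l * ((\<omega> ^ k + z) / (\<omega> ^ k - z))) = of_nat R * (if l = 0 then 1 + z ^ R else 2 * z ^ l) / (1 - z ^ R)"
proof -
  have ct: "cnj \<omega> * \<omega> = 1" using c complex_norm_square[of \<omega>] by (simp add: mult.commute)
  \<comment> \<open>\<open>R dvd l + R - j\<close> is the congruence of l and j modulo R, written
    without negative numbers.\<close>
  have orth: "(\<Sum>k<R. (\<omega> ^ k) ^ l * cnj (\<omega> ^ k) ^ j) = of_nat R * of_bool (R dvd l + R - j)" if "j \<le> R" for j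
  proof -
    have "cnj (\<omega> ^ k) ^ j = (\<omega> ^ k) ^ (R - j)" for k
    proof -
      have "(\<omega> ^ k) ^ R = 1" using \<omega>[of "k * R"] by (simp add: power_mult)
      then have "(\<omega> ^ k) ^ (R - j) * (\<omega> ^ k) ^ j = 1" using that by (simp flip: power_add)
      moreover have "cnj (\<omega> ^ k) ^ j * (\<omega> ^ k) ^ j = 1" using ct by (simp add: power_mult_distrib[symmetric])
      moreover have "\<omega> \<noteq> 0" using c by auto
      ultimately show ?thesis by (metis mult_right_cancel power_not_zero)
    qed
    then have "(\<Sum>k<R. (\<omega> ^ k) ^ l * cnj (\<omega> ^ k) ^ j) = (\<Sum>k<R. (\<omega> ^ k) ^ (l + R - j))"
      using that by (simp flip: power_add)
    then show ?thesis by (simp add: sum_root_powers[OF R \<omega>])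
  qed
  have dv: "R dvd l + R - j \<longleftrightarrow> j = l \<or> (l = 0 \<and> j = R)" if "j \<le> R" for j
  proof
    assume "R dvd l + R - j"
    then obtain q where q: "l + R - j = R * q" by auto
    have "R * q < 2 * R" using q l that by linarith
    then have "q = 0 \<or> q = 1" using R by (cases q; cases "q - 1") (auto simp: algebra_simps)
    then show "j = l \<or> (l = 0 \<and> j = R)" using q l that by auto
  qed (use that l in auto)
  have zR: "1 - z ^ R \<noteq> 0"
  proof
    assume "1 - z ^ R = 0"
    then have "cmod z ^ R = 1" by (metis norm_one norm_power right_minus_eq)
    then show False using z R power_less_one_iff[of "cmod z" R] by auto
  qed
  have e: "(t + z) / (t - z) * (1 - z ^ R) = (\<Sum>j<R. z ^ j * cnj t ^ j) + (\<Sum>j<R. z ^ Suc j * cnj t ^ Suc j)"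
    if t: "cmod t = 1" "t ^ R = 1" for t
  proof -
    have t1: "cnj t * t = 1" using t complex_norm_square[of t] by (simp add: mult.commute)
    have "t \<noteq> 0" "t \<noteq> z" using t z by auto
    define u where "u = z * cnj t"
    have zu: "z = u * t" using t1 by (simp add: u_def mult.assoc)
    have "u \<noteq> 1" using zu \<open>t \<noteq> z\<close> by auto
    have "(1 - u) * (\<Sum>j<R. u ^ j) = 1 - u ^ R" by (rule one_diff_power_eq[symmetric])
    moreover have "u ^ R = z ^ R" using t(2) by (simp add: zu power_mult_distrib)
    ultimately have g: "1 - z ^ R = (1 - u) * (\<Sum>j<R. u ^ j)" by simp
    have "(t + z) / (t - z) = (t * (1 + u)) / (t * (1 - u))" by (simp add: zu algebra_simps)
    also have "\<dots> = (1 + u) / (1 - u)" using \<open>t \<noteq> 0\<close> by simp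
    finally have "(t + z) / (t - z) * (1 - z ^ R) = (1 + u) * (\<Sum>j<R. u ^ j)" using \<open>u \<noteq> 1\<close> g by simp
    also have "\<dots> = (\<Sum>j<R. u ^ j) + (\<Sum>j<R. u ^ Suc j)" by (simp add: distrib_right sum_distrib_left sum.distrib)
    finally show ?thesis by (simp only: u_def power_mult_distrib)
  qed
  have cw: "cmod (\<omega> ^ k) = 1" "(\<omega> ^ k) ^ R = 1" for k
    using c \<omega>[of "k * R"] by (simp_all add: norm_power power_mult)
  have sw: "(\<Sum>k<R. (\<omega> ^ k) ^ l * (\<Sum>j<R. z ^ f j * cnj (\<omega> ^ k) ^ f j)) = (\<Sum>j<R. z ^ f j * (\<Sum>k<R. (\<omega> ^ k) ^ l * cnj (\<omega> ^ k) ^ f j))" for f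
    unfolding sum_distrib_left by (subst sum.swap) (simp only: mult.left_commute)
  have "(\<Sum>k<R. (\<omega> ^ k) ^ l * ((\<omega> ^ k + z) / (\<omega> ^ k - z))) * (1 - z ^ R)
      = (\<Sum>k<R. (\<omega> ^ k) ^ l * ((\<omega> ^ k + z) / (\<omega> ^ k - z) * (1 - z ^ R)))"
    by (simp only: sum_distrib_right mult.assoc)
  also have "\<dots> = (\<Sum>j<R. z ^ j * (of_nat R * of_bool (R dvd l + R - j))) + (\<Sum>j<R. z ^ Suc j * (of_nat R * of_bool (R dvd l + R - Suc j)))"
    unfolding e[OF cw] distrib_left sum.distrib sw[of "\<lambda>j. j"] sw[of Suc]
    by (rule arg_cong2[where f = "(+)"]; (rule sum.cong, rule refl, rule arg_cong2[where f = "(*)"], rule refl, rule orth, simp))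
  also have "(\<Sum>j<R. z ^ j * (of_nat R * of_bool (R dvd l + R - j))) = (\<Sum>j<R. of_nat R * z ^ j * of_bool (j = l))"
    by (intro sum.cong refl) (auto simp: dv)
  also have "\<dots> = of_nat R * z ^ l" by (rule of_bool_sum) (use l in auto)
  also have "(\<Sum>j<R. z ^ Suc j * (of_nat R * of_bool (R dvd l + R - Suc j))) = (if l = 0 then of_nat R * z ^ R else of_nat R * z ^ l)"
  proof (cases "l = 0")
    case True
    have dv0: "R dvd R - Suc j \<longleftrightarrow> j = R - 1" if "j < R" for j
      using dv[of "Suc j"] that True by auto
    have "(\<Sum>j<R. z ^ Suc j * (of_nat R * of_bool (R dvd l + R - Suc j))) = (\<Sum>j<R. of_nat R * z ^ Suc j * of_bool (j = R - 1))"
      using True by (intro sum.cong refl) (auto simp: dv0 simp del: power_Suc)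
    also have "\<dots> = of_nat R * z ^ Suc (R - 1)" by (rule of_bool_sum) (use R in auto)
    finally show ?thesis using True R by simp
  next
    case False
    have "(\<Sum>j<R. z ^ Suc j * (of_nat R * of_bool (R dvd l + R - Suc j))) = (\<Sum>j<R. of_nat R * z ^ Suc j * of_bool (j = l - 1))"
      using False by (intro sum.cong refl) (auto simp: dv Suc_le_eq simp del: power_Suc)
    also have "\<dots> = of_nat R * z ^ Suc (l - 1)" by (rule of_bool_sum) (use l in auto)
    finally show ?thesis using False by simp
  qed
  finally show ?thesis using zR by (auto simp: field_simps)
qed

text \<open>On the roots of unity the power -l is the power R - l. The aliased term
  \<open>z ^ (R - l)\<close> disappears as R grows.\<close>

lemma roots_of_unity_kernel_cnj:
  assumes R: "R > 0" and c: "cmod \<omega> = 1" and \<omega>: "\<And>m. \<omega> ^ m = (1::complex) \<longleftrightarrow> R dvd m" and z: "cmod z < 1" and l: "l < R"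
  shows "(\<Sum>k<R. cnj (\<omega> ^ k) ^ l * ((\<omega> ^ k + z) / (\<omega> ^ k - z))) = of_nat R * (if l = 0 then 1 + z ^ R else 2 * z ^ (R - l)) / (1 - z ^ R)"
proof (cases "l = 0")
  case False
  have "cnj (\<omega> ^ k) ^ l = (\<omega> ^ k) ^ (R - l)" for k
  proof -
    have "cnj \<omega> * \<omega> = 1" using c complex_norm_square[of \<omega>] by (simp add: mult.commute)
    then have "cnj (\<omega> ^ k) ^ l * (\<omega> ^ k) ^ l = 1" by (simp add: power_mult_distrib[symmetric])
    moreover have "(\<omega> ^ k) ^ R = 1" using \<omega>[of "k * R"] by (simp add: power_mult)
    then have "(\<omega> ^ k) ^ (R - l) * (\<omega> ^ k) ^ l = 1" using l by (simp flip: power_add)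
    moreover have "\<omega> \<noteq> 0" using c by auto
    ultimately show ?thesis by (metis mult_right_cancel power_not_zero)
  qed
  then show ?thesis using roots_of_unity_kernel[OF R c \<omega> z, of "R - l"] False l R by simp
qed (use roots_of_unity_kernel[OF R c \<omega> z R] in simp)

context hermitian_form
begin

lemma tendsto_frm:
  assumes "\<And>p. ((\<lambda>n. \<xi> n p) \<longlongrightarrow> \<xi>' p) G" "\<And>p. ((\<lambda>n. \<eta> n p) \<longlongrightarrow> \<eta>' p) G"
  shows "((\<lambda>n. frm (\<xi> n) (\<eta> n)) \<longlongrightarrow> frm \<xi>' \<eta>') G"
  unfolding frm_def by (intro tendsto_intros assms)

lemma tendsto_qn:
  assumes "\<And>p. ((\<lambda>n. \<xi> n p) \<longlongrightarrow> \<xi>' p) G"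
  shows "((\<lambda>n. qn (\<xi> n)) \<longlongrightarrow> qn \<xi>') G"
  unfolding qn_def by (intro tendsto_Re tendsto_frm assms)

lemma tendsto_herg:
  assumes "\<And>p b c. ((\<lambda>n. F n p b c) \<longlongrightarrow> F' p b c) G"
  shows "((\<lambda>n. herg (F n) \<alpha>) \<longlongrightarrow> herg F' \<alpha>) G"
  unfolding herg_def by (intro tendsto_intros tendsto_frm assms)

text \<open>The added constant contributes a purely imaginary number. This is needed because sampled
  real parts determine a holomorphic function only up to such a constant.\<close>

lemma herg_add_skew:
  assumes C: "\<And>b c. C b c = - cnj (C c b)"
  shows "herg (\<lambda>p b c. F p b c + C b c) \<alpha> = herg F \<alpha>"
proof -
  define X where "X b c = C b c * frm (\<alpha> c) (\<alpha> b)" for b c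
  have "cnj (X b c) = - X c b" for b c
    using C[of c b] frm_cnj[of "\<alpha> c" "\<alpha> b"] by (simp add: X_def)
  then have "cnj (\<Sum>b\<in>UNIV. \<Sum>c\<in>UNIV. X b c) = - (\<Sum>b\<in>UNIV. \<Sum>c\<in>UNIV. X c b)" by (simp add: cnj_sum sum_negf)
  also have "(\<Sum>b\<in>UNIV. \<Sum>c\<in>UNIV. X c b) = (\<Sum>b\<in>UNIV. \<Sum>c\<in>UNIV. X b c)" by (rule sum.swap)
  finally have z: "Re (\<Sum>b\<in>UNIV. \<Sum>c\<in>UNIV. X b c) = 0" by (simp add: complex_eq_iff)
  have "frm (\<lambda>p. \<Sum>c\<in>UNIV. (F p b c + C b c) * \<alpha> c p) (\<alpha> b) = frm (\<lambda>p. \<Sum>c\<in>UNIV. F p b c * \<alpha> c p) (\<alpha> b) + (\<Sum>c\<in>UNIV. X b c)" for b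
    unfolding X_def by (simp only: distrib_right sum.distrib frm_add1 frm_sum1)
  then show ?thesis using z by (simp add: herg_def sum.distrib)
qed

text \<open>The weights are the Hermitian parts of F at the R-th roots of unity, divided by R. Their
  first moment is exactly zero, not only in the limit, because \<open>A 1\<close> vanishes and R
  exceeds all exponents that could alias to it.\<close>

lemma herg_poly_nonneg:
  fixes A :: "nat \<Rightarrow> 'n::finite \<Rightarrow> 'n \<Rightarrow> complex"
  assumes z: "\<And>p. cmod (\<zeta> p) < 1"
    and mp: "\<And>(J :: (nat \<times> 'n) set) \<tau> (w :: nat \<times> 'n \<Rightarrow> 'n \<Rightarrow> complex). finite J \<Longrightarrow> (\<And>j. j \<in> J \<Longrightarrow> cmod (\<tau> j) = 1)
      \<Longrightarrow> (\<And>a b. (\<Sum>j\<in>J. \<tau> j * cnj (w j a) * w j b) = 0)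
      \<Longrightarrow> (\<And>x. (\<forall>j\<in>J. (\<Sum>a\<in>UNIV. w j a * x a) = 0) \<Longrightarrow> x = (\<lambda>_. 0)) \<Longrightarrow> meas_pos J \<tau> w"
    and A1: "\<And>b c. A 1 b c = 0"
    and pos: "\<And>t x. cmod t = 1 \<Longrightarrow> x \<noteq> (\<lambda>_. 0) \<Longrightarrow> 0 < Re (\<Sum>b\<in>UNIV. \<Sum>c\<in>UNIV. cnj (x b) * (\<Sum>l\<le>d. A l b c * t ^ l) * x c)"
  shows "0 \<le> herg (\<lambda>p b c. \<Sum>l\<le>d. A l b c * \<zeta> p ^ l) \<alpha>"
proof -
  define F where "F t b c = (\<Sum>l\<le>d. A l b c * t ^ l)" for t b c
  define GR where "GR R p b c = (1 / 2) * ((\<Sum>l\<le>d. A l b c * (if l = 0 then 1 + \<zeta> p ^ R else 2 * \<zeta> p ^ l))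
     + (\<Sum>l\<le>d. cnj (A l c b) * (if l = 0 then 1 + \<zeta> p ^ R else 2 * \<zeta> p ^ (R - l)))) / (1 - \<zeta> p ^ R)" for R p b c
  \<comment> \<open>In the first moment the conjugated coefficients occur with exponents l + 1 \<le>
    d + 1, none of which R divides.\<close>
  have ev: "0 \<le> herg (GR R) \<alpha>" if Rd: "R > d + 1" for R
  proof -
    have R: "R > 0" using Rd by simp
    obtain \<omega> where \<omega>: "cmod \<omega> = 1" "\<And>m. \<omega> ^ m = 1 \<longleftrightarrow> R dvd m" using primitive_root_of_unity[OF R] by metis
    define t where "t k = \<omega> ^ k" for k
    have t1: "cmod (t k) = 1" for k using \<omega>(1) by (simp add: t_def norm_power)
    define H where "H k b c = (F (t k) b c + cnj (F (t k) c b)) / of_nat (2 * R)" for k b c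
    have Hform: "Re (\<Sum>b\<in>UNIV. \<Sum>c\<in>UNIV. cnj (x b) * H k b c * x c)
        = Re (\<Sum>b\<in>UNIV. \<Sum>c\<in>UNIV. cnj (x b) * F (t k) b c * x c) / real R" for k x
    proof -
      define Q where "Q = (\<Sum>b\<in>UNIV. \<Sum>c\<in>UNIV. cnj (x b) * F (t k) b c * x c)"
      have "cnj Q = (\<Sum>b\<in>UNIV. \<Sum>c\<in>UNIV. cnj (x c) * cnj (F (t k) b c) * x b)"
        by (simp add: Q_def cnj_sum mult_ac)
      also have "\<dots> = (\<Sum>b\<in>UNIV. \<Sum>c\<in>UNIV. cnj (x b) * cnj (F (t k) c b) * x c)" by (rule sum.swap)
      finally have cQ: "cnj Q = (\<Sum>b\<in>UNIV. \<Sum>c\<in>UNIV. cnj (x b) * cnj (F (t k) c b) * x c)" .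
      have "(\<Sum>b\<in>UNIV. \<Sum>c\<in>UNIV. cnj (x b) * H k b c * x c) = (Q + cnj Q) / of_nat (2 * R)"
        unfolding cQ unfolding Q_def H_def sum.distrib[symmetric] sum_divide_distrib
        by (intro sum.cong refl) (simp add: distrib_left distrib_right)
      also have "\<dots> = of_real (Re Q / real R)" using R by (simp add: complex_add_cnj field_simps)
      finally show ?thesis by (simp add: Q_def)
    qed
    have "\<exists>w :: 'n \<Rightarrow> 'n \<Rightarrow> complex. \<forall>b c. H k b c = (\<Sum>e\<in>UNIV. cnj (w e b) * w e c)" for k
    proof (rule psd_factor)
      show "H k b c = cnj (H k c b)" for b c by (simp add: H_def add.commute)
      show "0 \<le> Re (\<Sum>b\<in>UNIV. \<Sum>c\<in>UNIV. cnj (x b) * H k b c * x c)" for x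
        unfolding Hform using pos[OF t1[of k], of x] by (cases "x = (\<lambda>_. 0)") (auto simp: F_def intro!: divide_nonneg_nonneg)
    qed
    then obtain w :: "nat \<Rightarrow> 'n \<Rightarrow> 'n \<Rightarrow> complex" where w: "\<And>k b c. H k b c = (\<Sum>e\<in>UNIV. cnj (w k e b) * w k e c)" by metis
    define J :: "(nat \<times> 'n) set" where "J = {..<R} \<times> UNIV"
    define \<tau> where "\<tau> j = cnj (t (fst j))" for j :: "nat \<times> 'n"
    define v where "v j = w (fst j) (snd j)" for j
    have finJ: "finite J" by (simp add: J_def)
    have \<tau>1: "cmod (\<tau> j) = 1" for j by (simp add: \<tau>_def t1)
    have sumJ: "(\<Sum>j\<in>J. f (t (fst j)) * (cnj (v j b) * v j c)) = (\<Sum>k<R. f (t k) * H k b c)" for f b c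
    proof -
      have "(\<Sum>k<R. f (t k) * H k b c) = (\<Sum>k<R. \<Sum>e\<in>UNIV. f (t k) * (cnj (w k e b) * w k e c))"
        by (simp add: w sum_distrib_left)
      also have "\<dots> = (\<Sum>(k,e)\<in>J. f (t k) * (cnj (w k e b) * w k e c))" unfolding J_def by (rule sum.cartesian_product)
      finally show ?thesis by (simp add: v_def case_prod_beta)
    qed
    have ct: "cnj (t k) * t k = 1" for k using t1[of k] complex_norm_square[of "t k"] by (simp add: mult.commute)
    have mH: "(\<Sum>k<R. cnj (t k) * H k b c) = 0" for b c
    proof -
      have "(\<Sum>k<R. cnj (t k) * F (t k) b c) = (\<Sum>k<R. \<Sum>l\<le>d. A l b c * (cnj (t k) * t k ^ l))"
        by (simp add: F_def sum_distrib_left mult_ac)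
      also have "\<dots> = (\<Sum>l\<le>d. A l b c * (\<Sum>k<R. cnj (t k) * t k ^ l))" unfolding sum_distrib_left by (rule sum.swap)
      also have "\<dots> = 0"
      proof (intro sum.neutral ballI)
        fix l assume l: "l \<in> {..d}"
        have "(\<Sum>k<R. cnj (t k) * t k ^ l) = 0" if "l \<noteq> 1"
        proof (cases l)
          case 0
          have "(\<Sum>k<R. cnj (t k) * t k ^ l) = cnj (\<Sum>k<R. (\<omega> ^ k) ^ 1)" using 0 by (simp add: t_def cnj_sum)
          also have "\<dots> = 0" unfolding sum_root_powers[OF R \<omega>(2)] using Rd by simp
          finally show ?thesis .
        next
          case (Suc m)
          have "(\<Sum>k<R. cnj (t k) * t k ^ l) = (\<Sum>k<R. (\<omega> ^ k) ^ m)"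
            using Suc ct by (simp add: mult.assoc[symmetric]) (simp add: t_def)
          also have "\<dots> = 0" unfolding sum_root_powers[OF R \<omega>(2)] using Rd Suc l that by (auto dest: dvd_imp_le)
          finally show ?thesis .
        qed
        then show "A l b c * (\<Sum>k<R. cnj (t k) * t k ^ l) = 0" using A1[of b c] by (cases "l = 1") auto
      qed
      finally have 1: "(\<Sum>k<R. cnj (t k) * F (t k) b c) = 0" .
      have "(\<Sum>k<R. cnj (t k) * cnj (F (t k) c b)) = cnj (\<Sum>k<R. \<Sum>l\<le>d. A l c b * (\<omega> ^ k) ^ Suc l)"
        by (simp add: F_def t_def cnj_sum sum_distrib_left mult_ac)
      also have "(\<Sum>k<R. \<Sum>l\<le>d. A l c b * (\<omega> ^ k) ^ Suc l) = (\<Sum>l\<le>d. A l c b * (\<Sum>k<R. (\<omega> ^ k) ^ Suc l))"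
        unfolding sum_distrib_left by (rule sum.swap)
      also have "\<dots> = 0" unfolding sum_root_powers[OF R \<omega>(2)] using Rd by (auto intro!: sum.neutral dest!: dvd_imp_le)
      finally have 2: "(\<Sum>k<R. cnj (t k) * cnj (F (t k) c b)) = 0" by simp
      have "(\<Sum>k<R. cnj (t k) * H k b c) = ((\<Sum>k<R. cnj (t k) * F (t k) b c) + (\<Sum>k<R. cnj (t k) * cnj (F (t k) c b))) / of_nat (2 * R)"
        unfolding H_def sum.distrib[symmetric] sum_divide_distrib by (simp add: distrib_left)
      then show ?thesis by (simp only: 1 2)  simp
    qed
    have mpJ: "meas_pos J \<tau> v"
    proof (rule mp[OF finJ \<tau>1])
      show "(\<Sum>j\<in>J. \<tau> j * cnj (v j a) * v j b) = 0" for a b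
        using sumJ[of cnj a b] mH[of a b] by (simp add: \<tau>_def mult.assoc)
    next
      fix x assume x: "\<forall>j\<in>J. (\<Sum>a\<in>UNIV. v j a * x a) = 0"
      show "x = (\<lambda>_. 0)"
      proof (rule ccontr)
        assume nz: "x \<noteq> (\<lambda>_. 0)"
        have "(\<Sum>c\<in>UNIV. H 0 b c * x c) = 0" for b
        proof -
          have "(\<Sum>c\<in>UNIV. H 0 b c * x c) = (\<Sum>c\<in>UNIV. \<Sum>e\<in>UNIV. cnj (w 0 e b) * (w 0 e c * x c))"
            by (simp add: w sum_distrib_right mult.assoc)
          also have "\<dots> = (\<Sum>e\<in>UNIV. cnj (w 0 e b) * (\<Sum>c\<in>UNIV. w 0 e c * x c))"
            unfolding sum_distrib_left by (rule sum.swap)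
          also have "\<dots> = 0"
          proof (intro sum.neutral ballI)
            fix e :: 'n
            have "(0, e) \<in> J" using R by (simp add: J_def)
            then show "cnj (w 0 e b) * (\<Sum>c\<in>UNIV. w 0 e c * x c) = 0" using x by (auto simp: v_def dest!: bspec)
          qed
          finally show ?thesis .
        qed
        then have "(\<Sum>b\<in>UNIV. \<Sum>c\<in>UNIV. cnj (x b) * H 0 b c * x c) = 0"
          by (simp add: mult.assoc flip: sum_distrib_left)
        then show False using Hform[of x 0] pos[OF t1[of 0] nz] R by (simp add: F_def)
      qed
    qed
    have nz: "1 - \<zeta> p * \<tau> j \<noteq> 0" for p j
    proof
      assume "1 - \<zeta> p * \<tau> j = 0"
      then have "cmod (\<zeta> p * \<tau> j) = 1" by simp
      then show False using z[of p] \<tau>1[of j] by (simp add: norm_mult)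
    qed
    define V where "V j p = (\<Sum>b\<in>UNIV. v j b * \<alpha> b p) / (1 - \<zeta> p * \<tau> j)" for j p
    have V: "(1 - \<zeta> p * \<tau> j) * V j p = (\<Sum>b\<in>UNIV. v j b * \<alpha> b p)" for j p
      using nz by (simp add: V_def)
    have "0 \<le> (\<Sum>j\<in>J. qn (V j)) - (\<Sum>j\<in>J. qn (\<lambda>p. \<zeta> p * V j p))"
      using mpJ[unfolded meas_pos_def, rule_format, of V \<alpha>] V by simp
    also have "\<dots> = herg (\<lambda>p b c. \<Sum>j\<in>J. cnj (v j b) * v j c * ((1 + \<zeta> p * \<tau> j) / (1 - \<zeta> p * \<tau> j))) \<alpha>"
      by (rule herg_meas[OF z \<tau>1 finJ V])
    also have "(\<lambda>p b c. \<Sum>j\<in>J. cnj (v j b) * v j c * ((1 + \<zeta> p * \<tau> j) / (1 - \<zeta> p * \<tau> j))) = GR R"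
    proof (intro ext)
      fix p b c
      define g where "g s = (s + \<zeta> p) / (s - \<zeta> p)" for s
      have "(1 + \<zeta> p * \<tau> j) / (1 - \<zeta> p * \<tau> j) = g (t (fst j))" for j
      proof -
        have "t (fst j) \<noteq> 0" using t1[of "fst j"] by auto
        then have "(1 + \<zeta> p * \<tau> j) / (1 - \<zeta> p * \<tau> j) = ((1 + \<zeta> p * \<tau> j) * t (fst j)) / ((1 - \<zeta> p * \<tau> j) * t (fst j))" by simp
        then show ?thesis using ct[of "fst j"] by (simp add: g_def \<tau>_def distrib_right left_diff_distrib mult.assoc)
      qed
      then have "(\<Sum>j\<in>J. cnj (v j b) * v j c * ((1 + \<zeta> p * \<tau> j) / (1 - \<zeta> p * \<tau> j))) = (\<Sum>k<R. g (t k) * H k b c)"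
        using sumJ[of g b c] by (simp add: mult.commute)
      also have "\<dots> = ((\<Sum>k<R. F (t k) b c * g (t k)) + (\<Sum>k<R. cnj (F (t k) c b) * g (t k))) / of_nat (2 * R)"
        unfolding H_def sum.distrib[symmetric] sum_divide_distrib by (simp add: algebra_simps)
      also have "(\<Sum>k<R. F (t k) b c * g (t k)) = (\<Sum>l\<le>d. A l b c * (\<Sum>k<R. t k ^ l * g (t k)))"
        unfolding F_def sum_distrib_left sum_distrib_right mult.assoc by (rule sum.swap)
      also have "\<dots> = (\<Sum>l\<le>d. A l b c * (of_nat R * (if l = 0 then 1 + \<zeta> p ^ R else 2 * \<zeta> p ^ l) / (1 - \<zeta> p ^ R)))"
        using Rd by (intro sum.cong refl arg_cong2[where f = "(*)"], unfold g_def t_def)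
          (rule roots_of_unity_kernel[OF R \<omega> z], simp)
      also have "(\<Sum>k<R. cnj (F (t k) c b) * g (t k)) = (\<Sum>l\<le>d. cnj (A l c b) * (\<Sum>k<R. cnj (t k) ^ l * g (t k)))"
        unfolding F_def cnj_sum complex_cnj_mult complex_cnj_power sum_distrib_left sum_distrib_right mult.assoc by (rule sum.swap)
      also have "\<dots> = (\<Sum>l\<le>d. cnj (A l c b) * (of_nat R * (if l = 0 then 1 + \<zeta> p ^ R else 2 * \<zeta> p ^ (R - l)) / (1 - \<zeta> p ^ R)))"
        using Rd by (intro sum.cong refl arg_cong2[where f = "(*)"], unfold g_def t_def)
          (rule roots_of_unity_kernel_cnj[OF R \<omega> z], simp)
      also have "((\<Sum>l\<le>d. A l b c * (of_nat R * (if l = 0 then 1 + \<zeta> p ^ R else 2 * \<zeta> p ^ l) / (1 - \<zeta> p ^ R)))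
          + (\<Sum>l\<le>d. cnj (A l c b) * (of_nat R * (if l = 0 then 1 + \<zeta> p ^ R else 2 * \<zeta> p ^ (R - l)) / (1 - \<zeta> p ^ R)))) / of_nat (2 * R) = GR R p b c"
      proof -
        have "(\<Sum>l\<le>d. a l * (of_nat R * h l / y)) = of_nat R * (\<Sum>l\<le>d. a l * h l) / y" for a h :: "nat \<Rightarrow> complex" and y
          by (simp add: sum_distrib_left sum_divide_distrib mult_ac)
        moreover have "(of_nat R * X / y + of_nat R * Y / y) / of_nat (2 * R) = (1 / 2) * (X + Y) / y" for X Y y :: complex
          using R by (simp add: add_divide_distrib[symmetric] distrib_left[symmetric])
        ultimately show ?thesis unfolding GR_def by simp
      qed
      finally show "(\<Sum>j\<in>J. cnj (v j b) * v j c * ((1 + \<zeta> p * \<tau> j) / (1 - \<zeta> p * \<tau> j))) = GR R p b c" .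
    qed
    finally show ?thesis .
  qed
  \<comment> \<open>Adding \<open>C\<close> replaces F(0) by its Hermitian part.\<close>
  define C where "C b c = (cnj (A 0 c b) - A 0 b c) / 2" for b c
  have lim: "(\<lambda>R. GR R p b c) \<longlonglongrightarrow> F (\<zeta> p) b c + C b c" for p b c
  proof -
    have z0: "(\<lambda>R. \<zeta> p ^ R) \<longlonglongrightarrow> 0" by (rule LIMSEQ_power_zero) (rule z)
    have zl: "(\<lambda>R. \<zeta> p ^ (R - l)) \<longlonglongrightarrow> 0" for l
      by (rule LIMSEQ_offset[where k = l]) (simp add: z0)
    have l1: "(\<lambda>R. if l = 0 then 1 + \<zeta> p ^ R else 2 * \<zeta> p ^ l) \<longlonglongrightarrow> (if l = 0 then 1 else 2 * \<zeta> p ^ l)" for l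
      using tendsto_add[OF tendsto_const z0, of 1] by simp
    have l2: "(\<lambda>R. if l = 0 then 1 + \<zeta> p ^ R else 2 * \<zeta> p ^ (R - l)) \<longlonglongrightarrow> (if l = 0 then 1 else 0)" for l
      using tendsto_add[OF tendsto_const z0, of 1] tendsto_mult_right_zero[OF zl[of l], of 2] by simp
    have "(\<lambda>R. GR R p b c) \<longlonglongrightarrow> (1 / 2) * ((\<Sum>l\<le>d. A l b c * (if l = 0 then 1 else 2 * \<zeta> p ^ l))
     + (\<Sum>l\<le>d. cnj (A l c b) * (if l = 0 then 1 else 0))) / (1 - 0)"
      unfolding GR_def by (intro tendsto_intros l1 l2 z0) simp
    also have "(\<Sum>l\<le>d. cnj (A l c b) * (if l = 0 then 1 else 0)) = cnj (A 0 c b)"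
      by (subst sum.remove[of _ 0]) (auto intro!: sum.neutral)
    also have "(\<Sum>l\<le>d. A l b c * (if l = 0 then 1 else 2 * \<zeta> p ^ l)) = 2 * F (\<zeta> p) b c - A 0 b c"
    proof -
      have "(\<Sum>l\<le>d. A l b c * (if l = 0 then 1 else 2 * \<zeta> p ^ l)) = A 0 b c + (\<Sum>l\<in>{..d} - {0}. 2 * (A l b c * \<zeta> p ^ l))"
        by (subst sum.remove[of _ 0]) (auto intro!: sum.cong)
      moreover have "F (\<zeta> p) b c = A 0 b c + (\<Sum>l\<in>{..d} - {0}. A l b c * \<zeta> p ^ l)"
        unfolding F_def by (subst sum.remove[of _ 0]) auto
      ultimately show ?thesis by (simp add: sum_distrib_left[symmetric])
    qed
    finally show ?thesis by (simp add: C_def field_simps)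
  qed
  have "(\<lambda>R. herg (GR R) \<alpha>) \<longlonglongrightarrow> herg (\<lambda>p b c. F (\<zeta> p) b c + C b c) \<alpha>"
    by (rule tendsto_herg) (rule lim)
  moreover have "eventually (\<lambda>R. 0 \<le> herg (GR R) \<alpha>) sequentially"
    using eventually_gt_at_top[of "d + 1"] by eventually_elim (rule ev)
  ultimately have "0 \<le> herg (\<lambda>p b c. F (\<zeta> p) b c + C b c) \<alpha>"
    by (rule tendsto_lowerbound) simp
  also have "\<dots> = herg (\<lambda>p. F (\<zeta> p)) \<alpha>"
    by (rule herg_add_skew) (simp add: C_def field_simps)
  finally show ?thesis by (simp add: F_def[abs_def])
qed

end

section \<open>Bounded holomorphic functions with vanishing derivative at the origin\<close>

lemma power_series_tail:
  fixes A :: "nat \<Rightarrow> complex"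
  assumes sm: "summable (\<lambda>l. norm (A l))" and F: "(\<lambda>l. A l * x ^ l) sums y" and x: "cmod x \<le> 1"
  shows "cmod (y - (\<Sum>l\<le>d. A l * x ^ l)) \<le> (\<Sum>i. norm (A (i + Suc d)))"
proof -
  have le: "norm (A l * x ^ l) \<le> norm (A l)" for l
    using x mult_left_le[of "cmod x ^ l" "cmod (A l)"] by (simp add: norm_mult norm_power power_le_one)
  have s1: "summable (\<lambda>i. norm (A (i + Suc d)))" using sm by (rule summable_ignore_initial_segment)
  have s2: "summable (\<lambda>i. norm (A (i + Suc d) * x ^ (i + Suc d)))"
    by (rule summable_comparison_test'[OF s1, of 0]) (simp only: real_norm_def abs_norm_cancel le)
  have "(\<Sum>i. A (i + Suc d) * x ^ (i + Suc d)) = y - (\<Sum>l\<le>d. A l * x ^ l)"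
    using suminf_minus_initial_segment[OF sums_summable[OF F], of "Suc d"] sums_unique[OF F] by (simp add: lessThan_Suc_atMost)
  then have "cmod (y - (\<Sum>l\<le>d. A l * x ^ l)) \<le> (\<Sum>i. norm (A (i + Suc d) * x ^ (i + Suc d)))"
    using summable_norm[OF s2] by simp
  also have "\<dots> \<le> (\<Sum>i. norm (A (i + Suc d)))" by (rule suminf_le[OF le s2 s1])
  finally show ?thesis .
qed

context hermitian_form
begin

text \<open>As \<rho> > 1, Taylor sums converge uniformly on the unit circle. Once the sum of all
  tails is below \<delta>, the Taylor polynomial inherits strict positivity there, and its linear
  coefficient is zero.\<close>

lemma herg_holomorphic_nonneg:
  fixes F :: "complex \<Rightarrow> 'n::finite \<Rightarrow> 'n \<Rightarrow> complex"
  assumes z: "\<And>p. cmod (\<zeta> p) < 1"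
    and mp: "\<And>(J :: (nat \<times> 'n) set) \<tau> (w :: nat \<times> 'n \<Rightarrow> 'n \<Rightarrow> complex). finite J \<Longrightarrow> (\<And>j. j \<in> J \<Longrightarrow> cmod (\<tau> j) = 1)
      \<Longrightarrow> (\<And>a b. (\<Sum>j\<in>J. \<tau> j * cnj (w j a) * w j b) = 0)
      \<Longrightarrow> (\<And>x. (\<forall>j\<in>J. (\<Sum>a\<in>UNIV. w j a * x a) = 0) \<Longrightarrow> x = (\<lambda>_. 0)) \<Longrightarrow> meas_pos J \<tau> w"
    and \<rho>: "1 < \<rho>" and hol: "\<And>b c. (\<lambda>x. F x b c) holomorphic_on ball 0 \<rho>"
    and d0: "\<And>b c. deriv (\<lambda>x. F x b c) 0 = 0"
    and \<delta>: "0 < \<delta>" and pos: "\<And>t x. cmod t = 1 \<Longrightarrow> \<delta> * (\<Sum>b\<in>UNIV. (cmod (x b))\<^sup>2) \<le> Re (\<Sum>b\<in>UNIV. \<Sum>c\<in>UNIV. cnj (x b) * F t b c * x c)"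
  shows "0 \<le> herg (\<lambda>p. F (\<zeta> p)) \<alpha>"
proof -
  define A where "A l b c = (deriv ^^ l) (\<lambda>x. F x b c) 0 / fact l" for l b c
  have ser: "(\<lambda>l. A l b c * x ^ l) sums F x b c" if "cmod x < \<rho>" for x b c
    using holomorphic_power_series[OF hol[of b c], of x] that by (simp add: A_def)
  have sm: "summable (\<lambda>l. norm (A l b c))" for b c
  proof -
    \<comment> \<open>A point strictly between 1 and \<rho>: convergence there gives absolute
      convergence at 1.\<close>
    define s :: complex where "s = of_real ((1 + \<rho>) / 2)"
    have s: "cmod s = (1 + \<rho>) / 2" unfolding s_def norm_of_real using \<rho> by simp
    have "summable (\<lambda>l. A l b c * s ^ l)" by (rule sums_summable[OF ser]) (use s \<rho> in simp)
    from powser_insidea[OF this, of 1] show ?thesis using s \<rho> by simp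
  qed
  define err where "err d = (\<Sum>b\<in>UNIV. \<Sum>c\<in>UNIV. \<Sum>i. norm (A (i + Suc d) b c))" for d
  have err0: "err \<longlonglongrightarrow> (\<Sum>b\<in>(UNIV::'n set). \<Sum>c\<in>(UNIV::'n set). 0)"
    unfolding err_def by (intro tendsto_sum LIMSEQ_Suc[OF suminf_exist_split2[OF sm]])
  then have ev: "eventually (\<lambda>d. err d < \<delta>) sequentially"
    using order_tendstoD(2)[of err 0 sequentially \<delta>] \<delta> by simp
  have "0 \<le> herg (\<lambda>p b c. \<Sum>l\<le>d. A l b c * \<zeta> p ^ l) \<alpha>" if d: "err d < \<delta>" for d
  proof (rule herg_poly_nonneg[OF z mp])
    show "A 1 b c = 0" for b c by (simp add: A_def d0)
    fix t :: complex and x :: "'n \<Rightarrow> complex"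
    assume t: "cmod t = 1" and x: "x \<noteq> (\<lambda>_. 0)"
    define X where "X = (\<Sum>b\<in>UNIV. (cmod (x b))\<^sup>2)"
    obtain b0 where "x b0 \<noteq> 0" using x by auto
    then have X: "X > 0" unfolding X_def by (intro sum_pos2[of _ b0]) auto
    define P where "P b c = (\<Sum>l\<le>d. A l b c * t ^ l)" for b c
    have E: "cmod (F t b c - P b c) \<le> (\<Sum>i. norm (A (i + Suc d) b c))" for b c
      unfolding P_def by (rule power_series_tail[OF sm ser]) (use t \<rho> in auto)
    have xX: "cmod (x b) * cmod (x c) \<le> X" for b c
    proof -
      have q: "(cmod (x b))\<^sup>2 \<le> X" for b unfolding X_def by (rule member_le_sum) auto
      have "2 * (cmod (x b) * cmod (x c)) \<le> (cmod (x b))\<^sup>2 + (cmod (x c))\<^sup>2"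
        using sum_squares_bound[of "cmod (x b)" "cmod (x c)"] by simp
      then show ?thesis using q[of b] q[of c] by linarith
    qed
    have "cmod (\<Sum>b\<in>UNIV. \<Sum>c\<in>UNIV. cnj (x b) * (F t b c - P b c) * x c) \<le> (\<Sum>b\<in>UNIV. \<Sum>c\<in>UNIV. (\<Sum>i. norm (A (i + Suc d) b c)) * X)"
    proof (intro order_trans[OF norm_sum] sum_mono)
      fix b c
      have "cmod (cnj (x b) * (F t b c - P b c) * x c) = cmod (F t b c - P b c) * (cmod (x b) * cmod (x c))"
        by (simp add: norm_mult)
      also have "\<dots> \<le> (\<Sum>i. norm (A (i + Suc d) b c)) * X"
        by (intro mult_mono E xX suminf_nonneg summable_ignore_initial_segment sm) auto
      finally show "cmod (cnj (x b) * (F t b c - P b c) * x c) \<le> (\<Sum>i. norm (A (i + Suc d) b c)) * X" .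
    qed
    also have "\<dots> = err d * X" by (simp add: err_def sum_distrib_right)
    also have "\<dots> < \<delta> * X" using d X by simp
    finally have "Re (\<Sum>b\<in>UNIV. \<Sum>c\<in>UNIV. cnj (x b) * (F t b c - P b c) * x c) < \<delta> * X"
      using complex_Re_le_cmod le_less_trans by blast
    moreover have "(\<Sum>b\<in>UNIV. \<Sum>c\<in>UNIV. cnj (x b) * (F t b c - P b c) * x c)
       = (\<Sum>b\<in>UNIV. \<Sum>c\<in>UNIV. cnj (x b) * F t b c * x c) - (\<Sum>b\<in>UNIV. \<Sum>c\<in>UNIV. cnj (x b) * P b c * x c)"
      by (simp only: right_diff_distrib left_diff_distrib sum_subtractf)
    ultimately have "Re (\<Sum>b\<in>UNIV. \<Sum>c\<in>UNIV. cnj (x b) * F t b c * x c) - Re (\<Sum>b\<in>UNIV. \<Sum>c\<in>UNIV. cnj (x b) * P b c * x c) < \<delta> * X"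
      by (simp only: minus_complex.sel)
    then show "0 < Re (\<Sum>b\<in>UNIV. \<Sum>c\<in>UNIV. cnj (x b) * (\<Sum>l\<le>d. A l b c * t ^ l) * x c)"
      unfolding P_def[symmetric] using pos[OF t, of x] unfolding X_def[symmetric] by linarith
  qed
  then have ev': "eventually (\<lambda>d. 0 \<le> herg (\<lambda>p b c. \<Sum>l\<le>d. A l b c * \<zeta> p ^ l) \<alpha>) sequentially"
    by (rule eventually_mono[OF ev])
  have "(\<lambda>d. herg (\<lambda>p b c. \<Sum>l\<le>d. A l b c * \<zeta> p ^ l) \<alpha>) \<longlonglongrightarrow> herg (\<lambda>p. F (\<zeta> p)) \<alpha>"
    by (rule tendsto_herg) (use ser z \<rho> in \<open>force simp flip: sums_def_le intro: less_trans\<close>)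
  then show ?thesis by (rule tendsto_lowerbound[OF _ ev']) simp
qed

end

text \<open>A class closed under sums and products of matrices, so that polynomials in S stay in
  it.\<close>

definition flat_at_origin :: "real \<Rightarrow> (complex \<Rightarrow> 'n::finite cmat) \<Rightarrow> bool" where
  "flat_at_origin \<rho> A \<longleftrightarrow> (\<forall>b c. (\<lambda>x. A x $ b $ c) holomorphic_on ball 0 \<rho>
     \<and> ((\<lambda>x. A x $ b $ c) has_field_derivative 0) (at 0))"

lemma flat_at_origin_const: "flat_at_origin \<rho> (\<lambda>_. C)"
  by (simp add: flat_at_origin_def)

lemma flat_at_origin_add: "flat_at_origin \<rho> A \<Longrightarrow> flat_at_origin \<rho> B \<Longrightarrow> flat_at_origin \<rho> (\<lambda>x. A x + B x)"
  unfolding flat_at_origin_def by (auto intro!: holomorphic_intros derivative_eq_intros)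

lemma flat_at_origin_mult: "flat_at_origin \<rho> A \<Longrightarrow> flat_at_origin \<rho> B \<Longrightarrow> flat_at_origin \<rho> (\<lambda>x. A x ** B x)"
  unfolding flat_at_origin_def matrix_matrix_mult_def by (auto intro!: holomorphic_intros derivative_eq_intros)

context hermitian_form
begin

text \<open>\<open>T L\<close> is a partial Neumann sum for the inverse of 1 - S, so
  \<open>F L\<close> approximates the Cayley transform and is a polynomial in S; holomorphy and
  flatness come without inverting. The form is tested at \<beta> = (1 - S) \<alpha>, where in the
  limit it is Re <(1 + S) \<alpha>, (1 - S) \<alpha>>, the difference of the squares of \<alpha> and
  S \<alpha>.\<close>

lemma strictly_contractive_right_mult:
  fixes S :: "complex \<Rightarrow> 'n::finite cmat"
  assumes z: "\<And>p. cmod (\<zeta> p) < 1"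
    and mp: "\<And>(J :: (nat \<times> 'n) set) \<tau> (w :: nat \<times> 'n \<Rightarrow> 'n \<Rightarrow> complex). finite J \<Longrightarrow> (\<And>j. j \<in> J \<Longrightarrow> cmod (\<tau> j) = 1)
      \<Longrightarrow> (\<And>a b. (\<Sum>j\<in>J. \<tau> j * cnj (w j a) * w j b) = 0)
      \<Longrightarrow> (\<And>x. (\<forall>j\<in>J. (\<Sum>a\<in>UNIV. w j a * x a) = 0) \<Longrightarrow> x = (\<lambda>_. 0)) \<Longrightarrow> meas_pos J \<tau> w"
    and \<rho>: "1 < \<rho>" and flat: "flat_at_origin \<rho> S"
    and r: "0 \<le> r" "r < 1" and bd: "\<And>x v. cmod x < \<rho> \<Longrightarrow> norm (S x *v v) \<le> r * norm v"
  shows "(\<Sum>b\<in>UNIV. qn (\<lambda>p. \<Sum>c\<in>UNIV. S (\<zeta> p) $ b $ c * \<alpha> c p)) \<le> (\<Sum>b\<in>UNIV. qn (\<alpha> b))"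
proof -
  define T where "T L x = ((\<lambda>B. mat 1 + S x ** B) ^^ L) (mat 1)" for L x
  define Q where "Q L x = ((\<lambda>B. S x ** B) ^^ L) (mat 1)" for L x
  define F where "F L x = (mat 1 + S x) ** T L x" for L x
  have TQ: "T L x ** (mat 1 - S x) = mat 1 - Q (Suc L) x" for L x
  proof (induction L)
    case (Suc L)
    have "T (Suc L) x ** (mat 1 - S x) = mat 1 - S x + S x ** (T L x ** (mat 1 - S x))"
      by (simp add: T_def matrix_distribs matrix_mul_assoc)
    also have "\<dots> = mat 1 - Q (Suc (Suc L)) x" unfolding Suc by (simp add: matrix_distribs Q_def)
    finally show ?case .
  qed (simp add: T_def Q_def)
  have FQ: "F L x *v (y - S x *v y) = (y - Q (Suc L) x *v y) + S x *v (y - Q (Suc L) x *v y)" for L x y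
  proof -
    have "F L x *v (y - S x *v y) = F L x *v ((mat 1 - S x) *v y)" by (simp add: matrix_vector_mult_diff_rdistrib)
    also have "\<dots> = (mat 1 + S x) *v ((mat 1 - Q (Suc L) x) *v y)"
      unfolding F_def matrix_vector_mul_assoc matrix_mul_assoc[symmetric] TQ ..
    finally show ?thesis by (simp add: matrix_vector_mult_diff_rdistrib matrix_vector_mult_add_rdistrib)
  qed
  have Qb: "norm (Q L x *v y) \<le> r ^ L * norm y" if "cmod x < \<rho>" for L x y
  proof (induction L)
    case (Suc L)
    have "norm (Q (Suc L) x *v y) = norm (S x *v (Q L x *v y))" by (simp add: Q_def matrix_vector_mul_assoc)
    also have "\<dots> \<le> r * norm (Q L x *v y)" by (rule bd[OF that])
    also have "\<dots> \<le> r * (r ^ L * norm y)" using Suc r by (intro mult_left_mono) auto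
    finally show ?case by simp
  qed (simp add: Q_def)
  have flatF: "flat_at_origin \<rho> (F L)" for L
  proof -
    have "flat_at_origin \<rho> (T L)"
      by (induction L) (simp_all add: T_def[abs_def] flat flat_at_origin_const flat_at_origin_add flat_at_origin_mult)
    then show ?thesis unfolding F_def[abs_def] by (intro flat_at_origin_mult flat_at_origin_add flat_at_origin_const flat)
  qed
  \<comment> \<open>For w = (1 - S) y the main term is at least 8 \<delta> |y|^2, the Neumann
    remainder costs at most 4 \<delta> |y|^2, and |w|^2 \<le> 4 |y|^2; hence the divisor 8.\<close>
  define \<delta> where "\<delta> = (1 - r\<^sup>2) / 8"
  have r2: "r\<^sup>2 < 1" using r by (simp add: power_less_one_iff)
  have \<delta>: "\<delta> > 0" using r2 by (simp add: \<delta>_def)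
  have inner_eq: "Re (\<Sum>b\<in>UNIV. \<Sum>c\<in>UNIV. cnj (y b) * G $ b $ c * y c) = (\<chi> b. y b) \<bullet> (G *v (\<chi> b. y b))" for y and G :: "'n cmat"
    using re_qform[of G "\<chi> b. y b"] by (simp add: qform_def)
  have key: "\<delta> * (norm w)\<^sup>2 \<le> w \<bullet> (F L x *v w)" if x: "cmod x = 1" and L: "4 * r ^ Suc L \<le> 4 * \<delta>" for L x w
  proof -
    have x\<rho>: "cmod x < \<rho>" using x \<rho> by simp
    have "\<exists>y. w = y - S x *v y"
    proof -
      have "y = 0" if "(mat 1 - S x) *v y = 0" for y
      proof (rule ccontr)
        assume "y \<noteq> 0"
        have "S x *v y = y" using that by (simp add: matrix_vector_mult_diff_rdistrib)
        then have "norm y \<le> r * norm y" using bd[OF x\<rho>, of y] by simp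
        then have "norm y * (1 - r) \<le> 0" by (simp add: algebra_simps)
        then show False using r \<open>y \<noteq> 0\<close> by (simp add: mult_le_0_iff)
      qed
      then have "invertible (mat 1 - S x)"
        using matrix_left_invertible_ker[of "mat 1 - S x"] invertible_left_inverse by blast
      then obtain B where "(mat 1 - S x) ** B = mat 1" unfolding invertible_def by blast
      then have "w = (mat 1 - S x) *v (B *v w)" by (simp add: matrix_vector_mul_assoc)
      then show ?thesis by (auto simp: matrix_vector_mult_diff_rdistrib)
    qed
    then obtain y where y: "w = y - S x *v y" by blast
    define s where "s = S x *v y"
    define q where "q = Q (Suc L) x *v y"
    have s: "norm s \<le> r * norm y" unfolding s_def by (rule bd[OF x\<rho>])
    have s1: "norm s \<le> norm y" using s r mult_right_mono[of r 1 "norm y"] by simp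
    have q: "norm q \<le> r ^ Suc L * norm y" unfolding q_def by (rule Qb[OF x\<rho>])
    have sq: "norm (S x *v q) \<le> norm q" using bd[OF x\<rho>, of q] r mult_right_mono[of r 1 "norm q"] by simp
    have w: "norm w \<le> 2 * norm y" using norm_triangle_ineq4[of y s] s1 by (simp add: y s_def)
    have Fw: "F L x *v w = (y + s) - (q + S x *v q)"
      unfolding y FQ by (simp add: matrix_vector_mult_diff_distrib s_def q_def)
    have "w \<bullet> (y + s) = (norm y)\<^sup>2 - (norm s)\<^sup>2"
      by (simp add: y s_def[symmetric] inner_add_right inner_diff_left inner_diff_right inner_commute power2_norm_eq_inner)
    moreover have "(norm s)\<^sup>2 \<le> r\<^sup>2 * (norm y)\<^sup>2" using power_mono[OF s, of 2] by (simp add: power_mult_distrib)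
    ultimately have 1: "w \<bullet> (y + s) \<ge> 8 * \<delta> * (norm y)\<^sup>2" by (simp add: \<delta>_def algebra_simps)
    have "w \<bullet> (q + S x *v q) \<le> norm w * norm (q + S x *v q)" using Cauchy_Schwarz_ineq2[of w "q + S x *v q"] by simp
    also have "\<dots> \<le> (2 * norm y) * (2 * (r ^ Suc L * norm y))"
      using w norm_triangle_ineq[of q "S x *v q"] sq q by (intro mult_mono) auto
    also have "\<dots> = (4 * r ^ Suc L) * (norm y)\<^sup>2" by (simp add: power2_eq_square)
    also have "\<dots> \<le> 4 * \<delta> * (norm y)\<^sup>2" by (rule mult_right_mono[OF L]) simp
    finally have 2: "w \<bullet> (q + S x *v q) \<le> 4 * \<delta> * (norm y)\<^sup>2" .
    have "(norm w)\<^sup>2 \<le> 4 * (norm y)\<^sup>2" using power_mono[OF w, of 2] by (simp add: power_mult_distrib)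
    then have "\<delta> * (norm w)\<^sup>2 \<le> \<delta> * (4 * (norm y)\<^sup>2)" using \<delta> by (intro mult_left_mono) auto
    also have "\<dots> \<le> w \<bullet> (F L x *v w)" unfolding Fw inner_diff_right using 1 2 by simp
    finally show ?thesis .
  qed
  define a :: "'p \<Rightarrow> complex^'n" where "a p = (\<chi> c. \<alpha> c p)" for p
  define \<beta> where "\<beta> c p = (a p - S (\<zeta> p) *v a p) $ c" for c p
  have pos: "0 \<le> herg (\<lambda>p b c. F L (\<zeta> p) $ b $ c) \<beta>" if L: "r ^ Suc L < \<delta>" for L
  proof (rule herg_holomorphic_nonneg[where F = "\<lambda>x b c. F L x $ b $ c", OF z mp \<rho> _ _ \<delta>])
    show "(\<lambda>x. F L x $ b $ c) holomorphic_on ball 0 \<rho>" "deriv (\<lambda>x. F L x $ b $ c) 0 = 0" for b c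
      using flatF[of L] by (auto simp: flat_at_origin_def intro: DERIV_imp_deriv)
    show "\<delta> * (\<Sum>b\<in>UNIV. (cmod (y b))\<^sup>2) \<le> Re (\<Sum>b\<in>UNIV. \<Sum>c\<in>UNIV. cnj (y b) * F L t $ b $ c * y c)" if "cmod t = 1" for t y
      using key[OF that, of L "\<chi> b. y b"] L unfolding inner_eq by (simp add: norm_vec_def L2_set_def sum_nonneg)
  qed
  have Q0: "(\<lambda>L. Q (Suc L) (\<zeta> p) *v a p) \<longlonglongrightarrow> 0" for p
  proof (rule tendsto_norm_zero_cancel, rule tendsto_sandwich[OF _ _ tendsto_const])
    show "(\<lambda>L. r ^ Suc L * norm (a p)) \<longlonglongrightarrow> 0"
      by (intro tendsto_mult_left_zero LIMSEQ_Suc LIMSEQ_power_zero) (use r in simp)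
  qed (use Qb[of "\<zeta> p" "Suc _" "a p"] less_trans[OF z \<rho>] in \<open>auto intro!: always_eventually simp del: power_Suc\<close>)
  define u where "u L p = (a p - Q (Suc L) (\<zeta> p) *v a p) + S (\<zeta> p) *v (a p - Q (Suc L) (\<zeta> p) *v a p)" for L p
  have ulim: "(\<lambda>L. u L p $ b) \<longlonglongrightarrow> (a p + S (\<zeta> p) *v a p) $ b" for p b
  proof -
    have c: "(\<lambda>L. a p - Q (Suc L) (\<zeta> p) *v a p) \<longlonglongrightarrow> a p" using tendsto_diff[OF tendsto_const Q0[of p], of "a p"] by simp
    then have c': "(\<lambda>L. (a p - Q (Suc L) (\<zeta> p) *v a p) $ c) \<longlonglongrightarrow> a p $ c" for c by (rule tendsto_vec_nth)
    have lin: "(\<lambda>L. (M *v w L) $ b) \<longlonglongrightarrow> (M *v w') $ b" if "\<And>c. (\<lambda>L. w L $ c) \<longlonglongrightarrow> w' $ c" for M :: "'n cmat" and w :: "nat \<Rightarrow> complex^'n" and w' :: "complex^'n"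
      unfolding matrix_vector_mult_def vec_lambda_beta by (intro tendsto_intros that)
    have "(\<lambda>L. (S (\<zeta> p) *v (a p - Q (Suc L) (\<zeta> p) *v a p)) $ b) \<longlonglongrightarrow> (S (\<zeta> p) *v a p) $ b"
      by (rule lin) (rule c')
    then show ?thesis unfolding u_def vector_add_component by (intro tendsto_add c')
  qed
  have hu: "herg (\<lambda>p b c. F L (\<zeta> p) $ b $ c) \<beta> = (\<Sum>b\<in>UNIV. Re (frm (\<lambda>p. u L p $ b) (\<beta> b)))" for L
  proof -
    have "(\<Sum>c\<in>UNIV. F L (\<zeta> p) $ b $ c * \<beta> c p) = (F L (\<zeta> p) *v (a p - S (\<zeta> p) *v a p)) $ b" for p b
      by (simp add: matrix_vector_mult_def \<beta>_def)
    then show ?thesis unfolding herg_def FQ u_def by simp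
  qed
  have lim: "(\<lambda>L. herg (\<lambda>p b c. F L (\<zeta> p) $ b $ c) \<beta>) \<longlonglongrightarrow> (\<Sum>b\<in>UNIV. Re (frm (\<lambda>p. (a p + S (\<zeta> p) *v a p) $ b) (\<beta> b)))"
    unfolding hu by (intro tendsto_sum tendsto_Re tendsto_frm ulim tendsto_const)
  have "(\<lambda>L. r ^ Suc L) \<longlonglongrightarrow> 0" by (intro LIMSEQ_Suc LIMSEQ_power_zero) (use r in simp)
  then have "eventually (\<lambda>L. r ^ Suc L < \<delta>) sequentially" using order_tendstoD(2) \<delta> by blast
  then have "eventually (\<lambda>L. 0 \<le> herg (\<lambda>p b c. F L (\<zeta> p) $ b $ c) \<beta>) sequentially"
    by eventually_elim (rule pos)
  with lim have "0 \<le> (\<Sum>b\<in>UNIV. Re (frm (\<lambda>p. (a p + S (\<zeta> p) *v a p) $ b) (\<beta> b)))"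
    by (rule tendsto_lowerbound) simp
  also have "\<dots> = (\<Sum>b\<in>UNIV. qn (\<alpha> b) - qn (\<lambda>p. \<Sum>c\<in>UNIV. S (\<zeta> p) $ b $ c * \<alpha> c p))"
  proof (intro sum.cong refl)
    fix b
    define s where "s p = (\<Sum>c\<in>UNIV. S (\<zeta> p) $ b $ c * \<alpha> c p)" for p
    have s: "(S (\<zeta> p) *v a p) $ b = s p" for p by (simp add: s_def a_def matrix_vector_mult_def)
    have b1: "\<beta> b = (\<lambda>p. \<alpha> b p - s p)" by (simp add: \<beta>_def fun_eq_iff s) (simp add: a_def)
    have b2: "(\<lambda>p. (a p + S (\<zeta> p) *v a p) $ b) = (\<lambda>p. \<alpha> b p + s p)" by (simp add: fun_eq_iff s) (simp add: a_def)
    show "Re (frm (\<lambda>p. (a p + S (\<zeta> p) *v a p) $ b) (\<beta> b)) = qn (\<alpha> b) - qn s"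
      unfolding b1 b2 using frm_cnj[of "\<alpha> b" s] by (simp add: qn_def frm_add1 frm_diff2)
  qed
  finally show ?thesis by (simp add: sum_subtractf)
qed

end

lemma norm_matrix_vector_le_opnorm: "norm (A *v v) \<le> opnorm A * norm v"
  unfolding opnorm_def
proof (rule onorm)
  show "bounded_linear ((*v) A)"
    by (rule linear_conv_bounded_linear[THEN iffD1], rule linearI)
      (simp_all add: matrix_vector_mult_def vec_eq_iff distrib_left sum.distrib scaleR_sum_right)
qed

text \<open>S is the pointwise limit of r S(r x) for r < 1. The outer factor r makes these strictly
  contractive, the inner one extends them to the disk of radius 1 / r.\<close>

theorem H1_ball_right_mult_contractive:
  fixes S :: "complex \<Rightarrow> 'n::finite cmat"
  assumes S: "S \<in> H1_ball" and adm: "admissible Psi1 K"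
  shows "right_mult_contractive K S"
proof -
  have K: "pos_kernel K" and psi: "\<And>n t W. ThetaHat n t W \<Longrightarrow> right_mult_contractive K (Sfun n t W)"
    using adm by (auto simp: admissible_def Psi1_def)
  show ?thesis unfolding right_mult_contractive_iff[OF K]
  proof (intro allI impI)
    fix m :: nat and z :: "nat \<Rightarrow> complex" and \<alpha> :: "'n \<Rightarrow> nat \<times> 'n \<Rightarrow> complex"
    assume zd: "\<forall>i. z i \<in> disk"
    define \<zeta> where "\<zeta> p = z (fst p)" for p :: "nat \<times> 'n"
    interpret hermitian_form "kpts m :: (nat \<times> 'n) set" "kker K z" \<zeta>
      using hermitian_form_kker[where z = z, OF K] zd by blast
    have \<zeta>: "\<zeta> p \<in> disk" for p using zd by (simp add: \<zeta>_def)
    have z1: "cmod (\<zeta> p) < 1" for p using \<zeta>[of p] by (simp add: disk_def)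
    have con: "(\<Sum>b\<in>UNIV. qn (\<lambda>p. \<Sum>c\<in>UNIV. Sfun n t W (\<zeta> p) $ b $ c * \<alpha> c p)) \<le> (\<Sum>b\<in>UNIV. qn (\<alpha> b))"
      if "ThetaHat n t W" for n t \<alpha> and W :: "nat \<Rightarrow> 'n cmat"
      using psi[OF that, unfolded right_mult_contractive_iff[OF K], rule_format, of z m \<alpha>] zd by (simp add: \<zeta>_def)
    have H2: "meas_pos J \<tau> w" if "card J \<le> 3 * CARD('n)" "normalised J \<tau> w"
      for J :: "('n + nat) set" and \<tau> and w :: "'n + nat \<Rightarrow> 'n \<Rightarrow> complex"
      by (rule test_functions_meas_pos[OF \<zeta> con that])
    note mp = meas_pos_nondegenerate[OF H2]
    define r where "r n = real (Suc n) / real (Suc (Suc n))" for n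
    have r: "0 < r n" "r n < 1" for n by (simp_all add: r_def)
    have rlim: "r \<longlonglongrightarrow> 1" unfolding r_def using LIMSEQ_Suc[OF LIMSEQ_n_over_Suc_n] by simp
    define Sr where "Sr n x = r n *\<^sub>R S (of_real (r n) * x)" for n x
    have le: "(\<Sum>b\<in>UNIV. qn (\<lambda>p. \<Sum>c\<in>UNIV. Sr n (\<zeta> p) $ b $ c * \<alpha> c p)) \<le> (\<Sum>b\<in>UNIV. qn (\<alpha> b))" for n
    proof (rule strictly_contractive_right_mult[OF z1 mp, where \<rho> = "1 / r n" and r = "r n"])
      show "1 < 1 / r n" using r[of n] by simp
      show "0 \<le> r n" "r n < 1" using r[of n] by auto
      have in_disk: "of_real (r n) * x \<in> disk" if "cmod x < 1 / r n" for x
        using that r[of n] by (simp add: disk_def norm_mult pos_less_divide_eq mult.commute)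
      show "norm (Sr n x *v v) \<le> r n * norm v" if "cmod x < 1 / r n" for x v
      proof -
        have "norm (S (of_real (r n) * x) *v v) \<le> opnorm (S (of_real (r n) * x)) * norm v" by (rule norm_matrix_vector_le_opnorm)
        also have "\<dots> \<le> 1 * norm v" using S in_disk[OF that] by (intro mult_right_mono) (auto simp: H1_ball_def)
        finally show ?thesis using r[of n] by (simp add: Sr_def matrix_vector_mult_scaleR)
      qed
      show "flat_at_origin (1 / r n) (Sr n)"
        unfolding flat_at_origin_def
      proof (intro allI conjI)
        fix b c
        have hol: "(\<lambda>x. S x $ b $ c) holomorphic_on disk" and d: "deriv (\<lambda>x. S x $ b $ c) 0 = 0"
          using S by (auto simp: H1_ball_def)
        have e: "(\<lambda>x. Sr n x $ b $ c) = (\<lambda>x. of_real (r n) * ((\<lambda>x. S x $ b $ c) \<circ> (\<lambda>x. of_real (r n) * x)) x)"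
          by (simp add: Sr_def fun_eq_iff scaleR_conv_of_real[where 'a = complex])
        show "(\<lambda>x. Sr n x $ b $ c) holomorphic_on ball 0 (1 / r n)"
          unfolding e by (intro holomorphic_on_mult holomorphic_on_const holomorphic_on_compose_gen[OF _ hol] holomorphic_intros)
            (auto simp: in_disk)
        have "((\<lambda>x. S x $ b $ c) has_field_derivative 0) (at (of_real (r n) * 0))"
          using holomorphic_derivI[OF hol, of 0] d by (simp add: disk_def)
        then have "((\<lambda>x. S x $ b $ c) \<circ> (\<lambda>x. of_real (r n) * x) has_field_derivative 0 * of_real (r n)) (at 0)"
          by (rule DERIV_chain) (auto intro!: derivative_eq_intros)
        then show "((\<lambda>x. Sr n x $ b $ c) has_field_derivative 0) (at 0)"
          unfolding e using DERIV_cmult[of "(\<lambda>x. S x $ b $ c) \<circ> (\<lambda>x. of_real (r n) * x)" 0 0 UNIV "of_real (r n)"] by simp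
      qed
    qed auto
    have "(\<lambda>n. Sr n (\<zeta> p) $ b $ c) \<longlonglongrightarrow> S (\<zeta> p) $ b $ c" for p b c
    proof -
      have "(\<lambda>x. S x $ b $ c) holomorphic_on disk" using S by (auto simp: H1_ball_def)
      then have "isCont (\<lambda>x. S x $ b $ c) (\<zeta> p)"
        using \<zeta>[of p] by (auto simp: disk_def dest!: holomorphic_on_imp_continuous_on simp: continuous_on_eq_continuous_at)
      moreover have rc: "(\<lambda>n. of_real (r n) :: complex) \<longlonglongrightarrow> 1" using tendsto_of_real[OF rlim] by simp
      then have "(\<lambda>n. of_real (r n) * \<zeta> p) \<longlonglongrightarrow> \<zeta> p" using tendsto_mult_right[OF rc, of "\<zeta> p"] by simp
      ultimately have "(\<lambda>n. S (of_real (r n) * \<zeta> p) $ b $ c) \<longlonglongrightarrow> S (\<zeta> p) $ b $ c"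
        by (rule isCont_tendsto_compose)
      from tendsto_scaleR[OF rlim this] show ?thesis by (simp add: Sr_def)
    qed
    then have "(\<lambda>n. \<Sum>b\<in>UNIV. qn (\<lambda>p. \<Sum>c\<in>UNIV. Sr n (\<zeta> p) $ b $ c * \<alpha> c p)) \<longlonglongrightarrow> (\<Sum>b\<in>UNIV. qn (\<lambda>p. \<Sum>c\<in>UNIV. S (\<zeta> p) $ b $ c * \<alpha> c p))"
      by (intro tendsto_sum tendsto_qn tendsto_mult tendsto_const)
    then have "(\<Sum>b\<in>UNIV. qn (\<lambda>p. \<Sum>c\<in>UNIV. S (\<zeta> p) $ b $ c * \<alpha> c p)) \<le> (\<Sum>b\<in>UNIV. qn (\<alpha> b))"
      by (rule LIMSEQ_le_const2) (use le in blast)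
    then show "(\<Sum>b\<in>UNIV. hermitian_form.qn (kpts m) (kker K z) (\<lambda>p. \<Sum>c\<in>UNIV. S (z (fst p)) $ b $ c * \<alpha> c p))
       \<le> (\<Sum>b\<in>UNIV. hermitian_form.qn (kpts m) (kker K z) (\<alpha> b))" by (simp add: \<zeta>_def)
  qed
qed

section \<open>The reproducing kernel of functions with vanishing derivative at the origin\<close>

definition szego :: "complex \<Rightarrow> complex \<Rightarrow> complex" where
  "szego z w = 1 / (1 - z * cnj w)"

text \<open>The geometric series of z cnj w without its term of degree 1.\<close>

definition flat_kernel :: "complex \<Rightarrow> complex \<Rightarrow> complex" where
  "flat_kernel z w = szego z w - z * cnj w"

lemma szego_nz:
  assumes "cmod z < 1" "cmod w < 1"
  shows "1 - z * cnj w \<noteq> 0"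
proof
  assume "1 - z * cnj w = 0"
  then have "cmod z * cmod w = 1" by (metis complex_mod_cnj norm_mult norm_one right_minus_eq)
  then show False using assms mult_le_one[of "cmod z" "cmod w"] mult_less_cancel_left2[of "cmod z" "cmod w"]
    by (smt (verit) mult_left_le norm_ge_zero)
qed

lemma szego_form_sums:
  assumes "\<And>i. cmod (z i) < 1"
  shows "(\<lambda>n. complex_of_real ((cmod (\<Sum>i<m. x i * z i ^ n))\<^sup>2)) sums (\<Sum>i<m. \<Sum>j<m. x i * szego (z i) (z j) * cnj (x j))"
proof -
  have "complex_of_real ((cmod (\<Sum>i<m. x i * z i ^ n))\<^sup>2) = (\<Sum>i<m. \<Sum>j<m. x i * (z i * cnj (z j)) ^ n * cnj (x j))" for n
    unfolding complex_norm_square cnj_sum sum_product by (intro sum.cong refl) (simp add: power_mult_distrib)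
  moreover have "(\<lambda>n. \<Sum>i<m. \<Sum>j<m. x i * (z i * cnj (z j)) ^ n * cnj (x j)) sums (\<Sum>i<m. \<Sum>j<m. x i * szego (z i) (z j) * cnj (x j))"
  proof (intro sums_sum sums_mult sums_mult2)
    fix i j
    have "cmod (z i * cnj (z j)) < 1" using assms[of i] assms[of j] mult_strict_mono'[of "cmod (z i)" 1 "cmod (z j)" 1] by (simp add: norm_mult)
    then show "(\<lambda>n. (z i * cnj (z j)) ^ n) sums szego (z i) (z j)" unfolding szego_def by (rule geometric_sums)
  qed
  ultimately show ?thesis by simp
qed

text \<open>The form is the sum of |sum of x_i z_i^n|^2 over all n \<noteq> 1: the term n = 0 alone
  gives the lower bound, putting n = 1 back gives the upper bound.\<close>

lemma flat_kernel_form: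
  assumes z: "\<And>i. cmod (z i) < 1"
  shows "Im (\<Sum>i<m. \<Sum>j<m. x i * flat_kernel (z i) (z j) * cnj (x j)) = 0"
    and "(cmod (\<Sum>i<m. x i))\<^sup>2 \<le> Re (\<Sum>i<m. \<Sum>j<m. x i * flat_kernel (z i) (z j) * cnj (x j))"
    and "Re (\<Sum>i<m. \<Sum>j<m. x i * flat_kernel (z i) (z j) * cnj (x j)) \<le> (\<Sum>n. (cmod (\<Sum>i<m. x i * z i ^ n))\<^sup>2)"
    and "summable (\<lambda>n. (cmod (\<Sum>i<m. x i * z i ^ n))\<^sup>2)"
proof -
  define e where "e n = (cmod (\<Sum>i<m. x i * z i ^ n))\<^sup>2" for n
  define T where "T = (\<Sum>i<m. \<Sum>j<m. x i * szego (z i) (z j) * cnj (x j))"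
  have s: "(\<lambda>n. complex_of_real (e n)) sums T" unfolding e_def T_def by (rule szego_form_sums[OF z])
  have sR: "e sums Re T" using sums_Re[OF s] by simp
  have "(\<lambda>n. 0) sums Im T" using sums_Im[OF s] by simp
  then have IT: "Im T = 0" by (rule sums_unique2) (rule sums_zero)
  have "(\<Sum>i<m. \<Sum>j<m. x i * flat_kernel (z i) (z j) * cnj (x j)) = T - (\<Sum>i<m. \<Sum>j<m. (x i * z i) * cnj (x j * z j))"
    unfolding T_def flat_kernel_def by (simp add: right_diff_distrib left_diff_distrib sum_subtractf mult_ac)
  also have "(\<Sum>i<m. \<Sum>j<m. (x i * z i) * cnj (x j * z j)) = complex_of_real (e 1)"
    unfolding e_def complex_norm_square cnj_sum sum_product by simp
  finally have f: "(\<Sum>i<m. \<Sum>j<m. x i * flat_kernel (z i) (z j) * cnj (x j)) = T - of_real (e 1)" .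
  show "Im (\<Sum>i<m. \<Sum>j<m. x i * flat_kernel (z i) (z j) * cnj (x j)) = 0" unfolding f by (simp add: IT)
  have e0: "e n \<ge> 0" for n by (simp add: e_def)
  show "summable (\<lambda>n. (cmod (\<Sum>i<m. x i * z i ^ n))\<^sup>2)" using sums_summable[OF sR] by (simp add: e_def[abs_def])
  have "sum e {0, 1} \<le> suminf e" by (rule sum_le_suminf[OF sums_summable[OF sR]]) (auto simp: e0)
  then show "(cmod (\<Sum>i<m. x i))\<^sup>2 \<le> Re (\<Sum>i<m. \<Sum>j<m. x i * flat_kernel (z i) (z j) * cnj (x j))"
    unfolding f using sums_unique[OF sR] by (simp add: e_def)
  show "Re (\<Sum>i<m. \<Sum>j<m. x i * flat_kernel (z i) (z j) * cnj (x j)) \<le> (\<Sum>n. (cmod (\<Sum>i<m. x i * z i ^ n))\<^sup>2)"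
    unfolding f using sums_unique[OF sR] e0[of 1] by (simp add: e_def[abs_def])
qed

definition flat_matrix_kernel :: "complex \<Rightarrow> complex \<Rightarrow> 'n::finite cmat" where
  "flat_matrix_kernel z w = flat_kernel z w *\<^sub>m mat 1"

lemma pos_kernel_flat: "pos_kernel (flat_matrix_kernel :: complex \<Rightarrow> complex \<Rightarrow> 'n::finite cmat)"
  unfolding pos_kernel_def Let_def
proof (intro allI impI)
  fix m :: nat and z :: "nat \<Rightarrow> complex" and v :: "nat \<Rightarrow> complex^'n"
  assume z: "\<forall>i<m. z i \<in> disk"
  define y where "y i = (if i < m then z i else 0)" for i
  have y: "cmod (y i) < 1" for i using z by (simp add: y_def disk_def)
  define q where "q a = (\<Sum>i<m. \<Sum>j<m. cnj (v i $ a) * flat_kernel (y i) (y j) * cnj (cnj (v j $ a)))" for a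
  have q: "Im (q a) = 0" "Re (q a) \<ge> 0" for a
    unfolding q_def
    by (rule flat_kernel_form(1)[where z = y, OF y], rule order_trans[OF zero_le_power2 flat_kernel_form(2)[where z = y, OF y]])
  have "(\<Sum>i<m. \<Sum>j<m. \<Sum>a\<in>UNIV. \<Sum>b\<in>UNIV. cnj (v i $ a) * flat_matrix_kernel (z i) (z j) $ a $ b * v j $ b)
     = (\<Sum>i<m. \<Sum>j<m. \<Sum>a\<in>UNIV. cnj (v i $ a) * flat_kernel (z i) (z j) * v j $ a)"
  proof (intro sum.cong refl)
    fix i j a
    have "(\<Sum>b\<in>UNIV. cnj (v i $ a) * flat_matrix_kernel (z i) (z j) $ a $ b * v j $ b)
        = (\<Sum>b\<in>UNIV. of_bool (a = b) * (cnj (v i $ a) * flat_kernel (z i) (z j) * v j $ b))"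
      by (intro sum.cong refl) (simp add: flat_matrix_kernel_def mat_def)
    also have "\<dots> = cnj (v i $ a) * flat_kernel (z i) (z j) * v j $ a" by (rule of_bool_sum) auto
    finally show "(\<Sum>b\<in>UNIV. cnj (v i $ a) * flat_matrix_kernel (z i) (z j) $ a $ b * v j $ b) = cnj (v i $ a) * flat_kernel (z i) (z j) * v j $ a" .
  qed
  also have "\<dots> = (\<Sum>i<m. \<Sum>a\<in>UNIV. \<Sum>j<m. cnj (v i $ a) * flat_kernel (z i) (z j) * v j $ a)"
    by (intro sum.cong refl sum.swap)
  also have "\<dots> = (\<Sum>a\<in>UNIV. \<Sum>i<m. \<Sum>j<m. cnj (v i $ a) * flat_kernel (z i) (z j) * v j $ a)" by (rule sum.swap)
  also have "\<dots> = (\<Sum>a\<in>UNIV. q a)" unfolding q_def by (intro sum.cong refl) (simp add: y_def)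
  finally have s: "(\<Sum>i<m. \<Sum>j<m. \<Sum>a\<in>UNIV. \<Sum>b\<in>UNIV. cnj (v i $ a) * flat_matrix_kernel (z i) (z j) $ a $ b * v j $ b) = (\<Sum>a\<in>UNIV. q a)" .
  show "Im (\<Sum>i<m. \<Sum>j<m. \<Sum>a\<in>UNIV. \<Sum>b\<in>UNIV. cnj (v i $ a) * flat_matrix_kernel (z i) (z j) $ a $ b * v j $ b) = 0 \<and>
    0 \<le> Re (\<Sum>i<m. \<Sum>j<m. \<Sum>a\<in>UNIV. \<Sum>b\<in>UNIV. cnj (v i $ a) * flat_matrix_kernel (z i) (z j) $ a $ b * v j $ b)"
    unfolding s by (simp add: q sum_nonneg)
qed

lemma flat_frm:
  fixes \<xi> \<eta> :: "nat \<times> 'n::finite \<Rightarrow> complex"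
  assumes "\<And>i. z i \<in> disk"
  shows "hermitian_form.frm (kpts m) (kker flat_matrix_kernel z) \<xi> \<eta>
    = (\<Sum>a\<in>UNIV. \<Sum>i<m. \<Sum>j<m. \<xi> (i, a) * flat_kernel (z i) (z j) * cnj (\<eta> (j, a)))"
proof -
  interpret hermitian_form "kpts m :: (nat \<times> 'n) set" "kker flat_matrix_kernel z" \<zeta> for \<zeta>
    by (rule hermitian_form_kker[OF pos_kernel_flat assms])
  have "flat_matrix_kernel z w $ a $ b = of_bool (a = b) * flat_kernel z w" for z w and a b :: 'n
    by (simp add: flat_matrix_kernel_def mat_def)
  then have "frm \<xi> \<eta> = (\<Sum>i<m. \<Sum>a\<in>UNIV. \<Sum>j<m. \<Sum>b\<in>UNIV. of_bool (a = b) * (\<xi> (i, a) * flat_kernel (z i) (z j) * cnj (\<eta> (j, b))))"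
    unfolding frm_def by (simp only: sum_kpts kker_def fst_conv snd_conv mult_ac)
  also have "\<dots> = (\<Sum>i<m. \<Sum>a\<in>UNIV. \<Sum>j<m. \<xi> (i, a) * flat_kernel (z i) (z j) * cnj (\<eta> (j, a)))"
    by (intro sum.cong refl of_bool_sum) auto
  also have "\<dots> = (\<Sum>a\<in>UNIV. \<Sum>i<m. \<Sum>j<m. \<xi> (i, a) * flat_kernel (z i) (z j) * cnj (\<eta> (j, a)))" by (rule sum.swap)
  finally show ?thesis .
qed

lemma flat_kernel_shift:
  assumes "cmod z < 1" "cmod w < 1"
  shows "flat_kernel z w - z * flat_kernel z w * cnj w = 1 - z * cnj w + z\<^sup>2 * (cnj w)\<^sup>2"
proof -
  have "szego z w * (1 - z * cnj w) = 1" using szego_nz[OF assms] by (simp add: szego_def)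
  then have "szego z w - szego z w * (z * cnj w) = 1" by (simp add: right_diff_distrib)
  then show ?thesis unfolding flat_kernel_def by (simp add: algebra_simps power2_eq_square)
qed

text \<open>The kernel times 1 - z cnj w is the polynomial 1 - z cnj w + (z cnj w)^2, a combination
  of three rank one kernels with signs +, -, +.\<close>

lemma flat_qn_shift:
  fixes v :: "nat \<times> 'n::finite \<Rightarrow> complex"
  assumes z: "\<And>i. z i \<in> disk"
  shows "hermitian_form.qn (kpts m) (kker flat_matrix_kernel z) v - hermitian_form.qn (kpts m) (kker flat_matrix_kernel z) (\<lambda>p. z (fst p) * v p)
    = (\<Sum>a\<in>UNIV. (cmod (\<Sum>i<m. v (i, a)))\<^sup>2 - (cmod (\<Sum>i<m. v (i, a) * z i))\<^sup>2 + (cmod (\<Sum>i<m. v (i, a) * (z i)\<^sup>2))\<^sup>2)"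
proof -
  interpret hermitian_form "kpts m :: (nat \<times> 'n) set" "kker flat_matrix_kernel z" \<zeta> for \<zeta>
    by (rule hermitian_form_kker[OF pos_kernel_flat z])
  have z1: "cmod (z i) < 1" for i using z[of i] by (simp add: disk_def)
  have sq: "complex_of_real ((cmod (\<Sum>i<m. x i))\<^sup>2) = (\<Sum>i<m. \<Sum>j<m. x i * cnj (x j))" for x
    unfolding complex_norm_square cnj_sum sum_product ..
  have "frm v v - frm (\<lambda>p. z (fst p) * v p) (\<lambda>p. z (fst p) * v p)
     = (\<Sum>a\<in>UNIV. \<Sum>i<m. \<Sum>j<m. v (i, a) * (flat_kernel (z i) (z j) - z i * flat_kernel (z i) (z j) * cnj (z j)) * cnj (v (j, a)))"
    unfolding flat_frm[OF z] sum_subtractf[symmetric] by (intro sum.cong refl) (simp add: algebra_simps)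
  also have "\<dots> = (\<Sum>a\<in>UNIV. (\<Sum>i<m. \<Sum>j<m. v (i, a) * cnj (v (j, a))) - (\<Sum>i<m. \<Sum>j<m. (v (i, a) * z i) * cnj (v (j, a) * z j))
      + (\<Sum>i<m. \<Sum>j<m. (v (i, a) * (z i)\<^sup>2) * cnj (v (j, a) * (z j)\<^sup>2)))"
    unfolding flat_kernel_shift[OF z1 z1] sum_subtractf[symmetric] sum.distrib[symmetric]
    by (intro sum.cong refl) (simp add: algebra_simps)
  also have "\<dots> = of_real (\<Sum>a\<in>UNIV. (cmod (\<Sum>i<m. v (i, a)))\<^sup>2 - (cmod (\<Sum>i<m. v (i, a) * z i))\<^sup>2 + (cmod (\<Sum>i<m. v (i, a) * (z i)\<^sup>2))\<^sup>2)"
    unfolding of_real_sum of_real_add of_real_diff sq ..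
  finally have "Re (frm v v - frm (\<lambda>p. z (fst p) * v p) (\<lambda>p. z (fst p) * v p))
     = (\<Sum>a\<in>UNIV. (cmod (\<Sum>i<m. v (i, a)))\<^sup>2 - (cmod (\<Sum>i<m. v (i, a) * z i))\<^sup>2 + (cmod (\<Sum>i<m. v (i, a) * (z i)\<^sup>2))\<^sup>2)"
    by (simp only: Re_complex_of_real)
  then show ?thesis by (simp add: qn_def)
qed

text \<open>The negative square is absorbed up to a cross term of \<open>p\<close> and
  \<open>y\<close>. Summed over the atoms of a measure, that cross term becomes a first
  moment.\<close>

lemma three_square_identity:
  fixes p y s :: complex
  shows "(cmod (p + y + s))\<^sup>2 - (cmod (y + s))\<^sup>2 + (cmod s)\<^sup>2 = (cmod (p + s))\<^sup>2 + 2 * Re (cnj p * y)"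
  unfolding cmod_power2 by (simp add: power2_eq_square algebra_simps)

text \<open>The Cayley transform in the direction opposite to
  \<open>herg_contractive\<close>.\<close>

lemma herg_nonneg_contractive:
  assumes "hermitian_form P \<kappa>" and "0 \<le> hermitian_form.herg P \<kappa> F \<alpha>"
  shows "(\<Sum>b\<in>UNIV. hermitian_form.qn P \<kappa> (\<lambda>p. (\<Sum>d\<in>UNIV. F p b d * \<alpha> d p) - \<alpha> b p))
    \<le> (\<Sum>b\<in>UNIV. hermitian_form.qn P \<kappa> (\<lambda>p. \<alpha> b p + (\<Sum>d\<in>UNIV. F p b d * \<alpha> d p)))"
proof -
  interpret hermitian_form P \<kappa> \<zeta> for \<zeta> by (rule assms(1))
  define f where "f b p = (\<Sum>d\<in>UNIV. F p b d * \<alpha> d p)" for b p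
  have q: "qn (\<lambda>p. \<alpha> b p + f b p) - qn (\<lambda>p. f b p - \<alpha> b p) = 4 * Re (frm (f b) (\<alpha> b))" for b
    using frm_cnj[of "\<alpha> b" "f b"] by (simp add: qn_def frm_add1 frm_add2 frm_diff1 frm_diff2)
  have "0 \<le> 4 * (\<Sum>b\<in>UNIV. Re (frm (f b) (\<alpha> b)))" using assms(2) by (simp add: herg_def f_def[abs_def])
  also have "\<dots> = (\<Sum>b\<in>UNIV. qn (\<lambda>p. \<alpha> b p + f b p)) - (\<Sum>b\<in>UNIV. qn (\<lambda>p. f b p - \<alpha> b p))"
    unfolding sum_distrib_left q[symmetric] sum_subtractf ..
  finally show ?thesis by (simp add: f_def)
qed

text \<open>The zero first moment of the measure cancels the only indefinite term of \<open>1 - z w\<^sup>* + (z w\<^sup>*)\<^sup>2\<close>.\<close>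

lemma flat_herg_nonneg:
  fixes \<alpha> :: "'n::finite \<Rightarrow> nat \<times> 'n \<Rightarrow> complex"
  assumes z: "\<And>i. z i \<in> disk" and W: "ThetaHat n t (W :: nat \<Rightarrow> 'n cmat)"
  shows "0 \<le> hermitian_form.herg (kpts m) (kker flat_matrix_kernel z) (\<lambda>p b c. Ffun n t W (z (fst p)) $ b $ c) \<alpha>"
proof -
  define \<zeta> where "\<zeta> p = z (fst p)" for p :: "nat \<times> 'n"
  interpret hermitian_form "kpts m :: (nat \<times> 'n) set" "kker flat_matrix_kernel z" \<zeta>
    by (rule hermitian_form_kker[OF pos_kernel_flat z])
  have z1: "cmod (\<zeta> p) < 1" for p using z[of "fst p"] by (simp add: \<zeta>_def disk_def)
  have t1: "cmod (t r) = 1" if "r < n" for r using W that by (simp add: ThetaHat_def)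
  have "\<exists>w :: 'n \<Rightarrow> 'n \<Rightarrow> complex. \<forall>b c. W r $ b $ c = (\<Sum>e\<in>UNIV. cnj (w e b) * w e c)" if r: "r < n" for r
  proof (rule psd_factor)
    have p: "psd (W r)" using W r by (simp add: ThetaHat_def)
    then show "W r $ b $ c = cnj (W r $ c $ b)" for b c
      unfolding psd_def hermitian_def cadj_def by (metis vec_lambda_beta)
    show "0 \<le> Re (\<Sum>b\<in>UNIV. \<Sum>c\<in>UNIV. cnj (x b) * W r $ b $ c * x c)" for x
      using p[unfolded psd_def qform_def, THEN conjunct2, THEN spec, of "\<chi> b. x b"] by simp
  qed
  then obtain w :: "nat \<Rightarrow> 'n \<Rightarrow> 'n \<Rightarrow> complex" where w: "\<And>r b c. r < n \<Longrightarrow> W r $ b $ c = (\<Sum>e\<in>UNIV. cnj (w r e b) * w r e c)"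
    by metis
  define J :: "(nat \<times> 'n) set" where "J = {..<n} \<times> UNIV"
  define \<tau> where "\<tau> j = cnj (t (fst j))" for j :: "nat \<times> 'n"
  define v where "v j = w (fst j) (snd j)" for j
  have finJ: "finite J" by (simp add: J_def)
  have \<tau>1: "cmod (\<tau> j) = 1" if "j \<in> J" for j using that by (auto simp: \<tau>_def J_def t1)
  have sumJ: "(\<Sum>j\<in>J. f (t (fst j)) * (cnj (v j b) * v j c)) = (\<Sum>r<n. f (t r) * W r $ b $ c)" for f b c
  proof -
    have "(\<Sum>r<n. f (t r) * W r $ b $ c) = (\<Sum>r<n. \<Sum>e\<in>UNIV. f (t r) * (cnj (w r e b) * w r e c))"
      by (simp add: w sum_distrib_left)
    also have "\<dots> = (\<Sum>(k,e)\<in>J. f (t k) * (cnj (w k e b) * w k e c))" unfolding J_def by (rule sum.cartesian_product)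
    finally show ?thesis by (simp add: v_def case_prod_beta)
  qed
  have mom: "(\<Sum>j\<in>J. \<tau> j * (cnj (v j b) * v j c)) = 0" for b c
  proof -
    have "(\<Sum>r<n. of_real (Re (t r)) *\<^sub>m W r) $ b $ c = 0" "(\<Sum>r<n. of_real (Im (t r)) *\<^sub>m W r) $ b $ c = 0"
      using W by (simp_all add: ThetaHat_def)
    then have "(\<Sum>r<n. of_real (Re (t r)) * W r $ b $ c) = 0" "(\<Sum>r<n. of_real (Im (t r)) * W r $ b $ c) = 0" by simp_all
    moreover have "(\<Sum>r<n. cnj (t r) * W r $ b $ c) = (\<Sum>r<n. of_real (Re (t r)) * W r $ b $ c) - \<i> * (\<Sum>r<n. of_real (Im (t r)) * W r $ b $ c)"
      unfolding sum_distrib_left sum_subtractf[symmetric] by (intro sum.cong refl) (simp add: complex_eq_iff algebra_simps)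
    ultimately show ?thesis using sumJ[of cnj b c] by (simp add: \<tau>_def)
  qed
  have nz: "1 - \<zeta> p * \<tau> j \<noteq> 0" if "j \<in> J" for p j
  proof
    assume "1 - \<zeta> p * \<tau> j = 0"
    then have "cmod (\<zeta> p * \<tau> j) = 1" by simp
    then show False using z1[of p] \<tau>1[OF that] by (simp add: norm_mult)
  qed
  define V where "V j p = (\<Sum>b\<in>UNIV. v j b * \<alpha> b p) / (1 - \<zeta> p * \<tau> j)" for j p
  have V: "(1 - \<zeta> p * \<tau> j) * V j p = (\<Sum>b\<in>UNIV. v j b * \<alpha> b p)" if "j \<in> J" for j p
    using nz[OF that] by (simp add: V_def)
  have "0 \<le> (\<Sum>j\<in>J. (cmod (\<Sum>i<m. V j (i, a)))\<^sup>2 - (cmod (\<Sum>i<m. V j (i, a) * z i))\<^sup>2 + (cmod (\<Sum>i<m. V j (i, a) * (z i)\<^sup>2))\<^sup>2)" for a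
  proof -
    define u0 where "u0 b = (\<Sum>i<m. \<alpha> b (i, a))" for b
    define u1 where "u1 b = (\<Sum>i<m. \<alpha> b (i, a) * z i)" for b
    define U0 where "U0 j = (\<Sum>b\<in>UNIV. v j b * u0 b)" for j
    define U1 where "U1 j = (\<Sum>b\<in>UNIV. v j b * u1 b)" for j
    define e2 where "e2 j = (\<Sum>i<m. V j (i, a) * (z i)\<^sup>2)" for j
    \<comment> \<open>The resolvent equation read as a recursion in k for the sums of V z^k over the
      nodes; two steps reduce the three squares to \<open>U0\<close>, \<open>U1\<close> and
      \<open>e2\<close>.\<close>
    have step: "(\<Sum>i<m. V j (i, a) * z i ^ k) = (\<Sum>b\<in>UNIV. v j b * (\<Sum>i<m. \<alpha> b (i, a) * z i ^ k)) + \<tau> j * (\<Sum>i<m. V j (i, a) * z i ^ Suc k)" if j: "j \<in> J" for j k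
    proof -
      have "V j (i, a) * z i ^ k = (\<Sum>b\<in>UNIV. v j b * (\<alpha> b (i, a) * z i ^ k)) + \<tau> j * (V j (i, a) * z i ^ Suc k)" for i
      proof -
        have "V j (i, a) = (\<Sum>b\<in>UNIV. v j b * \<alpha> b (i, a)) + z i * \<tau> j * V j (i, a)"
          using V[OF j, of "(i, a)"] by (simp add: \<zeta>_def algebra_simps)
        then have "V j (i, a) * z i ^ k = ((\<Sum>b\<in>UNIV. v j b * \<alpha> b (i, a)) + z i * \<tau> j * V j (i, a)) * z i ^ k" by simp
        also have "\<dots> = (\<Sum>b\<in>UNIV. v j b * (\<alpha> b (i, a) * z i ^ k)) + \<tau> j * (V j (i, a) * z i ^ Suc k)"
          by (simp add: distrib_left sum_distrib_left mult_ac)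
        finally show ?thesis .
      qed
      then have "(\<Sum>i<m. V j (i, a) * z i ^ k) = (\<Sum>i<m. \<Sum>b\<in>UNIV. v j b * (\<alpha> b (i, a) * z i ^ k)) + \<tau> j * (\<Sum>i<m. V j (i, a) * z i ^ Suc k)"
        by (simp only: sum.distrib sum_distrib_left)
      also have "(\<Sum>i<m. \<Sum>b\<in>UNIV. v j b * (\<alpha> b (i, a) * z i ^ k)) = (\<Sum>b\<in>UNIV. v j b * (\<Sum>i<m. \<alpha> b (i, a) * z i ^ k))"
        unfolding sum_distrib_left by (rule sum.swap)
      finally show ?thesis .
    qed
    have pt: "(cmod (\<Sum>i<m. V j (i, a)))\<^sup>2 - (cmod (\<Sum>i<m. V j (i, a) * z i))\<^sup>2 + (cmod (\<Sum>i<m. V j (i, a) * (z i)\<^sup>2))\<^sup>2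
       = (cmod (U0 j + \<tau> j * (\<tau> j * e2 j)))\<^sup>2 + 2 * Re (cnj (U0 j) * (\<tau> j * U1 j))" if j: "j \<in> J" for j
    proof -
      have e1: "(\<Sum>i<m. V j (i, a) * z i) = U1 j + \<tau> j * e2 j"
        using step[OF j, of 1] by (simp add: U1_def u1_def e2_def power2_eq_square)
      have e0: "(\<Sum>i<m. V j (i, a)) = U0 j + \<tau> j * U1 j + \<tau> j * (\<tau> j * e2 j)"
        using step[OF j, of 0] by (simp add: U0_def u0_def e1 distrib_left)
      have n: "cmod (\<tau> j * x) = cmod x" for x using \<tau>1[OF j] by (simp add: norm_mult)
      have "cmod (\<Sum>i<m. V j (i, a) * z i) = cmod (\<tau> j * U1 j + \<tau> j * (\<tau> j * e2 j))"
        unfolding e1 distrib_left[symmetric] n ..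
      moreover have "cmod (\<Sum>i<m. V j (i, a) * (z i)\<^sup>2) = cmod (\<tau> j * (\<tau> j * e2 j))" unfolding n e2_def ..
      ultimately show ?thesis unfolding e0 by (simp only: three_square_identity)
    qed
    \<comment> \<open>\<open>u0\<close> and \<open>u1\<close> do not depend on the atom, so this is
      a combination of entries of the vanishing first moment.\<close>
    have "(\<Sum>j\<in>J. cnj (U0 j) * (\<tau> j * U1 j)) = (\<Sum>j\<in>J. \<Sum>b\<in>UNIV. \<Sum>c\<in>UNIV. cnj (u0 b) * u1 c * (\<tau> j * (cnj (v j b) * v j c)))"
      unfolding mult.left_commute[of _ "\<tau> _"] unfolding U0_def U1_def cnj_sum sum_product unfolding sum_distrib_left
      by (intro sum.cong refl) (simp add: mult_ac)
    also have "\<dots> = (\<Sum>b\<in>UNIV. \<Sum>c\<in>UNIV. \<Sum>j\<in>J. cnj (u0 b) * u1 c * (\<tau> j * (cnj (v j b) * v j c)))"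
      by (subst sum.swap, rule sum.cong[OF refl], rule sum.swap)
    also have "\<dots> = 0" unfolding sum_distrib_left[symmetric] mom by simp
    finally have cross: "(\<Sum>j\<in>J. cnj (U0 j) * (\<tau> j * U1 j)) = 0" .
    have "(\<Sum>j\<in>J. (cmod (\<Sum>i<m. V j (i, a)))\<^sup>2 - (cmod (\<Sum>i<m. V j (i, a) * z i))\<^sup>2 + (cmod (\<Sum>i<m. V j (i, a) * (z i)\<^sup>2))\<^sup>2)
       = (\<Sum>j\<in>J. (cmod (U0 j + \<tau> j * (\<tau> j * e2 j)))\<^sup>2) + 2 * Re (\<Sum>j\<in>J. cnj (U0 j) * (\<tau> j * U1 j))"
      unfolding Re_sum sum_distrib_left sum.distrib[symmetric] by (intro sum.cong refl pt)
    then show ?thesis unfolding cross by (simp add: sum_nonneg)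
  qed
  then have "0 \<le> (\<Sum>a\<in>UNIV. \<Sum>j\<in>J. (cmod (\<Sum>i<m. V j (i, a)))\<^sup>2 - (cmod (\<Sum>i<m. V j (i, a) * z i))\<^sup>2 + (cmod (\<Sum>i<m. V j (i, a) * (z i)\<^sup>2))\<^sup>2)"
    by (rule sum_nonneg)
  also have "\<dots> = (\<Sum>j\<in>J. qn (V j) - qn (\<lambda>p. \<zeta> p * V j p))"
    unfolding \<zeta>_def flat_qn_shift[where z = z, OF z] by (rule sum.swap)
  also have "\<dots> = (\<Sum>j\<in>J. qn (V j)) - (\<Sum>j\<in>J. qn (\<lambda>p. \<zeta> p * V j p))" by (rule sum_subtractf)
  also have "\<dots> = herg (\<lambda>p b c. \<Sum>j\<in>J. cnj (v j b) * v j c * ((1 + \<zeta> p * \<tau> j) / (1 - \<zeta> p * \<tau> j))) \<alpha>"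
    by (rule herg_meas[OF z1 \<tau>1 finJ V])
  also have "(\<lambda>p b c. \<Sum>j\<in>J. cnj (v j b) * v j c * ((1 + \<zeta> p * \<tau> j) / (1 - \<zeta> p * \<tau> j))) = (\<lambda>p b c. Ffun n t W (z (fst p)) $ b $ c)"
  proof (intro ext)
    fix p b c
    define g where "g s = (s + \<zeta> p) / (s - \<zeta> p)" for s
    have gj: "(1 + \<zeta> p * \<tau> j) / (1 - \<zeta> p * \<tau> j) = g (t (fst j))" if "j \<in> J" for j
    proof -
      have "cmod (t (fst j)) = 1" using \<tau>1[OF that] by (simp add: \<tau>_def)
      then have ct: "cnj (t (fst j)) * t (fst j) = 1" and "t (fst j) \<noteq> 0" using complex_norm_square[of "t (fst j)"] by (auto simp: mult.commute)
      then have "(1 + \<zeta> p * \<tau> j) / (1 - \<zeta> p * \<tau> j) = ((1 + \<zeta> p * \<tau> j) * t (fst j)) / ((1 - \<zeta> p * \<tau> j) * t (fst j))" by simp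
      then show ?thesis using ct by (simp add: g_def \<tau>_def distrib_right left_diff_distrib mult.assoc)
    qed
    have "(\<Sum>j\<in>J. cnj (v j b) * v j c * ((1 + \<zeta> p * \<tau> j) / (1 - \<zeta> p * \<tau> j))) = (\<Sum>j\<in>J. g (t (fst j)) * (cnj (v j b) * v j c))"
      by (intro sum.cong refl) (simp only: gj mult.commute[of _ "g _"])
    also have "\<dots> = (\<Sum>r<n. g (t r) * W r $ b $ c)" by (rule sumJ)
    finally show "(\<Sum>j\<in>J. cnj (v j b) * v j c * ((1 + \<zeta> p * \<tau> j) / (1 - \<zeta> p * \<tau> j))) = Ffun n t W (z (fst p)) $ b $ c"
      by (simp add: Ffun_def g_def \<zeta>_def)
  qed
  finally show ?thesis .
qed

lemma admissible_flat: "admissible Psi1 (flat_matrix_kernel :: complex \<Rightarrow> complex \<Rightarrow> 'n::finite cmat)"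
  unfolding admissible_def
proof (intro conjI ballI)
  show "pos_kernel (flat_matrix_kernel :: complex \<Rightarrow> complex \<Rightarrow> 'n cmat)" by (rule pos_kernel_flat)
  fix \<psi> :: "complex \<Rightarrow> 'n cmat" assume "\<psi> \<in> Psi1"
  then obtain n t W where W: "ThetaHat n t W" and \<psi>: "\<psi> = Sfun n t W" by (auto simp: Psi1_def)
  show "right_mult_contractive flat_matrix_kernel \<psi>"
    unfolding right_mult_contractive_iff[OF pos_kernel_flat] \<psi>
  proof (intro allI impI)
    fix m :: nat and z :: "nat \<Rightarrow> complex" and \<alpha> :: "'n \<Rightarrow> nat \<times> 'n \<Rightarrow> complex"
    assume "\<forall>i. z i \<in> disk"
    then have z: "z i \<in> disk" for i by blast
    define F where "F p = Ffun n t W (z (fst p))" for p :: "nat \<times> 'n"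
    have inv: "invertible (F p + mat 1)" for p
      unfolding F_def using W z by (intro Ffun_plus_one_invertible) (auto simp: ThetaHat_def)
    then obtain B where B: "\<And>p. (F p + mat 1) ** B p = mat 1" unfolding invertible_def by metis
    \<comment> \<open>\<alpha> = (F + 1) a, hence S \<alpha> = (F - 1) a, and contractivity at
      \<alpha> is positivity of the Herglotz form at \<open>a\<close>.\<close>
    define a where "a p = B p *v (\<chi> c. \<alpha> c p)" for p
    have a: "F p *v a p + a p = (\<chi> c. \<alpha> c p)" for p
    proof -
      have "(F p + mat 1) *v a p = (\<chi> c. \<alpha> c p)" unfolding a_def matrix_vector_mul_assoc B by simp
      then show ?thesis by (simp add: matrix_vector_mult_add_rdistrib)
    qed
    have Sa: "Sfun n t W (z (fst p)) *v (\<chi> c. \<alpha> c p) = F p *v a p - a p" for p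
    proof -
      have "Sfun n t W (z (fst p)) *v (\<chi> c. \<alpha> c p) = (Sfun n t W (z (fst p)) ** (F p + mat 1)) *v a p"
        unfolding a[symmetric] by (simp add: matrix_vector_mul_assoc[symmetric] matrix_vector_mult_add_rdistrib)
      also have "\<dots> = (F p - mat 1) *v a p" using Sfun_relation[OF inv[of p, unfolded F_def]] by (simp add: F_def)
      finally show ?thesis by (simp add: matrix_vector_mult_diff_rdistrib)
    qed
    define \<alpha>' where "\<alpha>' c p = a p $ c" for c p
    have Fa: "(\<Sum>d\<in>UNIV. F p $ b $ d * \<alpha>' d p) = (F p *v a p) $ b" for p b
      by (simp add: matrix_vector_mult_def \<alpha>'_def)
    have 1: "(\<lambda>p. (\<Sum>d\<in>UNIV. F p $ b $ d * \<alpha>' d p) - \<alpha>' b p) = (\<lambda>p. \<Sum>c\<in>UNIV. Sfun n t W (z (fst p)) $ b $ c * \<alpha> c p)" for b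
    proof
      fix p
      have "(F p *v a p - a p) $ b = (Sfun n t W (z (fst p)) *v (\<chi> c. \<alpha> c p)) $ b" by (simp only: Sa)
      then show "(\<Sum>d\<in>UNIV. F p $ b $ d * \<alpha>' d p) - \<alpha>' b p = (\<Sum>c\<in>UNIV. Sfun n t W (z (fst p)) $ b $ c * \<alpha> c p)"
        unfolding Fa by (simp add: \<alpha>'_def) (simp add: matrix_vector_mult_def)
    qed
    have 2: "(\<lambda>p. \<alpha>' b p + (\<Sum>d\<in>UNIV. F p $ b $ d * \<alpha>' d p)) = \<alpha> b" for b
    proof
      fix p
      have "(F p *v a p + a p) $ b = \<alpha> b p" by (simp only: a vec_lambda_beta)
      then show "\<alpha>' b p + (\<Sum>d\<in>UNIV. F p $ b $ d * \<alpha>' d p) = \<alpha> b p" unfolding Fa by (simp add: \<alpha>'_def add.commute)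
    qed
    show "(\<Sum>b\<in>UNIV. hermitian_form.qn (kpts m) (kker flat_matrix_kernel z) (\<lambda>p. \<Sum>c\<in>UNIV. Sfun n t W (z (fst p)) $ b $ c * \<alpha> c p))
      \<le> (\<Sum>b\<in>UNIV. hermitian_form.qn (kpts m) (kker flat_matrix_kernel z) (\<alpha> b))"
      using herg_nonneg_contractive[OF hermitian_form_kker[where z = z, OF pos_kernel_flat z] flat_herg_nonneg[where z = z, OF z W], of m \<alpha>']
      unfolding F_def[symmetric] 1 2 .
  qed
qed

text \<open>The quotient (w^n - a^n) / (w - a) is the sum of w^p a^(n - 1 - p) over p < n. Each of
  the n summands is Lipschitz in w with a constant at most n \<rho>^(n - 2), which gives the factor
  n^2.\<close>

lemma second_difference_bound:
  fixes u v a :: complex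
  assumes \<rho>: "0 < \<rho>" and u: "cmod u \<le> \<rho>" "u \<noteq> a" and v: "cmod v \<le> \<rho>" "v \<noteq> a" and a: "cmod a \<le> \<rho>"
  shows "cmod ((u ^ n - a ^ n) / (u - a) - (v ^ n - a ^ n) / (v - a)) \<le> (real n)\<^sup>2 * \<rho> ^ n * cmod (u - v) / \<rho>\<^sup>2"
proof (cases n)
  case (Suc k)
  have pw: "cmod (u ^ p - v ^ p) \<le> real p * \<rho> ^ p * cmod (u - v) / \<rho>" for p
  proof -
    have "cmod ((u / of_real \<rho>) ^ p - (v / of_real \<rho>) ^ p) \<le> real p * cmod (u / of_real \<rho> - v / of_real \<rho>)"
      by (rule norm_power_diff) (use u v \<rho> in \<open>auto simp: norm_divide\<close>)
    moreover have "(u / of_real \<rho>) ^ p - (v / of_real \<rho>) ^ p = (u ^ p - v ^ p) / of_real (\<rho> ^ p)"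
      by (simp add: power_divide diff_divide_distrib)
    moreover have "u / of_real \<rho> - v / of_real \<rho> = (u - v) / of_real \<rho>" by (simp add: diff_divide_distrib)
    ultimately have "cmod (u ^ p - v ^ p) / \<rho> ^ p \<le> real p * (cmod (u - v) / \<rho>)"
      using \<rho> by (simp add: norm_divide norm_power)
    then show ?thesis using \<rho> by (simp add: pos_divide_le_eq mult_ac)
  qed
  have q: "(w ^ n - a ^ n) / (w - a) = (\<Sum>p<n. w ^ p * a ^ (k - p))" if "w \<noteq> a" for w
    using diff_power_eq_sum[of w k a] that by (simp add: Suc)
  have "(u ^ n - a ^ n) / (u - a) - (v ^ n - a ^ n) / (v - a) = (\<Sum>p<n. (u ^ p - v ^ p) * a ^ (k - p))"
    unfolding q[OF u(2)] q[OF v(2)] sum_subtractf[symmetric] by (simp add: left_diff_distrib)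
  also have "cmod \<dots> \<le> (\<Sum>p<n. real n * \<rho> ^ n * cmod (u - v) / \<rho>\<^sup>2)"
  proof (intro order_trans[OF norm_sum] sum_mono)
    fix p assume "p \<in> {..<n}"
    then have p: "p \<le> k" by (simp add: Suc)
    have "cmod ((u ^ p - v ^ p) * a ^ (k - p)) \<le> (real p * \<rho> ^ p * cmod (u - v) / \<rho>) * \<rho> ^ (k - p)"
      unfolding norm_mult norm_power by (intro mult_mono pw power_mono a) (use \<rho> in auto)
    also have "\<dots> = real p * (\<rho> ^ p * \<rho> ^ (k - p)) * cmod (u - v) / \<rho>" by simp
    also have "\<rho> ^ p * \<rho> ^ (k - p) = \<rho> ^ n / \<rho>" using p \<rho> by (simp add: Suc flip: power_add)
    also have "real p * (\<rho> ^ n / \<rho>) * cmod (u - v) / \<rho> = real p * (\<rho> ^ n * cmod (u - v) / \<rho>\<^sup>2)"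
      by (simp add: power2_eq_square)
    also have "\<dots> \<le> real n * (\<rho> ^ n * cmod (u - v) / \<rho>\<^sup>2)"
      by (rule mult_right_mono) (use p \<rho> Suc in auto)
    finally show "cmod ((u ^ p - v ^ p) * a ^ (k - p)) \<le> real n * \<rho> ^ n * cmod (u - v) / \<rho>\<^sup>2" by (simp add: mult.assoc)
  qed
  also have "\<dots> = (real n)\<^sup>2 * \<rho> ^ n * cmod (u - v) / \<rho>\<^sup>2" by (simp add: power2_eq_square)
  finally show ?thesis .
qed simp

text \<open>Difference quotients at a point are Lipschitz functions of the increment, by the bound on
  the second differences of the monomials.\<close>

lemma holomorphic_if_dominated:
  fixes f :: "complex \<Rightarrow> complex"
  assumes H: "\<And>m z x. (\<And>i::nat. cmod (z i) < 1) \<Longrightarrow> (cmod (\<Sum>i<m. f (z i) * x i))\<^sup>2 \<le> (\<Sum>n. (cmod (\<Sum>i<m. x i * z i ^ n))\<^sup>2)"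
  shows "f holomorphic_on disk"
  unfolding holomorphic_on_def
proof (intro ballI)
  fix a assume "a \<in> disk"
  then have a1: "cmod a < 1" by (simp add: disk_def)
  define \<rho> where "\<rho> = (1 + cmod a) / 2"
  have \<rho>: "cmod a < \<rho>" "\<rho> < 1" "0 < \<rho>" using a1 by (simp_all add: \<rho>_def add_pos_nonneg)
  \<comment> \<open>The cube root splits n^2 \<rho>^n into (n s^n)^2, which is bounded, and the
    geometric factor s^n.\<close>
  define s where "s = root 3 \<rho>"
  have s: "0 < s" "s < 1" "s ^ 3 = \<rho>" using \<rho> by (simp_all add: s_def)
  have "Bseq (\<lambda>n. real n * s ^ n)"
    by (rule convergent_imp_Bseq, rule convergentI, rule powser_times_n_limit_0) (use s in simp)
  then obtain B where B: "B > 0" "\<And>n. real n * s ^ n \<le> B"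
    unfolding Bseq_def using s by (auto simp: abs_mult)
  have nB: "(real n)\<^sup>2 * \<rho> ^ n \<le> B\<^sup>2 * s ^ n" for n
  proof -
    have "(real n)\<^sup>2 * \<rho> ^ n = (real n * s ^ n)\<^sup>2 * s ^ n"
      unfolding s(3)[symmetric] by (simp add: power_mult_distrib power_mult[symmetric] power_add[symmetric] mult.commute)
    also have "\<dots> \<le> B\<^sup>2 * s ^ n" by (intro mult_right_mono power_mono B) (use s in auto)
    finally show ?thesis .
  qed
  define C where "C = B\<^sup>2 / \<rho>\<^sup>2"
  have C: "C \<ge> 0" by (simp add: C_def)
  define L where "L = C\<^sup>2 / (1 - s\<^sup>2)"
  have s2: "s\<^sup>2 < 1" using s by (simp add: power_less_one_iff)
  have L: "L \<ge> 0" using s2 by (simp add: L_def)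
  define D where "D u = (f u - f a) / (u - a)" for u
  have lip: "(cmod (D u - D v))\<^sup>2 \<le> L * (cmod (u - v))\<^sup>2" if u: "u \<in> ball 0 \<rho> - {a}" and v: "v \<in> ball 0 \<rho> - {a}" for u v
  proof -
    \<comment> \<open>Three nodes and weights for which the left-hand side of \<open>H\<close> is
      the difference of two difference quotients at \<open>a\<close>; on the right the same happens
      to each monomial.\<close>
    define z where "z i = (if i = 0 then u else if i = 1 then v else a)" for i :: nat
    define x where "x i = (if i = 0 then 1 / (u - a) else if i = 1 then - 1 / (v - a) else 1 / (v - a) - 1 / (u - a))" for i :: nat
    have sum3: "(\<Sum>i<3. g i) = g 0 + g 1 + g 2" for g :: "nat \<Rightarrow> complex"
      by (simp add: numeral_3_eq_3 numeral_2_eq_2)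
    have z1: "cmod (z i) < 1" for i using u v \<rho> a1 by (auto simp: z_def)
    have e1: "(\<Sum>i<3. f (z i) * x i) = D u - D v"
      by (simp add: sum3 z_def x_def D_def diff_divide_distrib right_diff_distrib)
    have e2: "(\<Sum>i<3. x i * z i ^ n) = (u ^ n - a ^ n) / (u - a) - (v ^ n - a ^ n) / (v - a)" for n
      by (simp add: sum3 z_def x_def diff_divide_distrib left_diff_distrib)
    have le: "(cmod (\<Sum>i<3. x i * z i ^ n))\<^sup>2 \<le> C\<^sup>2 * (cmod (u - v))\<^sup>2 * (s\<^sup>2) ^ n" for n
    proof -
      have "cmod (\<Sum>i<3. x i * z i ^ n) \<le> (real n)\<^sup>2 * \<rho> ^ n * cmod (u - v) / \<rho>\<^sup>2"
        unfolding e2 by (rule second_difference_bound) (use u v \<rho> in auto)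
      also have "\<dots> \<le> (B\<^sup>2 * s ^ n) * cmod (u - v) / \<rho>\<^sup>2"
        by (intro divide_right_mono mult_right_mono nB) auto
      also have "\<dots> = C * cmod (u - v) * s ^ n" by (simp add: C_def)
      finally have "(cmod (\<Sum>i<3. x i * z i ^ n))\<^sup>2 \<le> (C * cmod (u - v) * s ^ n)\<^sup>2" by (intro power_mono) auto
      then show ?thesis by (simp add: power_mult_distrib power_mult[symmetric] mult.commute)
    qed
    have gs: "(\<lambda>n. C\<^sup>2 * (cmod (u - v))\<^sup>2 * (s\<^sup>2) ^ n) sums (C\<^sup>2 * (cmod (u - v))\<^sup>2 * (1 / (1 - s\<^sup>2)))"
      by (intro sums_mult geometric_sums) (use s2 in simp)
    have "summable (\<lambda>n. (cmod (\<Sum>i<3. x i * z i ^ n))\<^sup>2)"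
      by (rule summable_comparison_test'[OF sums_summable[OF gs], of 0]) (use le in simp)
    then have "(\<Sum>n. (cmod (\<Sum>i<3. x i * z i ^ n))\<^sup>2) \<le> (\<Sum>n. C\<^sup>2 * (cmod (u - v))\<^sup>2 * (s\<^sup>2) ^ n)"
      by (intro suminf_le le sums_summable[OF gs])
    also have "\<dots> = L * (cmod (u - v))\<^sup>2" using sums_unique[OF gs] by (simp add: L_def)
    finally show ?thesis using H[where z = z and x = x and m = 3, OF z1] unfolding e1 by linarith
  qed
  \<comment> \<open>Uniform continuity yields a limit of the difference quotient at \<open>a\<close>
    without a candidate for the derivative.\<close>
  have "uniformly_continuous_on (ball 0 \<rho> - {a}) D"
    unfolding uniformly_continuous_on_def
  proof (intro allI impI)
    fix \<epsilon> :: real assume \<epsilon>: "\<epsilon> > 0"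
    show "\<exists>d>0. \<forall>u\<in>ball 0 \<rho> - {a}. \<forall>v\<in>ball 0 \<rho> - {a}. dist v u < d \<longrightarrow> dist (D v) (D u) < \<epsilon>"
    proof (intro exI[of _ "\<epsilon> / sqrt (L + 1)"] conjI ballI impI)
      show "\<epsilon> / sqrt (L + 1) > 0" using \<epsilon> L by simp
      fix u v assume uv: "u \<in> ball 0 \<rho> - {a}" "v \<in> ball 0 \<rho> - {a}" and d: "dist v u < \<epsilon> / sqrt (L + 1)"
      have "(cmod (v - u))\<^sup>2 < (\<epsilon> / sqrt (L + 1))\<^sup>2" using d by (intro power_strict_mono) (auto simp: dist_norm)
      then have "(L + 1) * (cmod (v - u))\<^sup>2 < \<epsilon>\<^sup>2" using L by (simp add: power_divide pos_less_divide_eq mult.commute)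
      moreover have "L * (cmod (v - u))\<^sup>2 \<le> (L + 1) * (cmod (v - u))\<^sup>2" by (intro mult_right_mono) auto
      ultimately have "(cmod (D v - D u))\<^sup>2 < \<epsilon>\<^sup>2" using lip[OF uv(2,1)] by linarith
      then have "cmod (D v - D u) < \<epsilon>" by (rule power2_less_imp_less) (use \<epsilon> in simp)
      then show "dist (D v) (D u) < \<epsilon>" by (simp only: dist_norm)
    qed
  qed
  moreover have "a \<in> closure (ball 0 \<rho> - {a})"
  proof -
    have "a islimpt ball 0 \<rho>" using \<rho> by (intro interior_limit_point) auto
    then show ?thesis by (simp only: islimpt_in_closure)
  qed
  ultimately obtain l where "(D \<longlongrightarrow> l) (at a within (ball 0 \<rho> - {a}))"
    by (rule uniformly_continuous_on_extension_at_closure)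
  then have "(D \<longlongrightarrow> l) (at a within ball 0 \<rho>)" by (simp add: at_within_def)
  then have "(f has_field_derivative l) (at a within ball 0 \<rho>)" by (simp add: has_field_derivative_iff D_def[abs_def])
  then have "(f has_field_derivative l) (at a)" using \<rho> at_within_open[of a "ball 0 \<rho>"] by simp
  then show "f field_differentiable at a within disk"
    unfolding field_differentiable_def by (intro exI[of _ l]) (rule has_field_derivative_at_within)
qed

text \<open>For the nodes h, 0 with weights 1, -1 the form is \<open>flat_kernel h h - 1\<close> =
  |h|^4 / (1 - |h|^2), as the kernel has no term of degree 1. Thus f(h) - f(0) is of order
  |h|^2.\<close>

lemma derivative_zero_if_dominated:
  fixes f :: "complex \<Rightarrow> complex"
  assumes H: "\<And>m z x. (\<And>i::nat. cmod (z i) < 1) \<Longrightarrow> (cmod (\<Sum>i<m. f (z i) * x i))\<^sup>2 \<le> Re (\<Sum>i<m. \<Sum>j<m. x i * flat_kernel (z i) (z j) * cnj (x j))"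
  shows "(f has_field_derivative 0) (at 0)"
proof -
  have bd: "cmod ((f h - f 0) / h) \<le> 2 * cmod h" if h: "cmod h < 1 / 2" for h
  proof (cases "h = 0")
    case False
    define z where "z i = (if i = 0 then h else 0)" for i :: nat
    define x where "x i = (if i = 0 then 1 else - 1 :: complex)" for i :: nat
    have z1: "cmod (z i) < 1" for i using h by (simp add: z_def)
    have sum2: "(\<Sum>i<2. g i) = g 0 + g 1" for g :: "nat \<Rightarrow> complex" by (simp add: numeral_2_eq_2)
    have "(cmod (f h - f 0))\<^sup>2 \<le> Re (flat_kernel h h - 1)"
      using H[where z = z and x = x and m = 2, OF z1] by (simp add: sum2 z_def x_def flat_kernel_def szego_def)
    also have "flat_kernel h h = of_real (1 / (1 - (cmod h)\<^sup>2) - (cmod h)\<^sup>2)"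
      unfolding flat_kernel_def szego_def complex_norm_square[symmetric] by simp
    also have "Re (of_real (1 / (1 - (cmod h)\<^sup>2) - (cmod h)\<^sup>2) - 1) = 1 / (1 - (cmod h)\<^sup>2) - (cmod h)\<^sup>2 - 1" by simp
    also have "\<dots> \<le> 4 * ((cmod h)\<^sup>2)\<^sup>2"
    proof -
      define q where "q = (cmod h)\<^sup>2"
      have "q < (1 / 2)\<^sup>2" unfolding q_def using h by (intro power_strict_mono) auto
      then have q: "0 \<le> q" "q < 1 / 4" by (simp_all add: q_def power2_eq_square)
      then have "1 / (1 - q) - q - 1 = q\<^sup>2 / (1 - q)" by (simp add: field_simps power2_eq_square)
      also have "\<dots> \<le> q\<^sup>2 / (1 / 4)" using q by (intro divide_left_mono) auto
      finally show ?thesis by (simp add: q_def)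
    qed
    also have "\<dots> = (2 * cmod h * cmod h)\<^sup>2" by (simp add: power2_eq_square)
    finally have "cmod (f h - f 0) \<le> 2 * cmod h * cmod h" by (rule power2_le_imp_le) simp
    then show ?thesis using False by (simp add: norm_divide pos_divide_le_eq)
  qed simp
  have "((\<lambda>h. (f h - f 0) / h) \<longlongrightarrow> 0) (at 0)"
  proof (rule Lim_null_comparison)
    have "eventually (\<lambda>h. dist h 0 < 1 / 2) (at (0::complex))" unfolding eventually_at by (intro exI[of _ "1 / 2"]) auto
    then show "eventually (\<lambda>h. norm ((f h - f 0) / h) \<le> 2 * cmod h) (at 0)"
      by eventually_elim (rule bd, simp)
    show "((\<lambda>h. 2 * cmod h) \<longlongrightarrow> 0) (at (0::complex))"
      by (auto intro!: tendsto_eq_intros)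
  qed
  then show ?thesis by (simp add: DERIV_def)
qed

text \<open>The matrix kernel is a scalar kernel times the identity, so tuples supported in a single
  coordinate \<open>a0\<close> reduce the form to the scalar one.\<close>

lemma flat_right_mult_pointwise:
  fixes S :: "complex \<Rightarrow> 'n::finite cmat"
  assumes R: "right_mult_contractive flat_matrix_kernel S" and z: "\<And>i::nat. cmod (z i) < 1"
  shows "(\<Sum>b\<in>UNIV. Re (\<Sum>i<m. \<Sum>j<m. (x i * (S (z i) *v v) $ b) * flat_kernel (z i) (z j) * cnj (x j * (S (z j) *v v) $ b)))
    \<le> (\<Sum>b\<in>UNIV. Re (\<Sum>i<m. \<Sum>j<m. (x i * v $ b) * flat_kernel (z i) (z j) * cnj (x j * v $ b)))"
proof -
  have zd: "z i \<in> disk" for i using z by (simp add: disk_def)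
  interpret hermitian_form "kpts m :: (nat \<times> 'n) set" "kker flat_matrix_kernel z" \<zeta> for \<zeta>
    by (rule hermitian_form_kker[OF pos_kernel_flat zd])
  define a0 :: 'n where "a0 = undefined"
  have q: "qn (\<lambda>p. of_bool (snd p = a0) * y (fst p)) = Re (\<Sum>i<m. \<Sum>j<m. y i * flat_kernel (z i) (z j) * cnj (y j))" for y
  proof -
    have "frm (\<lambda>p. of_bool (snd p = a0) * y (fst p)) (\<lambda>p. of_bool (snd p = a0) * y (fst p))
       = (\<Sum>a\<in>UNIV. of_bool (a = a0) * (\<Sum>i<m. \<Sum>j<m. y i * flat_kernel (z i) (z j) * cnj (y j)))"
      unfolding flat_frm[OF zd] by (intro sum.cong refl) simp
    also have "\<dots> = (\<Sum>i<m. \<Sum>j<m. y i * flat_kernel (z i) (z j) * cnj (y j))" by (rule of_bool_sum) auto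
    finally show ?thesis by (simp add: qn_def)
  qed
  define \<alpha> where "\<alpha> c p = of_bool (snd p = a0) * (x (fst p) * v $ c)" for c p
  have "(\<Sum>b\<in>UNIV. qn (\<lambda>p. \<Sum>c\<in>UNIV. S (z (fst p)) $ b $ c * \<alpha> c p)) \<le> (\<Sum>b\<in>UNIV. qn (\<alpha> b))"
    using R[unfolded right_mult_contractive_iff[OF pos_kernel_flat], rule_format, of z m \<alpha>] zd by blast
  moreover have "(\<lambda>p. \<Sum>c\<in>UNIV. S (z (fst p)) $ b $ c * \<alpha> c p) = (\<lambda>p. of_bool (snd p = a0) * (x (fst p) * (S (z (fst p)) *v v) $ b))" for b
    by (simp add: \<alpha>_def matrix_vector_mult_def sum_distrib_left mult_ac)
  moreover have "\<alpha> b = (\<lambda>p. of_bool (snd p = a0) * (x (fst p) * v $ b))" for b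
    by (simp add: \<alpha>_def fun_eq_iff)
  moreover have "qn (\<lambda>p. of_bool (snd p = a0) * (x (fst p) * (S (z (fst p)) *v v) $ b))
     = Re (\<Sum>i<m. \<Sum>j<m. (x i * (S (z i) *v v) $ b) * flat_kernel (z i) (z j) * cnj (x j * (S (z j) *v v) $ b))"
    "qn (\<lambda>p. of_bool (snd p = a0) * (x (fst p) * v $ b)) = Re (\<Sum>i<m. \<Sum>j<m. (x i * v $ b) * flat_kernel (z i) (z j) * cnj (x j * v $ b))" for b
    by (rule q)+
  ultimately show ?thesis by simp
qed

text \<open>One node gives the norm bound, two nodes the vanishing derivative, three nodes
  holomorphy.\<close>

theorem SchurAgler_in_H1_ball:
  fixes S :: "complex \<Rightarrow> 'n::finite cmat"
  assumes "S \<in> SchurAgler Psi1"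
  shows "S \<in> H1_ball"
proof -
  have R: "right_mult_contractive flat_matrix_kernel S"
    using assms admissible_flat by (auto simp: SchurAgler_def)
  note pw = flat_right_mult_pointwise[OF R]
  define q where "q m z x = Re (\<Sum>i<m. \<Sum>j<m. x i * flat_kernel (z i) (z j) * cnj (x j))" for m and z x :: "nat \<Rightarrow> complex"
  \<comment> \<open>With \<open>v\<close> the unit vector at c, the column c of S is tested; the
    single entry b is one of the nonnegative terms of the sum.\<close>
  have entry: "(cmod (\<Sum>i<m. S (z i) $ b $ c * x i))\<^sup>2 \<le> q m z x" if z: "\<And>i. cmod (z i) < 1" for m z x b c
  proof -
    define v :: "complex^'n" where "v = (\<chi> i. of_bool (i = c))"
    have Sv: "(A *v v) $ b = A $ b $ c" for A :: "'n cmat" and b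
      unfolding matrix_vector_mult_def v_def vec_lambda_beta by (rule of_bool_sum) auto
    have qn0: "0 \<le> q m z y" for y
      unfolding q_def by (rule order_trans[OF zero_le_power2 flat_kernel_form(2)[where z = z, OF z]])
    have "(cmod (\<Sum>i<m. S (z i) $ b $ c * x i))\<^sup>2 = (cmod (\<Sum>i<m. x i * S (z i) $ b $ c))\<^sup>2" by (simp add: mult.commute)
    also have "\<dots> \<le> q m z (\<lambda>i. x i * S (z i) $ b $ c)"
      unfolding q_def by (rule flat_kernel_form(2)[where z = z, OF z])
    also have "\<dots> \<le> (\<Sum>b\<in>UNIV. q m z (\<lambda>i. x i * S (z i) $ b $ c))"
      by (rule member_le_sum) (auto simp: qn0)
    also have "\<dots> \<le> (\<Sum>b\<in>UNIV. q m z (\<lambda>i. x i * v $ b))"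
      using pw[where z = z and m = m and x = x and v = v, OF z] unfolding q_def Sv .
    also have "\<dots> = (\<Sum>b\<in>UNIV. if b = c then q m z x else 0)"
      by (intro sum.cong refl) (auto simp: v_def q_def)
    also have "\<dots> = q m z x" by simp
    finally show ?thesis .
  qed
  have hol: "(\<lambda>z. S z $ b $ c) holomorphic_on disk" for b c
  proof (rule holomorphic_if_dominated)
    fix m z x assume z: "\<And>i::nat. cmod (z i) < 1"
    have "q m z x \<le> (\<Sum>n. (cmod (\<Sum>i<m. x i * z i ^ n))\<^sup>2)"
      unfolding q_def by (rule flat_kernel_form(3)[where z = z, OF z])
    then show "(cmod (\<Sum>i<m. S (z i) $ b $ c * x i))\<^sup>2 \<le> (\<Sum>n. (cmod (\<Sum>i<m. x i * z i ^ n))\<^sup>2)"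
      using entry[where z = z and m = m and x = x and b = b and c = c, OF z] by linarith
  qed
  have der: "deriv (\<lambda>z. S z $ b $ c) 0 = 0" for b c
    by (rule DERIV_imp_deriv, rule derivative_zero_if_dominated) (use entry in \<open>simp add: q_def\<close>)
  have "opnorm (S w) \<le> 1" if w: "w \<in> disk" for w
    unfolding opnorm_def
  proof (rule onorm_bound)
    fix v
    have w1: "cmod w < 1" using w by (simp add: disk_def)
    \<comment> \<open>With a single node the kernel is only a scalar factor on both sides, and it is
      at least 1.\<close>
    define \<kappa> where "\<kappa> = Re (flat_kernel w w)"
    have "(1::real) \<le> \<kappa>" using flat_kernel_form(2)[where z = "\<lambda>_. w" and m = "Suc 0" and x = "\<lambda>_. 1", OF w1] by (simp add: \<kappa>_def)
    have r: "Re (y * flat_kernel w w * cnj y) = \<kappa> * (cmod y)\<^sup>2" for y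
    proof -
      have "y * flat_kernel w w * cnj y = of_real ((cmod y)\<^sup>2) * flat_kernel w w" unfolding complex_norm_square by (simp add: mult_ac)
      then show ?thesis by (simp only: Re_complex_of_real times_complex.sel Im_complex_of_real) (simp add: \<kappa>_def)
    qed
    have n: "(norm u)\<^sup>2 = (\<Sum>b\<in>UNIV. (cmod (u $ b))\<^sup>2)" for u :: "complex^'n"
      by (simp add: norm_vec_def L2_set_def sum_nonneg)
    have "(\<Sum>b\<in>UNIV. \<kappa> * (cmod ((S w *v v) $ b))\<^sup>2) \<le> (\<Sum>b\<in>UNIV. \<kappa> * (cmod (v $ b))\<^sup>2)"
      using pw[where z = "\<lambda>_. w" and m = "Suc 0" and x = "\<lambda>_. 1" and v = v, OF w1]
      by (simp only: lessThan_Suc lessThan_0 sum.insert finite.emptyI empty_iff not_False_eq_True sum.empty add_0_right mult_1 r)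
    then have "\<kappa> * (norm (S w *v v))\<^sup>2 \<le> \<kappa> * (norm v)\<^sup>2" unfolding n sum_distrib_left .
    then have "(norm (S w *v v))\<^sup>2 \<le> (norm v)\<^sup>2" using \<open>1 \<le> \<kappa>\<close> by simp
    then show "norm (S w *v v) \<le> 1 * norm v" using power2_le_imp_le by fastforce
  qed simp
  then show ?thesis unfolding H1_ball_def using hol der by blast
qed

theorem theoremT:
  shows "(H1_ball :: (complex \<Rightarrow> complex^'n::finite^'n) set) = SchurAgler Psi1"
proof (rule set_eqI, rule iffI)
  fix S :: "complex \<Rightarrow> complex^'n^'n"
  assume "S \<in> H1_ball"
  then show "S \<in> SchurAgler Psi1"
    unfolding SchurAgler_def using H1_ball_right_mult_contractive by blast
next
  fix S :: "complex \<Rightarrow> complex^'n^'n"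
  assume "S \<in> SchurAgler Psi1"
  then show "S \<in> H1_ball" by (rule SchurAgler_in_H1_ball)
qed

end
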